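(* Let $A$ be a small set of parameters, let $p$ be a global type generically stable over $A$, let $b$ be a tuple of $M$, and assume that $p$ is dominated over $Ab$ by an $Ab$-definable function $f_b$ into some $A$-definable stably embedded set $S$. Assume furthermore that either: (1) $\mathrm{tp}(b/A)$ does not fork over $A$, or (2) $p^{\otimes n}$ is generically stable for all $n<\omega$. Then there is an $A$-definable function $h: p\to \mathrm{Int}(S,A)$ that dominates $p$ over $A$.
   Context: $T$ is an arbitrary complete first-order theory that eliminates imaginaries and $M$ is its monster model; parameter sets are small; a global type is a complete type over $M$. A global type $p(x)$ is generically stable over $A$ if it is $A$-invariant and for every ordinal $\alpha\ge\omega$, every Morley sequence $(a_i)_{i<\alpha}$ of $p$ over $A$ (i.e. $a_i\models p\restriction_{Aa_{<i}}$) and every formula $\phi(x)$ over $M$, the set $\{i<\alpha : M\models\phi(a_i)\}$ is finite or cofinite. $p^{\otimes n}$ is the global type such that $(a_1,\dots,a_n)\models p^{\otimes n}\restriction_B$ iff $a_i\models p\restriction_{Ba_{<i}}$ for all $i$ ($B\supseteq A$ small). Domination: if $p$ is a global $A$-invariant type and $f_b$ is an $Ab$-definable function, $p$ is dominated by $f_b$ over $Ab$ if for every $a\models p\restriction_{Ab}$ and every tuple $d$ of $M$, whenever $f_b(a)\models f_b(p)\restriction_{Abd}$ (where $f_b(p)$ is the pushforward of $p$), then $a\models p\restriction_{Abd}$. Domination by an $A$-definable function $h$ over $A$ is the case where $b$ is empty. An $A$-definable set $S$ is stably embedded if every $M$-definable subset of a power $S^n$ is definable with parameters from $A\cup S(M)$.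 A definable set $X$ is $S$-internal if $X=\emptyset$ or there are $m\in\mathbb N$ and a surjective $M$-definable function $g:S^m\to X$. $\mathrm{Int}(S,A)$ is the union of the $A$-definable sets internal to $S$. A function $h:p\to \mathrm{Int}(S,A)$ means a function defined on the realizations of $p\restriction_A$ with values in $\mathrm{Int}(S,A)$. *)

theory Defs
  imports Main
begin

section \<open>Many-sorted first-order logic\<close>

text \<open>
  Structures are many-sorted (a one-sorted structure is the case where the type of sorts is unit).
  The universe is the whole type \<open>'m\<close>, and every element has exactly one sort.
\<close>

record ('s, 'f, 'r) lang =
  funs :: "'f set"
  rels :: "'r set"
  fdom :: "'f \<Rightarrow> 's list"
  fcod :: "'f \<Rightarrow> 's"
  rdom :: "'r \<Rightarrow> 's list"

record ('s, 'f, 'r, 'm) struct = "('s, 'f, 'r) lang" +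
  srt :: "'m \<Rightarrow> 's"
  fint :: "'f \<Rightarrow> 'm list \<Rightarrow> 'm"
  rint :: "'r \<Rightarrow> 'm list \<Rightarrow> bool"

text \<open>
  Formulas may contain elements of the structure as parameters (\<open>Par\<close>).  A variable is a pair of
  a sort and an index.
\<close>

datatype ('s, 'f, 'm) tm =
    Var 's nat
  | Par 'm
  | Fn 'f "('s, 'f, 'm) tm list"

datatype ('s, 'f, 'r, 'm) fm =
    Eq "('s, 'f, 'm) tm" "('s, 'f, 'm) tm"
  | Rel 'r "('s, 'f, 'm) tm list"
  | Neg "('s, 'f, 'r, 'm) fm"
  | Conj "('s, 'f, 'r, 'm) fm" "('s, 'f, 'r, 'm) fm"
  | Exi 's nat "('s, 'f, 'r, 'm) fm"

definition is_structure :: "('s, 'f, 'r, 'm) struct \<Rightarrow> bool" where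
  "is_structure M \<longleftrightarrow> surj (srt M) \<and>
     (\<forall>f\<in>funs M. \<forall>as. map (srt M) as = fdom M f \<longrightarrow> srt M (fint M f as) = fcod M f)"

fun tsort :: "('s, 'f, 'r, 'm) struct \<Rightarrow> ('s, 'f, 'm) tm \<Rightarrow> 's" where
  "tsort M (Var s n) = s"
| "tsort M (Par c) = srt M c"
| "tsort M (Fn f ts) = fcod M f"

fun twf :: "('s, 'f, 'r, 'm) struct \<Rightarrow> ('s, 'f, 'm) tm \<Rightarrow> bool" where
  "twf M (Var s n) \<longleftrightarrow> True"
| "twf M (Par c) \<longleftrightarrow> True"
| "twf M (Fn f ts) \<longleftrightarrow>
     f \<in> funs M \<and> map (tsort M) ts = fdom M f \<and> (\<forall>t\<in>set ts. twf M t)"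

fun wf :: "('s, 'f, 'r, 'm) struct \<Rightarrow> ('s, 'f, 'r, 'm) fm \<Rightarrow> bool" where
  "wf M (Eq t u) \<longleftrightarrow> twf M t \<and> twf M u \<and> tsort M t = tsort M u"
| "wf M (Rel r ts) \<longleftrightarrow>
     r \<in> rels M \<and> map (tsort M) ts = rdom M r \<and> (\<forall>t\<in>set ts. twf M t)"
| "wf M (Neg \<phi>) \<longleftrightarrow> wf M \<phi>"
| "wf M (Conj \<phi> \<psi>) \<longleftrightarrow> wf M \<phi> \<and> wf M \<psi>"
| "wf M (Exi s n \<phi>) \<longleftrightarrow> wf M \<phi>"

fun teval :: "('s, 'f, 'r, 'm) struct \<Rightarrow> ('s \<times> nat \<Rightarrow> 'm) \<Rightarrow> ('s, 'f, 'm) tm \<Rightarrow> 'm" where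
  "teval M v (Var s n) = v (s, n)"
| "teval M v (Par c) = c"
| "teval M v (Fn f ts) = fint M f (map (teval M v) ts)"

fun sat :: "('s, 'f, 'r, 'm) struct \<Rightarrow> ('s \<times> nat \<Rightarrow> 'm) \<Rightarrow> ('s, 'f, 'r, 'm) fm \<Rightarrow> bool" where
  "sat M v (Eq t u) \<longleftrightarrow> teval M v t = teval M v u"
| "sat M v (Rel r ts) \<longleftrightarrow> rint M r (map (teval M v) ts)"
| "sat M v (Neg \<phi>) \<longleftrightarrow> \<not> sat M v \<phi>"
| "sat M v (Conj \<phi> \<psi>) \<longleftrightarrow> sat M v \<phi> \<and> sat M v \<psi>"
| "sat M v (Exi s n \<phi>) \<longleftrightarrow> (\<exists>c. srt M c = s \<and> sat M (v((s, n) := c)) \<phi>)"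

fun tvars :: "('s, 'f, 'm) tm \<Rightarrow> ('s \<times> nat) set" where
  "tvars (Var s n) = {(s, n)}"
| "tvars (Par c) = {}"
| "tvars (Fn f ts) = (\<Union>t\<in>set ts. tvars t)"

fun fv :: "('s, 'f, 'r, 'm) fm \<Rightarrow> ('s \<times> nat) set" where
  "fv (Eq t u) = tvars t \<union> tvars u"
| "fv (Rel r ts) = (\<Union>t\<in>set ts. tvars t)"
| "fv (Neg \<phi>) = fv \<phi>"
| "fv (Conj \<phi> \<psi>) = fv \<phi> \<union> fv \<psi>"
| "fv (Exi s n \<phi>) = fv \<phi> - {(s, n)}"

fun tpars :: "('s, 'f, 'm) tm \<Rightarrow> 'm set" where
  "tpars (Var s n) = {}"
| "tpars (Par c) = {c}"
| "tpars (Fn f ts) = (\<Union>t\<in>set ts. tpars t)"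

fun pars :: "('s, 'f, 'r, 'm) fm \<Rightarrow> 'm set" where
  "pars (Eq t u) = tpars t \<union> tpars u"
| "pars (Rel r ts) = (\<Union>t\<in>set ts. tpars t)"
| "pars (Neg \<phi>) = pars \<phi>"
| "pars (Conj \<phi> \<psi>) = pars \<phi> \<union> pars \<psi>"
| "pars (Exi s n \<phi>) = pars \<phi>"

text \<open>
  Tuples are finite lists.  A tuple of variables is given by its list of sorts \<open>\<sigma>\<close>: it consists of
  the variables \<open>(\<sigma> ! i, i)\<close> for \<open>i < length \<sigma>\<close>, and takes its values in \<open>tuples M \<sigma>\<close>.
  \<open>fms M B \<sigma>\<close> is the set of formulas over \<open>B\<close> in these variables.
\<close>

definition tuples :: "('s, 'f, 'r, 'm) struct \<Rightarrow> 's list \<Rightarrow> 'm list set" where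
  "tuples M \<sigma> = {a. map (srt M) a = \<sigma>}"

definition fms ::
  "('s, 'f, 'r, 'm) struct \<Rightarrow> 'm set \<Rightarrow> 's list \<Rightarrow> ('s, 'f, 'r, 'm) fm set" where
  "fms M B \<sigma> = {\<phi>. wf M \<phi> \<and> pars \<phi> \<subseteq> B \<and> fv \<phi> \<subseteq> {(\<sigma> ! i, i) |i. i < length \<sigma>}}"

text \<open>
  \<open>holds M \<phi> a\<close> is truth of \<open>\<phi>\<close> at \<open>a\<close>; the default value in \<open>asg\<close> is never used
  when \<open>\<phi> \<in> fms M B \<sigma>\<close> and \<open>a \<in> tuples M \<sigma>\<close>.
\<close>

definition asg :: "('s, 'f, 'r, 'm) struct \<Rightarrow> 'm list \<Rightarrow> 's \<times> nat \<Rightarrow> 'm" where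
  "asg M a = (\<lambda>(s, i). if i < length a \<and> srt M (a ! i) = s then a ! i else (SOME c. srt M c = s))"

definition holds :: "('s, 'f, 'r, 'm) struct \<Rightarrow> ('s, 'f, 'r, 'm) fm \<Rightarrow> 'm list \<Rightarrow> bool" where
  "holds M \<phi> a \<longleftrightarrow> sat M (asg M a) \<phi>"


section \<open>Definable sets and functions\<close>

definition definable ::
  "('s, 'f, 'r, 'm) struct \<Rightarrow> 'm set \<Rightarrow> 's list \<Rightarrow> 'm list set \<Rightarrow> bool" where
  "definable M B \<sigma> X \<longleftrightarrow> (\<exists>\<phi>\<in>fms M B \<sigma>. X = {a \<in> tuples M \<sigma>. holds M \<phi> a})"

text \<open>\<open>h\<close> is, on the set \<open>X\<close> of \<open>\<sigma>\<close>-tuples, a \<open>B\<close>-definable function with values \<open>\<tau>\<close>-tuples.\<close>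

definition definable_fun :: "('s, 'f, 'r, 'm) struct \<Rightarrow> 'm set \<Rightarrow>
    's list \<Rightarrow> 'm list set \<Rightarrow> 's list \<Rightarrow> ('m list \<Rightarrow> 'm list) \<Rightarrow> bool" where
  "definable_fun M B \<sigma> X \<tau> h \<longleftrightarrow>
     definable M B \<sigma> X \<and> h ` X \<subseteq> tuples M \<tau> \<and> definable M B (\<sigma> @ \<tau>) ((\<lambda>a. a @ h a) ` X)"

definition set_power :: "'m list set \<Rightarrow> nat \<Rightarrow> 'm list set" where
  "set_power S n = {concat as |as. length as = n \<and> set as \<subseteq> S}"

definition stably_embedded ::
  "('s, 'f, 'r, 'm) struct \<Rightarrow> 'm set \<Rightarrow> 's list \<Rightarrow> 'm list set \<Rightarrow> bool" where
  "stably_embedded M A \<rho> S \<longleftrightarrow> definable M A \<rho> S \<and>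
     (\<forall>n X. X \<subseteq> set_power S n \<and> definable M UNIV (concat (replicate n \<rho>)) X \<longrightarrow>
        definable M (A \<union> (\<Union>s\<in>S. set s)) (concat (replicate n \<rho>)) X)"

text \<open>\<open>X\<close>, a definable set of \<open>\<tau>\<close>-tuples, is internal to the set \<open>S\<close> of \<open>\<rho>\<close>-tuples.\<close>

definition internal ::
  "('s, 'f, 'r, 'm) struct \<Rightarrow> 's list \<Rightarrow> 'm list set \<Rightarrow> 's list \<Rightarrow> 'm list set \<Rightarrow> bool" where
  "internal M \<rho> S \<tau> X \<longleftrightarrow> X = {} \<or>
     (\<exists>m g. definable_fun M UNIV (concat (replicate m \<rho>)) (set_power S m) \<tau> g \<and>
        g ` set_power S m = X)"

definition Int_set ::
  "('s, 'f, 'r, 'm) struct \<Rightarrow> 's list \<Rightarrow> 'm list set \<Rightarrow> 'm set \<Rightarrow> 'm list set" where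
  "Int_set M \<rho> S A = \<Union>{X. \<exists>\<tau>. definable M A \<tau> X \<and> internal M \<rho> S \<tau> X}"


section \<open>Monster models and elimination of imaginaries\<close>

definition automorphism :: "('s, 'f, 'r, 'm) struct \<Rightarrow> ('m \<Rightarrow> 'm) \<Rightarrow> bool" where
  "automorphism M g \<longleftrightarrow> bij g \<and> (\<forall>c. srt M (g c) = srt M c) \<and>
     (\<forall>f\<in>funs M. \<forall>as\<in>tuples M (fdom M f). g (fint M f as) = fint M f (map g as)) \<and>
     (\<forall>r\<in>rels M. \<forall>as\<in>tuples M (rdom M r). rint M r (map g as) \<longleftrightarrow> rint M r as)"

definition small :: "'k rel \<Rightarrow> 'a set \<Rightarrow> bool" where
  "small \<kappa> B \<longleftrightarrow> (card_of B, \<kappa>) \<in> ordLess"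

definition saturated :: "'k rel \<Rightarrow> ('s, 'f, 'r, 'm) struct \<Rightarrow> bool" where
  "saturated \<kappa> M \<longleftrightarrow> (\<forall>B s \<Sigma>. small \<kappa> B \<and> \<Sigma> \<subseteq> fms M B [s] \<and>
     (\<forall>\<Phi>. finite \<Phi> \<and> \<Phi> \<subseteq> \<Sigma> \<longrightarrow> (\<exists>a\<in>tuples M [s]. \<forall>\<phi>\<in>\<Phi>. holds M \<phi> a)) \<longrightarrow>
     (\<exists>a\<in>tuples M [s]. \<forall>\<phi>\<in>\<Sigma>. holds M \<phi> a))"

definition partial_elementary ::
  "('s, 'f, 'r, 'm) struct \<Rightarrow> 'm set \<Rightarrow> ('m \<Rightarrow> 'm) \<Rightarrow> bool" where
  "partial_elementary M B e \<longleftrightarrow> (\<forall>c\<in>B. srt M (e c) = srt M c) \<and>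
     (\<forall>a. set a \<subseteq> B \<longrightarrow>
        (\<forall>\<phi>\<in>fms M {} (map (srt M) a). holds M \<phi> (map e a) \<longleftrightarrow> holds M \<phi> a))"

definition strongly_homogeneous :: "'k rel \<Rightarrow> ('s, 'f, 'r, 'm) struct \<Rightarrow> bool" where
  "strongly_homogeneous \<kappa> M \<longleftrightarrow> (\<forall>B e. small \<kappa> B \<and> partial_elementary M B e \<longrightarrow>
     (\<exists>g. automorphism M g \<and> (\<forall>c\<in>B. g c = e c)))"

text \<open>A complete theory in the language of \<open>M\<close>, identified with its set of consequences.\<close>

definition complete_theory ::
  "('s, 'f, 'r, 'm) struct \<Rightarrow> ('s, 'f, 'r, 'm) fm set \<Rightarrow> bool" where
  "complete_theory M T \<longleftrightarrow> T \<subseteq> fms M {} [] \<and> (\<forall>\<phi>\<in>fms M {} []. \<phi> \<in> T \<or> Neg \<phi> \<in> T)"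

text \<open>
  \<open>M\<close> is a monster model of \<open>T\<close>: it is \<open>\<kappa>\<close>-saturated and strongly \<open>\<kappa>\<close>-homogeneous for an
  uncountable cardinal \<open>\<kappa>\<close> greater than the cardinality of the language; small means of
  cardinality less than \<open>\<kappa>\<close>.
\<close>

definition monster_model ::
  "'k rel \<Rightarrow> ('s, 'f, 'r, 'm) fm set \<Rightarrow> ('s, 'f, 'r, 'm) struct \<Rightarrow> bool" where
  "monster_model \<kappa> T M \<longleftrightarrow> is_structure M \<and> (\<forall>\<phi>\<in>T. holds M \<phi> []) \<and>
     Card_order \<kappa> \<and> small \<kappa> (UNIV :: nat set) \<and>
     small \<kappa> (UNIV :: 's set) \<and> small \<kappa> (funs M) \<and> small \<kappa> (rels M) \<and>
     saturated \<kappa> M \<and> strongly_homogeneous \<kappa> M"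

text \<open>
  Every class of a \<open>{}\<close>-definable equivalence relation has a code: it is defined by
  \<open>\<phi>(x, e)\<close> for some formula \<open>\<phi>(x, z)\<close> without parameters and exactly one tuple \<open>e\<close>.
  For a monster model \<open>M\<close> of a complete theory this is elimination of imaginaries of the theory.
\<close>

definition eliminates_imaginaries :: "('s, 'f, 'r, 'm) struct \<Rightarrow> bool" where
  "eliminates_imaginaries M \<longleftrightarrow>
     (\<forall>\<sigma> R. equiv (tuples M \<sigma>) R \<and> R \<subseteq> tuples M \<sigma> \<times> tuples M \<sigma> \<and>
        definable M {} (\<sigma> @ \<sigma>) {a @ a' |a a'. (a, a') \<in> R} \<longrightarrow>
        (\<forall>a\<in>tuples M \<sigma>. \<exists>\<tau>. \<exists>\<phi>\<in>fms M {} (\<sigma> @ \<tau>).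
           \<exists>!e. e \<in> tuples M \<tau> \<and> R `` {a} = {x \<in> tuples M \<sigma>. holds M \<phi> (x @ e)}))"


section \<open>Types\<close>

definition global_type ::
  "('s, 'f, 'r, 'm) struct \<Rightarrow> 's list \<Rightarrow> ('s, 'f, 'r, 'm) fm set \<Rightarrow> bool" where
  "global_type M \<sigma> p \<longleftrightarrow> p \<subseteq> fms M UNIV \<sigma> \<and>
     (\<forall>\<Phi>. finite \<Phi> \<and> \<Phi> \<subseteq> p \<longrightarrow> (\<exists>a\<in>tuples M \<sigma>. \<forall>\<phi>\<in>\<Phi>. holds M \<phi> a)) \<and>
     (\<forall>\<phi>\<in>fms M UNIV \<sigma>. \<phi> \<in> p \<or> Neg \<phi> \<in> p)"

text \<open>\<open>a\<close> realizes the restriction of \<open>p\<close> to \<open>B\<close>.\<close>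

definition realizes :: "('s, 'f, 'r, 'm) struct \<Rightarrow> 's list \<Rightarrow> 'm list \<Rightarrow>
    ('s, 'f, 'r, 'm) fm set \<Rightarrow> 'm set \<Rightarrow> bool" where
  "realizes M \<sigma> a p B \<longleftrightarrow> a \<in> tuples M \<sigma> \<and> (\<forall>\<phi>\<in>p. pars \<phi> \<subseteq> B \<longrightarrow> holds M \<phi> a)"

definition tp :: "('s, 'f, 'r, 'm) struct \<Rightarrow> 'm set \<Rightarrow> 'm list \<Rightarrow> ('s, 'f, 'r, 'm) fm set" where
  "tp M B a = {\<phi> \<in> fms M B (map (srt M) a). holds M \<phi> a}"

text \<open>\<open>map_fm id id id g\<close> applies \<open>g\<close> to the parameters of a formula.\<close>

definition invariant ::
  "('s, 'f, 'r, 'm) struct \<Rightarrow> 'm set \<Rightarrow> ('s, 'f, 'r, 'm) fm set \<Rightarrow> bool" where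
  "invariant M A p \<longleftrightarrow>
     (\<forall>g. automorphism M g \<and> (\<forall>c\<in>A. g c = c) \<longrightarrow> map_fm id id id g ` p = p)"

text \<open>
  Morley sequences of ordinal length: the ordinal is given by a well-order \<open>r\<close>, and
  \<open>underS r i\<close> is the set of indices below \<open>i\<close>.
\<close>

definition morley_sequence :: "('s, 'f, 'r, 'm) struct \<Rightarrow> 'm set \<Rightarrow> 's list \<Rightarrow>
    ('s, 'f, 'r, 'm) fm set \<Rightarrow> 'i rel \<Rightarrow> ('i \<Rightarrow> 'm list) \<Rightarrow> bool" where
  "morley_sequence M A \<sigma> p r a \<longleftrightarrow>
     (\<forall>i\<in>Field r. realizes M \<sigma> (a i) p (A \<union> (\<Union>j\<in>underS r i. set (a j))))"

text \<open>
  All infinite well-orders on subsets of the type \<open>'m list\<close> are considered.  No order type that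
  matters is missed: if \<open>p\<close> is not realized in \<open>M\<close>, then a Morley sequence of tuples of \<open>M\<close> is
  injective, and if \<open>p\<close> is realized, then it is constant.
\<close>

definition generically_stable :: "('s, 'f, 'r, 'm) struct \<Rightarrow> 'm set \<Rightarrow> 's list \<Rightarrow>
    ('s, 'f, 'r, 'm) fm set \<Rightarrow> bool" where
  "generically_stable M A \<sigma> p \<longleftrightarrow> global_type M \<sigma> p \<and> invariant M A p \<and>
     (\<forall>(r :: 'm list rel) a. Well_order r \<and> infinite (Field r) \<and> morley_sequence M A \<sigma> p r a \<longrightarrow>
        (\<forall>\<phi>\<in>fms M UNIV \<sigma>. finite {i \<in> Field r. holds M \<phi> (a i)} \<or>
                         finite {i \<in> Field r. \<not> holds M \<phi> (a i)}))"

text \<open>\<open>q\<close> is the \<open>n\<close>-th tensor power of the \<open>A\<close>-invariant type \<open>p\<close>.\<close>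

definition tensor_power :: "'k rel \<Rightarrow> ('s, 'f, 'r, 'm) struct \<Rightarrow> 'm set \<Rightarrow> 's list \<Rightarrow>
    ('s, 'f, 'r, 'm) fm set \<Rightarrow> nat \<Rightarrow> ('s, 'f, 'r, 'm) fm set \<Rightarrow> bool" where
  "tensor_power \<kappa> M A \<sigma> p n q \<longleftrightarrow> global_type M (concat (replicate n \<sigma>)) q \<and>
     (\<forall>B as. A \<subseteq> B \<and> small \<kappa> B \<and> length as = n \<and> set as \<subseteq> tuples M \<sigma> \<longrightarrow>
        (realizes M (concat (replicate n \<sigma>)) (concat as) q B \<longleftrightarrow>
         (\<forall>i<n. realizes M \<sigma> (as ! i) p (B \<union> (\<Union>j<i. set (as ! j))))))"


section \<open>Forking\<close>

text \<open>The formula \<open>\<phi>(x, c)\<close>, where \<open>x\<close> has sorts \<open>\<sigma>\<close>, divides over \<open>A\<close>.\<close>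

definition divides :: "('s, 'f, 'r, 'm) struct \<Rightarrow> 'm set \<Rightarrow> 's list \<Rightarrow>
    ('s, 'f, 'r, 'm) fm \<Rightarrow> 'm list \<Rightarrow> bool" where
  "divides M A \<sigma> \<phi> c \<longleftrightarrow> (\<exists>k. \<exists>cs :: nat \<Rightarrow> 'm list.
     (\<forall>i. tp M A (cs i) = tp M A c) \<and>
     (\<forall>I. finite I \<and> card I = k \<longrightarrow> \<not> (\<exists>a\<in>tuples M \<sigma>. \<forall>i\<in>I. holds M \<phi> (a @ cs i))))"

text \<open>
  A set of formulas in variables of sorts \<open>\<sigma>\<close> over a small set forks over \<open>A\<close> if it implies a
  finite disjunction of formulas that divide over \<open>A\<close>.
\<close>

definition forks ::
  "('s, 'f, 'r, 'm) struct \<Rightarrow> 'm set \<Rightarrow> 's list \<Rightarrow> ('s, 'f, 'r, 'm) fm set \<Rightarrow> bool" where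
  "forks M A \<sigma> \<pi> \<longleftrightarrow> (\<exists>\<Delta>. finite \<Delta> \<and>
     (\<forall>(\<phi>, c)\<in>\<Delta>. \<phi> \<in> fms M {} (\<sigma> @ map (srt M) c) \<and> divides M A \<sigma> \<phi> c) \<and>
     (\<forall>a\<in>tuples M \<sigma>. (\<forall>\<theta>\<in>\<pi>. holds M \<theta> a) \<longrightarrow> (\<exists>(\<phi>, c)\<in>\<Delta>. holds M \<phi> (a @ c))))"


section \<open>Functions on a type and domination\<close>

text \<open>
  A \<open>B\<close>-definable function from the restriction of \<open>p\<close> to \<open>B\<close> into \<open>Y\<close>, a set of tuples;
  the values are of sorts \<open>\<tau>\<close>.
\<close>

definition definable_fun_on_type :: "('s, 'f, 'r, 'm) struct \<Rightarrow> 'm set \<Rightarrow> 's list \<Rightarrow>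
    ('s, 'f, 'r, 'm) fm set \<Rightarrow> 's list \<Rightarrow> 'm list set \<Rightarrow> ('m list \<Rightarrow> 'm list) \<Rightarrow> bool" where
  "definable_fun_on_type M B \<sigma> p \<tau> Y h \<longleftrightarrow>
     (\<exists>X. definable_fun M B \<sigma> X \<tau> h \<and> {a. realizes M \<sigma> a p B} \<subseteq> X) \<and>
     (\<forall>a. realizes M \<sigma> a p B \<longrightarrow> h a \<in> Y)"

text \<open>The global type of the formulas \<open>\<psi>(y)\<close> such that \<open>p(x)\<close> implies \<open>\<psi>(h(x))\<close>.\<close>

definition pushforward :: "('s, 'f, 'r, 'm) struct \<Rightarrow> 's list \<Rightarrow> ('s, 'f, 'r, 'm) fm set \<Rightarrow>
    's list \<Rightarrow> ('m list \<Rightarrow> 'm list) \<Rightarrow> ('s, 'f, 'r, 'm) fm set" where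
  "pushforward M \<sigma> p \<tau> h =
     {\<psi> \<in> fms M UNIV \<tau>. \<exists>\<phi>\<in>p. \<forall>a\<in>tuples M \<sigma>. holds M \<phi> a \<longrightarrow> holds M \<psi> (h a)}"

text \<open>
  \<open>p\<close> is dominated by the \<open>C\<close>-definable function \<open>h\<close> over \<open>C\<close>.  Letting \<open>d\<close> range over small
  infinite tuples would be equivalent, since a formula over \<open>C d\<close> uses a finite part of \<open>d\<close>.
\<close>

definition dominated :: "('s, 'f, 'r, 'm) struct \<Rightarrow> 'm set \<Rightarrow> 's list \<Rightarrow>
    ('s, 'f, 'r, 'm) fm set \<Rightarrow> 's list \<Rightarrow> ('m list \<Rightarrow> 'm list) \<Rightarrow> bool" where
  "dominated M C \<sigma> p \<tau> h \<longleftrightarrow> (\<forall>a d. realizes M \<sigma> a p C \<longrightarrow>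
     realizes M \<tau> (h a) (pushforward M \<sigma> p \<tau> h) (C \<union> set d) \<longrightarrow>
     realizes M \<sigma> a p (C \<union> set d))"

end

theory Submission
  imports Defs
begin

text \<open>
  Choose a set \<open>G(x, z, y)\<close>, definable over \<open>A\<close>, such that \<open>G(x, z, b)\<close> is the graph of \<open>f\<^sub>b\<close>
  near \<open>p\<close> and \<open>G(x, \<cdot>, y)\<close> always defines a partial function \<open>f\<^sub>y\<close> with values in \<open>S\<close>.  The
  function \<open>h\<close> sends \<open>a\<close> to a code of the whole family \<open>(f\<^sub>y(a))\<^sub>y\<close>, for \<open>y\<close> ranging over germs
  of functions at \<open>p\<close> rather than over parameters.

  \<^emph>\<open>The code exists over \<open>A\<close>.\<close>  For a formula \<open>Z(x, c)\<close> in \<open>p\<close> there is a bound, uniform in \<open>c\<close>,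
  on the number of its failures along a Morley sequence over \<open>A\<close>: otherwise saturation yields a
  Morley sequence of order type \<open>\<omega> + \<omega>\<close> on whose first half some \<open>Z(x, c)\<close> fails and on whose
  second half it holds (\<open>failure_bound\<close>).  Hence \<open>p\<close> is definable over \<open>A\<close> by majority vote along
  a Morley sequence (\<open>P_fibre_set_definable\<close>), and so is the relation that \<open>f\<^sub>y\<close> and \<open>f\<^sub>y\<^sub>'\<close> have
  the same germ at \<open>p\<close>.  The same bound makes germs strong: \<open>f\<^sub>y(a)\<close> depends on the germ of \<open>y\<close>
  only, for \<open>y\<close> conjugate to \<open>b\<close> and \<open>a\<close> realizing \<open>p\<close> over \<open>Ay\<close>; one exception could be repeated
  at as many places of one Morley sequence as desired (\<open>strong_germs\<close>).  By compactness a
  condition \<open>\<Theta>(a, y)\<close> in \<open>p\<close> suffices in place of genericity (\<open>uniform_strong_germs\<close>).  Let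
  \<open>H(a, y, z)\<close> say that \<open>z = f\<^sub>y\<^sub>'(a)\<close> for some \<open>y'\<close> with the germ of \<open>y\<close> and \<open>\<Theta>(a, y')\<close>, and let
  \<open>h(a)\<close> be the canonical parameter of the fibre of \<open>H\<close> over \<open>a\<close>, given by elimination of
  imaginaries (\<open>canonical_parameters\<close>).

  \<^emph>\<open>The code is internal to \<open>S\<close>.\<close>  Along a fixed finite Morley sequence \<open>c\<close> of sufficient length
  the values \<open>f\<^sub>y(c\<^sub>i)\<close>, even with a bounded number of errors, determine the germ of \<open>y\<close>.  So the
  fibre of \<open>H\<close> over \<open>a\<close> amounts to a definable subset of a power of \<open>S\<close>.  By stable embeddedness
  this subset has parameters in \<open>S\<close> and \<open>A\<close>, and by compactness finitely many formulas serve for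
  all \<open>a\<close> (\<open>internal_code\<close>).

  \<^emph>\<open>The code dominates.\<close>  Suppose that \<open>a\<close> realizes \<open>p\<close> over \<open>A\<close> and that \<open>h(a)\<close> realizes \<open>h(p)\<close>
  over \<open>Ad\<close>.  If some conjugate \<open>b'\<close> of \<open>b\<close> over \<open>A\<close> satisfies that \<open>a\<close> realizes \<open>p\<close> over \<open>Ab'\<close>
  and \<open>h(a)\<close> realizes \<open>h(p)\<close> over \<open>Adb'\<close>, then \<open>f\<^sub>b\<^sub>'(a)\<close>, which is computed from \<open>h(a)\<close> and
  \<open>b'\<close>, is generic over \<open>Adb'\<close>, and domination by \<open>f\<^sub>b\<^sub>'\<close> finishes (\<open>dominated_conjugate\<close>).  By
  saturation it is enough to find, for finitely many of these conditions, a tuple that satisfies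
  them (\<open>dominated_if_consistent\<close>).

  If \<open>tp(b/A)\<close> does not fork over \<open>A\<close>, then each of these conditions can be violated by \<open>y\<close> only
  if \<open>y\<close> satisfies a formula over \<open>a\<close>, respectively over \<open>h(a)d\<close>, that divides over \<open>A\<close>: its
  conjugates along a Morley sequence are \<open>(N + 1)\<close>-inconsistent by the bound on failures
  (\<open>consistent_if_nonforking\<close>).

  If the powers of \<open>p\<close> are generically stable and \<open>\<Theta>'(x, b)\<close> is in \<open>p\<close>, then finitely many
  conjugates of \<open>\<Theta>'(x, b)\<close> cover all realizations of \<open>p\<close> over \<open>A\<close>: take a longest Morley sequence
  on which \<open>\<Theta>'(x, b)\<close> fails, conjugate it along a Morley sequence of the corresponding power, and
  use the bound on failures for that power (\<open>conjugates_cover\<close>).  Moving the conjugates by an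
  automorphism over \<open>Ad\<close> makes \<open>h(a)\<close> generic over all of them, and one of them is as required
  (\<open>consistent_if_cover\<close>).
\<close>

section \<open>Substitution\<close>

fun tsub :: "('s \<times> nat \<Rightarrow> ('s, 'f, 'm) tm) \<Rightarrow> ('m \<Rightarrow> ('s, 'f, 'm) tm) \<Rightarrow>
    ('s, 'f, 'm) tm \<Rightarrow> ('s, 'f, 'm) tm" where
  "tsub \<rho> \<pi> (Var s n) = \<rho> (s, n)"
| "tsub \<rho> \<pi> (Par c) = \<pi> c"
| "tsub \<rho> \<pi> (Fn f ts) = Fn f (map (tsub \<rho> \<pi>) ts)"

text \<open>
  Simultaneous substitution of terms for free variables (by \<open>\<rho>\<close>) and for parameters (by \<open>\<pi>\<close>).
  Every bound variable has its index raised by \<open>k\<close>.  If the substituted terms use only indices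
  below \<open>k\<close>, nothing is captured, and no choice of fresh variables is needed.
\<close>

fun sub :: "nat \<Rightarrow> ('s \<times> nat \<Rightarrow> ('s, 'f, 'm) tm) \<Rightarrow> ('m \<Rightarrow> ('s, 'f, 'm) tm) \<Rightarrow>
    ('s, 'f, 'r, 'm) fm \<Rightarrow> ('s, 'f, 'r, 'm) fm" where
  "sub k \<rho> \<pi> (Eq t u) = Eq (tsub \<rho> \<pi> t) (tsub \<rho> \<pi> u)"
| "sub k \<rho> \<pi> (Rel r ts) = Rel r (map (tsub \<rho> \<pi>) ts)"
| "sub k \<rho> \<pi> (Neg \<phi>) = Neg (sub k \<rho> \<pi> \<phi>)"
| "sub k \<rho> \<pi> (Conj \<phi> \<psi>) = Conj (sub k \<rho> \<pi> \<phi>) (sub k \<rho> \<pi> \<psi>)"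
| "sub k \<rho> \<pi> (Exi s n \<phi>) = Exi s (n + k) (sub k (\<rho>((s, n) := Var s (n + k))) \<pi> \<phi>)"

lemma teval_cong:
  "(\<And>w. w \<in> tvars t \<Longrightarrow> v w = v' w) \<Longrightarrow> teval M v t = teval M v' t"
proof (induction t)
  case (Fn f ts)
  have "map (teval M v) ts = map (teval M v') ts" using Fn by (auto simp: map_eq_conv)
  then show ?case by (simp only: teval.simps)
qed auto

lemma sat_cong:
  "(\<And>w. w \<in> fv \<phi> \<Longrightarrow> v w = v' w) \<Longrightarrow> sat M v \<phi> = sat M v' \<phi>"
proof (induction \<phi> arbitrary: v v')
  case (Eq t u)
  have "teval M v t = teval M v' t" "teval M v u = teval M v' u"
    by (rule teval_cong; use Eq in simp)+
  then show ?case by simp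
next
  case (Rel r ts)
  have "map (teval M v) ts = map (teval M v') ts"
    unfolding map_eq_conv by (intro ballI teval_cong) (use Rel in auto)
  then show ?case by (simp only: sat.simps)
next
  case (Neg \<phi>) then show ?case by (metis fv.simps(3) sat.simps(3))
next
  case (Conj \<phi> \<psi>) then show ?case by (metis UnCI fv.simps(4) sat.simps(4))
next
  case (Exi s n \<phi>)
  have "sat M (v((s, n) := c)) \<phi> = sat M (v'((s, n) := c)) \<phi>" for c
    by (rule Exi.IH) (use Exi.prems in auto)
  then show ?case by simp
qed

lemma teval_tsub:
  "(\<And>c. c \<in> tpars t \<Longrightarrow> teval M v (\<pi> c) = c) \<Longrightarrow>
   teval M v (tsub \<rho> \<pi> t) = teval M (\<lambda>w. teval M v (\<rho> w)) t"
proof (induction t)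
  case (Fn f ts)
  have "map (teval M v \<circ> tsub \<rho> \<pi>) ts = map (teval M (\<lambda>w. teval M v (\<rho> w))) ts"
    unfolding map_eq_conv using Fn by auto
  then show ?case by (simp only: teval.simps tsub.simps map_map)
qed auto

text \<open>
  The hypothesis allows two kinds of values of \<open>\<rho>\<close>: terms with indices below \<open>k\<close>, which no
  renamed quantifier can bind, and the renaming \<open>(s, n) \<mapsto> (s, n + k)\<close>, which is what \<open>\<rho>\<close> becomes
  at the variables bound on the way.
\<close>

lemma sat_sub:
  assumes "\<And>w. (\<forall>x\<in>tvars (\<rho> w). snd x < k) \<or> \<rho> w = Var (fst w) (snd w + k)"
    and "\<And>c. c \<in> pars \<phi> \<Longrightarrow> teval M v (\<pi> c) = c \<and> (\<forall>x\<in>tvars (\<pi> c). snd x < k)"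
  shows "sat M v (sub k \<rho> \<pi> \<phi>) = sat M (\<lambda>w. teval M v (\<rho> w)) \<phi>"
  using assms
proof (induction \<phi> arbitrary: v \<rho>)
  case (Eq t u) then show ?case by (simp add: teval_tsub)
next
  case (Rel r ts)
  have "map (teval M v \<circ> tsub \<rho> \<pi>) ts = map (teval M (\<lambda>w. teval M v (\<rho> w))) ts"
    unfolding map_eq_conv o_def by (intro ballI teval_tsub) (use Rel in fastforce)
  then show ?case by (simp only: sat.simps sub.simps map_map)
next
  case (Exi s n \<phi>)
  let ?\<rho> = "\<rho>((s, n) := Var s (n + k))"
  have "sat M (v((s, n + k) := c)) (sub k ?\<rho> \<pi> \<phi>) =
        sat M ((\<lambda>w. teval M v (\<rho> w))((s, n) := c)) \<phi>" for c
  proof -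
    let ?v = "v((s, n + k) := c)"
    have "sat M ?v (sub k ?\<rho> \<pi> \<phi>) = sat M (\<lambda>w. teval M ?v (?\<rho> w)) \<phi>"
    proof (rule Exi.IH)
      fix w show "(\<forall>x\<in>tvars (?\<rho> w). snd x < k) \<or> ?\<rho> w = Var (fst w) (snd w + k)"
        using Exi.prems(1)[of w] by auto
    next
      fix d assume d: "d \<in> pars \<phi>"
      have "teval M ?v (\<pi> d) = teval M v (\<pi> d)"
        by (rule teval_cong) (use Exi.prems(2)[of d] d in auto)
      then show "teval M ?v (\<pi> d) = d \<and> (\<forall>x\<in>tvars (\<pi> d). snd x < k)"
        using Exi.prems(2)[of d] d by simp
    qed
    also have "(\<lambda>w. teval M ?v (?\<rho> w)) = (\<lambda>w. teval M v (\<rho> w))((s, n) := c)"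
    proof
      fix w
      show "teval M ?v (?\<rho> w) = ((\<lambda>w. teval M v (\<rho> w))((s, n) := c)) w"
      proof (cases "w = (s, n)")
        case False
        have "teval M ?v (\<rho> w) = teval M v (\<rho> w)"
          by (rule teval_cong) (use Exi.prems(1)[of w] False in \<open>auto simp: prod_eq_iff\<close>)
        then show ?thesis using False by simp
      qed simp
    qed
    finally show ?thesis .
  qed
  then show ?case by simp
next
  case (Conj \<phi> \<psi>)
  have "sat M v (sub k \<rho> \<pi> \<phi>) = sat M (\<lambda>w. teval M v (\<rho> w)) \<phi>"
    "sat M v (sub k \<rho> \<pi> \<psi>) = sat M (\<lambda>w. teval M v (\<rho> w)) \<psi>"
    by (rule Conj.IH(1), rule Conj.prems(1), use Conj.prems(2) in fastforce)
      (rule Conj.IH(2), rule Conj.prems(1), use Conj.prems(2) in fastforce)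
  then show ?case by simp
qed auto

lemma tvars_tsub: "tvars (tsub \<rho> \<pi> t) = (\<Union>w\<in>tvars t. tvars (\<rho> w)) \<union> (\<Union>c\<in>tpars t. tvars (\<pi> c))"
  by (induction t) auto

lemma tpars_tsub: "tpars (tsub \<rho> \<pi> t) = (\<Union>w\<in>tvars t. tpars (\<rho> w)) \<union> (\<Union>c\<in>tpars t. tpars (\<pi> c))"
  by (induction t) auto

lemma fv_subD:
  "x \<in> fv (sub k \<rho> \<pi> \<phi>) \<Longrightarrow> (\<exists>w\<in>fv \<phi>. x \<in> tvars (\<rho> w)) \<or> (\<exists>c\<in>pars \<phi>. x \<in> tvars (\<pi> c))"
proof (induction \<phi> arbitrary: \<rho>)
  case (Eq t u) then show ?case by (simp add: tvars_tsub) blast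
next
  case (Rel r ts) then show ?case by (simp add: tvars_tsub) blast
next
  case (Neg \<phi>) then show ?case by simp
next
  case (Conj \<phi> \<psi>)
  then consider "x \<in> fv (sub k \<rho> \<pi> \<phi>)" | "x \<in> fv (sub k \<rho> \<pi> \<psi>)" by auto
  then show ?case using Conj.IH[of \<rho>] by cases (simp, blast)+
next
  case (Exi s n \<phi>)
  let ?\<rho> = "\<rho>((s, n) := Var s (n + k))"
  have x: "x \<in> fv (sub k ?\<rho> \<pi> \<phi>)" using Exi.prems by simp
  from Exi.IH[OF x] show ?case
  proof (elim disjE bexE)
    fix w assume w: "w \<in> fv \<phi>" "x \<in> tvars (?\<rho> w)"
    then have "w \<noteq> (s, n)" using Exi.prems by auto
    then have "w \<in> fv (Exi s n \<phi>)" "x \<in> tvars (\<rho> w)" using w by auto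
    then show ?thesis by blast
  qed auto
qed

lemma pars_subD:
  "x \<in> pars (sub k \<rho> \<pi> \<phi>) \<Longrightarrow> (\<exists>w\<in>fv \<phi>. x \<in> tpars (\<rho> w)) \<or> (\<exists>c\<in>pars \<phi>. x \<in> tpars (\<pi> c))"
proof (induction \<phi> arbitrary: \<rho>)
  case (Eq t u) then show ?case by (simp add: tpars_tsub) blast
next
  case (Rel r ts) then show ?case by (simp add: tpars_tsub) blast
next
  case (Neg \<phi>) then show ?case by simp
next
  case (Conj \<phi> \<psi>)
  then consider "x \<in> pars (sub k \<rho> \<pi> \<phi>)" | "x \<in> pars (sub k \<rho> \<pi> \<psi>)" by auto
  then show ?case using Conj.IH[of \<rho>] by cases (simp, blast)+
next
  case (Exi s n \<phi>)
  let ?\<rho> = "\<rho>((s, n) := Var s (n + k))"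
  have x: "x \<in> pars (sub k ?\<rho> \<pi> \<phi>)" using Exi.prems by simp
  from Exi.IH[OF x] show ?case
  proof (elim disjE bexE)
    fix w assume w: "w \<in> fv \<phi>" "x \<in> tpars (?\<rho> w)"
    then have "w \<noteq> (s, n)" using Exi.prems by auto
    then have "w \<in> fv (Exi s n \<phi>)" "x \<in> tpars (\<rho> w)" using w by auto
    then show ?thesis by blast
  qed auto
qed

lemma twf_tsub:
  assumes "\<And>w. twf M (\<rho> w) \<and> tsort M (\<rho> w) = fst w"
    and "\<And>c. c \<in> tpars t \<Longrightarrow> twf M (\<pi> c) \<and> tsort M (\<pi> c) = srt M c" "twf M t"
  shows "twf M (tsub \<rho> \<pi> t) \<and> tsort M (tsub \<rho> \<pi> t) = tsort M t"
  using assms(2,3)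
proof (induction t)
  case (Fn f ts)
  have "map (tsort M \<circ> tsub \<rho> \<pi>) ts = map (tsort M) ts"
    unfolding map_eq_conv using Fn by auto
  moreover have "\<forall>u\<in>set ts. twf M (tsub \<rho> \<pi> u)" using Fn by fastforce
  ultimately show ?case using Fn.prems(2) by (simp del: map_eq_conv)
qed (use assms(1) in auto)

lemma wf_sub:
  assumes "\<And>w. twf M (\<rho> w) \<and> tsort M (\<rho> w) = fst w"
    and "\<And>c. c \<in> pars \<phi> \<Longrightarrow> twf M (\<pi> c) \<and> tsort M (\<pi> c) = srt M c" "wf M \<phi>"
  shows "wf M (sub k \<rho> \<pi> \<phi>)"
  using assms
proof (induction \<phi> arbitrary: \<rho>)
  case (Eq t u)
  then show ?case using twf_tsub[of M \<rho> t \<pi>] twf_tsub[of M \<rho> u \<pi>] by auto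
next
  case (Rel r ts)
  have *: "twf M (tsub \<rho> \<pi> t) \<and> tsort M (tsub \<rho> \<pi> t) = tsort M t" if "t \<in> set ts" for t
    by (rule twf_tsub) (use Rel that in auto)
  then have "map (tsort M \<circ> tsub \<rho> \<pi>) ts = map (tsort M) ts"
    unfolding map_eq_conv by auto
  then show ?case using * Rel.prems(3) by (simp del: map_eq_conv)
next
  case (Exi s n \<phi>)
  have "wf M (sub k (\<rho>((s, n) := Var s (n + k))) \<pi> \<phi>)"
    by (rule Exi.IH) (use Exi.prems in auto)
  then show ?case by simp
qed auto

lemma finite_tpars: "finite (tpars t)" by (induction t) auto
lemma finite_pars: "finite (pars \<phi>)" by (induction \<phi>) (auto simp: finite_tpars)

section \<open>Definable sets\<close>

lemma tuples_nil [simp]: "tuples M [] = {[]}"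
  by (auto simp: tuples_def)

lemma tuples_append_iff: "length a = length \<sigma> \<Longrightarrow> a @ c \<in> tuples M (\<sigma> @ \<tau>) \<longleftrightarrow> a \<in> tuples M \<sigma> \<and> c \<in> tuples M \<tau>"
  by (auto simp: tuples_def)

lemma tuples_appendI [intro]: "a \<in> tuples M \<sigma> \<Longrightarrow> c \<in> tuples M \<tau> \<Longrightarrow> a @ c \<in> tuples M (\<sigma> @ \<tau>)"
  by (auto simp: tuples_def)

lemma tuples_length: "a \<in> tuples M \<sigma> \<Longrightarrow> length a = length \<sigma>"
  by (auto simp: tuples_def)

lemma tuples_appendE:
  assumes "w \<in> tuples M (\<sigma> @ \<tau>)"
  obtains a c where "a \<in> tuples M \<sigma>" "c \<in> tuples M \<tau>" "w = a @ c"
proof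
  let ?n = "length \<sigma>"
  have m: "map (srt M) w = \<sigma> @ \<tau>" using assms by (simp add: tuples_def)
  show "take ?n w \<in> tuples M \<sigma>" "drop ?n w \<in> tuples M \<tau>" "w = take ?n w @ drop ?n w"
    using m by (simp_all add: tuples_def flip: take_map drop_map)
qed

lemma tuples_self [simp]: "a \<in> tuples M (map (srt M) a)"
  by (simp add: tuples_def)

lemma append_tuples_eq:
  "a \<in> tuples M \<sigma> \<Longrightarrow> a' \<in> tuples M \<sigma> \<Longrightarrow> a @ c = a' @ c' \<longleftrightarrow> a = a' \<and> c = c'"
  by (auto simp: tuples_def dest: map_eq_imp_length_eq)

lemma concat_inj:
  "length as = length bs \<Longrightarrow> set as \<subseteq> tuples M \<rho> \<Longrightarrow> set bs \<subseteq> tuples M \<rho> \<Longrightarrow> concat as = concat bs \<Longrightarrow> as = bs"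
proof (induction as bs rule: list_induct2)
  case (Cons a as b bs)
  have "a = b \<and> concat as = concat bs" using append_tuples_eq[of a M \<rho> b "concat as" "concat bs"] Cons.prems by simp
  then show ?case using Cons by simp
qed simp

lemma asg_tuple: "a \<in> tuples M \<sigma> \<Longrightarrow> i < length \<sigma> \<Longrightarrow> asg M a (\<sigma> ! i, i) = a ! i"
  by (auto simp: asg_def tuples_def)

lemma asg_tuple': "a \<in> tuples M \<sigma> \<Longrightarrow> i < length \<sigma> \<Longrightarrow> \<sigma> ! i = s \<Longrightarrow> asg M a (s, i) = a ! i"
  using asg_tuple by blast

lemma fmsD:
  assumes "\<phi> \<in> fms M B \<sigma>" shows "wf M \<phi>" "pars \<phi> \<subseteq> B" "fv \<phi> \<subseteq> {(\<sigma> ! i, i) |i. i < length \<sigma>}"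
  using assms by (auto simp: fms_def)

lemma definable_sub: "definable M B \<sigma> X \<Longrightarrow> X \<subseteq> tuples M \<sigma>"
  by (auto simp: definable_def)

lemma definable_mono: "definable M B \<sigma> X \<Longrightarrow> B \<subseteq> B' \<Longrightarrow> definable M B' \<sigma> X"
  unfolding definable_def fms_def by blast

lemma definable_Int:
  assumes "definable M B \<sigma> X" "definable M B \<sigma> Y" shows "definable M B \<sigma> (X \<inter> Y)"
proof -
  obtain \<phi> \<psi> where "\<phi> \<in> fms M B \<sigma>" "X = {a \<in> tuples M \<sigma>. holds M \<phi> a}"
    "\<psi> \<in> fms M B \<sigma>" "Y = {a \<in> tuples M \<sigma>. holds M \<psi> a}"
    using assms unfolding definable_def by blast
  then show ?thesis unfolding definable_def
    by (intro bexI[of _ "Conj \<phi> \<psi>"]) (auto simp: holds_def fms_def)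
qed

lemma definable_Diff:
  assumes "definable M B \<sigma> X" shows "definable M B \<sigma> (tuples M \<sigma> - X)"
proof -
  obtain \<phi> where "\<phi> \<in> fms M B \<sigma>" "X = {a \<in> tuples M \<sigma>. holds M \<phi> a}"
    using assms unfolding definable_def by blast
  then show ?thesis unfolding definable_def
    by (intro bexI[of _ "Neg \<phi>"]) (auto simp: holds_def fms_def)
qed

text \<open>
  The list \<open>es\<close> says what to put at each coordinate of \<open>X\<close>: a coordinate of the new tuple or a
  parameter.  So coordinates may be permuted, repeated, added, or specialized to parameters.
\<close>

lemma definable_reindex:
  assumes X: "definable M B \<tau> X" and len: "length es = length \<tau>" and BB: "B \<subseteq> B'"
    and es: "\<And>i. i < length \<tau> \<Longrightarrow>
      case es ! i of Inl j \<Rightarrow> j < length \<sigma> \<and> \<sigma> ! j = \<tau> ! i | Inr c \<Rightarrow> c \<in> B' \<and> srt M c = \<tau> ! i"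
  shows "definable M B' \<sigma> {a \<in> tuples M \<sigma>. map (case_sum ((!) a) id) es \<in> X}"
proof -
  obtain \<phi> where \<phi>: "\<phi> \<in> fms M B \<tau>" and Xeq: "X = {a \<in> tuples M \<tau>. holds M \<phi> a}"
    using X unfolding definable_def by blast
  let ?k = "length \<sigma>"
  define \<rho> :: "'a \<times> nat \<Rightarrow> ('a, 'b, 'd) tm" where
    "\<rho> = (\<lambda>(s, n). if n < length \<tau> \<and> \<tau> ! n = s
        then (case es ! n of Inl j \<Rightarrow> Var s j | Inr c \<Rightarrow> Par c) else Var s (n + ?k))"
  let ?\<psi> = "sub ?k \<rho> Par \<phi>"
  have sorts: "twf M (\<rho> w) \<and> tsort M (\<rho> w) = fst w" for w
    using es[of "snd w"] by (cases w) (auto simp: \<rho>_def split: sum.splits)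
  have low: "(\<forall>x\<in>tvars (\<rho> w). snd x < ?k) \<or> \<rho> w = Var (fst w) (snd w + ?k)" for w
    using es[of "snd w"] by (cases w) (auto simp: \<rho>_def split: sum.splits)
  have wf: "wf M ?\<psi>" by (rule wf_sub) (use sorts fmsD(1)[OF \<phi>] in auto)
  have fv\<phi>: "\<exists>i<length \<tau>. w = (\<tau> ! i, i)" if "w \<in> fv \<phi>" for w using fmsD(3)[OF \<phi>] that by auto
  have "x \<in> {(\<sigma> ! i, i) |i. i < length \<sigma>}" if "x \<in> fv ?\<psi>" for x
  proof -
    from fv_subD[OF that] have "\<exists>w\<in>fv \<phi>. x \<in> tvars (\<rho> w)" by simp
    then obtain w where "w \<in> fv \<phi>" "x \<in> tvars (\<rho> w)" by blast
    moreover then obtain i where "i < length \<tau>" "w = (\<tau> ! i, i)" using fv\<phi> by blast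
    ultimately show ?thesis using es[of i] by (auto simp: \<rho>_def split: sum.splits)
  qed
  moreover have "pars ?\<psi> \<subseteq> B'"
  proof
    fix c assume "c \<in> pars ?\<psi>"
    then consider "c \<in> pars \<phi>" | w where "w \<in> fv \<phi>" "c \<in> tpars (\<rho> w)"
      using pars_subD[of c ?k \<rho> Par \<phi>] by auto
    then show "c \<in> B'"
    proof cases
      case 1 then show ?thesis using fmsD(2)[OF \<phi>] BB by auto
    next
      case 2
      then obtain i where "i < length \<tau>" "w = (\<tau> ! i, i)" using fv\<phi> by blast
      then show ?thesis using es[of i] 2 by (auto simp: \<rho>_def split: sum.splits)
    qed
  qed
  ultimately have mem: "?\<psi> \<in> fms M B' \<sigma>" using wf by (auto simp: fms_def)
  have "holds M ?\<psi> a \<longleftrightarrow> map (case_sum ((!) a) id) es \<in> X" if a: "a \<in> tuples M \<sigma>" for a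
  proof -
    let ?e = "map (case_sum ((!) a) id) es"
    have sa: "i < length \<sigma> \<Longrightarrow> srt M (a ! i) = \<sigma> ! i" "length a = length \<sigma>" for i
      using a by (auto simp: tuples_def)
    have et: "?e \<in> tuples M \<tau>"
      unfolding tuples_def mem_Collect_eq
    proof (rule nth_equalityI)
      fix i assume "i < length (map (srt M) ?e)"
      then have "i < length \<tau>" using len by simp
      then show "map (srt M) ?e ! i = \<tau> ! i" using es[of i] sa len by (auto split: sum.splits)
    qed (use len in simp)
    have "holds M ?\<psi> a \<longleftrightarrow> sat M (\<lambda>w. teval M (asg M a) (\<rho> w)) \<phi>"
      unfolding holds_def by (rule sat_sub) (use low in auto)
    also have "\<dots> \<longleftrightarrow> holds M \<phi> ?e" unfolding holds_def
    proof (rule sat_cong)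
      fix w assume "w \<in> fv \<phi>"
      then obtain i where i: "i < length \<tau>" "w = (\<tau> ! i, i)" using fv\<phi> by blast
      show "teval M (asg M a) (\<rho> w) = asg M ?e w"
      proof (cases "es ! i")
        case (Inl j)
        then have "j < length \<sigma>" "\<sigma> ! j = \<tau> ! i" using es[OF i(1)] by auto
        then show ?thesis using i len asg_tuple[OF et i(1)] asg_tuple'[OF a, of j "\<tau> ! i"] Inl
          by (simp add: \<rho>_def)
      next
        case (Inr c)
        then show ?thesis using i len asg_tuple[OF et i(1)] by (simp add: \<rho>_def)
      qed
    qed
    finally show ?thesis using et Xeq by auto
  qed
  then show ?thesis unfolding definable_def by (intro bexI[OF _ mem]) auto
qed

text \<open>
  The converse of specialization: a set definable over \<open>B \<union> set b\<close> is the fibre over \<open>b\<close> of a set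
  definable over \<open>B\<close>.  The substitution replaces each parameter from \<open>b\<close> by the variable of one of
  its positions in \<open>b\<close>.
\<close>

lemma definable_abstract:
  assumes X: "definable M (B \<union> set b) \<sigma> X"
  shows "\<exists>Z. definable M B (\<sigma> @ map (srt M) b) Z \<and> X = {a \<in> tuples M \<sigma>. a @ b \<in> Z}"
proof -
  obtain \<phi> where \<phi>: "\<phi> \<in> fms M (B \<union> set b) \<sigma>" and Xeq: "X = {a \<in> tuples M \<sigma>. holds M \<phi> a}"
    using X unfolding definable_def by blast
  let ?k = "length \<sigma> + length b" and ?\<tau> = "\<sigma> @ map (srt M) b"
  define ix where "ix c = (LEAST i. i < length b \<and> b ! i = c)" for c
  have ix: "ix c < length b \<and> b ! ix c = c" if "c \<in> set b" for c
    using that unfolding ix_def in_set_conv_nth by (rule LeastI_ex)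
  define \<rho> :: "'a \<times> nat \<Rightarrow> ('a, 'b, 'd) tm" where
    "\<rho> = (\<lambda>(s, n). if n < length \<sigma> then Var s n else Var s (n + ?k))"
  define \<pi> :: "'d \<Rightarrow> ('a, 'b, 'd) tm" where
    "\<pi> = (\<lambda>c. if c \<in> set b then Var (srt M c) (length \<sigma> + ix c) else Par c)"
  let ?\<psi> = "sub ?k \<rho> \<pi> \<phi>"
  have wf: "wf M ?\<psi>"
    by (rule wf_sub) (use fmsD(1)[OF \<phi>] in \<open>auto simp: \<rho>_def \<pi>_def\<close>)
  have fv\<phi>: "\<exists>i<length \<sigma>. w = (\<sigma> ! i, i)" if "w \<in> fv \<phi>" for w using fmsD(3)[OF \<phi>] that by auto
  have "x \<in> {(?\<tau> ! i, i) |i. i < length ?\<tau>}" if "x \<in> fv ?\<psi>" for x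
  proof -
    from fv_subD[OF that] show ?thesis
    proof (elim disjE bexE exE)
      fix w assume 1: "w \<in> fv \<phi>" "x \<in> tvars (\<rho> w)"
      then obtain i where i: "i < length \<sigma>" "w = (\<sigma> ! i, i)" using fv\<phi> by blast
      then have "\<rho> w = Var (\<sigma> ! i) i" by (simp add: \<rho>_def)
      then have "x = (?\<tau> ! i, i)" "i < length ?\<tau>" using 1 i(1) by (simp_all add: nth_append)
      then show ?thesis unfolding mem_Collect_eq by (intro exI conjI)
    next
      fix c assume 2: "x \<in> tvars (\<pi> c)"
      have c: "c \<in> set b"
      proof (rule ccontr)
        assume "c \<notin> set b"
        then show False using 2 by (simp add: \<pi>_def)
      qed
      then have "x = (srt M c, length \<sigma> + ix c)" using 2 by (simp add: \<pi>_def)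
      then have "x = (?\<tau> ! (length \<sigma> + ix c), length \<sigma> + ix c)" "length \<sigma> + ix c < length ?\<tau>"
        using ix[OF c] by (simp_all add: nth_append)
      then show ?thesis unfolding mem_Collect_eq by (intro exI conjI)
    qed
  qed
  moreover have "pars ?\<psi> \<subseteq> B"
  proof -
    have "tpars (\<rho> w) = {}" for w by (cases w) (simp add: \<rho>_def)
    moreover have "tpars (\<pi> c) \<subseteq> B" if "c \<in> pars \<phi>" for c
      using subsetD[OF fmsD(2)[OF \<phi>] that] by (auto simp: \<pi>_def)
    ultimately show ?thesis using pars_subD[of _ ?k \<rho> \<pi> \<phi>] by blast
  qed
  ultimately have mem: "?\<psi> \<in> fms M B ?\<tau>" using wf by (auto simp: fms_def)
  have "holds M ?\<psi> (a @ b) \<longleftrightarrow> holds M \<phi> a" if a: "a \<in> tuples M \<sigma>" for a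
  proof -
    have ab: "a @ b \<in> tuples M ?\<tau>" using a by auto
    have la: "length a = length \<sigma>" using a by (auto simp: tuples_def)
    have "holds M ?\<psi> (a @ b) \<longleftrightarrow> sat M (\<lambda>w. teval M (asg M (a @ b)) (\<rho> w)) \<phi>"
      unfolding holds_def
    proof (rule sat_sub)
      fix c
      show "teval M (asg M (a @ b)) (\<pi> c) = c \<and> (\<forall>x\<in>tvars (\<pi> c). snd x < ?k)"
      proof (cases "c \<in> set b")
        case True
        then show ?thesis using ix[OF True] la by (simp add: \<pi>_def asg_def nth_append)
      qed (simp add: \<pi>_def)
    next
      fix w show "(\<forall>x\<in>tvars (\<rho> w). snd x < ?k) \<or> \<rho> w = Var (fst w) (snd w + ?k)"
      proof (cases "snd w < length \<sigma>")
        case True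
        then have "\<rho> w = Var (fst w) (snd w)" by (cases w) (simp add: \<rho>_def)
        then show ?thesis using True by simp
      next
        case False
        then show ?thesis by (cases w) (simp add: \<rho>_def)
      qed
    qed
    also have "\<dots> \<longleftrightarrow> holds M \<phi> a" unfolding holds_def
    proof (rule sat_cong)
      fix w assume "w \<in> fv \<phi>"
      then obtain i where i: "i < length \<sigma>" "w = (\<sigma> ! i, i)" using fv\<phi> by blast
      show "teval M (asg M (a @ b)) (\<rho> w) = asg M a w"
      proof -
        have "asg M (a @ b) (\<sigma> ! i, i) = (a @ b) ! i"
          by (rule asg_tuple'[OF ab]) (use i in \<open>simp_all add: nth_append\<close>)
        then show ?thesis using i asg_tuple[OF a i(1)] la by (simp add: \<rho>_def nth_append)
      qed
    qed
    finally show ?thesis .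
  qed
  moreover have "a @ b \<in> tuples M ?\<tau>" if "a \<in> tuples M \<sigma>" for a using that by auto
  ultimately have "X = {a \<in> tuples M \<sigma>. a @ b \<in> {w \<in> tuples M ?\<tau>. holds M ?\<psi> w}}"
    unfolding Xeq by (intro Collect_cong) blast
  then show ?thesis unfolding definable_def using mem by blast
qed

lemma definable_project1:
  assumes X: "definable M B (\<sigma> @ [s]) X"
  shows "definable M B \<sigma> {a \<in> tuples M \<sigma>. \<exists>c\<in>tuples M [s]. a @ c \<in> X}"
proof -
  obtain \<phi> where \<phi>: "\<phi> \<in> fms M B (\<sigma> @ [s])" and Xeq: "X = {a \<in> tuples M (\<sigma> @ [s]). holds M \<phi> a}"
    using X unfolding definable_def by blast
  let ?\<psi> = "Exi s (length \<sigma>) \<phi>"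
  have mem: "?\<psi> \<in> fms M B \<sigma>"
  proof -
    have "fv ?\<psi> \<subseteq> {(\<sigma> ! i, i) |i. i < length \<sigma>}"
    proof
      fix w assume w: "w \<in> fv ?\<psi>"
      then obtain i where i: "i < Suc (length \<sigma>)" "w = ((\<sigma> @ [s]) ! i, i)"
        using fmsD(3)[OF \<phi>] by auto
      then have "i < length \<sigma>" using w by (auto simp: less_Suc_eq)
      then show "w \<in> {(\<sigma> ! i, i) |i. i < length \<sigma>}" using i by (auto simp: nth_append)
    qed
    then show ?thesis using \<phi> by (auto simp: fms_def)
  qed
  have "holds M ?\<psi> a \<longleftrightarrow> (\<exists>c\<in>tuples M [s]. a @ c \<in> X)" if a: "a \<in> tuples M \<sigma>" for a
  proof -
    have la: "length a = length \<sigma>" using a by (auto simp: tuples_def)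
    have *: "sat M ((asg M a)((s, length \<sigma>) := c)) \<phi> \<longleftrightarrow> a @ [c] \<in> X" if c: "srt M c = s" for c
    proof -
      have ac: "a @ [c] \<in> tuples M (\<sigma> @ [s])" using a c by (auto simp: tuples_def)
      have "sat M ((asg M a)((s, length \<sigma>) := c)) \<phi> \<longleftrightarrow> sat M (asg M (a @ [c])) \<phi>"
      proof (rule sat_cong)
        fix w assume "w \<in> fv \<phi>"
        then obtain i where i: "i < Suc (length \<sigma>)" "w = ((\<sigma> @ [s]) ! i, i)"
          using fmsD(3)[OF \<phi>] by auto
        then show "((asg M a)((s, length \<sigma>) := c)) w = asg M (a @ [c]) w"
        proof (cases "i < length \<sigma>")
          case True
          have "asg M (a @ [c]) (\<sigma> ! i, i) = (a @ [c]) ! i"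
            by (rule asg_tuple'[OF ac]) (use True in \<open>simp_all add: nth_append\<close>)
          then show ?thesis using i True asg_tuple[OF a True] la by (simp add: nth_append)
        next
          case False
          have "asg M (a @ [c]) (s, length \<sigma>) = (a @ [c]) ! length \<sigma>"
            by (rule asg_tuple'[OF ac]) simp_all
          then show ?thesis using i False la by (simp add: nth_append less_Suc_eq)
        qed
      qed
      then show ?thesis using ac Xeq by (simp add: holds_def)
    qed
    have "holds M ?\<psi> a \<longleftrightarrow> (\<exists>c. srt M c = s \<and> a @ [c] \<in> X)"
      unfolding holds_def using * by auto
    also have "\<dots> \<longleftrightarrow> (\<exists>c\<in>tuples M [s]. a @ c \<in> X)"
      by (auto simp: tuples_def map_eq_Cons_conv Bex_def)
    finally show ?thesis .
  qed
  then show ?thesis unfolding definable_def by (intro bexI[OF _ mem]) auto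
qed

lemma definable_project:
  "definable M B (\<sigma> @ \<tau>) X \<Longrightarrow> definable M B \<sigma> {a \<in> tuples M \<sigma>. \<exists>c\<in>tuples M \<tau>. a @ c \<in> X}"
proof (induction \<tau> arbitrary: X rule: rev_induct)
  case Nil
  then have "{a \<in> tuples M \<sigma>. \<exists>c\<in>tuples M []. a @ c \<in> X} = X" using definable_sub by fastforce
  then show ?case using Nil by simp
next
  case (snoc s \<tau>)
  let ?Y = "{a \<in> tuples M (\<sigma> @ \<tau>). \<exists>c\<in>tuples M [s]. a @ c \<in> X}"
  have "definable M B (\<sigma> @ \<tau>) ?Y" by (rule definable_project1) (use snoc in simp)
  then have "definable M B \<sigma> {a \<in> tuples M \<sigma>. \<exists>c\<in>tuples M \<tau>. a @ c \<in> ?Y}" by (rule snoc.IH)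
  also have "{a \<in> tuples M \<sigma>. \<exists>c\<in>tuples M \<tau>. a @ c \<in> ?Y} = {a \<in> tuples M \<sigma>. \<exists>c\<in>tuples M (\<tau> @ [s]). a @ c \<in> X}"
  proof (intro equalityI subsetI)
    fix a assume "a \<in> {a \<in> tuples M \<sigma>. \<exists>c\<in>tuples M \<tau>. a @ c \<in> ?Y}"
    then obtain c d where "a \<in> tuples M \<sigma>" "c \<in> tuples M \<tau>" "d \<in> tuples M [s]" "a @ c @ d \<in> X" by auto
    then show "a \<in> {a \<in> tuples M \<sigma>. \<exists>c\<in>tuples M (\<tau> @ [s]). a @ c \<in> X}" by blast
  qed (auto elim!: tuples_appendE)
  finally show ?case .
qed

lemma definable_finite_parameters:
  assumes "definable M B \<sigma> X" shows "\<exists>b. set b \<subseteq> B \<and> definable M (set b) \<sigma> X"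
proof -
  obtain \<phi> where \<phi>: "\<phi> \<in> fms M B \<sigma>" and Xeq: "X = {a \<in> tuples M \<sigma>. holds M \<phi> a}"
    using assms unfolding definable_def by blast
  obtain b where "set b = pars \<phi>" using finite_list[OF finite_pars[of \<phi>]] by blast
  then have "\<phi> \<in> fms M (set b) \<sigma>" "set b \<subseteq> B" using \<phi> by (simp_all add: fms_def)
  then show ?thesis unfolding definable_def using Xeq by blast
qed

lemma definable_const:
  fixes M :: "('s, 'f, 'r, 'm) struct"
  assumes "is_structure M" shows "definable M B \<sigma> (tuples M \<sigma>)" "definable M B \<sigma> {}"
proof -
  fix s :: 's
  let ?\<phi> = "Exi s 0 (Eq (Var s 0) (Var s 0)) :: ('s, 'f, 'r, 'm) fm"
  obtain c where "srt M c = s" using assms unfolding is_structure_def surj_def by metis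
  then have "holds M ?\<phi> a" for a by (auto simp: holds_def)
  moreover have "?\<phi> \<in> fms M B \<sigma>" by (auto simp: fms_def)
  ultimately show 1: "definable M B \<sigma> (tuples M \<sigma>)" unfolding definable_def by blast
  show "definable M B \<sigma> {}" using definable_Diff[OF 1] by simp
qed

lemma definable_diagonal:
  fixes M :: "('s, 'f, 'r, 'm) struct"
  assumes "is_structure M" shows "definable M B (\<sigma> @ \<sigma>) {a @ a |a. a \<in> tuples M \<sigma>}"
proof -
  have coord: "definable M B (\<sigma> @ \<sigma>) {w \<in> tuples M (\<sigma> @ \<sigma>). w ! i = w ! (length \<sigma> + i)}"
    if i: "i < length \<sigma>" for i
  proof -
    let ?\<phi> = "Eq (Var (\<sigma> ! i) i) (Var (\<sigma> ! i) (length \<sigma> + i)) :: ('s, 'f, 'r, 'm) fm"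
    let ?V = "{((\<sigma> @ \<sigma>) ! i, i) |i. i < length (\<sigma> @ \<sigma>)}"
    have V: "(s, j) \<in> ?V" if "j < length (\<sigma> @ \<sigma>)" "(\<sigma> @ \<sigma>) ! j = s" for s j
      unfolding mem_Collect_eq by (rule exI[of _ j]) (use that in simp)
    have "(\<sigma> ! i, i) \<in> ?V" by (rule V) (use i in \<open>simp_all add: nth_append\<close>)
    moreover have "(\<sigma> ! i, length \<sigma> + i) \<in> ?V" by (rule V) (use i in \<open>simp_all add: nth_append\<close>)
    ultimately have "fv ?\<phi> \<subseteq> ?V" by (simp only: fv.simps tvars.simps Un_subset_iff) (simp only: empty_subsetI insert_subset)
    then have mem: "?\<phi> \<in> fms M B (\<sigma> @ \<sigma>)" by (simp add: fms_def)
    have "holds M ?\<phi> w \<longleftrightarrow> w ! i = w ! (length \<sigma> + i)" if w: "w \<in> tuples M (\<sigma> @ \<sigma>)" for w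
    proof -
      have "asg M w (\<sigma> ! i, i) = w ! i"
        by (rule asg_tuple'[OF w]) (use i in \<open>simp_all add: nth_append\<close>)
      moreover have "asg M w (\<sigma> ! i, length \<sigma> + i) = w ! (length \<sigma> + i)"
        by (rule asg_tuple'[OF w]) (use i in \<open>simp_all add: nth_append\<close>)
      ultimately show ?thesis by (simp add: holds_def)
    qed
    then show ?thesis unfolding definable_def by (intro bexI[OF _ mem]) (rule Collect_cong, blast)
  qed
  have "definable M B (\<sigma> @ \<sigma>) {w \<in> tuples M (\<sigma> @ \<sigma>). \<forall>i<n. w ! i = w ! (length \<sigma> + i)}"
    if "n \<le> length \<sigma>" for n
    using that
  proof (induction n)
    case 0 then show ?case using definable_const(1)[OF assms, of B "\<sigma> @ \<sigma>"] by simp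
  next
    case (Suc n)
    have "{w \<in> tuples M (\<sigma> @ \<sigma>). \<forall>i<Suc n. w ! i = w ! (length \<sigma> + i)} =
      {w \<in> tuples M (\<sigma> @ \<sigma>). \<forall>i<n. w ! i = w ! (length \<sigma> + i)} \<inter>
      {w \<in> tuples M (\<sigma> @ \<sigma>). w ! n = w ! (length \<sigma> + n)}" by (auto simp only: less_Suc_eq)
    then show ?case using definable_Int[OF Suc.IH coord[of n]] Suc.prems by simp
  qed
  from this[of "length \<sigma>"]
  have "definable M B (\<sigma> @ \<sigma>) {w \<in> tuples M (\<sigma> @ \<sigma>). \<forall>i<length \<sigma>. w ! i = w ! (length \<sigma> + i)}" by simp
  also have "{w \<in> tuples M (\<sigma> @ \<sigma>). \<forall>i<length \<sigma>. w ! i = w ! (length \<sigma> + i)} = {a @ a |a. a \<in> tuples M \<sigma>}"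
  proof (intro equalityI subsetI)
    fix w assume w: "w \<in> {w \<in> tuples M (\<sigma> @ \<sigma>). \<forall>i<length \<sigma>. w ! i = w ! (length \<sigma> + i)}"
    then obtain a c where ac: "a \<in> tuples M \<sigma>" "c \<in> tuples M \<sigma>" "w = a @ c" by (auto elim: tuples_appendE)
    have l: "length a = length \<sigma>" "length c = length \<sigma>" using ac by (simp_all add: tuples_length)
    have "a ! i = c ! i" if "i < length a" for i
    proof -
      have "w ! i = w ! (length \<sigma> + i)" using w that l by simp
      then show ?thesis using that l ac(3) by (simp add: nth_append)
    qed
    then have "a = c" using l by (intro nth_equalityI) simp_all
    then show "w \<in> {a @ a |a. a \<in> tuples M \<sigma>}" using ac by blast
  next
    fix w assume "w \<in> {a @ a |a. a \<in> tuples M \<sigma>}"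
    then obtain a where a: "w = a @ a" "a \<in> tuples M \<sigma>" by blast
    then have "length a = length \<sigma>" by (simp add: tuples_length)
    then show "w \<in> {w \<in> tuples M (\<sigma> @ \<sigma>). \<forall>i<length \<sigma>. w ! i = w ! (length \<sigma> + i)}"
      using a by (simp add: nth_append tuples_appendI)
  qed
  finally show ?thesis .
qed

lemma definable_fibre:
  assumes X: "definable M B (\<sigma> @ \<tau>) X" and c: "c \<in> tuples M \<tau>" and B': "B \<union> set c \<subseteq> B'"
  shows "definable M B' \<sigma> {a \<in> tuples M \<sigma>. a @ c \<in> X}"
proof -
  let ?es = "map Inl [0..<length \<sigma>] @ map Inr c"
  have lc: "length c = length \<tau>" and mc: "map (srt M) c = \<tau>" using c by (auto simp: tuples_def)
  have "definable M B' \<sigma> {a \<in> tuples M \<sigma>. map (case_sum ((!) a) id) ?es \<in> X}"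
  proof (rule definable_reindex[OF X])
    fix i assume i: "i < length (\<sigma> @ \<tau>)"
    show "case ?es ! i of Inl j \<Rightarrow> j < length \<sigma> \<and> \<sigma> ! j = (\<sigma> @ \<tau>) ! i
        | Inr c \<Rightarrow> c \<in> B' \<and> srt M c = (\<sigma> @ \<tau>) ! i"
    proof (cases "i < length \<sigma>")
      case False
      then have k: "i - length \<sigma> < length c" using i lc by simp
      then have "c ! (i - length \<sigma>) \<in> B'" using B' nth_mem by blast
      moreover have "srt M (c ! (i - length \<sigma>)) = \<tau> ! (i - length \<sigma>)" using k mc by (simp flip: nth_map)
      ultimately show ?thesis using False k by (simp add: nth_append)
    qed (simp add: nth_append)
  qed (use B' lc in auto)
  also have "{a \<in> tuples M \<sigma>. map (case_sum ((!) a) id) ?es \<in> X} = {a \<in> tuples M \<sigma>. a @ c \<in> X}"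
  proof (rule Collect_cong, rule conj_cong[OF refl])
    fix a assume "a \<in> tuples M \<sigma>"
    then have "length a = length \<sigma>" by (rule tuples_length)
    then have "map (case_sum ((!) a) id) ?es = a @ c"
      using map_nth[of a] by (simp add: o_def)
    then show "map (case_sum ((!) a) id) ?es \<in> X \<longleftrightarrow> a @ c \<in> X" by simp
  qed
  finally show ?thesis .
qed

section \<open>Definable predicates of several tuples\<close>

text \<open>
  Definability of relations between several tuples is handled without formulas.  A valuation \<open>v\<close>
  assigns to the number \<open>i\<close> a tuple of sorts \<open>\<Gamma> i\<close>, so numbers serve as names of tuple variables;
  a predicate of valuations is definable if it depends definably on finitely many of them.  The
  closure rules for \<open>Def\<close> then follow the syntax of a predicate.
\<close>

definition blocks :: "('s, 'f, 'r, 'm) struct \<Rightarrow> (nat \<Rightarrow> 's list) \<Rightarrow> (nat \<Rightarrow> 'm list) \<Rightarrow> bool" where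
  "blocks M \<Gamma> v \<longleftrightarrow> (\<forall>i. v i \<in> tuples M (\<Gamma> i))"

definition Def :: "('s, 'f, 'r, 'm) struct \<Rightarrow> 'm set \<Rightarrow> (nat \<Rightarrow> 's list) \<Rightarrow>
    ((nat \<Rightarrow> 'm list) \<Rightarrow> bool) \<Rightarrow> bool" where
  "Def M B \<Gamma> P \<longleftrightarrow> (\<exists>ks X. distinct ks \<and> definable M B (concat (map \<Gamma> ks)) X \<and>
     (\<forall>v. blocks M \<Gamma> v \<longrightarrow> (P v \<longleftrightarrow> concat (map v ks) \<in> X)))"

text \<open>The offset at which the block named \<open>i\<close> starts in the concatenation of the blocks \<open>ks\<close>.\<close>

definition pos :: "(nat \<Rightarrow> 'a list) \<Rightarrow> nat list \<Rightarrow> nat \<Rightarrow> nat" where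
  "pos \<Gamma> ks i = length (concat (map \<Gamma> (takeWhile (\<lambda>k. k \<noteq> i) ks)))"

lemma nth_concat_pos:
  assumes "\<And>i. length (u i) = length (\<Gamma> i)" "i \<in> set ks" "j < length (u i)"
  shows "concat (map u ks) ! (pos \<Gamma> ks i + j) = u i ! j \<and> pos \<Gamma> ks i + j < length (concat (map u ks))"
  using assms(2)
proof (induction ks)
  case (Cons k ks)
  show ?case
  proof (cases "k = i")
    case True then show ?thesis using assms(3) by (simp add: pos_def nth_append)
  next
    case False
    then have "pos \<Gamma> (k # ks) i = length (u k) + pos \<Gamma> ks i" using assms(1) by (simp add: pos_def)
    then show ?thesis using Cons False by (simp add: nth_append)
  qed
qed simp

lemma concat_blocks: "blocks M \<Gamma> v \<Longrightarrow> concat (map v ks) \<in> tuples M (concat (map \<Gamma> ks))"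
  by (induction ks) (auto simp: blocks_def)

lemma blocks_eq:
  "blocks M \<Gamma> v \<Longrightarrow> blocks M \<Gamma> v' \<Longrightarrow> concat (map v ks) = concat (map v' ks) \<Longrightarrow> k \<in> set ks \<Longrightarrow> v k = v' k"
proof (induction ks)
  case (Cons l ks)
  have "v l @ concat (map v ks) = v' l @ concat (map v' ks)" using Cons.prems(3) by simp
  moreover have "v l \<in> tuples M (\<Gamma> l)" "v' l \<in> tuples M (\<Gamma> l)" using Cons.prems by (auto simp: blocks_def)
  ultimately have "v l = v' l" "concat (map v ks) = concat (map v' ks)"
    using append_tuples_eq by blast+
  then show ?case using Cons by auto
qed simp

lemma blocks_upd: "blocks M \<Gamma> v \<Longrightarrow> c \<in> tuples M (\<Gamma> i) \<Longrightarrow> blocks M \<Gamma> (v(i := c))"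
  by (simp add: blocks_def)

lemma blocksD: "blocks M \<Gamma> v \<Longrightarrow> v i \<in> tuples M (\<Gamma> i)"
  by (simp add: blocks_def)

lemma tuples_nonempty:
  assumes "is_structure M" shows "\<exists>a. a \<in> tuples M \<sigma>"
proof -
  have "srt M (inv (srt M) s) = s" for s
    using assms by (simp add: is_structure_def surj_f_inv_f)
  then have "map (inv (srt M)) \<sigma> \<in> tuples M \<sigma>" by (simp add: tuples_def o_def)
  then show ?thesis by blast
qed

lemma blocks_exist:
  assumes "is_structure M"
  shows "distinct ks \<Longrightarrow> a \<in> tuples M (concat (map \<Gamma> ks)) \<Longrightarrow>
    \<exists>v. blocks M \<Gamma> v \<and> concat (map v ks) = a"
proof (induction ks arbitrary: a)
  case Nil
  have "blocks M \<Gamma> (\<lambda>i. SOME a. a \<in> tuples M (\<Gamma> i))"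
    unfolding blocks_def using someI_ex[OF tuples_nonempty[OF assms]] by blast
  then show ?case using Nil by auto
next
  case (Cons k ks)
  have "a \<in> tuples M (\<Gamma> k @ concat (map \<Gamma> ks))" using Cons.prems by simp
  then obtain a1 a2 where a: "a1 \<in> tuples M (\<Gamma> k)" "a2 \<in> tuples M (concat (map \<Gamma> ks))" "a = a1 @ a2"
    by (rule tuples_appendE)
  obtain v where v: "blocks M \<Gamma> v" "concat (map v ks) = a2" using Cons a by auto
  have "map (v(k := a1)) ks = map v ks" using Cons.prems(1) by (intro map_cong) auto
  then have "concat (map (v(k := a1)) (k # ks)) = a" using v a by (simp del: map_eq_conv)
  then show ?case using blocks_upd[OF v(1) a(1)] by blast
qed

lemma definable_blocks:
  assumes M: "is_structure M" and X: "definable M B (concat (map \<Gamma> ls)) X"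
    and sub: "set ls \<subseteq> set ks" and dist: "distinct ks"
  shows "definable M B (concat (map \<Gamma> ks)) {concat (map v ks) |v. blocks M \<Gamma> v \<and> concat (map v ls) \<in> X}"
proof -
  let ?\<sigma> = "concat (map \<Gamma> ks)"
  define es :: "(nat + 'd) list" where
    "es = concat (map (\<lambda>i. map (\<lambda>j. Inl (pos \<Gamma> ks i + j)) [0..<length (\<Gamma> i)]) ls)"
  have all2: "list_all2 (\<lambda>e s. case e of Inl j \<Rightarrow> j < length ?\<sigma> \<and> ?\<sigma> ! j = s
      | Inr c \<Rightarrow> c \<in> B \<and> srt M c = s) es (concat (map \<Gamma> ls))"
    unfolding es_def using sub
  proof (induction ls)
    case (Cons i ls)
    have "list_all2 (\<lambda>e s. case e of Inl j \<Rightarrow> j < length ?\<sigma> \<and> ?\<sigma> ! j = s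
      | Inr c \<Rightarrow> c \<in> B \<and> srt M c = s) (map (\<lambda>j. Inl (pos \<Gamma> ks i + j)) [0..<length (\<Gamma> i)]) (\<Gamma> i)"
      unfolding list_all2_conv_all_nth
      using nth_concat_pos[of \<Gamma> \<Gamma> i ks] Cons.prems by simp
    then show ?case using Cons by (simp add: list_all2_appendI)
  qed simp
  have "definable M B ?\<sigma> {a \<in> tuples M ?\<sigma>. map (case_sum ((!) a) id) es \<in> X}"
    by (rule definable_reindex[OF X]) (use all2 in \<open>auto dest: list_all2_lengthD list_all2_nthD2\<close>)
  also have "{a \<in> tuples M ?\<sigma>. map (case_sum ((!) a) id) es \<in> X} =
    {concat (map v ks) |v. blocks M \<Gamma> v \<and> concat (map v ls) \<in> X}"
  proof -
    have *: "map (case_sum ((!) (concat (map v ks))) id) es = concat (map v ls)" if v: "blocks M \<Gamma> v" for v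
      unfolding es_def using sub
    proof (induction ls)
      case (Cons i ls)
      have len: "length (v j) = length (\<Gamma> j)" for j using blocksD[OF v] by (rule tuples_length)
      have "map (\<lambda>j. concat (map v ks) ! (pos \<Gamma> ks i + j)) [0..<length (\<Gamma> i)] = v i"
        by (rule nth_equalityI) (use len nth_concat_pos[OF len, of i ks] Cons.prems in simp_all)
      then show ?case using Cons by (simp add: o_def)
    qed simp
    show ?thesis
    proof (intro equalityI subsetI)
      fix a assume a: "a \<in> {a \<in> tuples M ?\<sigma>. map (case_sum ((!) a) id) es \<in> X}"
      then obtain v where v: "blocks M \<Gamma> v" "concat (map v ks) = a"
        using blocks_exist[OF M dist, of a \<Gamma>] by blast
      then have "concat (map v ls) \<in> X" using a *[OF v(1)] by simp
      then show "a \<in> {concat (map v ks) |v. blocks M \<Gamma> v \<and> concat (map v ls) \<in> X}" using v by blast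
    next
      fix a assume "a \<in> {concat (map v ks) |v. blocks M \<Gamma> v \<and> concat (map v ls) \<in> X}"
      then obtain v where v: "blocks M \<Gamma> v" "a = concat (map v ks)" "concat (map v ls) \<in> X" by blast
      then show "a \<in> {a \<in> tuples M ?\<sigma>. map (case_sum ((!) a) id) es \<in> X}"
        using *[OF v(1)] concat_blocks[OF v(1)] by simp
    qed
  qed
  finally show ?thesis .
qed

lemma Def_extend:
  assumes M: "is_structure M" and X: "definable M B (concat (map \<Gamma> ls)) X"
    and sub: "set ls \<subseteq> set ks" and dist: "distinct ks"
  shows "\<exists>Y. definable M B (concat (map \<Gamma> ks)) Y \<and>
    (\<forall>v. blocks M \<Gamma> v \<longrightarrow> (concat (map v ls) \<in> X \<longleftrightarrow> concat (map v ks) \<in> Y))"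
proof (intro exI conjI allI impI)
  show "definable M B (concat (map \<Gamma> ks)) {concat (map v ks) |v. blocks M \<Gamma> v \<and> concat (map v ls) \<in> X}"
    by (rule definable_blocks[OF assms])
  fix v assume v: "blocks M \<Gamma> v"
  show "concat (map v ls) \<in> X \<longleftrightarrow> concat (map v ks) \<in> {concat (map v ks) |v. blocks M \<Gamma> v \<and> concat (map v ls) \<in> X}"
  proof
    assume "concat (map v ks) \<in> {concat (map v ks) |v. blocks M \<Gamma> v \<and> concat (map v ls) \<in> X}"
    then obtain v' where v': "concat (map v ks) = concat (map v' ks)" "blocks M \<Gamma> v'" "concat (map v' ls) \<in> X"
      by blast
    have "map v ls = map v' ls" using blocks_eq[OF v v'(2) v'(1)] sub by (intro map_cong) auto
    then show "concat (map v ls) \<in> X" using v'(3) by (simp del: map_eq_conv)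
  qed (use v in blast)
qed

lemma Def_cong:
  "Def M B \<Gamma> P \<Longrightarrow> (\<And>v. blocks M \<Gamma> v \<Longrightarrow> Q v \<longleftrightarrow> P v) \<Longrightarrow> Def M B \<Gamma> Q"
  unfolding Def_def by metis

lemma Def_mono: "Def M B \<Gamma> P \<Longrightarrow> B \<subseteq> B' \<Longrightarrow> Def M B' \<Gamma> P"
  unfolding Def_def using definable_mono by metis

lemma Def_neg: "Def M B \<Gamma> P \<Longrightarrow> Def M B \<Gamma> (\<lambda>v. \<not> P v)"
  unfolding Def_def using definable_Diff concat_blocks by (metis DiffE DiffI)

lemma Def_conj:
  assumes M: "is_structure M" and P: "Def M B \<Gamma> P" and Q: "Def M B \<Gamma> Q"
  shows "Def M B \<Gamma> (\<lambda>v. P v \<and> Q v)"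
proof -
  obtain ls X where X: "definable M B (concat (map \<Gamma> ls)) X" "\<And>v. blocks M \<Gamma> v \<Longrightarrow> P v \<longleftrightarrow> concat (map v ls) \<in> X"
    using P unfolding Def_def by blast
  obtain js Y where Y: "definable M B (concat (map \<Gamma> js)) Y" "\<And>v. blocks M \<Gamma> v \<Longrightarrow> Q v \<longleftrightarrow> concat (map v js) \<in> Y"
    using Q unfolding Def_def by blast
  let ?ks = "remdups (ls @ js)"
  obtain X' where X': "definable M B (concat (map \<Gamma> ?ks)) X'"
    "\<And>v. blocks M \<Gamma> v \<Longrightarrow> concat (map v ls) \<in> X \<longleftrightarrow> concat (map v ?ks) \<in> X'"
    using Def_extend[OF M X(1), of ?ks] by auto
  obtain Y' where Y': "definable M B (concat (map \<Gamma> ?ks)) Y'"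
    "\<And>v. blocks M \<Gamma> v \<Longrightarrow> concat (map v js) \<in> Y \<longleftrightarrow> concat (map v ?ks) \<in> Y'"
    using Def_extend[OF M Y(1), of ?ks] by auto
  show ?thesis unfolding Def_def
    by (intro exI[of _ ?ks] exI[of _ "X' \<inter> Y'"])
      (use X(2) X'(2) Y(2) Y'(2) definable_Int[OF X'(1) Y'(1)] in simp)
qed

lemma Def_mem:
  assumes M: "is_structure M" and X: "definable M B (concat (map \<Gamma> ls)) X"
  shows "Def M B \<Gamma> (\<lambda>v. concat (map v ls) \<in> X)"
  unfolding Def_def using Def_extend[OF M X, of "remdups ls"] by (metis distinct_remdups set_remdups subset_refl)

text \<open>
  The one rule behind both quantifiers and the passage from \<open>Def\<close> to \<open>definable\<close>: the variables of
  \<open>P\<close> outside \<open>js\<close> are projected away.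
\<close>

lemma Def_image:
  assumes M: "is_structure M" and P: "Def M B \<Gamma> P" and js: "distinct js"
  shows "definable M B (concat (map \<Gamma> js)) {concat (map v js) |v. blocks M \<Gamma> v \<and> P v}"
proof -
  obtain ks X where X: "distinct ks" "definable M B (concat (map \<Gamma> ks)) X"
    "\<And>v. blocks M \<Gamma> v \<Longrightarrow> P v \<longleftrightarrow> concat (map v ks) \<in> X"
    using P unfolding Def_def by blast
  let ?r = "filter (\<lambda>k. k \<notin> set js) ks"
  have dist: "distinct (js @ ?r)" using js X(1) by auto
  obtain Y where Y: "definable M B (concat (map \<Gamma> (js @ ?r))) Y"
    "\<And>v. blocks M \<Gamma> v \<Longrightarrow> concat (map v ks) \<in> X \<longleftrightarrow> concat (map v (js @ ?r)) \<in> Y"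
    using Def_extend[OF M X(2), of "js @ ?r"] dist by auto
  let ?Z = "{a \<in> tuples M (concat (map \<Gamma> js)). \<exists>c\<in>tuples M (concat (map \<Gamma> ?r)). a @ c \<in> Y}"
  have "definable M B (concat (map \<Gamma> js)) ?Z" by (rule definable_project) (use Y(1) in simp)
  also have "?Z = {concat (map v js) |v. blocks M \<Gamma> v \<and> P v}"
  proof (intro equalityI subsetI)
    fix a assume "a \<in> ?Z"
    then obtain c where c: "a \<in> tuples M (concat (map \<Gamma> js))" "c \<in> tuples M (concat (map \<Gamma> ?r))" "a @ c \<in> Y" by blast
    then have "a @ c \<in> tuples M (concat (map \<Gamma> (js @ ?r)))" by auto
    then obtain v where v: "blocks M \<Gamma> v" "concat (map v (js @ ?r)) = a @ c"
      using blocks_exist[OF M dist] by blast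
    then have "concat (map v js) @ concat (map v ?r) = a @ c" by simp
    then have "concat (map v js) = a" using append_tuples_eq[OF concat_blocks[OF v(1)] c(1)] by blast
    moreover have "P v" using X(3)[OF v(1)] Y(2)[OF v(1)] v(2) c(3) by simp
    ultimately show "a \<in> {concat (map v js) |v. blocks M \<Gamma> v \<and> P v}" using v(1) by blast
  next
    fix a assume "a \<in> {concat (map v js) |v. blocks M \<Gamma> v \<and> P v}"
    then obtain v where v: "a = concat (map v js)" "blocks M \<Gamma> v" "P v" by blast
    then have "concat (map v js) @ concat (map v ?r) \<in> Y" using X(3)[OF v(2)] Y(2)[OF v(2)] by simp
    then show "a \<in> ?Z" using v concat_blocks[OF v(2)] by blast
  qed
  finally show ?thesis .
qed

text \<open>
  The matrix is given as a predicate \<open>Q\<close> with a separate argument for the quantified tuple, which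
  lives in block \<open>i\<close> while its definability is shown; \<open>indep\<close> says that \<open>Q v\<close> does not read that
  block otherwise, so that \<open>i\<close> is a fresh variable.
\<close>

lemma Def_ex:
  assumes M: "is_structure M" and \<Gamma>: "\<Gamma> i = \<tau>" and P: "Def M B \<Gamma> (\<lambda>v. Q v (v i))"
    and indep: "\<And>v c d. blocks M \<Gamma> v \<Longrightarrow> c \<in> tuples M \<tau> \<Longrightarrow> d \<in> tuples M \<tau> \<Longrightarrow> Q (v(i := d)) c \<longleftrightarrow> Q v c"
  shows "Def M B \<Gamma> (\<lambda>v. \<exists>c\<in>tuples M \<tau>. Q v c)"
proof -
  obtain ks X where X: "distinct ks" "definable M B (concat (map \<Gamma> ks)) X"
    "\<And>v. blocks M \<Gamma> v \<Longrightarrow> Q v (v i) \<longleftrightarrow> concat (map v ks) \<in> X"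
    using P unfolding Def_def by blast
  let ?js = "filter (\<lambda>k. k \<noteq> i) ks"
  let ?Y = "{concat (map v ?js) |v. blocks M \<Gamma> v \<and> Q v (v i)}"
  have "Def M B \<Gamma> (\<lambda>v. concat (map v ?js) \<in> ?Y)"
    by (rule Def_mem[OF M]) (rule Def_image[OF M P], use X(1) in simp)
  then show ?thesis
  proof (rule Def_cong)
    fix v assume v: "blocks M \<Gamma> v"
    show "(\<exists>c\<in>tuples M \<tau>. Q v c) \<longleftrightarrow> concat (map v ?js) \<in> ?Y"
    proof
      assume "\<exists>c\<in>tuples M \<tau>. Q v c"
      then obtain c where c: "c \<in> tuples M \<tau>" "Q v c" by blast
      have "blocks M \<Gamma> (v(i := c))" using v c(1) \<Gamma> by (simp add: blocks_upd)
      moreover have "Q (v(i := c)) ((v(i := c)) i)" using indep[OF v c(1) c(1)] c(2) by simp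
      moreover have "map v ?js = map (v(i := c)) ?js" by (intro map_cong) auto
      ultimately show "concat (map v ?js) \<in> ?Y" unfolding mem_Collect_eq by metis
    next
      assume "concat (map v ?js) \<in> ?Y"
      then obtain v' where v': "concat (map v ?js) = concat (map v' ?js)" "blocks M \<Gamma> v'" "Q v' (v' i)" by blast
      have c: "v' i \<in> tuples M \<tau>" using blocksD[OF v'(2), of i] \<Gamma> by simp
      have b: "blocks M \<Gamma> (v(i := v' i))" using v c \<Gamma> by (simp add: blocks_upd)
      have "v k = v' k" if "k \<in> set ?js" for k by (rule blocks_eq[OF v v'(2) v'(1) that])
      then have "map (v(i := v' i)) ks = map v' ks" by (intro map_cong) auto
      then have "Q (v(i := v' i)) (v' i)" using X(3)[OF v'(2)] X(3)[OF b] v'(3) by (simp del: map_eq_conv)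
      then show "\<exists>c\<in>tuples M \<tau>. Q v c" using indep[OF v c c] c by blast
    qed
  qed
qed

lemma Def_True: assumes "is_structure M" shows "Def M B \<Gamma> (\<lambda>v. True)"
  using Def_mem[OF assms, of B \<Gamma> "[]" "{[]}"] definable_const(1)[OF assms, of B "[]"] by simp

lemma Def_const: assumes "is_structure M" shows "Def M B \<Gamma> (\<lambda>v. P)"
  using Def_True[OF assms, of B \<Gamma>] Def_neg[OF Def_True[OF assms, of B \<Gamma>]] by (cases P) simp_all

lemma Def_disj:
  assumes "is_structure M" "Def M B \<Gamma> P" "Def M B \<Gamma> Q" shows "Def M B \<Gamma> (\<lambda>v. P v \<or> Q v)"
  by (rule Def_cong[OF Def_neg[OF Def_conj[OF assms(1) Def_neg[OF assms(2)] Def_neg[OF assms(3)]]]]) blast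

lemma Def_imp:
  assumes "is_structure M" "Def M B \<Gamma> P" "Def M B \<Gamma> Q" shows "Def M B \<Gamma> (\<lambda>v. P v \<longrightarrow> Q v)"
  by (rule Def_cong[OF Def_disj[OF assms(1) Def_neg[OF assms(2)] assms(3)]]) blast

lemma Def_iff:
  assumes "is_structure M" "Def M B \<Gamma> P" "Def M B \<Gamma> Q" shows "Def M B \<Gamma> (\<lambda>v. P v \<longleftrightarrow> Q v)"
  by (rule Def_cong[OF Def_conj[OF assms(1) Def_imp[OF assms] Def_imp[OF assms(1,3,2)]]]) blast

lemma Def_all:
  assumes M: "is_structure M" and \<Gamma>: "\<Gamma> i = \<tau>" and P: "Def M B \<Gamma> (\<lambda>v. Q v (v i))"
    and indep: "\<And>v c d. blocks M \<Gamma> v \<Longrightarrow> c \<in> tuples M \<tau> \<Longrightarrow> d \<in> tuples M \<tau> \<Longrightarrow> Q (v(i := d)) c \<longleftrightarrow> Q v c"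
  shows "Def M B \<Gamma> (\<lambda>v. \<forall>c\<in>tuples M \<tau>. Q v c)"
proof -
  have "Def M B \<Gamma> (\<lambda>v. \<exists>c\<in>tuples M \<tau>. \<not> Q v c)"
    by (rule Def_ex[where Q = "\<lambda>v c. \<not> Q v c", OF M \<Gamma> Def_neg[OF P]]) (use indep in simp)
  from Def_neg[OF this] show ?thesis by simp
qed

lemma Def_Ball:
  assumes M: "is_structure M" and "finite I" "\<And>i. i \<in> I \<Longrightarrow> Def M B \<Gamma> (P i)"
  shows "Def M B \<Gamma> (\<lambda>v. \<forall>i\<in>I. P i v)"
  using assms(2,3)
proof (induction I)
  case empty then show ?case using Def_True[OF M] by simp
next
  case (insert i I)
  then have "Def M B \<Gamma> (\<lambda>v. P i v \<and> (\<forall>i\<in>I. P i v))" by (intro Def_conj[OF M]) auto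
  then show ?case by simp
qed

lemma Def_Bex:
  assumes M: "is_structure M" and "finite I" "\<And>i. i \<in> I \<Longrightarrow> Def M B \<Gamma> (P i)"
  shows "Def M B \<Gamma> (\<lambda>v. \<exists>i\<in>I. P i v)"
proof -
  have "Def M B \<Gamma> (\<lambda>v. \<forall>i\<in>I. \<not> P i v)" using assms(2,3) by (intro Def_Ball[OF M]) (auto intro: Def_neg)
  from Def_neg[OF this] show ?thesis by simp
qed

lemma Def_eq:
  assumes "is_structure M" "\<Gamma> i = \<Gamma> j" shows "Def M B \<Gamma> (\<lambda>v. v i = v j)"
proof -
  have "Def M B \<Gamma> (\<lambda>v. concat (map v [i, j]) \<in> {a @ a |a. a \<in> tuples M (\<Gamma> i)})"
    by (rule Def_mem[OF assms(1)]) (use definable_diagonal[OF assms(1), of B "\<Gamma> i"] assms(2) in simp)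
  then show ?thesis
  proof (rule Def_cong)
    fix v assume v: "blocks M \<Gamma> v"
    have t: "v i \<in> tuples M (\<Gamma> i)" "v j \<in> tuples M (\<Gamma> i)" using blocksD[OF v] assms(2) by metis+
    then show "v i = v j \<longleftrightarrow> concat (map v [i, j]) \<in> {a @ a |a. a \<in> tuples M (\<Gamma> i)}"
      using append_tuples_eq[OF t(1)] by auto
  qed
qed

lemma definable_singleton:
  assumes "is_structure M" "c \<in> tuples M \<sigma>" "set c \<subseteq> B" shows "definable M B \<sigma> {c}"
proof -
  have "definable M B \<sigma> {a \<in> tuples M \<sigma>. a @ c \<in> {a @ a |a. a \<in> tuples M \<sigma>}}"
    by (rule definable_fibre[OF definable_diagonal[OF assms(1), of B]]) (use assms in auto)
  also have "{a \<in> tuples M \<sigma>. a @ c \<in> {a @ a |a. a \<in> tuples M \<sigma>}} = {c}"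
    using assms(2) append_tuples_eq by blast
  finally show ?thesis .
qed

lemma Def_param:
  assumes M: "is_structure M" and \<Gamma>: "\<Gamma> i = \<tau>" and c: "c \<in> tuples M \<tau>" "set c \<subseteq> B"
    and P: "Def M B \<Gamma> (\<lambda>v. Q v (v i))"
    and indep: "\<And>v c d. blocks M \<Gamma> v \<Longrightarrow> c \<in> tuples M \<tau> \<Longrightarrow> d \<in> tuples M \<tau> \<Longrightarrow> Q (v(i := d)) c \<longleftrightarrow> Q v c"
  shows "Def M B \<Gamma> (\<lambda>v. Q v c)"
proof -
  have "Def M B \<Gamma> (\<lambda>v. concat (map v [i]) \<in> {c})"
    by (rule Def_mem[OF M]) (use definable_singleton[OF M c] \<Gamma> in simp)
  then have "Def M B \<Gamma> (\<lambda>v. v i = c \<and> Q v (v i))" using Def_conj[OF M _ P] by simp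
  from Def_ex[where Q = "\<lambda>v e. e = c \<and> Q v e", OF M \<Gamma> this]
  have "Def M B \<Gamma> (\<lambda>v. \<exists>e\<in>tuples M \<tau>. e = c \<and> Q v e)" using indep by simp
  then show ?thesis by (rule Def_cong) (use c in blast)
qed

lemma Def_mem1:
  "is_structure M \<Longrightarrow> definable M B (\<Gamma> i) X \<Longrightarrow> Def M B \<Gamma> (\<lambda>v. v i \<in> X)"
  using Def_mem[of M B \<Gamma> "[i]" X] by simp

lemma Def_mem2:
  "is_structure M \<Longrightarrow> definable M B (\<Gamma> i @ \<Gamma> j) X \<Longrightarrow> Def M B \<Gamma> (\<lambda>v. v i @ v j \<in> X)"
  using Def_mem[of M B \<Gamma> "[i, j]" X] by simp

lemma Def_mem3:
  "is_structure M \<Longrightarrow> definable M B (\<Gamma> i @ \<Gamma> j @ \<Gamma> k) X \<Longrightarrow> Def M B \<Gamma> (\<lambda>v. v i @ v j @ v k \<in> X)"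
  using Def_mem[of M B \<Gamma> "[i, j, k]" X] by simp

text \<open>
  Relations between tuples are identified with sets of concatenated tuples; since the sorts fix the
  lengths, the components of a concatenation can be recovered.
\<close>

definition rel2 where
  "rel2 M \<sigma> \<tau> Q = {a @ c |a c. a \<in> tuples M \<sigma> \<and> c \<in> tuples M \<tau> \<and> Q a c}"

definition rel3 where
  "rel3 M \<sigma> \<tau> \<rho> Q = {a @ c @ e |a c e. a \<in> tuples M \<sigma> \<and> c \<in> tuples M \<tau> \<and> e \<in> tuples M \<rho> \<and> Q a c e}"

lemma rel2_iff: "a \<in> tuples M \<sigma> \<Longrightarrow> a @ c \<in> rel2 M \<sigma> \<tau> Q \<longleftrightarrow> c \<in> tuples M \<tau> \<and> Q a c"
  unfolding rel2_def using append_tuples_eq by blast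

lemma rel3_iff:
  assumes "a \<in> tuples M \<sigma>" "c \<in> tuples M \<tau>"
  shows "a @ c @ e \<in> rel3 M \<sigma> \<tau> \<rho> Q \<longleftrightarrow> e \<in> tuples M \<rho> \<and> Q a c e"
proof
  assume "a @ c @ e \<in> rel3 M \<sigma> \<tau> \<rho> Q"
  then obtain a' c' e' where *: "a @ c @ e = a' @ c' @ e'" "a' \<in> tuples M \<sigma>" "c' \<in> tuples M \<tau>"
    "e' \<in> tuples M \<rho>" "Q a' c' e'" unfolding rel3_def by blast
  then have "a = a'" "c @ e = c' @ e'" using append_tuples_eq[OF assms(1) *(2)] by auto
  then have "c = c'" "e = e'" using append_tuples_eq[OF assms(2) *(3)] by auto
  then show "e \<in> tuples M \<rho> \<and> Q a c e" using * \<open>a = a'\<close> by simp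
qed (use assms in \<open>auto simp: rel3_def\<close>)

lemma Def_set1:
  assumes M: "is_structure M" and \<Gamma>: "\<Gamma> i = \<sigma>" and P: "Def M B \<Gamma> (\<lambda>v. Q (v i))"
  shows "definable M B \<sigma> {a \<in> tuples M \<sigma>. Q a}"
proof -
  have "{concat (map v [i]) |v. blocks M \<Gamma> v \<and> Q (v i)} = {a \<in> tuples M \<sigma>. Q a}"
  proof (intro equalityI subsetI)
    fix a assume a: "a \<in> {a \<in> tuples M \<sigma>. Q a}"
    then obtain v where "blocks M \<Gamma> v" "concat (map v [i]) = a"
      using blocks_exist[OF M, of "[i]" a \<Gamma>] \<Gamma> by auto
    then show "a \<in> {concat (map v [i]) |v. blocks M \<Gamma> v \<and> Q (v i)}" using a by auto
  qed (use \<Gamma> blocksD in fastforce)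
  then show ?thesis using Def_image[OF M P, of "[i]"] \<Gamma> by simp
qed

lemma Def_set2:
  assumes M: "is_structure M" and \<Gamma>: "\<Gamma> i = \<sigma>" "\<Gamma> j = \<tau>" and ij: "i \<noteq> j"
    and P: "Def M B \<Gamma> (\<lambda>v. Q (v i) (v j))"
  shows "definable M B (\<sigma> @ \<tau>) (rel2 M \<sigma> \<tau> Q)"
proof -
  have "{concat (map v [i, j]) |v. blocks M \<Gamma> v \<and> Q (v i) (v j)} = rel2 M \<sigma> \<tau> Q"
  proof (intro equalityI subsetI)
    fix w assume "w \<in> rel2 M \<sigma> \<tau> Q"
    then obtain a c where ac: "w = a @ c" "a \<in> tuples M \<sigma>" "c \<in> tuples M \<tau>" "Q a c"
      unfolding rel2_def by blast
    then have "w \<in> tuples M (concat (map \<Gamma> [i, j]))" using \<Gamma> by auto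
    then obtain v where v: "blocks M \<Gamma> v" "concat (map v [i, j]) = w"
      using blocks_exist[OF M, of "[i, j]" w \<Gamma>] ij by auto
    have "v i \<in> tuples M \<sigma>" using blocksD[OF v(1), of i] \<Gamma> by simp
    then have "v i = a" "v j = c" using v(2) ac append_tuples_eq[of "v i" M \<sigma> a] by auto
    then show "w \<in> {concat (map v [i, j]) |v. blocks M \<Gamma> v \<and> Q (v i) (v j)}" using v ac(4) by auto
  next
    fix w assume "w \<in> {concat (map v [i, j]) |v. blocks M \<Gamma> v \<and> Q (v i) (v j)}"
    then obtain v where v: "w = v i @ v j" "blocks M \<Gamma> v" "Q (v i) (v j)" by auto
    then show "w \<in> rel2 M \<sigma> \<tau> Q" unfolding rel2_def using blocksD[OF v(2)] \<Gamma> by blast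
  qed
  then show ?thesis using Def_image[OF M P, of "[i, j]"] \<Gamma> ij by simp
qed

lemma Def_set3:
  assumes M: "is_structure M" and \<Gamma>: "\<Gamma> i = \<sigma>" "\<Gamma> j = \<tau>" "\<Gamma> k = \<rho>" and ij: "i \<noteq> j" "i \<noteq> k" "j \<noteq> k"
    and P: "Def M B \<Gamma> (\<lambda>v. Q (v i) (v j) (v k))"
  shows "definable M B (\<sigma> @ \<tau> @ \<rho>) (rel3 M \<sigma> \<tau> \<rho> Q)"
proof -
  have "{concat (map v [i, j, k]) |v. blocks M \<Gamma> v \<and> Q (v i) (v j) (v k)} = rel3 M \<sigma> \<tau> \<rho> Q"
  proof (intro equalityI subsetI)
    fix w assume "w \<in> rel3 M \<sigma> \<tau> \<rho> Q"
    then obtain a c e where ac: "w = a @ c @ e" "a \<in> tuples M \<sigma>" "c \<in> tuples M \<tau>" "e \<in> tuples M \<rho>" "Q a c e"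
      unfolding rel3_def by blast
    then have "w \<in> tuples M (concat (map \<Gamma> [i, j, k]))" using \<Gamma> by auto
    then obtain v where v: "blocks M \<Gamma> v" "concat (map v [i, j, k]) = w"
      using blocks_exist[OF M, of "[i, j, k]" w \<Gamma>] ij by auto
    have t: "v i \<in> tuples M \<sigma>" "v j \<in> tuples M \<tau>" using blocksD[OF v(1)] \<Gamma> by metis+
    have "v i @ v j @ v k = a @ c @ e" using v(2) ac(1) by simp
    then have 1: "v i = a" "v j @ v k = c @ e" using append_tuples_eq[OF t(1) ac(2)] by blast+
    then have "v j = c" "v k = e" using append_tuples_eq[OF t(2) ac(3)] by blast+
    then show "w \<in> {concat (map v [i, j, k]) |v. blocks M \<Gamma> v \<and> Q (v i) (v j) (v k)}" using v ac(5) 1 by auto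
  next
    fix w assume "w \<in> {concat (map v [i, j, k]) |v. blocks M \<Gamma> v \<and> Q (v i) (v j) (v k)}"
    then obtain v where v: "w = v i @ v j @ v k" "blocks M \<Gamma> v" "Q (v i) (v j) (v k)" by auto
    then show "w \<in> rel3 M \<sigma> \<tau> \<rho> Q" unfolding rel3_def using blocksD[OF v(2)] \<Gamma> by blast
  qed
  then show ?thesis using Def_image[OF M P, of "[i, j, k]"] \<Gamma> ij by simp
qed

definition rel4 where
  "rel4 M \<sigma> \<tau> \<rho> \<pi> Q = {a @ c @ e @ d |a c e d. a \<in> tuples M \<sigma> \<and> c \<in> tuples M \<tau> \<and> e \<in> tuples M \<rho> \<and>
     d \<in> tuples M \<pi> \<and> Q a c e d}"

lemma Def_set4:
  assumes M: "is_structure M" and \<Gamma>: "\<Gamma> 0 = \<sigma>" "\<Gamma> (Suc 0) = \<tau>" "\<Gamma> 2 = \<rho>" "\<Gamma> 3 = \<pi>"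
    and P: "Def M B \<Gamma> (\<lambda>v. Q (v 0) (v (Suc 0)) (v 2) (v 3))"
  shows "definable M B (\<sigma> @ \<tau> @ \<rho> @ \<pi>) (rel4 M \<sigma> \<tau> \<rho> \<pi> Q)"
proof -
  let ?j = "[0, Suc 0, 2, 3]"
  have "{concat (map v ?j) |v. blocks M \<Gamma> v \<and> Q (v 0) (v (Suc 0)) (v 2) (v 3)} = rel4 M \<sigma> \<tau> \<rho> \<pi> Q"
  proof (intro equalityI subsetI)
    fix w assume "w \<in> rel4 M \<sigma> \<tau> \<rho> \<pi> Q"
    then obtain a c e d where ac: "w = a @ c @ e @ d" "a \<in> tuples M \<sigma>" "c \<in> tuples M \<tau>" "e \<in> tuples M \<rho>"
      "d \<in> tuples M \<pi>" "Q a c e d" unfolding rel4_def by blast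
    then have "w \<in> tuples M (concat (map \<Gamma> ?j))" using \<Gamma> by auto
    then obtain v where v: "blocks M \<Gamma> v" "concat (map v ?j) = w"
      using blocks_exist[OF M, of ?j w \<Gamma>] by auto
    have t: "v 0 \<in> tuples M \<sigma>" "v (Suc 0) \<in> tuples M \<tau>" "v 2 \<in> tuples M \<rho>" using blocksD[OF v(1)] \<Gamma> by metis+
    have "v 0 @ v (Suc 0) @ v 2 @ v 3 = a @ c @ e @ d" using v(2) ac(1) by simp
    then have 1: "v 0 = a" "v (Suc 0) @ v 2 @ v 3 = c @ e @ d" using append_tuples_eq[OF t(1) ac(2)] by blast+
    then have 2: "v (Suc 0) = c" "v 2 @ v 3 = e @ d" using append_tuples_eq[OF t(2) ac(3)] by blast+
    then have 3: "v 2 = e" "v 3 = d" using append_tuples_eq[OF t(3) ac(4)] by blast+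
    have "Q (v 0) (v (Suc 0)) (v 2) (v 3)" using ac(6) 1(1) 2(1) 3 by simp
    then show "w \<in> {concat (map v ?j) |v. blocks M \<Gamma> v \<and> Q (v 0) (v (Suc 0)) (v 2) (v 3)}" using v by blast
  next
    fix w assume "w \<in> {concat (map v ?j) |v. blocks M \<Gamma> v \<and> Q (v 0) (v (Suc 0)) (v 2) (v 3)}"
    then obtain v where v: "w = v 0 @ v (Suc 0) @ v 2 @ v 3" "blocks M \<Gamma> v" "Q (v 0) (v (Suc 0)) (v 2) (v 3)" by auto
    have "v 0 \<in> tuples M \<sigma>" "v (Suc 0) \<in> tuples M \<tau>" "v 2 \<in> tuples M \<rho>" "v 3 \<in> tuples M \<pi>"
      using blocksD[OF v(2)] \<Gamma> by metis+
    then show "w \<in> rel4 M \<sigma> \<tau> \<rho> \<pi> Q" unfolding rel4_def using v by blast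
  qed
  then show ?thesis using Def_image[OF M P, of ?j] \<Gamma> by simp
qed

lemma Def_rel2:
  assumes M: "is_structure M" and Q: "definable M B (\<sigma> @ \<tau>) (rel2 M \<sigma> \<tau> Q)" and \<Gamma>: "\<Gamma> i = \<sigma>" "\<Gamma> j = \<tau>"
  shows "Def M B \<Gamma> (\<lambda>v. Q (v i) (v j))"
proof -
  have "Def M B \<Gamma> (\<lambda>v. v i @ v j \<in> rel2 M \<sigma> \<tau> Q)" by (rule Def_mem2[OF M]) (use Q \<Gamma> in simp)
  then show ?thesis
  proof (rule Def_cong)
    fix v assume v: "blocks M \<Gamma> v"
    have "v i \<in> tuples M \<sigma>" "v j \<in> tuples M \<tau>" using blocksD[OF v] \<Gamma> by metis+
    then show "Q (v i) (v j) \<longleftrightarrow> v i @ v j \<in> rel2 M \<sigma> \<tau> Q" by (simp add: rel2_iff)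
  qed
qed

lemma Def_rel3:
  assumes M: "is_structure M" and Q: "definable M B (\<sigma> @ \<tau> @ \<rho>) (rel3 M \<sigma> \<tau> \<rho> Q)"
    and \<Gamma>: "\<Gamma> i = \<sigma>" "\<Gamma> j = \<tau>" "\<Gamma> k = \<rho>"
  shows "Def M B \<Gamma> (\<lambda>v. Q (v i) (v j) (v k))"
proof -
  have "Def M B \<Gamma> (\<lambda>v. v i @ v j @ v k \<in> rel3 M \<sigma> \<tau> \<rho> Q)" by (rule Def_mem3[OF M]) (use Q \<Gamma> in simp)
  then show ?thesis
  proof (rule Def_cong)
    fix v assume v: "blocks M \<Gamma> v"
    have "v i \<in> tuples M \<sigma>" "v j \<in> tuples M \<tau>" "v k \<in> tuples M \<rho>" using blocksD[OF v] \<Gamma> by metis+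
    then show "Q (v i) (v j) (v k) \<longleftrightarrow> v i @ v j @ v k \<in> rel3 M \<sigma> \<tau> \<rho> Q" by (simp add: rel3_iff)
  qed
qed

text \<open>
  The fibre is taken in the first block of coordinates, where appending the parameters to the
  variables, as in \<open>definable_fibre\<close>, does not apply.
\<close>

lemma definable_fibre_left:
  assumes M: "is_structure M" and X: "definable M B (\<sigma> @ \<tau>) X" and a: "a \<in> tuples M \<sigma>" and B': "B \<union> set a \<subseteq> B'"
  shows "definable M B' \<tau> {c \<in> tuples M \<tau>. a @ c \<in> X}"
proof -
  let ?\<Gamma> = "(\<lambda>_. [])(0 := \<sigma>, 1 := \<tau>)"
  have "definable M B' (\<sigma> @ \<tau>) X" by (rule definable_mono[OF X]) (use B' in simp)
  then have D: "Def M B' ?\<Gamma> (\<lambda>v. v 0 @ v 1 \<in> X)" by (intro Def_mem2[OF M]) simp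
  have "Def M B' ?\<Gamma> (\<lambda>v. a @ v 1 \<in> X)"
    by (rule Def_param[where Q = "\<lambda>v x. x @ v 1 \<in> X" and i = 0 and \<tau> = \<sigma>, OF M _ a])
      (simp, use B' in simp, fact, simp)
  then show ?thesis by (rule Def_set1[where i = 1 and \<Gamma> = ?\<Gamma>, OF M, rotated]) simp
qed

lemma definable_fun_restrict:
  assumes M: "is_structure M" and h: "definable_fun M B \<sigma> X \<tau> h" and Y: "definable M B \<sigma> Y" "Y \<subseteq> X"
  shows "definable_fun M B \<sigma> Y \<tau> h"
proof -
  let ?G = "(\<lambda>a. a @ h a) ` X"
  have G: "definable M B (\<sigma> @ \<tau>) ?G" "h ` X \<subseteq> tuples M \<tau>" "X \<subseteq> tuples M \<sigma>"
    using h definable_sub[of M B \<sigma> X] unfolding definable_fun_def by simp_all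
  have "definable M B (\<sigma> @ \<tau>) (rel2 M \<sigma> \<tau> (\<lambda>a e. a \<in> Y \<and> a @ e \<in> ?G))"
    by (rule Def_set2[where \<Gamma> = "(\<lambda>_. \<tau>)(0 := \<sigma>)" and i = 0 and j = 1, OF M], simp, simp, simp,
        rule Def_conj[OF M Def_mem1[OF M] Def_mem2[OF M]]) (use G(1) Y in simp_all)
  also have "rel2 M \<sigma> \<tau> (\<lambda>a e. a \<in> Y \<and> a @ e \<in> ?G) = (\<lambda>a. a @ h a) ` Y"
  proof (intro equalityI subsetI)
    fix w assume "w \<in> rel2 M \<sigma> \<tau> (\<lambda>a e. a \<in> Y \<and> a @ e \<in> ?G)"
    then obtain a e x where w: "w = a @ e" "a \<in> tuples M \<sigma>" "a \<in> Y" "x \<in> X" "a @ e = x @ h x"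
      unfolding rel2_def by blast
    then have "a = x" "e = h x" using append_tuples_eq[of a M \<sigma> x e "h x"] G(3) by blast+
    then show "w \<in> (\<lambda>a. a @ h a) ` Y" using w by blast
  next
    fix w assume "w \<in> (\<lambda>a. a @ h a) ` Y"
    then obtain a where a: "w = a @ h a" "a \<in> Y" by blast
    then have "a \<in> X" "a \<in> tuples M \<sigma>" "h a \<in> tuples M \<tau>" using Y(2) G by blast+
    then show "w \<in> rel2 M \<sigma> \<tau> (\<lambda>a e. a \<in> Y \<and> a @ e \<in> ?G)" using a by (simp add: rel2_iff)
  qed
  finally show ?thesis using Y G(2) unfolding definable_fun_def by blast
qed

lemma graph_iff:
  assumes "definable_fun M B \<sigma> X \<tau> h" "a \<in> X" shows "a @ e \<in> (\<lambda>a. a @ h a) ` X \<longleftrightarrow> e = h a"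
proof -
  have X: "X \<subseteq> tuples M \<sigma>" using assms(1) definable_sub[of M B \<sigma> X] unfolding definable_fun_def by blast
  show ?thesis
  proof
    assume "a @ e \<in> (\<lambda>a. a @ h a) ` X"
    then obtain x where "x \<in> X" "a @ e = x @ h x" by blast
    then show "e = h a" using append_tuples_eq[of a M \<sigma> x e "h x"] X assms(2) by blast
  qed (use assms(2) in blast)
qed

section \<open>Automorphisms\<close>

lemma aut_teval:
  assumes M: "is_structure M" and g: "automorphism M g" and v: "\<And>s n. srt M (v (s, n)) = s"
  shows "twf M t \<Longrightarrow> teval M (\<lambda>w. g (v w)) (map_tm (\<lambda>x. x) (\<lambda>x. x) g t) = g (teval M v t) \<and> srt M (teval M v t) = tsort M t"
proof (induction t)
  case (Fn f ts)
  have ts: "map (teval M (\<lambda>w. g (v w))) (map (map_tm (\<lambda>x. x) (\<lambda>x. x) g) ts) = map g (map (teval M v) ts)"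
    unfolding map_map map_eq_conv comp_apply using Fn by simp
  have "map (srt M) (map (teval M v) ts) = map (tsort M) ts"
    unfolding map_map o_def by (rule map_cong) (use Fn in auto)
  also have "\<dots> = fdom M f" using Fn.prems by simp
  finally have dom: "map (srt M) (map (teval M v) ts) = fdom M f" .
  then have "map (teval M v) ts \<in> tuples M (fdom M f)" by (simp add: tuples_def)
  then have "g (fint M f (map (teval M v) ts)) = fint M f (map g (map (teval M v) ts))"
    using g Fn.prems unfolding automorphism_def by (simp del: map_map)
  moreover have "srt M (fint M f (map (teval M v) ts)) = fcod M f"
    using M Fn.prems dom unfolding is_structure_def by (simp del: map_map)
  ultimately show ?case using ts by (simp del: map_map)
qed (use v in auto)

text \<open>
  The valuation must respect sorts because an automorphism commutes with the functions and
  relations only at arguments of the right sorts.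
\<close>

lemma aut_sat:
  assumes M: "is_structure M" and g: "automorphism M g"
  shows "wf M \<phi> \<Longrightarrow> (\<And>s n. srt M (v (s, n)) = s) \<Longrightarrow>
    sat M (\<lambda>w. g (v w)) (map_fm (\<lambda>x. x) (\<lambda>x. x) (\<lambda>x. x) g \<phi>) = sat M v \<phi>"
proof (induction \<phi> arbitrary: v)
  case (Eq t u)
  have "inj g" using g by (simp add: automorphism_def bij_def)
  moreover have "teval M (\<lambda>w. g (v w)) (map_tm (\<lambda>x. x) (\<lambda>x. x) g t) = g (teval M v t)"
    "teval M (\<lambda>w. g (v w)) (map_tm (\<lambda>x. x) (\<lambda>x. x) g u) = g (teval M v u)"
    using Eq aut_teval[OF M g, of v] by simp_all
  ultimately show ?case by (simp add: inj_eq del: comp_apply)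
next
  case (Rel r ts)
  have ts: "map (teval M (\<lambda>w. g (v w))) (map (map_tm (\<lambda>x. x) (\<lambda>x. x) g) ts) = map g (map (teval M v) ts)"
    unfolding map_map map_eq_conv comp_apply using Rel aut_teval[OF M g, of v] by simp
  have "map (srt M) (map (teval M v) ts) = map (tsort M) ts"
    unfolding map_map o_def by (rule map_cong) (use Rel aut_teval[OF M g, of v] in auto)
  also have "\<dots> = rdom M r" using Rel.prems by simp
  finally have "map (teval M v) ts \<in> tuples M (rdom M r)" by (simp only: tuples_def mem_Collect_eq)
  then have "rint M r (map g (map (teval M v) ts)) = rint M r (map (teval M v) ts)"
    using g Rel.prems unfolding automorphism_def by (simp del: map_map)
  then show ?case using ts by (simp del: map_map)
next
  case (Exi s n \<phi>)
  have bij: "bij g" and srt: "\<And>c. srt M (g c) = srt M c" using g by (auto simp: automorphism_def)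
  have *: "sat M ((\<lambda>w. g (v w))((s, n) := g c)) (map_fm (\<lambda>x. x) (\<lambda>x. x) (\<lambda>x. x) g \<phi>) = sat M (v((s, n) := c)) \<phi>" if "srt M c = s" for c
  proof -
    have "(\<lambda>w. g (v w))((s, n) := g c) = (\<lambda>w. g ((v((s, n) := c)) w))" by auto
    moreover have "sat M (\<lambda>w. g ((v((s, n) := c)) w)) (map_fm (\<lambda>x. x) (\<lambda>x. x) (\<lambda>x. x) g \<phi>) =
        sat M (v((s, n) := c)) \<phi>"
      by (rule Exi.IH) (use Exi.prems that in auto)
    ultimately show ?thesis by (simp only:)
  qed
  have "(\<exists>c. srt M c = s \<and> sat M ((\<lambda>w. g (v w))((s, n) := c)) (map_fm (\<lambda>x. x) (\<lambda>x. x) (\<lambda>x. x) g \<phi>)) \<longleftrightarrow>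
    (\<exists>c. srt M (g c) = s \<and> sat M ((\<lambda>w. g (v w))((s, n) := g c)) (map_fm (\<lambda>x. x) (\<lambda>x. x) (\<lambda>x. x) g \<phi>))"
    using bij by (metis bij_pointE)
  then show ?case using * srt by auto
qed auto

lemma aut_wf_tm:
  assumes "automorphism M g"
  shows "tsort M (map_tm (\<lambda>x. x) (\<lambda>x. x) g t) = tsort M t \<and> twf M (map_tm (\<lambda>x. x) (\<lambda>x. x) g t) = twf M t"
proof (induction t)
  case (Fn f ts)
  have "map (tsort M) (map (map_tm (\<lambda>x. x) (\<lambda>x. x) g) ts) = map (tsort M) ts"
    unfolding map_map o_def by (rule map_cong) (use Fn in auto)
  then show ?case using Fn by (simp del: map_map)
qed (use assms in \<open>auto simp: automorphism_def\<close>)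

lemma tvars_map_tm: "tvars (map_tm (\<lambda>x. x) (\<lambda>x. x) g t) = tvars t" by (induction t) auto
lemma tpars_map_tm: "tpars (map_tm (\<lambda>x. x) (\<lambda>x. x) g t) = g ` tpars t" by (induction t) auto
lemma fv_map_fm: "fv (map_fm (\<lambda>x. x) (\<lambda>x. x) (\<lambda>x. x) g \<phi>) = fv \<phi>" by (induction \<phi>) (auto simp: tvars_map_tm)
lemma pars_map_fm: "pars (map_fm (\<lambda>x. x) (\<lambda>x. x) (\<lambda>x. x) g \<phi>) = g ` pars \<phi>" by (induction \<phi>) (auto simp: tpars_map_tm)

lemma aut_wf_fm: "automorphism M g \<Longrightarrow> wf M (map_fm (\<lambda>x. x) (\<lambda>x. x) (\<lambda>x. x) g \<phi>) = wf M \<phi>"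
proof (induction \<phi>)
  case (Rel r ts)
  have "map (tsort M) (map (map_tm (\<lambda>x. x) (\<lambda>x. x) g) ts) = map (tsort M) ts"
    unfolding map_map o_def by (rule map_cong) (use Rel aut_wf_tm in auto)
  then show ?case using Rel aut_wf_tm[OF Rel] by (simp del: map_map)
qed (auto simp: aut_wf_tm)

lemma aut_fms:
  "automorphism M g \<Longrightarrow> \<phi> \<in> fms M B \<sigma> \<Longrightarrow> map_fm (\<lambda>x. x) (\<lambda>x. x) (\<lambda>x. x) g \<phi> \<in> fms M (g ` B) \<sigma>"
  by (auto simp: fms_def aut_wf_fm fv_map_fm pars_map_fm)

lemma aut_tuples: "automorphism M g \<Longrightarrow> map g a \<in> tuples M \<sigma> \<longleftrightarrow> a \<in> tuples M \<sigma>"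
  by (simp add: tuples_def automorphism_def o_def)

lemma aut_srt: "automorphism M g \<Longrightarrow> map (srt M) (map g a) = map (srt M) a"
  by (simp add: automorphism_def o_def)

lemma asg_sorted:
  assumes "is_structure M" shows "srt M (asg M a (s, n)) = s"
proof -
  have "\<exists>c. srt M c = s" using assms by (metis is_structure_def surjD)
  then show ?thesis by (auto simp: asg_def intro: someI_ex)
qed

lemma aut_holds:
  assumes M: "is_structure M" and g: "automorphism M g" and \<phi>: "\<phi> \<in> fms M B \<sigma>" and a: "a \<in> tuples M \<sigma>"
  shows "holds M (map_fm (\<lambda>x. x) (\<lambda>x. x) (\<lambda>x. x) g \<phi>) (map g a) = holds M \<phi> a"
proof -
  have ga: "map g a \<in> tuples M \<sigma>" using a aut_tuples[OF g] by blast
  have "holds M (map_fm (\<lambda>x. x) (\<lambda>x. x) (\<lambda>x. x) g \<phi>) (map g a) = sat M (\<lambda>w. g (asg M a w)) (map_fm (\<lambda>x. x) (\<lambda>x. x) (\<lambda>x. x) g \<phi>)"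
    unfolding holds_def
  proof (rule sat_cong)
    fix w assume "w \<in> fv (map_fm (\<lambda>x. x) (\<lambda>x. x) (\<lambda>x. x) g \<phi>)"
    then obtain i where i: "i < length \<sigma>" "w = (\<sigma> ! i, i)" using fmsD(3)[OF \<phi>] by (auto simp: fv_map_fm)
    then show "asg M (map g a) w = (\<lambda>w. g (asg M a w)) w"
      using asg_tuple[OF a i(1)] asg_tuple[OF ga i(1)] tuples_length[OF a] by simp
  qed
  then show ?thesis unfolding holds_def using aut_sat[OF M g fmsD(1)[OF \<phi>] asg_sorted[OF M]] by simp
qed

lemma map_tm_fix: "(\<And>c. c \<in> tpars t \<Longrightarrow> g c = c) \<Longrightarrow> map_tm (\<lambda>x. x) (\<lambda>x. x) g t = t"
  by (induction t) (auto intro: map_idI)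

lemma map_fm_fix: "(\<And>c. c \<in> pars \<phi> \<Longrightarrow> g c = c) \<Longrightarrow> map_fm (\<lambda>x. x) (\<lambda>x. x) (\<lambda>x. x) g \<phi> = \<phi>"
  by (induction \<phi>) (auto intro!: map_idI map_tm_fix)

lemma aut_definable:
  assumes M: "is_structure M" and g: "automorphism M g" and X: "definable M B \<sigma> X"
    and fx: "\<And>c. c \<in> B \<Longrightarrow> g c = c"
  shows "map g a \<in> X \<longleftrightarrow> a \<in> X"
proof -
  obtain \<phi> where \<phi>: "\<phi> \<in> fms M B \<sigma>" and Xeq: "X = {a \<in> tuples M \<sigma>. holds M \<phi> a}"
    using X unfolding definable_def by blast
  have "map_fm (\<lambda>x. x) (\<lambda>x. x) (\<lambda>x. x) g \<phi> = \<phi>" by (rule map_fm_fix) (use fmsD(2)[OF \<phi>] fx in auto)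
  then have "holds M \<phi> (map g a) = holds M \<phi> a" if "a \<in> tuples M \<sigma>"
    using aut_holds[OF M g \<phi> that] by simp
  then show ?thesis unfolding Xeq using aut_tuples[OF g] by blast
qed

definition fixes_aut :: "('s, 'f, 'r, 'm) struct \<Rightarrow> 'm set \<Rightarrow> ('m \<Rightarrow> 'm) \<Rightarrow> bool" where
  "fixes_aut M B g \<longleftrightarrow> automorphism M g \<and> (\<forall>c\<in>B. g c = c)"

lemma fixes_aut_definable:
  "is_structure M \<Longrightarrow> fixes_aut M B g \<Longrightarrow> definable M B \<sigma> X \<Longrightarrow> map g a \<in> X \<longleftrightarrow> a \<in> X"
  using aut_definable unfolding fixes_aut_def by metis

lemma fixes_aut_tuples: "fixes_aut M B g \<Longrightarrow> map g a \<in> tuples M \<sigma> \<longleftrightarrow> a \<in> tuples M \<sigma>"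
  unfolding fixes_aut_def using aut_tuples by metis

lemma fixes_aut_mono: "fixes_aut M B g \<Longrightarrow> B' \<subseteq> B \<Longrightarrow> fixes_aut M B' g"
  unfolding fixes_aut_def by blast

lemma fixes_aut_comp:
  assumes "fixes_aut M B g" "fixes_aut M B h" shows "fixes_aut M B (g \<circ> h)"
proof -
  have g: "automorphism M g" and h: "automorphism M h" using assms by (auto simp: fixes_aut_def)
  have "automorphism M (g \<circ> h)"
    unfolding automorphism_def
  proof (intro conjI allI ballI)
    show "bij (g \<circ> h)" using g h by (auto simp: automorphism_def intro: bij_comp)
    show "srt M ((g \<circ> h) c) = srt M c" for c using g h by (auto simp: automorphism_def)
  next
    fix f as assume *: "f \<in> funs M" "as \<in> tuples M (fdom M f)"
    have "map h as \<in> tuples M (fdom M f)" using *(2) aut_tuples[OF h] by blast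
    then show "(g \<circ> h) (fint M f as) = fint M f (map (g \<circ> h) as)"
      using * g h by (simp add: automorphism_def flip: map_map)
  next
    fix r as assume *: "r \<in> rels M" "as \<in> tuples M (rdom M r)"
    have "map h as \<in> tuples M (rdom M r)" using *(2) aut_tuples[OF h] by blast
    then show "rint M r (map (g \<circ> h) as) \<longleftrightarrow> rint M r as"
      using * g h by (simp add: automorphism_def flip: map_map)
  qed
  then show ?thesis using assms by (auto simp: fixes_aut_def)
qed

lemma fixes_aut_inv:
  assumes "fixes_aut M B g" shows "fixes_aut M B (inv g)"
proof -
  have g: "automorphism M g" using assms by (auto simp: fixes_aut_def)
  have bij: "bij g" and srt: "\<And>c. srt M (g c) = srt M c" using g by (auto simp: automorphism_def)
  have gi: "g (inv g c) = c" "inv g (g c) = c" for c using bij by (simp_all add: bij_def surj_f_inv_f)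
  have mgi: "map g (map (inv g) as) = as" for as by (simp add: o_def gi)
  have srti: "srt M (inv g c) = srt M c" for c using srt[of "inv g c"] gi by simp
  have tup: "map (inv g) as \<in> tuples M \<sigma> \<longleftrightarrow> as \<in> tuples M \<sigma>" for as \<sigma> by (simp add: tuples_def o_def srti)
  have "automorphism M (inv g)"
    unfolding automorphism_def
  proof (intro conjI allI ballI)
    show "bij (inv g)" using bij by (rule bij_imp_bij_inv)
    show "srt M (inv g c) = srt M c" for c by (rule srti)
  next
    fix f as assume *: "f \<in> funs M" "as \<in> tuples M (fdom M f)"
    then have "g (fint M f (map (inv g) as)) = fint M f (map g (map (inv g) as))"
      using g tup[of as "fdom M f"] unfolding automorphism_def by blast
    then show "inv g (fint M f as) = fint M f (map (inv g) as)" using mgi gi by metis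
  next
    fix r as assume *: "r \<in> rels M" "as \<in> tuples M (rdom M r)"
    then have "rint M r (map g (map (inv g) as)) \<longleftrightarrow> rint M r (map (inv g) as)"
      using g tup[of as "rdom M r"] unfolding automorphism_def by blast
    then show "rint M r (map (inv g) as) \<longleftrightarrow> rint M r as" using mgi by simp
  qed
  moreover have "inv g c = c" if "c \<in> B" for c using assms gi(2)[of c] that by (auto simp: fixes_aut_def)
  ultimately show ?thesis by (auto simp: fixes_aut_def)
qed

lemma fixes_aut_map_id: "fixes_aut M B g \<Longrightarrow> set a \<subseteq> B \<Longrightarrow> map g a = a"
  unfolding fixes_aut_def by (auto intro!: map_idI)

lemma fixes_aut_map_inv:
  assumes "fixes_aut M B g" "map g a = c" shows "map (inv g) c = a"
proof -
  have "inj g" using assms(1) by (auto simp: fixes_aut_def automorphism_def bij_def)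
  then show ?thesis using assms(2) by (auto simp: o_def)
qed

section \<open>Monster models\<close>

text \<open>
  Equality of types is expressed by definable sets rather than formulas, which fits the calculus
  above.
\<close>

definition eqtp :: "('s, 'f, 'r, 'm) struct \<Rightarrow> 'm set \<Rightarrow> 'm list \<Rightarrow> 'm list \<Rightarrow> bool" where
  "eqtp M B a c \<longleftrightarrow> map (srt M) a = map (srt M) c \<and>
     (\<forall>X. definable M B (map (srt M) a) X \<longrightarrow> (a \<in> X \<longleftrightarrow> c \<in> X))"

lemma eqtp_sym: "eqtp M B a c \<Longrightarrow> eqtp M B c a"
  unfolding eqtp_def by metis

lemma eqtp_trans: "eqtp M B a c \<Longrightarrow> eqtp M B c e \<Longrightarrow> eqtp M B a e"
  unfolding eqtp_def by metis

lemma eqtp_mem: "eqtp M B a c \<Longrightarrow> definable M B \<sigma> X \<Longrightarrow> a \<in> X \<longleftrightarrow> c \<in> X"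
proof -
  assume *: "eqtp M B a c" "definable M B \<sigma> X"
  show ?thesis
  proof (cases "map (srt M) a = \<sigma>")
    case True then show ?thesis using * by (auto simp: eqtp_def)
  next
    case False
    then have "a \<notin> tuples M \<sigma>" "c \<notin> tuples M \<sigma>" using *(1) by (auto simp: eqtp_def tuples_def)
    then show ?thesis using definable_sub[OF *(2)] by blast
  qed
qed

lemma eqtp_tuples: "eqtp M B a c \<Longrightarrow> a \<in> tuples M \<sigma> \<longleftrightarrow> c \<in> tuples M \<sigma>"
  by (auto simp: eqtp_def tuples_def)

lemma fixes_aut_eqtp:
  assumes "is_structure M" "fixes_aut M B g" shows "eqtp M B a (map g a)"
  unfolding eqtp_def
proof (intro conjI allI impI)
  show "map (srt M) a = map (srt M) (map g a)"
    using assms(2) aut_srt[of M g a] by (simp add: fixes_aut_def)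
qed (use fixes_aut_definable[OF assms] in blast)

lemma eqtp_tp: "eqtp M A a c \<Longrightarrow> tp M A a = tp M A c"
proof -
  assume e: "eqtp M A a c"
  have "holds M \<phi> a \<longleftrightarrow> holds M \<phi> c" if \<phi>: "\<phi> \<in> fms M A (map (srt M) a)" for \<phi>
  proof -
    have "definable M A (map (srt M) a) {x \<in> tuples M (map (srt M) a). holds M \<phi> x}"
      unfolding definable_def using \<phi> by blast
    from eqtp_mem[OF e this] show ?thesis using eqtp_tuples[OF e, of "map (srt M) a"] by simp
  qed
  then show ?thesis using e unfolding tp_def eqtp_def by auto
qed

lemma tp_eqtp:
  assumes "c \<in> tuples M (map (srt M) a)" "\<And>\<theta>. \<theta> \<in> tp M A a \<Longrightarrow> holds M \<theta> c"
  shows "eqtp M A a c"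
  unfolding eqtp_def
proof (intro conjI allI impI)
  show "map (srt M) a = map (srt M) c" using assms(1) by (simp add: tuples_def)
  have one: "c \<in> X" if X: "definable M A (map (srt M) a) X" "a \<in> X" for X
  proof -
    obtain \<phi> where \<phi>: "\<phi> \<in> fms M A (map (srt M) a)" "X = {x \<in> tuples M (map (srt M) a). holds M \<phi> x}"
      using X unfolding definable_def by blast
    then have "\<phi> \<in> tp M A a" using X(2) by (simp add: tp_def)
    then show ?thesis using assms \<phi> by simp
  qed
  fix X assume X: "definable M A (map (srt M) a) X"
  show "a \<in> X \<longleftrightarrow> c \<in> X"
    using one[OF X] one[OF definable_Diff[OF X]] by auto
qed

locale monster =
  fixes \<kappa> :: "'k rel" and M :: "('s, 'f, 'r, 'm) struct"
  assumes struct: "is_structure M" and card: "Card_order \<kappa>"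
    and small_nat: "small \<kappa> (UNIV :: nat set)"
    and satur: "saturated \<kappa> M" and homog: "strongly_homogeneous \<kappa> M"
begin

lemma small_image_nat: "small \<kappa> (range (f :: nat \<Rightarrow> 'a))"
  unfolding small_def
  by (rule ordLeq_ordLess_trans[OF card_of_image small_nat[unfolded small_def]])

lemma small_subset: "small \<kappa> B \<Longrightarrow> C \<subseteq> B \<Longrightarrow> small \<kappa> C"
  unfolding small_def using card_of_mono1 ordLeq_ordLess_trans by blast

lemma infinite_Field: "\<not> finite (Field \<kappa>)"
proof
  assume fin: "finite (Field \<kappa>)"
  have "(card_of (UNIV :: nat set), card_of (Field \<kappa>)) \<in> ordLess"
    using ordLess_ordIso_trans[OF small_nat[unfolded small_def] ordIso_symmetric[OF card_of_Field_ordIso[OF card]]] .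
  then have "(card_of (UNIV :: nat set), card_of (Field \<kappa>)) \<in> ordLeq" by (rule ordLess_imp_ordLeq)
  then show False using card_of_ordLeq_finite[OF _ fin] infinite_UNIV_nat by blast
qed

lemma small_Un: "small \<kappa> B \<Longrightarrow> small \<kappa> C \<Longrightarrow> small \<kappa> (B \<union> C)"
  unfolding small_def by (rule card_of_Un_ordLess_infinite_Field[OF infinite_Field card])

lemma small_list: "small \<kappa> (set a)"
proof (cases a)
  case Nil
  show ?thesis using small_subset[OF small_image_nat[of "\<lambda>_. undefined :: 'a"]] Nil by simp
next
  case (Cons x xs)
  have "set a \<subseteq> range (\<lambda>i. if i < length a then a ! i else x)"
    by (auto simp: in_set_conv_nth image_def)
  then show ?thesis using small_subset[OF small_image_nat] by blast
qed

lemma small_seq: "small \<kappa> (\<Union>i::nat. set (c i))"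
proof -
  have "(card_of (set (c i)), card_of (UNIV :: nat set)) \<in> ordLeq" for i
    by (rule ordLess_imp_ordLeq[OF finite_ordLess_infinite[OF card_of_Well_order card_of_Well_order]])
      (simp_all only: Field_card_of finite_set infinite_UNIV_nat not_False_eq_True)
  then have "(card_of (\<Union>i::nat. set (c i)), card_of (UNIV :: nat set)) \<in> ordLeq"
    by (intro card_of_UNION_ordLeq_infinite card_of_mono1) simp_all
  then show ?thesis unfolding small_def by (rule ordLeq_ordLess_trans[OF _ small_nat[unfolded small_def]])
qed

text \<open>
  Saturation for 1-types gives it for types of tuples, by induction on the length.  First all
  coordinates but the last are found so as to satisfy the projections of all finite intersections;
  over them the last coordinate has to satisfy a finitely satisfiable type in one variable.
\<close>

theorem saturation:
  "small \<kappa> B \<Longrightarrow> (\<And>X. X \<in> F \<Longrightarrow> definable M B \<sigma> X) \<Longrightarrow>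
   (\<And>G. finite G \<Longrightarrow> G \<subseteq> F \<Longrightarrow> \<exists>a\<in>tuples M \<sigma>. \<forall>X\<in>G. a \<in> X) \<Longrightarrow>
   \<exists>a\<in>tuples M \<sigma>. \<forall>X\<in>F. a \<in> X"
proof (induction \<sigma> arbitrary: B F rule: rev_induct)
  case Nil
  have "[] \<in> X" if "X \<in> F" for X using Nil(3)[of "{X}"] that by auto
  then show ?case by auto
next
  case (snoc s \<sigma>)
  define I where "I G = {a \<in> tuples M (\<sigma> @ [s]). \<forall>X\<in>G. a \<in> X}" for G
  have defI: "definable M B (\<sigma> @ [s]) (I G)" if "finite G" "G \<subseteq> F" for G
    using that
  proof (induction G)
    case empty
    then show ?case using definable_const(1)[OF struct, of B "\<sigma> @ [s]"] by (simp add: I_def)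
  next
    case (insert X G)
    have "I (insert X G) = X \<inter> I G" using definable_sub[OF snoc.prems(2)] insert.prems by (auto simp: I_def)
    then show ?case using definable_Int[OF snoc.prems(2), of X "I G"] insert by simp
  qed
  define pr where "pr G = {a \<in> tuples M \<sigma>. \<exists>c\<in>tuples M [s]. a @ c \<in> I G}" for G
  define FF where "FF = pr ` {G. finite G \<and> G \<subseteq> F}"
  have "\<exists>a\<in>tuples M \<sigma>. \<forall>X\<in>FF. a \<in> X"
  proof (rule snoc.IH[OF snoc.prems(1)])
    fix X assume "X \<in> FF"
    then obtain G where "finite G" "G \<subseteq> F" "X = pr G" by (auto simp: FF_def)
    then show "definable M B \<sigma> X" using definable_project[OF defI] by (simp add: pr_def)
  next
    fix H assume "finite H" "H \<subseteq> FF"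
    then obtain K where K: "K \<subseteq> {G. finite G \<and> G \<subseteq> F}" "finite K" "H = pr ` K"
      unfolding FF_def using finite_subset_image[of H pr "{G. finite G \<and> G \<subseteq> F}"] by blast
    then have "finite (\<Union>K)" "\<Union>K \<subseteq> F" by auto
    from snoc.prems(3)[OF this] obtain w where w: "w \<in> tuples M (\<sigma> @ [s])" "\<forall>X\<in>\<Union>K. w \<in> X" by blast
    obtain a c where ac: "a \<in> tuples M \<sigma>" "c \<in> tuples M [s]" "w = a @ c" using w(1) by (rule tuples_appendE)
    have "a \<in> pr G" if "G \<in> K" for G
    proof -
      have "w \<in> I G" using w that by (auto simp: I_def)
      then show ?thesis using ac by (auto simp: pr_def)
    qed
    then show "\<exists>a\<in>tuples M \<sigma>. \<forall>X\<in>H. a \<in> X" using ac(1) K(3) by blast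
  qed
  then obtain a where a: "a \<in> tuples M \<sigma>" "\<And>G. finite G \<Longrightarrow> G \<subseteq> F \<Longrightarrow> \<exists>c\<in>tuples M [s]. a @ c \<in> I G"
    by (auto simp: FF_def pr_def)
  let ?B = "B \<union> set a"
  let ?\<Sigma> = "{\<phi> \<in> fms M ?B [s]. \<exists>X\<in>F. \<forall>c\<in>tuples M [s]. a @ c \<in> X \<longrightarrow> holds M \<phi> c}"
  have "\<exists>c\<in>tuples M [s]. \<forall>\<phi>\<in>?\<Sigma>. holds M \<phi> c"
  proof (rule satur[unfolded saturated_def, rule_format, of ?B], intro conjI allI impI)
    show "small \<kappa> ?B" using small_Un[OF snoc.prems(1) small_list] .
    fix \<Phi> assume \<Phi>: "finite \<Phi> \<and> \<Phi> \<subseteq> ?\<Sigma>"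
    then have "\<forall>\<phi>\<in>\<Phi>. \<exists>X\<in>F. \<forall>c\<in>tuples M [s]. a @ c \<in> X \<longrightarrow> holds M \<phi> c" by blast
    then obtain h where h: "\<forall>\<phi>\<in>\<Phi>. h \<phi> \<in> F \<and> (\<forall>c\<in>tuples M [s]. a @ c \<in> h \<phi> \<longrightarrow> holds M \<phi> c)"
      by metis
    then have "h ` \<Phi> \<subseteq> F" by blast
    then obtain c where c: "c \<in> tuples M [s]" "a @ c \<in> I (h ` \<Phi>)" using a(2)[of "h ` \<Phi>"] \<Phi> by blast
    then show "\<exists>c\<in>tuples M [s]. \<forall>\<phi>\<in>\<Phi>. holds M \<phi> c" using h by (auto simp: I_def)
  qed blast
  then obtain c where c: "c \<in> tuples M [s]" "\<And>\<phi>. \<phi> \<in> ?\<Sigma> \<Longrightarrow> holds M \<phi> c" by blast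
  have ac: "a @ c \<in> tuples M (\<sigma> @ [s])" using a(1) c(1) by auto
  have "a @ c \<in> X" if X: "X \<in> F" for X
  proof -
    have "definable M ?B [s] {c \<in> tuples M [s]. a @ c \<in> X}"
      by (rule definable_fibre_left[OF struct snoc.prems(2)[OF X] a(1)]) simp
    then obtain \<phi> where \<phi>: "\<phi> \<in> fms M ?B [s]" "{c \<in> tuples M [s]. a @ c \<in> X} = {c \<in> tuples M [s]. holds M \<phi> c}"
      unfolding definable_def by blast
    have "\<phi> \<in> ?\<Sigma>" using \<phi> X by blast
    then show ?thesis using c \<phi>(2) by blast
  qed
  then show ?case using ac by blast
qed

corollary compactness:
  assumes "small \<kappa> B" "\<And>X. X \<in> F \<Longrightarrow> definable M B \<sigma> X" "\<And>a. a \<in> tuples M \<sigma> \<Longrightarrow> \<exists>X\<in>F. a \<notin> X"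
  shows "\<exists>G. finite G \<and> G \<subseteq> F \<and> (\<forall>a\<in>tuples M \<sigma>. \<exists>X\<in>G. a \<notin> X)"
proof (rule ccontr)
  assume no: "\<nexists>G. finite G \<and> G \<subseteq> F \<and> (\<forall>a\<in>tuples M \<sigma>. \<exists>X\<in>G. a \<notin> X)"
  have "\<exists>a\<in>tuples M \<sigma>. \<forall>X\<in>F. a \<in> X"
  proof (rule saturation[OF assms(1)])
    fix G assume G: "finite G" "G \<subseteq> F"
    show "\<exists>a\<in>tuples M \<sigma>. \<forall>X\<in>G. a \<in> X"
    proof (rule ccontr)
      assume "\<not> (\<exists>a\<in>tuples M \<sigma>. \<forall>X\<in>G. a \<in> X)"
      then have "\<forall>a\<in>tuples M \<sigma>. \<exists>X\<in>G. a \<notin> X" by simp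
      with G have "finite G \<and> G \<subseteq> F \<and> (\<forall>a\<in>tuples M \<sigma>. \<exists>X\<in>G. a \<notin> X)" by (intro conjI)
      then have "\<exists>G. finite G \<and> G \<subseteq> F \<and> (\<forall>a\<in>tuples M \<sigma>. \<exists>X\<in>G. a \<notin> X)" ..
      with no show False ..
    qed
  qed (rule assms(2))
  then obtain a where "a \<in> tuples M \<sigma>" "\<forall>X\<in>F. a \<in> X" ..
  then show False using assms(3)[of a] by simp
qed

text \<open>
  The finite map \<open>a \<mapsto> c\<close> together with the identity on \<open>A\<close> is well defined and elementary, because
  equality of coordinates with each other and with elements of \<open>A\<close> is part of the type.
\<close>

lemma homogeneity:
  assumes e: "eqtp M A a c" and A: "small \<kappa> A"
  shows "\<exists>g. fixes_aut M A g \<and> map g a = c"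
proof -
  let ?\<sigma> = "map (srt M) a"
  have at: "a \<in> tuples M ?\<sigma>" and ct: "c \<in> tuples M ?\<sigma>" using e by (auto simp: eqtp_def tuples_def)
  have len: "length c = length a" using e by (metis eqtp_def length_map)
  have transfer: "map (case_sum ((!) a) id) es \<in> X \<longleftrightarrow> map (case_sum ((!) c) id) es \<in> X"
    if "definable M A \<tau> X" "length es = length \<tau>"
      "\<And>i. i < length \<tau> \<Longrightarrow> case es ! i of Inl j \<Rightarrow> j < length ?\<sigma> \<and> ?\<sigma> ! j = \<tau> ! i | Inr x \<Rightarrow> x \<in> A \<and> srt M x = \<tau> ! i"
    for es \<tau> X
  proof -
    have "definable M A ?\<sigma> {w \<in> tuples M ?\<sigma>. map (case_sum ((!) w) id) es \<in> X}"
      by (rule definable_reindex[OF that(1,2) subset_refl]) (use that(3) in auto)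
    from eqtp_mem[OF e this] show ?thesis using at ct by simp
  qed
  have inA: "c ! i = a ! i" if i: "i < length a" "a ! i \<in> A" for i
  proof -
    have "definable M A [srt M (a ! i)] {[a ! i]}"
      by (rule definable_singleton[OF struct]) (use i in \<open>auto simp: tuples_def\<close>)
    from transfer[OF this, of "[Inl i]"] show ?thesis using i by simp
  qed
  have eq: "c ! i = c ! j" if ij: "i < length a" "j < length a" "a ! i = a ! j" for i j
  proof -
    have "definable M A ([srt M (a ! i)] @ [srt M (a ! i)]) {x @ x |x. x \<in> tuples M [srt M (a ! i)]}"
      by (rule definable_diagonal[OF struct])
    then have D: "definable M A [srt M (a ! i), srt M (a ! i)] {x @ x |x. x \<in> tuples M [srt M (a ! i)]}" by simp
    have "[a ! i, a ! j] \<in> {x @ x |x. x \<in> tuples M [srt M (a ! i)]}"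
      using ij(3) by (auto intro!: exI[of _ "[a ! j]"] simp: tuples_def)
    then have "[c ! i, c ! j] \<in> {x @ x |x. x \<in> tuples M [srt M (a ! i)]}"
      using transfer[OF D, of "[Inl i, Inl j]"] ij by (auto simp: nth_Cons split: nat.splits)
    then show ?thesis by (auto simp: tuples_def)
  qed
  define ix where "ix x = (LEAST i. i < length a \<and> a ! i = x)" for x
  have ix: "ix x < length a \<and> a ! ix x = x" if "x \<in> set a" for x
    using that unfolding ix_def in_set_conv_nth by (rule LeastI_ex)
  define h where "h x = (if x \<in> set a then c ! ix x else x)" for x
  have ha: "h (a ! i) = c ! i" if "i < length a" for i
    using that ix[of "a ! i"] eq[of "ix (a ! i)" i] by (simp add: h_def)
  have hA: "h x = x" if "x \<in> A" for x
  proof (cases "x \<in> set a")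
    case True then show ?thesis using inA[of "ix x"] ix[OF True] that by (simp add: h_def)
  qed (simp add: h_def)
  have "map (srt M) a = map (srt M) c" using e by (simp add: eqtp_def)
  then have srtc: "srt M (c ! i) = srt M (a ! i)" if "i < length a" for i
    using that len nth_map[of i a "srt M"] nth_map[of i c "srt M"] by simp
  have srth: "srt M (h x) = srt M x" if "x \<in> A \<union> set a" for x
  proof (cases "x \<in> set a")
    case True then show ?thesis using ix[OF True] srtc[of "ix x"] by (simp add: h_def)
  next
    case False then show ?thesis using hA that by simp
  qed
  have "partial_elementary M (A \<union> set a) h"
    unfolding partial_elementary_def
  proof (intro conjI ballI allI impI)
    fix l \<phi> assume l: "set l \<subseteq> A \<union> set a" and \<phi>: "\<phi> \<in> fms M {} (map (srt M) l)"
    let ?es = "map (\<lambda>x. if x \<in> set a then Inl (ix x) else Inr x) l"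
    let ?X = "{w \<in> tuples M (map (srt M) l). holds M \<phi> w}"
    have D: "definable M A (map (srt M) l) ?X"
      by (rule definable_mono[of M "{}"]) (use \<phi> in \<open>auto simp: definable_def\<close>)
    have "map (case_sum ((!) a) id) ?es \<in> ?X \<longleftrightarrow> map (case_sum ((!) c) id) ?es \<in> ?X"
    proof (rule transfer[OF D])
      fix i assume "i < length (map (srt M) l)"
      then have i: "i < length l" by simp
      show "case ?es ! i of Inl j \<Rightarrow> j < length ?\<sigma> \<and> ?\<sigma> ! j = map (srt M) l ! i
        | Inr x \<Rightarrow> x \<in> A \<and> srt M x = map (srt M) l ! i"
      proof (cases "l ! i \<in> set a")
        case True then show ?thesis using i ix[OF True] by simp
      next
        case False
        then have "l ! i \<in> A" using i l nth_mem by blast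
        then show ?thesis using i False by simp
      qed
    qed simp
    moreover have "map (case_sum ((!) a) id) ?es = l"
      unfolding map_map by (rule map_idI) (use ix in \<open>auto simp: o_def\<close>)
    moreover have "map (case_sum ((!) c) id) ?es = map h l"
      unfolding map_map by (rule map_cong) (auto simp: h_def)
    moreover have "map h l \<in> tuples M (map (srt M) l)"
      unfolding tuples_def mem_Collect_eq map_map by (rule map_cong) (use srth l in auto)
    ultimately have "l \<in> ?X \<longleftrightarrow> map h l \<in> ?X" by (simp only:)
    then show "holds M \<phi> (map h l) \<longleftrightarrow> holds M \<phi> l" using \<open>map h l \<in> tuples M (map (srt M) l)\<close> by simp
  qed (rule srth)
  moreover have "small \<kappa> (A \<union> set a)" by (rule small_Un[OF A small_list])
  ultimately obtain g where g: "automorphism M g" "\<forall>x\<in>A \<union> set a. g x = h x"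
    using homog unfolding strongly_homogeneous_def by blast
  have "map g a = c" by (rule nth_equalityI) (use g(2) ha len in auto)
  moreover have "fixes_aut M A g" using g hA by (simp add: fixes_aut_def)
  ultimately show ?thesis by blast
qed

text \<open>
  Tuples with the same type over \<open>A\<close> are conjugate over \<open>A\<close>, so no pair \<open>(y, y')\<close> with \<open>y \<in> W\<close> and
  \<open>y' \<notin> W\<close> lies on the same side of every set definable over \<open>A\<close>.  By compactness finitely many
  such sets already decide membership in \<open>W\<close>, and \<open>W\<close> is a Boolean combination of them.
\<close>

theorem invariant_definable:
  assumes A: "small \<kappa> A" and W: "definable M UNIV \<tau> W"
    and inv: "\<And>g y. fixes_aut M A g \<Longrightarrow> y \<in> W \<Longrightarrow> map g y \<in> W"
  shows "definable M A \<tau> W"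
proof -
  obtain b where b: "definable M (set b) \<tau> W" using definable_finite_parameters[OF W] by blast
  let ?B = "A \<union> set b"
  have WB: "definable M ?B \<tau> W" using b by (rule definable_mono) simp
  let ?\<Gamma> = "(\<lambda>_. [])(0 := \<tau>, Suc 0 := \<tau>)"
  define E where "E X = rel2 M \<tau> \<tau> (\<lambda>y y'. y \<in> X \<longleftrightarrow> y' \<in> X)" for X
  define D where "D = rel2 M \<tau> \<tau> (\<lambda>y y'. y \<in> W \<and> y' \<notin> W)"
  have E: "definable M ?B (\<tau> @ \<tau>) (E X)" if "definable M A \<tau> X" for X
  proof -
    have X: "definable M ?B \<tau> X" using that by (rule definable_mono) simp
    show ?thesis unfolding E_def
      by (rule Def_set2[where \<Gamma> = ?\<Gamma> and i = 0 and j = "Suc 0", OF struct])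
        (simp_all add: X struct Def_iff Def_mem1)
  qed
  have D: "definable M ?B (\<tau> @ \<tau>) D" unfolding D_def
    by (rule Def_set2[where \<Gamma> = ?\<Gamma> and i = 0 and j = "Suc 0", OF struct])
      (simp_all add: WB struct Def_conj Def_neg Def_mem1)
  let ?F = "insert D (E ` {X. definable M A \<tau> X})"
  have "\<exists>G. finite G \<and> G \<subseteq> ?F \<and> (\<forall>w\<in>tuples M (\<tau> @ \<tau>). \<exists>X\<in>G. w \<notin> X)"
  proof (rule compactness)
    show "small \<kappa> ?B" by (rule small_Un[OF A small_list])
    fix X assume "X \<in> ?F" then show "definable M ?B (\<tau> @ \<tau>) X" using E D by blast
  next
    fix w assume "w \<in> tuples M (\<tau> @ \<tau>)"
    then obtain y y' where y: "y \<in> tuples M \<tau>" "y' \<in> tuples M \<tau>" "w = y @ y'" by (rule tuples_appendE)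
    show "\<exists>X\<in>?F. w \<notin> X"
    proof (rule ccontr)
      assume "\<not> (\<exists>X\<in>?F. w \<notin> X)"
      then have w: "w \<in> D" "\<And>X. definable M A \<tau> X \<Longrightarrow> w \<in> E X" by blast+
      have yW: "y \<in> W" "y' \<notin> W" using w(1) y by (auto simp: D_def rel2_iff)
      have "eqtp M A y y'" unfolding eqtp_def
      proof (intro conjI allI impI)
        show "map (srt M) y = map (srt M) y'" using y by (simp add: tuples_def)
        fix X assume "definable M A (map (srt M) y) X"
        then have "definable M A \<tau> X" using y(1) by (simp add: tuples_def)
        from w(2)[OF this] show "y \<in> X \<longleftrightarrow> y' \<in> X" using y by (auto simp: E_def rel2_iff)
      qed
      then show False using homogeneity[OF _ A] inv yW by blast
    qed
  qed
  then obtain G where G0: "finite G \<and> G \<subseteq> ?F \<and> (\<forall>w\<in>tuples M (\<tau> @ \<tau>). \<exists>X\<in>G. w \<notin> X)" ..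
  then have G: "finite G" "G \<subseteq> ?F" "\<And>w. w \<in> tuples M (\<tau> @ \<tau>) \<Longrightarrow> \<exists>X\<in>G. w \<notin> X" by simp_all
  have "finite (G - {D})" "G - {D} \<subseteq> E ` {X. definable M A \<tau> X}" using G by auto
  then obtain K where K: "K \<subseteq> {X. definable M A \<tau> X}" "finite K" "G - {D} = E ` K"
    using finite_subset_image[of "G - {D}" E "{X. definable M A \<tau> X}"] by blast
  have key: "y' \<in> W" if "y \<in> W" "y' \<in> tuples M \<tau>" "\<forall>X\<in>K. y \<in> X \<longleftrightarrow> y' \<in> X" for y y'
  proof (rule ccontr)
    assume "y' \<notin> W"
    have y: "y \<in> tuples M \<tau>" using that(1) definable_sub[OF W] by blast
    have "y @ y' \<in> D" using that \<open>y' \<notin> W\<close> y by (simp add: D_def rel2_iff)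
    moreover have "y @ y' \<in> E X" if "X \<in> K" for X
      using that \<open>\<forall>X\<in>K. y \<in> X \<longleftrightarrow> y' \<in> X\<close> \<open>y' \<in> tuples M \<tau>\<close> y by (simp add: E_def rel2_iff)
    ultimately show False using G(3)[of "y @ y'"] y that(2) K(3) by blast
  qed
  let ?J = "(\<lambda>y. {X\<in>K. y \<in> X}) ` W"
  have fin: "finite ?J" by (rule finite_subset[of _ "Pow K"]) (use K(2) in auto)
  have "W = {y \<in> tuples M \<tau>. \<exists>J\<in>?J. \<forall>X\<in>K. y \<in> X \<longleftrightarrow> X \<in> J}"
  proof (intro equalityI subsetI)
    fix y assume "y \<in> W"
    then have "y \<in> tuples M \<tau>" "{X\<in>K. y \<in> X} \<in> ?J" using definable_sub[OF W] by blast+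
    moreover have "\<forall>X\<in>K. y \<in> X \<longleftrightarrow> X \<in> {X\<in>K. y \<in> X}" by simp
    ultimately show "y \<in> {y \<in> tuples M \<tau>. \<exists>J\<in>?J. \<forall>X\<in>K. y \<in> X \<longleftrightarrow> X \<in> J}"
      by (intro CollectI conjI bexI)
  next
    fix y assume "y \<in> {y \<in> tuples M \<tau>. \<exists>J\<in>?J. \<forall>X\<in>K. y \<in> X \<longleftrightarrow> X \<in> J}"
    then obtain J where J: "y \<in> tuples M \<tau>" "J \<in> ?J" "\<forall>X\<in>K. y \<in> X \<longleftrightarrow> X \<in> J"
      unfolding mem_Collect_eq by (elim conjE bexE)
    from J(2) obtain y' where y': "J = {X\<in>K. y' \<in> X}" "y' \<in> W" by (elim imageE)
    have "\<forall>X\<in>K. y' \<in> X \<longleftrightarrow> y \<in> X" using J(3) y'(1) by simp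
    then show "y \<in> W" using key[OF y'(2) J(1)] by simp
  qed
  also have "definable M A \<tau> \<dots>"
    by (rule Def_set1[where \<Gamma> = ?\<Gamma> and i = 0, OF struct], simp)
      (rule Def_Bex[OF struct fin], rule Def_Ball[OF struct K(2)], rule Def_iff[OF struct _ Def_const[OF struct]],
        rule Def_mem1[OF struct], use K(1) in auto)
  finally show ?thesis .
qed

end

lemma aut_image_definable:
  assumes M: "is_structure M" and g: "automorphism M g" and \<phi>: "\<phi> \<in> fms M B \<sigma>"
  shows "map g ` {a \<in> tuples M \<sigma>. holds M \<phi> a} =
    {a \<in> tuples M \<sigma>. holds M (map_fm (\<lambda>x. x) (\<lambda>x. x) (\<lambda>x. x) g \<phi>) a}" (is "?L = ?R")
proof (intro equalityI subsetI)
  fix a assume "a \<in> ?L"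
  then obtain c where c: "a = map g c" "c \<in> tuples M \<sigma>" "holds M \<phi> c" by auto
  have "a \<in> tuples M \<sigma>" using c aut_tuples[OF g] by simp
  moreover have "holds M (map_fm (\<lambda>x. x) (\<lambda>x. x) (\<lambda>x. x) g \<phi>) a"
    using aut_holds[OF M g \<phi> c(2)] c by simp
  ultimately show "a \<in> ?R" by simp
next
  fix a assume a: "a \<in> ?R"
  have bij: "bij g" using g by (simp add: automorphism_def)
  have ga: "map g (map (inv g) a) = a" using bij by (simp add: o_def bij_def surj_f_inv_f)
  then have "map (inv g) a \<in> tuples M \<sigma>" using a aut_tuples[OF g, of "map (inv g) a" \<sigma>] by simp
  moreover then have "holds M \<phi> (map (inv g) a)" using aut_holds[OF M g \<phi>, of "map (inv g) a"] ga a by simp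
  ultimately show "a \<in> ?L" using ga by (intro image_eqI[of _ _ "map (inv g) a"]) simp_all
qed

section \<open>Generically stable types\<close>

locale generic_type = monster \<kappa> M for \<kappa> :: "'k rel" and M :: "('s, 'f, 'r, 'm) struct" +
  fixes A :: "'m set" and \<sigma> :: "'s list" and p :: "('s, 'f, 'r, 'm) fm set"
  assumes smallA: "small \<kappa> A" and gs: "generically_stable M A \<sigma> p"
begin

text \<open>
  The type \<open>p\<close> as an ultrafilter on the definable sets of \<open>\<sigma>\<close>-tuples.  Different formulas that
  define the same set need not be distinguished.
\<close>

definition P :: "'m list set \<Rightarrow> bool" where
  "P X \<longleftrightarrow> (\<exists>\<phi>\<in>p. X = {a \<in> tuples M \<sigma>. holds M \<phi> a})"

abbreviation Real :: "'m list \<Rightarrow> 'm set \<Rightarrow> bool" where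
  "Real a B \<equiv> realizes M \<sigma> a p B"

lemma glob: "global_type M \<sigma> p" using gs by (simp add: generically_stable_def)

lemma p_fms: "\<phi> \<in> p \<Longrightarrow> \<phi> \<in> fms M UNIV \<sigma>"
  using glob by (auto simp: global_type_def)

lemma P_definable: "P X \<Longrightarrow> definable M UNIV \<sigma> X"
  unfolding P_def definable_def using p_fms by blast

lemma P_sub: "P X \<Longrightarrow> X \<subseteq> tuples M \<sigma>"
  unfolding P_def by blast

lemma P_finite:
  assumes "finite F" "\<And>X. X \<in> F \<Longrightarrow> P X" shows "\<exists>a\<in>tuples M \<sigma>. \<forall>X\<in>F. a \<in> X"
proof -
  have "\<forall>X\<in>F. \<exists>\<phi>. \<phi> \<in> p \<and> X = {a \<in> tuples M \<sigma>. holds M \<phi> a}" using assms(2) by (auto simp: P_def)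
  then obtain h where h: "\<forall>X\<in>F. h X \<in> p \<and> X = {a \<in> tuples M \<sigma>. holds M (h X) a}" by (rule bchoice[THEN exE])
  have "finite (h ` F) \<and> h ` F \<subseteq> p" using assms(1) h by auto
  then obtain a where a: "a \<in> tuples M \<sigma>" "\<forall>\<phi>\<in>h ` F. holds M \<phi> a"
    using glob unfolding global_type_def by meson
  have "a \<in> X" if X: "X \<in> F" for X
  proof -
    have "X = {a \<in> tuples M \<sigma>. holds M (h X) a}" using h X by blast
    moreover have "holds M (h X) a" using a(2) X by blast
    ultimately show ?thesis using a(1) by blast
  qed
  then show ?thesis using a(1) by blast
qed

lemma P_complete:
  assumes "definable M UNIV \<sigma> X" shows "P X \<or> P (tuples M \<sigma> - X)"
proof -
  obtain \<phi> where \<phi>: "\<phi> \<in> fms M UNIV \<sigma>" "X = {a \<in> tuples M \<sigma>. holds M \<phi> a}"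
    using assms unfolding definable_def by blast
  have "\<phi> \<in> p \<or> Neg \<phi> \<in> p" using glob \<phi>(1) by (simp add: global_type_def)
  then show ?thesis
  proof
    assume "\<phi> \<in> p" then show ?thesis using \<phi>(2) by (auto simp: P_def)
  next
    assume n: "Neg \<phi> \<in> p"
    have "tuples M \<sigma> - X = {a \<in> tuples M \<sigma>. holds M (Neg \<phi>) a}" using \<phi>(2) by (auto simp: holds_def)
    then show ?thesis using n by (auto simp: P_def)
  qed
qed

lemma P_meet: "P X \<Longrightarrow> P Y \<Longrightarrow> \<exists>a. a \<in> X \<and> a \<in> Y"
  using P_finite[of "{X, Y}"] by auto

lemma P_neg: "definable M UNIV \<sigma> X \<Longrightarrow> P (tuples M \<sigma> - X) \<longleftrightarrow> \<not> P X"
  using P_complete[of X] P_meet[of X "tuples M \<sigma> - X"] by blast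

lemma P_mono:
  assumes "P X" "X \<subseteq> Y" "definable M UNIV \<sigma> Y" shows "P Y"
  using P_complete[OF assms(3)] P_meet[OF assms(1), of "tuples M \<sigma> - Y"] assms(2) by blast

lemma P_Int:
  assumes "P X" "P Y" shows "P (X \<inter> Y)"
proof (rule ccontr)
  assume no: "\<not> P (X \<inter> Y)"
  have "definable M UNIV \<sigma> (X \<inter> Y)" by (rule definable_Int) (use assms P_definable in simp_all)
  then have "P (tuples M \<sigma> - (X \<inter> Y))" using no P_neg by simp
  then have "\<exists>a\<in>tuples M \<sigma>. \<forall>Z\<in>{X, Y, tuples M \<sigma> - (X \<inter> Y)}. a \<in> Z"
    by (intro P_finite) (use assms in auto)
  then show False by auto
qed

lemma real_tuples: "Real a B \<Longrightarrow> a \<in> tuples M \<sigma>"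
  by (simp add: realizes_def)

lemma real_mono: "Real a B \<Longrightarrow> B' \<subseteq> B \<Longrightarrow> Real a B'"
  unfolding realizes_def by blast

lemma real_mem:
  assumes a: "Real a B" and X: "definable M B \<sigma> X" shows "a \<in> X \<longleftrightarrow> P X"
proof -
  have one: "a \<in> X" if X: "definable M B \<sigma> X" "P X" for X
  proof -
    obtain \<phi> where \<phi>: "\<phi> \<in> fms M B \<sigma>" "X = {a \<in> tuples M \<sigma>. holds M \<phi> a}"
      using X(1) unfolding definable_def by blast
    have X': "tuples M \<sigma> - X = {a \<in> tuples M \<sigma>. holds M (Neg \<phi>) a}" using \<phi>(2) by (auto simp: holds_def)
    have "definable M UNIV \<sigma> X" using X(1) by (rule definable_mono) simp
    then have "\<not> P (tuples M \<sigma> - X)" using X(2) P_neg by simp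
    then have "Neg \<phi> \<notin> p" unfolding P_def using X' by blast
    moreover have "\<phi> \<in> fms M UNIV \<sigma>" using \<phi>(1) by (auto simp: fms_def)
    ultimately have "\<phi> \<in> p" using glob by (auto simp: global_type_def)
    then have "holds M \<phi> a" using a fmsD(2)[OF \<phi>(1)] by (simp add: realizes_def)
    then show ?thesis using \<phi>(2) real_tuples[OF a] by simp
  qed
  have U: "definable M UNIV \<sigma> X" using X by (rule definable_mono) simp
  show ?thesis
  proof
    assume aX: "a \<in> X"
    show "P X"
    proof (rule ccontr)
      assume "\<not> P X"
      then have "P (tuples M \<sigma> - X)" using P_neg[OF U] by simp
      then have "a \<in> tuples M \<sigma> - X" using one[OF definable_Diff[OF X]] by simp
      then show False using aX by simp
    qed
  qed (use one[OF X] in simp)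
qed

lemma realI:
  assumes "a \<in> tuples M \<sigma>" "\<And>X. definable M B \<sigma> X \<Longrightarrow> P X \<Longrightarrow> a \<in> X" shows "Real a B"
  unfolding realizes_def
proof (intro conjI ballI impI)
  fix \<phi> assume \<phi>: "\<phi> \<in> p" "pars \<phi> \<subseteq> B"
  then have "\<phi> \<in> fms M B \<sigma>" using p_fms[OF \<phi>(1)] by (simp add: fms_def)
  then have "definable M B \<sigma> {a \<in> tuples M \<sigma>. holds M \<phi> a}" unfolding definable_def by blast
  moreover have "P {a \<in> tuples M \<sigma>. holds M \<phi> a}" using \<phi>(1) unfolding P_def by blast
  ultimately have "a \<in> {a \<in> tuples M \<sigma>. holds M \<phi> a}" by (rule assms(2))
  then show "holds M \<phi> a" by simp
qed (rule assms(1))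

lemma real_exists:
  assumes "small \<kappa> B" shows "\<exists>a. Real a B"
proof -
  have "\<exists>a\<in>tuples M \<sigma>. \<forall>X\<in>{X. definable M B \<sigma> X \<and> P X}. a \<in> X"
  proof (rule saturation[OF assms])
    fix G assume "finite G" "G \<subseteq> {X. definable M B \<sigma> X \<and> P X}"
    then show "\<exists>a\<in>tuples M \<sigma>. \<forall>X\<in>G. a \<in> X" by (intro P_finite) auto
  qed simp
  then obtain a where "a \<in> tuples M \<sigma>" "\<forall>X\<in>{X. definable M B \<sigma> X \<and> P X}. a \<in> X" ..
  then have "Real a B" by (intro realI) simp_all
  then show ?thesis ..
qed

text \<open>
  The usual way to see that a set over \<open>B\<close> belongs to \<open>p\<close>: check it at the realizations of \<open>p\<close>
  over \<open>B\<close>, of which there is at least one.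
\<close>

lemma P_real:
  assumes "small \<kappa> B" "definable M B \<sigma> X" "\<And>a. Real a B \<Longrightarrow> a \<in> X" shows "P X"
proof -
  obtain a where a: "Real a B" using real_exists[OF assms(1)] ..
  show ?thesis using real_mem[OF a assms(2)] assms(3)[OF a] by simp
qed

lemma real_eqtp: "Real a B \<Longrightarrow> Real a' B \<Longrightarrow> eqtp M B a a'"
  unfolding eqtp_def using real_tuples real_mem by (simp add: tuples_def)

lemma P_aut:
  assumes g: "fixes_aut M A g" and X: "P X" shows "P (map g ` X)"
proof -
  have aut: "automorphism M g" using g by (simp add: fixes_aut_def)
  obtain \<phi> where \<phi>: "\<phi> \<in> p" "X = {a \<in> tuples M \<sigma>. holds M \<phi> a}" using X unfolding P_def by blast
  have "map_fm (\<lambda>x. x) (\<lambda>x. x) (\<lambda>x. x) g ` p = p"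
    using gs g unfolding generically_stable_def invariant_def fixes_aut_def id_def by blast
  then have "map_fm (\<lambda>x. x) (\<lambda>x. x) (\<lambda>x. x) g \<phi> \<in> p" using \<phi>(1) by blast
  then show ?thesis unfolding P_def using aut_image_definable[OF struct aut p_fms[OF \<phi>(1)]] \<phi>(2) by blast
qed

lemma image_definable:
  assumes g: "fixes_aut M A g" and X: "definable M B \<sigma>' X" shows "definable M (g ` B) \<sigma>' (map g ` X)"
proof -
  have aut: "automorphism M g" using g by (simp add: fixes_aut_def)
  obtain \<phi> where \<phi>: "\<phi> \<in> fms M B \<sigma>'" "X = {a \<in> tuples M \<sigma>'. holds M \<phi> a}"
    using X unfolding definable_def by blast
  show ?thesis unfolding definable_def
    using aut_fms[OF aut \<phi>(1)] aut_image_definable[OF struct aut \<phi>(1)] \<phi>(2) by blast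
qed

lemma inv_image_aut: "fixes_aut M C g \<Longrightarrow> inv g ` g ` B = B"
  unfolding fixes_aut_def automorphism_def bij_def by (simp add: image_image)

lemma real_aut:
  assumes g: "fixes_aut M A g" and a: "Real a B" shows "Real (map g a) (g ` B)"
proof (rule realI)
  show "map g a \<in> tuples M \<sigma>" using fixes_aut_tuples[OF g] real_tuples[OF a] by blast
  have gi: "fixes_aut M A (inv g)" by (rule fixes_aut_inv[OF g])
  have bij: "bij g" using g by (simp add: fixes_aut_def automorphism_def)
  fix X assume X: "definable M (g ` B) \<sigma> X" "P X"
  have "definable M B \<sigma> (map (inv g) ` X)"
    using image_definable[OF gi X(1)] inv_image_aut[OF g] by simp
  moreover have "P (map (inv g) ` X)" by (rule P_aut[OF gi X(2)])
  ultimately have "a \<in> map (inv g) ` X" using real_mem[OF a] by simp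
  then obtain x where "x \<in> X" "a = map (inv g) x" by blast
  moreover have "map g (map (inv g) x) = x" for x using bij by (simp add: o_def bij_def surj_f_inv_f)
  ultimately show "map g a \<in> X" by simp
qed

lemma fixes_aut_image: "fixes_aut M B g \<Longrightarrow> g ` (B \<union> C) = B \<union> g ` C"
  unfolding fixes_aut_def by (simp add: image_Un)

lemma P_fibre_definable:
  assumes "definable M A (\<sigma> @ \<tau>) Z" "c \<in> tuples M \<tau>"
  shows "definable M (A \<union> set c) \<sigma> {a \<in> tuples M \<sigma>. a @ c \<in> Z}"
  by (rule definable_fibre[OF assms]) simp

text \<open>By invariance of \<open>p\<close> under the automorphism that takes \<open>c\<close> to \<open>c'\<close>.\<close>

lemma P_fibre_eqtp:
  assumes Z: "definable M A (\<sigma> @ \<tau>) Z" and e: "eqtp M A c c'"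
    and P: "P {a \<in> tuples M \<sigma>. a @ c \<in> Z}"
  shows "P {a \<in> tuples M \<sigma>. a @ c' \<in> Z}"
proof -
  obtain g where g: "fixes_aut M A g" "map g c = c'" using homogeneity[OF e smallA] by (elim exE conjE)
  have "map g ` {a \<in> tuples M \<sigma>. a @ c \<in> Z} = {a \<in> tuples M \<sigma>. a @ c' \<in> Z}"
  proof (intro equalityI subsetI)
    fix a assume "a \<in> map g ` {a \<in> tuples M \<sigma>. a @ c \<in> Z}"
    then obtain x where x: "x \<in> tuples M \<sigma>" "x @ c \<in> Z" "a = map g x" by auto
    have "map g (x @ c) \<in> Z" using fixes_aut_definable[OF struct g(1) Z, of "x @ c"] x(2) by (simp only:)
    then show "a \<in> {a \<in> tuples M \<sigma>. a @ c' \<in> Z}" using x g(2) fixes_aut_tuples[OF g(1)] by simp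
  next
    fix a assume a: "a \<in> {a \<in> tuples M \<sigma>. a @ c' \<in> Z}"
    have bij: "bij g" using g by (simp add: fixes_aut_def automorphism_def)
    let ?x = "map (inv g) a"
    have gx: "map g ?x = a" using bij by (simp add: o_def bij_def surj_f_inv_f)
    then have "?x \<in> tuples M \<sigma>" using a fixes_aut_tuples[OF g(1), of ?x] by simp
    moreover have "?x @ c \<in> Z" using fixes_aut_definable[OF struct g(1) Z, of "?x @ c"] gx g(2) a by simp
    ultimately show "a \<in> map g ` {a \<in> tuples M \<sigma>. a @ c \<in> Z}" using gx by (intro image_eqI[of _ _ ?x]) simp_all
  qed
  then show ?thesis using P_aut[OF g(1) P] by simp
qed

subsection \<open>Morley sequences\<close>

text \<open>
  Finite Morley sequences over \<open>B\<close>.  Lists with recursion from the front keep the part of the base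
  that has been accumulated explicit.
\<close>

fun mor :: "'m set \<Rightarrow> 'm list list \<Rightarrow> bool" where
  "mor B [] \<longleftrightarrow> True"
| "mor B (a # as) \<longleftrightarrow> Real a B \<and> mor (B \<union> set a) as"

lemma mor_append: "mor B (as @ bs) \<longleftrightarrow> mor B as \<and> mor (B \<union> set (concat as)) bs"
  by (induction as arbitrary: B) (auto simp: Un_assoc)

lemma mor_mono: "mor B as \<Longrightarrow> B' \<subseteq> B \<Longrightarrow> mor B' as"
proof (induction as arbitrary: B B')
  case (Cons a as)
  have "mor (B' \<union> set a) as" by (rule Cons.IH[of "B \<union> set a"]) (use Cons.prems in auto)
  then show ?case using Cons.prems real_mono[of a B B'] by simp
qed simp

lemma mor_real: "mor B as \<Longrightarrow> a \<in> set as \<Longrightarrow> Real a B"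
proof (induction as arbitrary: B)
  case (Cons x as)
  show ?case
  proof (cases "a = x")
    case False
    then have "Real a (B \<union> set x)" using Cons by simp
    then show ?thesis by (rule real_mono) simp
  qed (use Cons.prems in simp)
qed simp

lemma mor_filter: "mor B as \<Longrightarrow> mor B (filter Q as)"
proof (induction as arbitrary: B)
  case (Cons a as)
  then have *: "mor (B \<union> set a) (filter Q as)" by simp
  then have "mor B (filter Q as)" by (rule mor_mono) simp
  then show ?case using * Cons.prems by simp
qed simp

lemma mor_take: "mor B as \<Longrightarrow> mor B (take n as)"
  using mor_append[of B "take n as" "drop n as"] by simp

lemma mor_nth: "mor B as \<longleftrightarrow> (\<forall>i<length as. Real (as ! i) (B \<union> (\<Union>j<i. set (as ! j))))"
proof (induction as arbitrary: B)
  case (Cons a as)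
  have *: "(B \<union> (\<Union>j<Suc i. set ((a # as) ! j))) = B \<union> set a \<union> (\<Union>j<i. set (as ! j))" for i
    unfolding lessThan_Suc_eq_insert_0 by auto
  show ?case unfolding mor.simps Cons.IH
    by (simp only: list.size All_less_Suc2 nth_Cons_0 nth_Cons_Suc * add_0_right add_Suc_right) simp
qed simp

lemma mor_aut: "fixes_aut M A g \<Longrightarrow> mor B as \<Longrightarrow> mor (g ` B) (map (map g) as)"
proof (induction as arbitrary: B)
  case (Cons a as)
  have "mor (g ` (B \<union> set a)) (map (map g) as)" using Cons by simp
  then show ?case using real_aut[OF Cons.prems(1), of a B] Cons.prems(2) by (simp add: image_Un)
qed simp

lemma small_list_Un: "small \<kappa> B \<Longrightarrow> small \<kappa> (B \<union> set a)"
  by (rule small_Un[OF _ small_list])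

text \<open>
  The type over \<open>B\<close> of a Morley sequence depends only on its length.  The automorphism is composed
  of one that takes the first element to its counterpart and one, fixing the first element, that
  takes care of the rest.
\<close>

lemma mor_conjugate:
  "small \<kappa> B \<Longrightarrow> A \<subseteq> B \<Longrightarrow> mor B as \<Longrightarrow> mor B as' \<Longrightarrow> length as = length as' \<Longrightarrow>
   \<exists>g. fixes_aut M B g \<and> map (map g) as = as'"
proof (induction as arbitrary: B as')
  case Nil
  have "fixes_aut M B (\<lambda>x. x)" using bij_id by (simp add: fixes_aut_def automorphism_def id_def)
  then show ?case using Nil by auto
next
  case (Cons a as)
  obtain a' bs where as': "as' = a' # bs" using Cons.prems(5) by (cases as') simp_all
  have "eqtp M B a a'" by (rule real_eqtp) (use Cons.prems as' in simp_all)
  then obtain g where g: "fixes_aut M B g" "map g a = a'" using homogeneity[OF _ Cons.prems(1)] by blast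
  have gi: "fixes_aut M B (inv g)" by (rule fixes_aut_inv[OF g(1)])
  have "map (inv g) a' = a" by (rule fixes_aut_map_inv[OF g])
  then have im': "inv g ` (B \<union> set a') = B \<union> set a" using fixes_aut_image[OF gi] by (metis list.set_map)
  have "mor (inv g ` (B \<union> set a')) (map (map (inv g)) bs)"
    by (rule mor_aut[OF fixes_aut_mono[OF gi Cons.prems(2)]]) (use Cons.prems(4) as' in simp)
  then have "\<exists>h. fixes_aut M (B \<union> set a) h \<and> map (map h) as = map (map (inv g)) bs"
    by (intro Cons.IH) (use Cons.prems as' small_list_Un im' in auto)
  then obtain h where h: "fixes_aut M (B \<union> set a) h" "map (map h) as = map (map (inv g)) bs" by (elim exE conjE)
  have "fixes_aut M B (g \<circ> h)" by (rule fixes_aut_comp[OF g(1) fixes_aut_mono[OF h(1)]]) simp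
  moreover have "map (g \<circ> h) a = a'"
  proof -
    have "map h a = a" by (rule fixes_aut_map_id[OF h(1)]) simp
    then show ?thesis using g(2) by (simp flip: map_map)
  qed
  moreover have "map (map (g \<circ> h)) as = bs"
  proof -
    have "map (map (g \<circ> h)) as = map (map g) (map (map h) as)" by simp
    also have "\<dots> = map (map g) (map (map (inv g)) bs)" by (simp only: h(2))
    also have "\<dots> = bs" using g(1)
      by (simp add: o_def fixes_aut_def automorphism_def bij_def surj_f_inv_f)
    finally show ?thesis .
  qed
  ultimately have "fixes_aut M B (g \<circ> h) \<and> map (map (g \<circ> h)) (a # as) = as'"
    unfolding as' list.map by (simp only: simp_thms)
  then show ?case by (intro exI[of _ "g \<circ> h"])
qed

lemma mor_exists: "small \<kappa> B \<Longrightarrow> \<exists>as. length as = n \<and> mor B as"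
proof (induction n arbitrary: B)
  case (Suc n)
  obtain a where a: "Real a B" using real_exists[OF Suc.prems] ..
  obtain as where "length as = n \<and> mor (B \<union> set a) as" using Suc.IH[OF small_list_Un[OF Suc.prems]] ..
  then show ?case using a by (intro exI[of _ "a # as"]) simp
qed simp

lemma mor_sequence:
  assumes "small \<kappa> B" shows "\<exists>c :: nat \<Rightarrow> 'm list. \<forall>n. mor B (map c [0..<n])"
proof -
  define L where "L = rec_nat [] (\<lambda>n l. l @ [SOME a. Real a (B \<union> set (concat l))])"
  have L0: "L 0 = []" and LS: "L (Suc n) = L n @ [SOME a. Real a (B \<union> set (concat (L n)))]" for n
    by (simp_all add: L_def)
  define c where "c n = last (L (Suc n))" for n
  have Lc: "L n = map c [0..<n]" for n by (induction n) (simp_all add: L0 LS c_def)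
  have "mor B (L n)" for n
  proof (induction n)
    case 0 then show ?case by (simp add: L0)
  next
    case (Suc n)
    have "Real (SOME a. Real a (B \<union> set (concat (L n)))) (B \<union> set (concat (L n)))"
      by (rule someI_ex[OF real_exists[OF small_list_Un[OF assms]]])
    then show ?case unfolding LS mor_append using Suc by simp
  qed
  then show ?thesis unfolding Lc by (intro exI[of _ c]) simp
qed

lemma mor_map_nth: "(\<And>n. mor B (map c [0..<n])) \<Longrightarrow> Real (c i) (B \<union> (\<Union>j<i. set (c j)))"
proof -
  assume "\<And>n. mor B (map c [0..<n])"
  then have "mor B (map c [0..<Suc i])" .
  then have "Real (map c [0..<Suc i] ! i) (B \<union> (\<Union>j<i. set (map c [0..<Suc i] ! j)))"
    unfolding mor_nth by simp
  moreover have "(\<Union>j<i. set (map c [0..<Suc i] ! j)) = (\<Union>j<i. set (c j))"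
    by (rule SUP_cong) (simp_all add: nth_append del: upt_Suc)
  ultimately show ?thesis by (simp del: upt_Suc)
qed

text \<open>
  The two sequences together form a Morley sequence of order type \<open>\<omega> + \<omega>\<close>, on which membership in
  \<open>X\<close> is neither finite nor cofinite, against generic stability.
\<close>

lemma no_alternating_morley_sequence:
  assumes e: "\<And>n. mor A (map e [0..<n])" and e': "\<And>n. mor (A \<union> (\<Union>i. set (e i))) (map e' [0..<n])"
    and X: "definable M UNIV \<sigma> X" and no: "\<And>i. e i \<notin> X" and yes: "\<And>i::nat. e' i \<in> X"
  shows False
proof -
  \<comment> \<open>The index sets of Morley sequences are sets of lists.  Lists of pairwise different lengths
    stand for the natural numbers; the order puts all even numbers before all odd ones, and so has
    type \<open>\<omega> + \<omega>\<close>.\<close>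
  define ix :: "nat \<Rightarrow> 'm list" where "ix n = replicate n undefined" for n
  have len: "length (ix n) = n" for n by (simp add: ix_def)
  define r where "r = {(l, l'). l \<in> range ix \<and> l' \<in> range ix \<and>
    (even (length l) \<and> odd (length l') \<or> (even (length l) = even (length l') \<and> length l \<le> length l'))}"
  have Fr: "Field r = range ix" unfolding Field_def r_def by auto
  have "Well_order r" unfolding well_order_on_def linear_order_on_def partial_order_on_def preorder_on_def Fr
  proof (intro conjI)
    show "refl_on (range ix) r" unfolding refl_on_def r_def by auto
    show "trans r" unfolding trans_def r_def by auto
    show "antisym r" unfolding antisym_def r_def by (auto simp: len)
    show "total_on (range ix) r" unfolding total_on_def r_def by (auto simp: len)
    have "r - Id \<subseteq> inv_image (less_than <*lex*> less_than) (\<lambda>l. (length l mod 2, length l))"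
      unfolding r_def by (auto simp: len even_iff_mod_2_eq_zero odd_iff_mod_2_eq_one)
    then show "Wellfounded.wf (r - Id)" by (rule wf_subset[rotated]) auto
    show "r \<subseteq> range ix \<times> range ix" unfolding r_def by auto
  qed
  moreover have inj: "inj ix" by (metis injI len)
  then have "infinite (Field r)" unfolding Fr using finite_imageD infinite_UNIV_nat by blast
  moreover define s where "s l = (if even (length l) then e (length l div 2) else e' (length l div 2))" for l :: "'m list"
  have "morley_sequence M A \<sigma> p r s" unfolding morley_sequence_def Fr
  proof
    fix l assume "l \<in> range ix"
    then obtain n where n: "l = ix n" by blast
    show "Real (s l) (A \<union> (\<Union>j\<in>underS r l. set (s j)))"
    proof (cases "even n")
      case True
      have "set (s j) \<subseteq> (\<Union>j<n div 2. set (e j))" if "j \<in> underS r l" for j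
      proof -
        have "j \<in> range ix" "j \<noteq> l" "(j, l) \<in> r" using that by (auto simp: underS_def r_def)
        then obtain m where m: "j = ix m" by blast
        then have "even m" "m < n" using \<open>j \<noteq> l\<close> \<open>(j, l) \<in> r\<close> True by (auto simp: r_def n len le_less)
        then have "m div 2 < n div 2" using True by (auto elim!: evenE)
        then show ?thesis using \<open>even m\<close> by (auto simp: s_def m len)
      qed
      then have "A \<union> (\<Union>j\<in>underS r l. set (s j)) \<subseteq> A \<union> (\<Union>j<n div 2. set (e j))" by blast
      then show ?thesis using real_mono[OF mor_map_nth[OF e, of "n div 2"]] True by (simp add: s_def n len)
    next
      case False
      have "set (s j) \<subseteq> (\<Union>i. set (e i)) \<union> (\<Union>j<n div 2. set (e' j))" if "j \<in> underS r l" for j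
      proof -
        have "j \<in> range ix" "j \<noteq> l" "(j, l) \<in> r" using that by (auto simp: underS_def r_def)
        then obtain m where m: "j = ix m" by blast
        show ?thesis
        proof (cases "even m")
          case True
          then show ?thesis by (auto simp: s_def m len)
        next
          case odd: False
          then have "m < n" using \<open>j \<noteq> l\<close> \<open>(j, l) \<in> r\<close> by (auto simp: r_def m n len le_less)
          then have "m div 2 < n div 2" using odd False by (auto elim!: oddE)
          then show ?thesis using odd by (auto simp: s_def m len)
        qed
      qed
      then have "A \<union> (\<Union>j\<in>underS r l. set (s j)) \<subseteq> A \<union> (\<Union>i. set (e i)) \<union> (\<Union>j<n div 2. set (e' j))" by blast
      then show ?thesis using real_mono[OF mor_map_nth[OF e', of "n div 2"]] False by (simp add: s_def n len)
    qed
  qed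
  moreover obtain \<phi> where \<phi>: "\<phi> \<in> fms M UNIV \<sigma>" "X = {a \<in> tuples M \<sigma>. holds M \<phi> a}"
    using X unfolding definable_def by blast
  ultimately have "finite {i \<in> Field r. holds M \<phi> (s i)} \<or> finite {i \<in> Field r. \<not> holds M \<phi> (s i)}"
    using gs unfolding generically_stable_def by blast
  moreover have "infinite {i \<in> Field r. holds M \<phi> (s i)}"
  proof
    assume fin: "finite {i \<in> Field r. holds M \<phi> (s i)}"
    have "range (\<lambda>n. ix (2 * n + 1)) \<subseteq> {i \<in> Field r. holds M \<phi> (s i)}"
      using yes \<phi>(2) by (auto simp: Fr s_def len)
    then have "finite (range (\<lambda>n. ix (2 * n + 1)))" using fin by (rule finite_subset)
    moreover have "inj (\<lambda>n. ix (2 * n + 1))" by (intro injI) (auto dest: injD[OF inj])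
    ultimately show False using finite_imageD infinite_UNIV_nat by blast
  qed
  moreover have "infinite {i \<in> Field r. \<not> holds M \<phi> (s i)}"
  proof
    assume fin: "finite {i \<in> Field r. \<not> holds M \<phi> (s i)}"
    have "e n \<in> tuples M \<sigma>" for n using mor_map_nth[OF e, of n] by (rule real_tuples)
    then have "range (\<lambda>n. ix (2 * n)) \<subseteq> {i \<in> Field r. \<not> holds M \<phi> (s i)}"
      using no \<phi>(2) by (auto simp: Fr s_def len)
    then have "finite (range (\<lambda>n. ix (2 * n)))" using fin by (rule finite_subset)
    moreover have "inj (\<lambda>n. ix (2 * n))" by (intro injI) (auto dest: injD[OF inj])
    ultimately show False using finite_imageD infinite_UNIV_nat by blast
  qed
  ultimately show False by blast
qed

text \<open>
  Suppose that arbitrarily long Morley sequences consist of failures of \<open>Z(x, c)\<close> for some \<open>c\<close>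
  with \<open>Z(x, c) \<in> p\<close>.  Continued by equally many elements generic over it and \<open>c\<close>, which satisfy
  \<open>Z(x, c)\<close>, such a sequence is conjugate to an initial part of \<open>e\<close> followed by one of \<open>e'\<close>, for a
  fixed Morley sequence \<open>e, e'\<close> of order type \<open>\<omega> + \<omega>\<close>.  By saturation one \<open>y\<close> makes \<open>Z(x, y)\<close>
  fail on all of \<open>e\<close> and hold on all of \<open>e'\<close>.
\<close>

lemma failure_bound:
  assumes Z: "definable M A (\<sigma> @ \<tau>) Z"
  shows "\<exists>N. \<forall>c\<in>tuples M \<tau>. \<forall>as. mor A as \<and> P {a \<in> tuples M \<sigma>. a @ c \<in> Z} \<longrightarrow>
    length (filter (\<lambda>a. a @ c \<notin> Z) as) \<le> N"
proof (rule ccontr)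
  assume "\<not> ?thesis"
  then have bad: "\<exists>c\<in>tuples M \<tau>. \<exists>as. mor A as \<and> P {a \<in> tuples M \<sigma>. a @ c \<in> Z} \<and>
    N < length (filter (\<lambda>a. a @ c \<notin> Z) as)" for N
    by (simp add: not_le)
  obtain e where e: "\<forall>n. mor A (map e [0..<n])" using mor_sequence[OF smallA] ..
  let ?E = "A \<union> (\<Union>i. set (e i))"
  have smallE: "small \<kappa> ?E" by (rule small_Un[OF smallA small_seq])
  obtain e' where e': "\<forall>n. mor ?E (map e' [0..<n])" using mor_sequence[OF smallE] ..
  let ?E' = "?E \<union> (\<Union>i. set (e' i))"
  have tup: "e i \<in> tuples M \<sigma>" "e' i \<in> tuples M \<sigma>" for i
    using mor_map_nth[of A e i] mor_map_nth[of ?E e' i] e e' real_tuples by blast+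
  define h where "h k = {y \<in> tuples M \<tau>. e k @ y \<notin> Z \<and> e' k @ y \<in> Z}" for k
  have "\<exists>y\<in>tuples M \<tau>. \<forall>X\<in>range h. y \<in> X"
  proof (rule saturation)
    show "small \<kappa> ?E'" by (rule small_Un[OF smallE small_seq])
    fix X assume "X \<in> range h"
    then obtain k where k: "X = h k" by blast
    have 1: "definable M ?E' \<tau> {y \<in> tuples M \<tau>. e k @ y \<in> Z}" "definable M ?E' \<tau> {y \<in> tuples M \<tau>. e' k @ y \<in> Z}"
      by (rule definable_fibre_left[OF struct Z]; use tup in auto)+
    have "h k = (tuples M \<tau> - {y \<in> tuples M \<tau>. e k @ y \<in> Z}) \<inter> {y \<in> tuples M \<tau>. e' k @ y \<in> Z}"
      unfolding h_def by blast
    then show "definable M ?E' \<tau> X" using definable_Int[OF definable_Diff[OF 1(1)] 1(2)] k by simp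
  next
    fix G assume G: "finite G" "G \<subseteq> range h"
    obtain K where K: "finite K" "G = h ` K" using finite_subset_image[OF G] by (elim exE conjE)
    obtain N where N: "\<forall>k\<in>K. k < N" using K(1) finite_nat_set_iff_bounded by blast
    obtain c as where c: "c \<in> tuples M \<tau>" "mor A as" "P {a \<in> tuples M \<sigma>. a @ c \<in> Z}"
      "N < length (filter (\<lambda>a. a @ c \<notin> Z) as)" using bad[of N] by (elim bexE exE conjE)
    define fs where "fs = take N (filter (\<lambda>a. a @ c \<notin> Z) as)"
    have las: "length fs = N" unfolding fs_def using c(4) by simp
    have mas: "mor A fs" unfolding fs_def by (rule mor_take[OF mor_filter[OF c(2)]])
    have nas: "a @ c \<notin> Z" if "a \<in> set fs" for a
      using that unfolding fs_def by (auto dest: in_set_takeD)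
    let ?B = "A \<union> set c \<union> set (concat fs)"
    obtain bs where bs: "length bs = N \<and> mor ?B bs"
      using mor_exists[OF small_list_Un[OF small_list_Un[OF smallA]]] ..
    have bsZ: "a @ c \<in> Z" if "a \<in> set bs" for a
    proof -
      have "Real a (A \<union> set c)" by (rule real_mono[OF mor_real[OF conjunct2[OF bs] that] Un_upper1])
      from real_mem[OF this P_fibre_definable[OF Z c(1)]] show ?thesis using c(3) by simp
    qed
    have "mor (A \<union> set (concat fs)) bs" by (rule mor_mono[OF conjunct2[OF bs]]) blast
    then have m1: "mor A (fs @ bs)" using mas by (simp add: mor_append)
    have "mor (A \<union> set (concat (map e [0..<N]))) (map e' [0..<N])"
      by (rule mor_mono[OF e'[rule_format]]) auto
    then have m2: "mor A (map e [0..<N] @ map e' [0..<N])" using e by (simp add: mor_append)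
    obtain g where g: "fixes_aut M A g" "map (map g) (fs @ bs) = map e [0..<N] @ map e' [0..<N]"
      using mor_conjugate[OF smallA subset_refl m1 m2] las bs by auto
    have g1: "map (map g) fs = map e [0..<N]" and g2: "map (map g) bs = map e' [0..<N]"
      using g(2) las by (simp_all add: append_eq_append_conv)
    let ?y = "map g c"
    have y: "?y \<in> tuples M \<tau>" using c(1) fixes_aut_tuples[OF g(1)] by blast
    have "?y \<in> h k" if "k \<in> K" for k
    proof -
      have k: "k < N" using that N by blast
      have "map g (fs ! k) = e k" using k las arg_cong[OF g1, of "\<lambda>l. l ! k"] by simp
      moreover have "map g (bs ! k) = e' k" using k bs arg_cong[OF g2, of "\<lambda>l. l ! k"] by simp
      moreover have "(fs ! k) @ c \<notin> Z" by (rule nas) (use k las nth_mem in metis)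
      moreover have "(bs ! k) @ c \<in> Z" by (rule bsZ) (use k bs nth_mem in metis)
      moreover have "map g (x @ c) \<in> Z \<longleftrightarrow> x @ c \<in> Z" for x by (rule fixes_aut_definable[OF struct g(1) Z])
      ultimately show ?thesis unfolding h_def using y by (metis (mono_tags, lifting) map_append mem_Collect_eq)
    qed
    then have "\<forall>X\<in>G. ?y \<in> X" using K(2) by simp
    then show "\<exists>y\<in>tuples M \<tau>. \<forall>X\<in>G. y \<in> X" using y by (intro bexI)
  qed
  then obtain y where y: "y \<in> tuples M \<tau>" "\<forall>X\<in>range h. y \<in> X" ..
  then have yh: "e k @ y \<notin> Z" "e' k @ y \<in> Z" for k by (simp_all add: h_def)
  show False
  proof (rule no_alternating_morley_sequence[of e e' "{a \<in> tuples M \<sigma>. a @ y \<in> Z}"])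
    show "definable M UNIV \<sigma> {a \<in> tuples M \<sigma>. a @ y \<in> Z}"
      by (rule definable_mono[OF P_fibre_definable[OF Z y(1)]]) simp
  qed (use e e' yh tup in simp_all)
qed

text \<open>
  Symmetry of independence for a generically stable type.  If \<open>a\<close> failed a formula \<open>Z(x, d)\<close> of
  \<open>p\<close> with \<open>d\<close> from \<open>as\<close> and \<open>B\<close>, then so would every member \<open>x\<close> of a long Morley sequence \<open>es\<close>
  over \<open>B\<close>, with \<open>d\<close> replaced by a single conjugate: the pairs \<open>(a, as)\<close> and \<open>(x, as')\<close> are
  conjugate over \<open>B\<close> when \<open>as'\<close> is generic over all of \<open>es\<close>.  This violates the bound on failures.
\<close>

lemma morley_exchange:
  assumes B: "small \<kappa> B" and AB: "A \<subseteq> B" and a: "Real a B" and as: "mor (B \<union> set a) as"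
  shows "Real a (B \<union> set (concat as))"
proof (rule realI[OF real_tuples[OF a]], rule ccontr)
  fix X assume X: "definable M (B \<union> set (concat as)) \<sigma> X" "P X" and aX: "a \<notin> X"
  obtain d where d: "set d \<subseteq> B \<union> set (concat as)" "definable M (set d) \<sigma> X"
    using definable_finite_parameters[OF X(1)] by (elim exE conjE)
  have "definable M (A \<union> set d) \<sigma> X" by (rule definable_mono[OF d(2)]) simp
  from definable_abstract[OF this] obtain Z where
    Z: "definable M A (\<sigma> @ map (srt M) d) Z" "X = {a \<in> tuples M \<sigma>. a @ d \<in> Z}" by (elim exE conjE)
  obtain N where N: "\<forall>c\<in>tuples M (map (srt M) d). \<forall>as. mor A as \<and> P {a \<in> tuples M \<sigma>. a @ c \<in> Z} \<longrightarrow>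
      length (filter (\<lambda>a. a @ c \<notin> Z) as) \<le> N" using failure_bound[OF Z(1)] ..
  obtain es where es: "length es = Suc N \<and> mor B es" using mor_exists[OF B] ..
  obtain as' where as': "length as' = length as \<and> mor (B \<union> set (concat es)) as'"
    using mor_exists[OF small_list_Un[OF B]] ..
  have "mor B as" "mor B as'" using as as' mor_mono by blast+
  then obtain h where h: "fixes_aut M B h" "map (map h) as = as'"
    using mor_conjugate[OF B AB] as' by metis
  let ?d = "map h d"
  have hA: "fixes_aut M A h" by (rule fixes_aut_mono[OF h(1) AB])
  have "P {a \<in> tuples M \<sigma>. a @ ?d \<in> Z}"
    by (rule P_fibre_eqtp[OF Z(1) fixes_aut_eqtp[OF struct hA]]) (use X(2) Z(2) in simp)
  moreover have "?d \<in> tuples M (map (srt M) d)" using fixes_aut_tuples[OF h(1)] tuples_self by blast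
  moreover have "mor A es" using es AB mor_mono by blast
  ultimately have le: "length (filter (\<lambda>a. a @ ?d \<notin> Z) es) \<le> N" using N by simp
  have "x @ ?d \<notin> Z" if x: "x \<in> set es" for x
  proof -
    have "mor (B \<union> set x) as'" by (rule mor_mono[of "B \<union> set (concat es)"]) (use as' x in auto)
    moreover have "Real x B" using mor_real es x by blast
    ultimately have m: "mor B (x # as')" by simp
    have "mor B (a # as)" using a as by simp
    from mor_conjugate[OF B AB this m] as' obtain k where
      k: "fixes_aut M B k" "map k a = x" "map (map k) as = as'" by auto
    have "map (map k) as = map (map h) as" using k(3) h(2) by simp
    then have kh: "k y = h y" if "y \<in> set (concat as)" for y using that by auto
    have "k y = h y" if "y \<in> B" for y using k(1) h(1) that by (simp add: fixes_aut_def)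
    then have "map k d = ?d" using d(1) kh by (intro map_cong) auto
    moreover have "a @ d \<notin> Z" using aX Z(2) real_tuples[OF a] by simp
    moreover have "map k (a @ d) \<in> Z \<longleftrightarrow> a @ d \<in> Z"
      by (rule fixes_aut_definable[OF struct fixes_aut_mono[OF k(1) AB] Z(1)])
    ultimately show ?thesis using k(2) by (simp del: map_eq_conv)
  qed
  then have "filter (\<lambda>a. a @ ?d \<notin> Z) es = es" by (simp add: filter_id_conv)
  then show False using le es by simp
qed

text \<open>
  Definability of \<open>p\<close>.  Along a fixed Morley sequence the members of \<open>p\<close> are recognized by having
  few failures.  This makes the set definable over the Morley sequence, and by invariance of \<open>p\<close>
  it is definable over \<open>A\<close>.
\<close>

theorem P_fibre_set_definable:
  assumes Z: "definable M A (\<sigma> @ \<tau>) Z"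
  shows "definable M A \<tau> {c \<in> tuples M \<tau>. P {a \<in> tuples M \<sigma>. a @ c \<in> Z}}"
proof -
  let ?Z' = "tuples M (\<sigma> @ \<tau>) - Z"
  obtain N1 where N1: "\<forall>c\<in>tuples M \<tau>. \<forall>as. mor A as \<and> P {a \<in> tuples M \<sigma>. a @ c \<in> Z} \<longrightarrow>
    length (filter (\<lambda>a. a @ c \<notin> Z) as) \<le> N1" using failure_bound[OF Z] ..
  obtain N2 where N2: "\<forall>c\<in>tuples M \<tau>. \<forall>as. mor A as \<and> P {a \<in> tuples M \<sigma>. a @ c \<in> ?Z'} \<longrightarrow>
    length (filter (\<lambda>a. a @ c \<notin> ?Z') as) \<le> N2" using failure_bound[OF definable_Diff[OF Z]] ..
  \<comment> \<open>A set and its complement cannot both have few exceptions in a sequence of this length.\<close>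
  let ?L = "N1 + N2 + 1"
  obtain as where as: "length as = ?L \<and> mor A as" using mor_exists[OF smallA] ..
  have ast: "a \<in> tuples M \<sigma>" if "a \<in> set as" for a using mor_real[of A as a] as that real_tuples by blast
  have iff: "P {a \<in> tuples M \<sigma>. a @ c \<in> Z} \<longleftrightarrow> length (filter (\<lambda>a. a @ c \<notin> Z) as) \<le> N1"
    if c: "c \<in> tuples M \<tau>" for c
  proof
    assume le: "length (filter (\<lambda>a. a @ c \<notin> Z) as) \<le> N1"
    show "P {a \<in> tuples M \<sigma>. a @ c \<in> Z}"
    proof (rule ccontr)
      have D: "definable M UNIV \<sigma> {a \<in> tuples M \<sigma>. a @ c \<in> Z}"
        by (rule definable_mono[OF P_fibre_definable[OF Z c]]) simp
      assume "\<not> P {a \<in> tuples M \<sigma>. a @ c \<in> Z}"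
      then have "P (tuples M \<sigma> - {a \<in> tuples M \<sigma>. a @ c \<in> Z})" using P_neg[OF D] by simp
      also have "tuples M \<sigma> - {a \<in> tuples M \<sigma>. a @ c \<in> Z} = {a \<in> tuples M \<sigma>. a @ c \<in> ?Z'}"
        using c by blast
      finally have "length (filter (\<lambda>a. a @ c \<notin> ?Z') as) \<le> N2" using N2 c as by simp
      also have "filter (\<lambda>a. a @ c \<notin> ?Z') as = filter (\<lambda>a. \<not> (a @ c \<notin> Z)) as"
        by (rule filter_cong) (use ast c in auto)
      finally show False using le as sum_length_filter_compl[of "\<lambda>a. a @ c \<notin> Z" as] by simp
    qed
  qed (use N1 c as in simp)
  have "definable M UNIV \<tau> {c \<in> tuples M \<tau>. \<exists>J\<in>{J \<in> Pow {..<?L}. card J \<le> N1}. \<forall>i\<in>{..<?L}. as ! i @ c \<notin> Z \<longrightarrow> i \<in> J}"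
  proof (rule Def_set1[where i = 0 and \<Gamma> = "\<lambda>_. \<tau>", OF struct refl],
      intro Def_Bex[OF struct] Def_Ball[OF struct] Def_imp[OF struct] Def_neg Def_const[OF struct])
    fix J i assume "i \<in> {..<?L}"
    then have "as ! i \<in> tuples M \<sigma>" using ast as nth_mem by (metis lessThan_iff)
    then have D: "definable M UNIV \<tau> {c \<in> tuples M \<tau>. as ! i @ c \<in> Z}"
      by (rule definable_fibre_left[OF struct Z]) simp
    have "Def M UNIV (\<lambda>_. \<tau>) (\<lambda>v. v 0 \<in> {c \<in> tuples M \<tau>. as ! i @ c \<in> Z})"
      by (rule Def_mem1[OF struct D])
    then show "Def M UNIV (\<lambda>_. \<tau>) (\<lambda>v. as ! i @ v 0 \<in> Z)"
      by (rule Def_cong) (simp add: blocks_def)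
  qed simp_all
  also have "{c \<in> tuples M \<tau>. \<exists>J\<in>{J \<in> Pow {..<?L}. card J \<le> N1}. \<forall>i\<in>{..<?L}. as ! i @ c \<notin> Z \<longrightarrow> i \<in> J} =
    {c \<in> tuples M \<tau>. P {a \<in> tuples M \<sigma>. a @ c \<in> Z}}"
  proof (rule Collect_cong, rule conj_cong[OF refl])
    fix c assume c: "c \<in> tuples M \<tau>"
    let ?J = "{i. i < ?L \<and> as ! i @ c \<notin> Z}"
    have len: "length (filter (\<lambda>a. a @ c \<notin> Z) as) = card ?J" using as by (simp add: length_filter_conv_card)
    show "(\<exists>J\<in>{J \<in> Pow {..<?L}. card J \<le> N1}. \<forall>i\<in>{..<?L}. as ! i @ c \<notin> Z \<longrightarrow> i \<in> J) \<longleftrightarrow>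
      P {a \<in> tuples M \<sigma>. a @ c \<in> Z}"
      unfolding iff[OF c] len
    proof
      assume "\<exists>J\<in>{J \<in> Pow {..<?L}. card J \<le> N1}. \<forall>i\<in>{..<?L}. as ! i @ c \<notin> Z \<longrightarrow> i \<in> J"
      then obtain J where J: "J \<subseteq> {..<?L}" "card J \<le> N1" "\<forall>i\<in>{..<?L}. as ! i @ c \<notin> Z \<longrightarrow> i \<in> J" by auto
      have "card ?J \<le> card J" by (rule card_mono) (use J finite_subset[OF J(1)] in auto)
      then show "card ?J \<le> N1" using J(2) by simp
    next
      assume "card ?J \<le> N1"
      then show "\<exists>J\<in>{J \<in> Pow {..<?L}. card J \<le> N1}. \<forall>i\<in>{..<?L}. as ! i @ c \<notin> Z \<longrightarrow> i \<in> J"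
        by (intro bexI[of _ ?J]) auto
    qed
  qed
  finally have U: "definable M UNIV \<tau> {c \<in> tuples M \<tau>. P {a \<in> tuples M \<sigma>. a @ c \<in> Z}}" .
  show ?thesis
  proof (rule invariant_definable[OF smallA U])
    fix g y assume g: "fixes_aut M A g" and y: "y \<in> {c \<in> tuples M \<tau>. P {a \<in> tuples M \<sigma>. a @ c \<in> Z}}"
    have "P {a \<in> tuples M \<sigma>. a @ map g y \<in> Z}"
      by (rule P_fibre_eqtp[OF Z fixes_aut_eqtp[OF struct g]]) (use y in simp)
    then show "map g y \<in> {c \<in> tuples M \<tau>. P {a \<in> tuples M \<sigma>. a @ c \<in> Z}}"
      using y fixes_aut_tuples[OF g] by simp
  qed
qed

end

lemma (in monster) finite_intersection_definable:
  assumes "finite K" "\<And>X. X \<in> K \<Longrightarrow> definable M B \<tau> X"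
  shows "definable M B \<tau> {a \<in> tuples M \<tau>. \<forall>X\<in>K. a \<in> X}"
proof -
  have "Def M B (\<lambda>_. \<tau>) (\<lambda>v. \<forall>X\<in>K. v 0 \<in> X)"
    by (rule Def_Ball[OF struct assms(1)]) (rule Def_mem1[OF struct], rule assms(2))
  then show ?thesis by (rule Def_set1[OF struct refl])
qed

context generic_type
begin

text \<open>
  The type of \<open>(a, b)\<close> for \<open>a\<close> realizing \<open>p\<close> over \<open>Ab\<close> is given by the sets \<open>\<Theta>\<close> over \<open>A\<close> with
  \<open>\<Theta>(x, b) \<in> p\<close>.  It is in this form that genericity over an unknown conjugate \<open>y\<close> of \<open>b\<close> enters
  compactness arguments.
\<close>

lemma realize_pair:
  assumes a: "a \<in> tuples M \<sigma>" and y: "y \<in> tuples M (map (srt M) b)"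
    and all: "\<And>\<Theta>. definable M A (\<sigma> @ map (srt M) b) \<Theta> \<Longrightarrow> P {x \<in> tuples M \<sigma>. x @ b \<in> \<Theta>} \<Longrightarrow> a @ y \<in> \<Theta>"
  shows "eqtp M A b y \<and> Real a (A \<union> set y)"
proof -
  let ?\<beta> = "map (srt M) b"
  have sy: "map (srt M) y = ?\<beta>" using y by (simp add: tuples_def)
  have one: "y \<in> X" if X: "definable M A ?\<beta> X" "b \<in> X" for X
  proof -
    let ?\<Theta> = "rel2 M \<sigma> ?\<beta> (\<lambda>x y. y \<in> X)"
    have "definable M A (\<sigma> @ ?\<beta>) ?\<Theta>"
      by (rule Def_set2[where \<Gamma> = "(\<lambda>_. ?\<beta>)(0 := \<sigma>)" and i = 0 and j = 1, OF struct])
        (simp, simp, simp, rule Def_mem1[OF struct], simp add: X(1))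
    moreover have "{x \<in> tuples M \<sigma>. x @ b \<in> ?\<Theta>} = tuples M \<sigma>" using X(2) by (auto simp: rel2_iff)
    moreover have "P (tuples M \<sigma>)"
      by (rule P_real[OF smallA definable_const(1)[OF struct]]) (rule real_tuples)
    ultimately have "a @ y \<in> ?\<Theta>" using all[of ?\<Theta>] by (simp only:)
    then show ?thesis using a by (simp add: rel2_iff)
  qed
  have e: "eqtp M A b y" unfolding eqtp_def
  proof (intro conjI allI impI)
    fix X assume X: "definable M A ?\<beta> X"
    show "b \<in> X \<longleftrightarrow> y \<in> X" using one[OF X] one[OF definable_Diff[OF X]] y by auto
  qed (use sy in simp)
  have "Real a (A \<union> set y)"
  proof (rule realI[OF a])
    fix X assume X: "definable M (A \<union> set y) \<sigma> X" "P X"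
    obtain Z where Z: "definable M A (\<sigma> @ ?\<beta>) Z" "X = {x \<in> tuples M \<sigma>. x @ y \<in> Z}"
      using definable_abstract[OF X(1)] unfolding sy by (elim exE conjE)
    have "P {x \<in> tuples M \<sigma>. x @ b \<in> Z}"
      by (rule P_fibre_eqtp[OF Z(1) eqtp_sym[OF e]]) (use X(2) Z(2) in simp)
    then have "a @ y \<in> Z" using all[OF Z(1)] by simp
    then show "a \<in> X" using Z(2) a by simp
  qed
  then show ?thesis using e by simp
qed

lemma P_Inter_fibre:
  assumes "finite K" "\<And>\<Theta>. \<Theta> \<in> K \<Longrightarrow> definable M A (\<sigma> @ \<tau>) \<Theta> \<and> P {x \<in> tuples M \<sigma>. x @ b \<in> \<Theta>}" "b \<in> tuples M \<tau>"
  shows "P {x \<in> tuples M \<sigma>. x @ b \<in> {w \<in> tuples M (\<sigma> @ \<tau>). \<forall>\<Theta>\<in>K. w \<in> \<Theta>}}"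
proof (rule P_real)
  show "small \<kappa> (A \<union> set b)" by (rule small_list_Un[OF smallA])
  show "definable M (A \<union> set b) \<sigma> {x \<in> tuples M \<sigma>. x @ b \<in> {w \<in> tuples M (\<sigma> @ \<tau>). \<forall>\<Theta>\<in>K. w \<in> \<Theta>}}"
    by (rule P_fibre_definable[OF finite_intersection_definable[OF assms(1)] assms(3)]) (use assms(2) in simp)
  fix a assume a: "Real a (A \<union> set b)"
  have "a @ b \<in> \<Theta>" if "\<Theta> \<in> K" for \<Theta>
    using real_mem[OF a P_fibre_definable[OF _ assms(3)], of \<Theta>] assms(2)[OF that] by simp
  then show "a \<in> {x \<in> tuples M \<sigma>. x @ b \<in> {w \<in> tuples M (\<sigma> @ \<tau>). \<forall>\<Theta>\<in>K. w \<in> \<Theta>}}"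
    using real_tuples[OF a] assms(3) by (simp add: tuples_appendI)
qed

end

section \<open>Germs of a definable family of functions\<close>

text \<open>
  \<open>G\<close> contains the concatenations \<open>x @ z @ y\<close> with \<open>f\<^sub>y(x) = z\<close>, for a family of partial functions
  \<open>f\<^sub>y\<close> into \<open>S\<close>; only the member \<open>f\<^sub>b\<close> is required to be defined at generic arguments.
\<close>

locale family = generic_type \<kappa> M A \<sigma> p
  for \<kappa> :: "'k rel" and M :: "('s, 'f, 'r, 'm) struct" and A \<sigma> p +
  fixes \<rho> :: "'s list" and S G :: "'m list set" and b :: "'m list"
  assumes defS: "definable M A \<rho> S"
    and defG: "definable M A (\<sigma> @ \<rho> @ map (srt M) b) G"
    and funG: "\<And>x y z z'. x \<in> tuples M \<sigma> \<Longrightarrow> y \<in> tuples M (map (srt M) b) \<Longrightarrow> z \<in> tuples M \<rho> \<Longrightarrow>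
      z' \<in> tuples M \<rho> \<Longrightarrow> x @ z @ y \<in> G \<Longrightarrow> x @ z' @ y \<in> G \<Longrightarrow> z = z'"
    and inS: "\<And>x y z. x \<in> tuples M \<sigma> \<Longrightarrow> y \<in> tuples M (map (srt M) b) \<Longrightarrow> z \<in> tuples M \<rho> \<Longrightarrow>
      x @ z @ y \<in> G \<Longrightarrow> z \<in> S"
    and totG: "\<And>a. Real a (A \<union> set b) \<Longrightarrow> \<exists>z\<in>tuples M \<rho>. a @ z @ b \<in> G"
begin

abbreviation \<beta> :: "'s list" where "\<beta> \<equiv> map (srt M) b"

definition Gr :: "'m list \<Rightarrow> 'm list \<Rightarrow> 'm list \<Rightarrow> bool" where
  "Gr x z y \<longleftrightarrow> x \<in> tuples M \<sigma> \<and> z \<in> tuples M \<rho> \<and> y \<in> tuples M \<beta> \<and> x @ z @ y \<in> G"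

text \<open>Both functions are defined at \<open>x\<close>; thus \<open>agree x y y\<close> expresses that \<open>f\<^sub>y(x)\<close> is defined.\<close>

definition agree :: "'m list \<Rightarrow> 'm list \<Rightarrow> 'm list \<Rightarrow> bool" where
  "agree x y y' \<longleftrightarrow> (\<exists>z\<in>tuples M \<rho>. Gr x z y \<and> Gr x z y')"

definition germ :: "'m list \<Rightarrow> 'm list \<Rightarrow> bool" where
  "germ y y' \<longleftrightarrow> P {x \<in> tuples M \<sigma>. agree x y y'}"

lemma Gr_fun: "Gr x z y \<Longrightarrow> Gr x z' y \<Longrightarrow> z = z'"
  unfolding Gr_def using funG by blast

lemma Gr_S: "Gr x z y \<Longrightarrow> z \<in> S"
  unfolding Gr_def using inS by blast

lemma agree_sym: "agree x y y' \<Longrightarrow> agree x y' y"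
  unfolding agree_def by blast

lemma agree_trans: "agree x y y' \<Longrightarrow> agree x y' y'' \<Longrightarrow> agree x y y''"
  unfolding agree_def using Gr_fun by blast

lemma agree_tuples: "agree x y y' \<Longrightarrow> x \<in> tuples M \<sigma> \<and> y \<in> tuples M \<beta> \<and> y' \<in> tuples M \<beta>"
  unfolding agree_def Gr_def by blast

lemma Def_Gr: "\<Gamma> i = \<sigma> \<Longrightarrow> \<Gamma> j = \<rho> \<Longrightarrow> \<Gamma> k = \<beta> \<Longrightarrow> Def M A \<Gamma> (\<lambda>v. Gr (v i) (v j) (v k))"
proof -
  assume \<Gamma>: "\<Gamma> i = \<sigma>" "\<Gamma> j = \<rho>" "\<Gamma> k = \<beta>"
  have "Def M A \<Gamma> (\<lambda>v. v i @ v j @ v k \<in> G)" by (rule Def_mem3[OF struct]) (use \<Gamma> defG in simp)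
  then show ?thesis
  proof (rule Def_cong)
    fix v assume v: "blocks M \<Gamma> v"
    have "v i \<in> tuples M \<sigma>" "v j \<in> tuples M \<rho>" "v k \<in> tuples M \<beta>" using blocksD[OF v] \<Gamma> by metis+
    then show "Gr (v i) (v j) (v k) \<longleftrightarrow> v i @ v j @ v k \<in> G" by (simp add: Gr_def)
  qed
qed

lemma definable_agree: "definable M A (\<sigma> @ \<beta> @ \<beta>) (rel3 M \<sigma> \<beta> \<beta> agree)"
proof (rule Def_set3[where \<Gamma> = "(\<lambda>_. \<rho>)(0 := \<sigma>, Suc 0 := \<beta>, 2 := \<beta>)" and i = 0 and j = "Suc 0" and k = 2, OF struct])
  let ?\<Gamma> = "(\<lambda>_. \<rho>)(0 := \<sigma>, Suc 0 := \<beta>, 2 := \<beta>)"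
  show "Def M A ?\<Gamma> (\<lambda>v. agree (v 0) (v (Suc 0)) (v 2))"
    unfolding agree_def
    by (rule Def_ex[where i = 3 and Q = "\<lambda>v z. Gr (v 0) z (v (Suc 0)) \<and> Gr (v 0) z (v 2)", OF struct])
      (simp, rule Def_conj[OF struct Def_Gr Def_Gr], simp_all)
qed simp_all

lemma Def_agree: "\<Gamma> i = \<sigma> \<Longrightarrow> \<Gamma> j = \<beta> \<Longrightarrow> \<Gamma> k = \<beta> \<Longrightarrow> Def M A \<Gamma> (\<lambda>v. agree (v i) (v j) (v k))"
  by (rule Def_rel3[OF struct definable_agree])

lemma agree_set_eq:
  "y \<in> tuples M \<beta> \<Longrightarrow> y' \<in> tuples M \<beta> \<Longrightarrow>
   {a \<in> tuples M \<sigma>. a @ (y @ y') \<in> rel3 M \<sigma> \<beta> \<beta> agree} = {a \<in> tuples M \<sigma>. agree a y y'}"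
  by (rule Collect_cong) (auto simp: rel3_iff)

lemma definable_agree_fibre:
  assumes "y \<in> tuples M \<beta>" "y' \<in> tuples M \<beta>"
  shows "definable M (A \<union> set y \<union> set y') \<sigma> {a \<in> tuples M \<sigma>. agree a y y'}"
proof -
  have "definable M (A \<union> set (y @ y')) \<sigma> {a \<in> tuples M \<sigma>. a @ (y @ y') \<in> rel3 M \<sigma> \<beta> \<beta> agree}"
    by (rule P_fibre_definable[OF definable_agree]) (use assms in blast)
  then show ?thesis unfolding agree_set_eq[OF assms] by (simp add: Un_assoc)
qed

lemma definable_germ: "definable M A (\<beta> @ \<beta>) (rel2 M \<beta> \<beta> germ)"
proof -
  have "{c \<in> tuples M (\<beta> @ \<beta>). P {a \<in> tuples M \<sigma>. a @ c \<in> rel3 M \<sigma> \<beta> \<beta> agree}} = rel2 M \<beta> \<beta> germ"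
  proof (intro equalityI subsetI)
    fix c assume c: "c \<in> {c \<in> tuples M (\<beta> @ \<beta>). P {a \<in> tuples M \<sigma>. a @ c \<in> rel3 M \<sigma> \<beta> \<beta> agree}}"
    then have "c \<in> tuples M (\<beta> @ \<beta>)" by simp
    then obtain y y' where y: "y \<in> tuples M \<beta>" "y' \<in> tuples M \<beta>" "c = y @ y'" by (rule tuples_appendE)
    then show "c \<in> rel2 M \<beta> \<beta> germ" using c agree_set_eq[OF y(1,2)] by (simp add: rel2_iff germ_def)
  next
    fix c assume "c \<in> rel2 M \<beta> \<beta> germ"
    then obtain y y' where y: "y \<in> tuples M \<beta>" "y' \<in> tuples M \<beta>" "c = y @ y'" "germ y y'"
      unfolding rel2_def by blast
    then show "c \<in> {c \<in> tuples M (\<beta> @ \<beta>). P {a \<in> tuples M \<sigma>. a @ c \<in> rel3 M \<sigma> \<beta> \<beta> agree}}"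
      using agree_set_eq[OF y(1,2)] by (simp add: germ_def tuples_appendI)
  qed
  then show ?thesis using P_fibre_set_definable[OF definable_agree] by simp
qed

lemma Def_germ: "\<Gamma> i = \<beta> \<Longrightarrow> \<Gamma> j = \<beta> \<Longrightarrow> Def M A \<Gamma> (\<lambda>v. germ (v i) (v j))"
  by (rule Def_rel2[OF struct definable_germ])

lemma germ_tuples: "germ y y' \<Longrightarrow> y \<in> tuples M \<beta> \<and> y' \<in> tuples M \<beta>"
  unfolding germ_def using P_meet[of "{x \<in> tuples M \<sigma>. agree x y y'}" "{x \<in> tuples M \<sigma>. agree x y y'}"] agree_tuples
  by blast

lemma germ_sym: "germ y y' \<Longrightarrow> germ y' y"
proof -
  have "{x \<in> tuples M \<sigma>. agree x y y'} = {x \<in> tuples M \<sigma>. agree x y' y}" using agree_sym by blast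
  then show "germ y y' \<Longrightarrow> germ y' y" unfolding germ_def by simp
qed

lemma real_agree:
  assumes "germ y y'" "Real x (A \<union> set y \<union> set y')" shows "agree x y y'"
  using real_mem[OF assms(2) definable_agree_fibre] germ_tuples[OF assms(1)] assms(1) by (simp add: germ_def)

lemma germ_trans:
  assumes "germ y y'" "germ y' y''" shows "germ y y''"
  unfolding germ_def
proof (rule P_mono[OF P_Int[OF assms[unfolded germ_def]]])
  show "definable M UNIV \<sigma> {x \<in> tuples M \<sigma>. agree x y y''}"
    by (rule definable_mono[OF definable_agree_fibre]) (use germ_tuples assms in blast)+
qed (use agree_trans in blast)

lemma agree_aut: "fixes_aut M A g \<Longrightarrow> agree (map g x) (map g y) (map g y') \<longleftrightarrow> agree x y y'"
proof -
  assume g: "fixes_aut M A g"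
  have "map g (x @ y @ y') \<in> rel3 M \<sigma> \<beta> \<beta> agree \<longleftrightarrow> x @ y @ y' \<in> rel3 M \<sigma> \<beta> \<beta> agree"
    by (rule fixes_aut_definable[OF struct g definable_agree])
  moreover have "a @ c @ e \<in> rel3 M \<sigma> \<beta> \<beta> agree \<longleftrightarrow> agree a c e"
    if "a \<in> tuples M \<sigma>" "c \<in> tuples M \<beta>" for a c e
    using rel3_iff[OF that] agree_tuples by blast
  ultimately show ?thesis using agree_tuples fixes_aut_tuples[OF g] by (metis map_append)
qed

lemma germ_aut: "fixes_aut M A g \<Longrightarrow> germ (map g y) (map g y') \<longleftrightarrow> germ y y'"
proof -
  assume g: "fixes_aut M A g"
  have "map g (y @ y') \<in> rel2 M \<beta> \<beta> germ \<longleftrightarrow> y @ y' \<in> rel2 M \<beta> \<beta> germ"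
    by (rule fixes_aut_definable[OF struct g definable_germ])
  moreover have "c @ e \<in> rel2 M \<beta> \<beta> germ \<longleftrightarrow> germ c e" if "c \<in> tuples M \<beta>" for c e
    using rel2_iff[OF that] germ_tuples by blast
  ultimately show ?thesis using germ_tuples fixes_aut_tuples[OF g] by (metis map_append)
qed

lemma Gr_aut: "fixes_aut M A g \<Longrightarrow> Gr (map g x) (map g z) (map g y) \<longleftrightarrow> Gr x z y"
  unfolding Gr_def using fixes_aut_definable[OF struct _ defG, of g "x @ z @ y"] fixes_aut_tuples[of M A g] by simp

lemma real_conjugate:
  assumes y: "eqtp M A b y" and a: "Real a (A \<union> set y)"
  obtains g where "fixes_aut M A g" "map g y = b" "Real (map g a) (A \<union> set b)"
proof -
  obtain g where g: "fixes_aut M A g" "map g y = b" using homogeneity[OF eqtp_sym[OF y] smallA] by (elim exE conjE)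
  have "g ` (A \<union> set y) = A \<union> set b" using fixes_aut_image[OF g(1)] g(2) by (metis list.set_map)
  then have "Real (map g a) (A \<union> set b)" using real_aut[OF g(1) a] by simp
  then show ?thesis using that g by blast
qed

lemma Gr_total:
  assumes y: "eqtp M A b y" and a: "Real a (A \<union> set y)" shows "\<exists>z. Gr a z y"
proof -
  obtain g where g: "fixes_aut M A g" "map g y = b" "Real (map g a) (A \<union> set b)"
    by (rule real_conjugate[OF assms])
  obtain z where z: "z \<in> tuples M \<rho>" "map g a @ z @ b \<in> G" using totG[OF g(3)] by (elim bexE)
  then have "Gr (map g a) z (map g y)" using real_tuples[OF g(3)] g(2) by (simp add: Gr_def)
  moreover have "map g (map (inv g) z) = z"
    using g(1) by (simp add: o_def fixes_aut_def automorphism_def bij_def surj_f_inv_f)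
  ultimately have "Gr a (map (inv g) z) y" using Gr_aut[OF g(1), of a "map (inv g) z" y] by simp
  then show ?thesis ..
qed

lemma agree_refl:
  assumes y: "eqtp M A b y" and a: "Real a (A \<union> set y)" shows "agree a y y"
  using Gr_total[OF assms] unfolding agree_def Gr_def by blast

lemma germ_refl:
  assumes "eqtp M A b y" shows "germ y y"
  unfolding germ_def
proof (rule P_real)
  have y: "y \<in> tuples M \<beta>" using eqtp_tuples[OF assms] tuples_self by blast
  show "definable M (A \<union> set y \<union> set y) \<sigma> {x \<in> tuples M \<sigma>. agree x y y}"
    by (rule definable_agree_fibre[OF y y])
  show "small \<kappa> (A \<union> set y \<union> set y)" by (intro small_list_Un smallA)
  fix a assume "Real a (A \<union> set y \<union> set y)"
  then have "Real a (A \<union> set y)" by (simp add: Un_assoc)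
  then show "a \<in> {x \<in> tuples M \<sigma>. agree x y y}" using agree_refl[OF assms] real_tuples by simp
qed

lemma disagree_bound:
  "\<exists>N. \<forall>y y' as. mor A as \<and> germ y y' \<longrightarrow> length (filter (\<lambda>a. \<not> agree a y y') as) \<le> N"
proof -
  obtain N where N: "\<forall>c\<in>tuples M (\<beta> @ \<beta>). \<forall>as. mor A as \<and> P {a \<in> tuples M \<sigma>. a @ c \<in> rel3 M \<sigma> \<beta> \<beta> agree} \<longrightarrow>
    length (filter (\<lambda>a. a @ c \<notin> rel3 M \<sigma> \<beta> \<beta> agree) as) \<le> N" using failure_bound[OF definable_agree] ..
  have "length (filter (\<lambda>a. \<not> agree a y y') as) \<le> N" if as: "mor A as" and g: "germ y y'" for y y' as
  proof -
    have y: "y \<in> tuples M \<beta>" "y' \<in> tuples M \<beta>" using germ_tuples[OF g] by simp_all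
    have "filter (\<lambda>a. a @ (y @ y') \<notin> rel3 M \<sigma> \<beta> \<beta> agree) as = filter (\<lambda>a. \<not> agree a y y') as"
    proof (rule filter_cong[OF refl])
      fix a assume "a \<in> set as"
      then have "a \<in> tuples M \<sigma>" by (rule real_tuples[OF mor_real[OF as]])
      then show "a @ (y @ y') \<notin> rel3 M \<sigma> \<beta> \<beta> agree \<longleftrightarrow> \<not> agree a y y'" using y by (simp add: rel3_iff)
    qed
    moreover have "P {a \<in> tuples M \<sigma>. a @ (y @ y') \<in> rel3 M \<sigma> \<beta> \<beta> agree}"
      using g agree_set_eq[OF y] by (simp add: germ_def)
    moreover have "y @ y' \<in> tuples M (\<beta> @ \<beta>)" using y by blast
    ultimately show ?thesis using N[rule_format, of "y @ y'" as] as by simp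
  qed
  then show ?thesis by blast
qed

lemma agree_bound:
  "\<exists>N. \<forall>y y' as. mor A as \<and> y \<in> tuples M \<beta> \<and> y' \<in> tuples M \<beta> \<and> \<not> germ y y' \<longrightarrow>
    length (filter (\<lambda>a. agree a y y') as) \<le> N"
proof -
  let ?Z = "tuples M (\<sigma> @ \<beta> @ \<beta>) - rel3 M \<sigma> \<beta> \<beta> agree"
  obtain N where N: "\<forall>c\<in>tuples M (\<beta> @ \<beta>). \<forall>as. mor A as \<and> P {a \<in> tuples M \<sigma>. a @ c \<in> ?Z} \<longrightarrow>
    length (filter (\<lambda>a. a @ c \<notin> ?Z) as) \<le> N" using failure_bound[OF definable_Diff[OF definable_agree]] ..
  have "length (filter (\<lambda>a. agree a y y') as) \<le> N"
    if as: "mor A as" and y: "y \<in> tuples M \<beta>" "y' \<in> tuples M \<beta>" and g: "\<not> germ y y'" for y y' as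
  proof -
    have iff: "a @ (y @ y') \<notin> ?Z \<longleftrightarrow> agree a y y'" if "a \<in> tuples M \<sigma>" for a
      using that y by (simp add: rel3_iff tuples_appendI)
    have "filter (\<lambda>a. a @ (y @ y') \<notin> ?Z) as = filter (\<lambda>a. agree a y y') as"
      by (rule filter_cong[OF refl iff]) (rule real_tuples[OF mor_real[OF as]])
    moreover have "P {a \<in> tuples M \<sigma>. a @ (y @ y') \<in> ?Z}"
    proof -
      have "{a \<in> tuples M \<sigma>. a @ (y @ y') \<in> ?Z} = tuples M \<sigma> - {a \<in> tuples M \<sigma>. agree a y y'}" using iff by blast
      moreover have "definable M UNIV \<sigma> {a \<in> tuples M \<sigma>. agree a y y'}"
        by (rule definable_mono[OF definable_agree_fibre[OF y]]) simp
      ultimately show ?thesis using g P_neg by (simp add: germ_def)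
    qed
    moreover have "y @ y' \<in> tuples M (\<beta> @ \<beta>)" using y by blast
    ultimately show ?thesis using N[rule_format, of "y @ y'" as] as by simp
  qed
  then show ?thesis by blast
qed

text \<open>By exchange, \<open>a\<close> may stand at any place of a Morley sequence that is generic over it.\<close>

lemma insert_morley:
  assumes a: "Real a (A \<union> set w)" and bs: "mor (A \<union> set w \<union> set a) bs"
  shows "mor (A \<union> set w) (take m bs @ a # drop m bs)"
proof -
  let ?B = "A \<union> set w"
  have split: "mor (?B \<union> set a) (take m bs)" "mor (?B \<union> set a \<union> set (concat (take m bs))) (drop m bs)"
    using bs mor_append[of "?B \<union> set a" "take m bs" "drop m bs"] by simp_all
  have "mor ?B (take m bs)" by (rule mor_mono[OF split(1)]) simp
  moreover have "Real a (?B \<union> set (concat (take m bs)))"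
    by (rule morley_exchange[OF small_list_Un[OF smallA] _ a split(1)]) simp
  moreover have "mor (?B \<union> set (concat (take m bs)) \<union> set a) (drop m bs)"
    by (rule mor_mono[OF split(2)]) blast
  ultimately show ?thesis by (simp add: mor_append)
qed

lemma move_mor:
  assumes g: "fixes_aut M A g" and "mor (A \<union> set y) as" "map (map g) as = as'"
  shows "mor (A \<union> set (map g y)) as'"
  using mor_aut[OF g assms(2)] fixes_aut_image[OF g, of "set y"] assms(3) by simp

lemma eqtp_aut: "fixes_aut M A g \<Longrightarrow> eqtp M A b y \<Longrightarrow> eqtp M A b (map g y)"
  by (rule eqtp_trans[OF _ fixes_aut_eqtp[OF struct]])

text \<open>
  Choose the other members of the sequence generic over \<open>y\<close>, \<open>y'\<close> and \<open>a\<close>: there the two functions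
  agree, because their germs do, so \<open>a\<close> is the only place of disagreement.  Inserted at place \<open>m\<close>,
  it yields a sequence that is Morley over \<open>y\<close> and over \<open>y'\<close>, though not over both together, and a
  conjugation turns this sequence into \<open>as\<close>.
\<close>

lemma change_one_place:
  assumes y: "eqtp M A b y" "eqtp M A b y'" and g: "germ y y'"
    and a: "Real a (A \<union> set y)" "Real a (A \<union> set y')" and dis: "\<not> agree a y y'"
    and as: "mor A as" "m < length as"
  shows "\<exists>z z'. eqtp M A b z \<and> eqtp M A b z' \<and> germ z z' \<and> mor (A \<union> set z) as \<and> mor (A \<union> set z') as \<and>
    \<not> agree (as ! m) z z' \<and> (\<forall>i<length as. i \<noteq> m \<longrightarrow> agree (as ! i) z z')"
proof -
  let ?B = "A \<union> set y \<union> set y' \<union> set a"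
  obtain bs where bs: "length bs = length as - 1 \<and> mor ?B bs"
    using mor_exists[OF small_list_Un[OF small_list_Un[OF small_list_Un[OF smallA]]]] ..
  have mbs: "mor ?B bs" using bs ..
  let ?cs = "take m bs @ a # drop m bs"
  have mor1: "mor (A \<union> set y) ?cs" by (rule insert_morley[OF a(1) mor_mono[OF mbs]]) blast
  have mor2: "mor (A \<union> set y') ?cs" by (rule insert_morley[OF a(2) mor_mono[OF mbs]]) blast
  have lm: "length (take m bs) = m" using bs as(2) by simp
  have len: "length ?cs = length as" using bs as(2) by simp
  have "mor A ?cs" by (rule mor_mono[OF mor1]) simp
  from mor_conjugate[OF smallA subset_refl this as(1) len]
  obtain h where h: "fixes_aut M A h" "map (map h) ?cs = as" by (elim exE conjE)
  have agr: "agree x y y'" if "x \<in> set bs" for x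
    by (rule real_agree[OF g real_mono[OF mor_real[OF mbs that]]]) blast
  have nth: "as ! i = map h (?cs ! i)" if "i < length as" for i
    using h(2) that len nth_map[of i ?cs "map h"] by (simp del: map_append list.map)
  show ?thesis
  proof (intro exI conjI allI impI)
    show "eqtp M A b (map h y)" "eqtp M A b (map h y')" by (rule eqtp_aut[OF h(1)], rule y)+
    show "germ (map h y) (map h y')" using g germ_aut[OF h(1)] by simp
    show "mor (A \<union> set (map h y)) as" by (rule move_mor[OF h(1) mor1 h(2)])
    show "mor (A \<union> set (map h y')) as" by (rule move_mor[OF h(1) mor2 h(2)])
    have "?cs ! m = a" using lm by (simp add: nth_append)
    then show "\<not> agree (as ! m) (map h y) (map h y')" using nth[OF as(2)] dis agree_aut[OF h(1)] by simp
    fix i assume i: "i < length as" "i \<noteq> m"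
    have "?cs ! i \<in> set bs"
    proof (cases "i < m")
      case True
      then have "?cs ! i = take m bs ! i" using lm by (simp add: nth_append)
      moreover have "take m bs ! i \<in> set (take m bs)" using True lm by (intro nth_mem) simp
      ultimately show ?thesis using in_set_takeD by metis
    next
      case False
      then have j: "i = m + Suc (i - m - 1)" using i(2) by simp
      have "?cs ! (m + Suc (i - m - 1)) = drop m bs ! (i - m - 1)" using lm by (simp add: nth_append)
      moreover have "i - m - 1 < length (drop m bs)" using i False bs by simp
      ultimately show ?thesis using j nth_mem in_set_dropD by metis
    qed
    then show "agree (as ! i) (map h y) (map h y')" using nth[OF i(1)] agr agree_aut[OF h(1)] by simp
  qed
qed

text \<open>
  A counterexample can be copied to any place of a Morley sequence \<open>as\<close>.  Starting from \<open>y0\<close>, the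
  parameter is changed step by step within its germ, at step \<open>m\<close> so that only the value at place
  \<open>m\<close> changes.  In the end all values differ from those of \<open>y0\<close>, while the germ is still that of
  \<open>y0\<close>; this contradicts the bound on disagreements when \<open>as\<close> is long enough.
\<close>

theorem strong_germs:
  assumes y: "eqtp M A b y" "eqtp M A b y'" and g: "germ y y'"
    and a: "Real a (A \<union> set y)" "Real a (A \<union> set y')"
  shows "agree a y y'"
proof (rule ccontr)
  assume dis: "\<not> agree a y y'"
  obtain N where N: "\<forall>y y' as. mor A as \<and> germ y y' \<longrightarrow> length (filter (\<lambda>a. \<not> agree a y y') as) \<le> N"
    using disagree_bound ..
  obtain as where as: "length as = Suc N \<and> mor (A \<union> set y) as"
    using mor_exists[OF small_list_Un[OF smallA]] ..
  have mas: "mor (A \<union> set y) as" using as ..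
  have masA: "mor A as" by (rule mor_mono[OF mas]) simp
  have "\<exists>y0 ym. eqtp M A b ym \<and> mor (A \<union> set ym) as \<and> germ y0 ym \<and>
    (\<forall>i<m. \<not> agree (as ! i) y0 ym) \<and> (\<forall>i<length as. m \<le> i \<longrightarrow> agree (as ! i) y0 ym)"
    if "m \<le> length as" for m
    using that
  proof (induction m)
    case 0
    have "agree (as ! i) y y" if "i < length as" for i
      by (rule agree_refl[OF y(1) mor_real[OF mas nth_mem[OF that]]])
    then show ?case using y(1) mas germ_refl[OF y(1)] by (intro exI[of _ y]) simp
  next
    case (Suc m)
    then obtain y0 ym where ym: "eqtp M A b ym" "mor (A \<union> set ym) as" "germ y0 ym"
      "\<forall>i<m. \<not> agree (as ! i) y0 ym" "\<forall>i<length as. m \<le> i \<longrightarrow> agree (as ! i) y0 ym" by auto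
    have m: "m < length as" using Suc.prems by simp
    obtain z z' where z: "eqtp M A b z" "eqtp M A b z'" "germ z z'" "mor (A \<union> set z) as" "mor (A \<union> set z') as"
      "\<not> agree (as ! m) z z'" "\<forall>i<length as. i \<noteq> m \<longrightarrow> agree (as ! i) z z'"
      using change_one_place[OF y g a dis masA m] by (elim exE conjE)
    \<comment> \<open>The pair \<open>z, z'\<close> is moved, with \<open>as\<close> fixed, so that its first component becomes \<open>ym\<close>; this
      is possible since \<open>as\<close> is a Morley sequence over \<open>z\<close> and over \<open>ym\<close>.\<close>
    have "eqtp M A z ym" by (rule eqtp_trans[OF eqtp_sym[OF z(1)] ym(1)])
    from homogeneity[OF this smallA] obtain g1 where g1: "fixes_aut M A g1" "map g1 z = ym" by (elim exE conjE)
    have "mor (A \<union> set ym) (map (map g1) as)" using move_mor[OF g1(1) z(4) refl] g1(2) by simp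
    from mor_conjugate[OF small_list_Un[OF smallA] Un_upper1 this ym(2) length_map]
    obtain g2 where g2: "fixes_aut M (A \<union> set ym) g2" "map (map g2) (map (map g1) as) = as" by (elim exE conjE)
    have g2A: "fixes_aut M A g2" by (rule fixes_aut_mono[OF g2(1)]) simp
    let ?g = "g2 \<circ> g1"
    have h: "fixes_aut M A ?g" by (rule fixes_aut_comp[OF g2A g1(1)])
    have "map g2 ym = ym" by (rule fixes_aut_map_id[OF g2(1)]) simp
    then have hz: "map ?g z = ym" using g1(2) by (simp flip: map_map)
    have has: "map (map ?g) as = as" using g2(2) by simp
    have hnth: "map ?g (as ! i) = as ! i" if "i < length as" for i
      using has nth_map[OF that, of "map ?g"] by (simp del: map_eq_conv)
    let ?y = "map ?g z'"
    have agr: "agree (as ! i) ym ?y \<longleftrightarrow> agree (as ! i) z z'" if "i < length as" for i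
      using agree_aut[OF h, of "as ! i" z z'] hnth[OF that] hz by (simp only:)
    have gy: "germ ym ?y" using germ_aut[OF h, of z z'] z(3) hz by (simp only:)
    have "eqtp M A b ?y" by (rule eqtp_aut[OF h z(2)])
    moreover have "mor (A \<union> set ?y) as" by (rule move_mor[OF h z(5) has])
    moreover have "germ y0 ?y" by (rule germ_trans[OF ym(3) gy])
    moreover have "\<not> agree (as ! i) y0 ?y" if i: "i < Suc m" for i
    proof
      assume c: "agree (as ! i) y0 ?y"
      show False
      proof (cases "i = m")
        case True
        have "agree (as ! m) y0 ym" using ym(5) m by simp
        then have "agree (as ! m) ym ?y" using c True agree_sym agree_trans by blast
        then show False using agr[OF m] z(6) by simp
      next
        case False
        then have "agree (as ! i) ym ?y" using agr[of i] z(7) i m by simp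
        then have "agree (as ! i) y0 ym" using c agree_sym agree_trans by blast
        then show False using ym(4) i False by simp
      qed
    qed
    moreover have "agree (as ! i) y0 ?y" if i: "i < length as" "Suc m \<le> i" for i
    proof -
      have "agree (as ! i) ym ?y" using agr[OF i(1)] z(7) i by simp
      moreover have "agree (as ! i) y0 ym" using ym(5) i by simp
      ultimately show ?thesis using agree_trans by blast
    qed
    ultimately show ?case by (intro exI[of _ y0] exI[of _ ?y]) simp
  qed
  from this[OF order_refl] obtain y0 ym where
    ym: "germ y0 ym" "\<forall>i<length as. \<not> agree (as ! i) y0 ym" by (elim exE conjE)
  have "filter (\<lambda>a. \<not> agree a y0 ym) as = as"
    using ym(2) by (auto simp: filter_id_conv in_set_conv_nth)
  then have "length as \<le> N" using N[rule_format, of as y0 ym] masA ym(1) by simp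
  then show False using as by simp
qed

text \<open>
  Genericity of \<open>a\<close> over \<open>y\<close> and over \<open>y'\<close> consists of conditions on the pairs \<open>(a, y)\<close> and
  \<open>(a, y')\<close>, and by compactness finitely many of them suffice for the preceding theorem.  Joint
  genericity over \<open>(y, y')\<close> would not yield such a \<open>\<Theta>\<close>; that is why strong germs are needed.
\<close>

lemma uniform_strong_germs:
  "\<exists>\<Theta>. definable M A (\<sigma> @ \<beta>) \<Theta> \<and> P {x \<in> tuples M \<sigma>. x @ b \<in> \<Theta>} \<and>
    (\<forall>a\<in>tuples M \<sigma>. \<forall>y\<in>tuples M \<beta>. \<forall>y'\<in>tuples M \<beta>. a @ y \<in> \<Theta> \<longrightarrow> a @ y' \<in> \<Theta> \<longrightarrow> germ y y' \<longrightarrow> agree a y y')"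
proof -
  define T where "T = {\<Theta>. definable M A (\<sigma> @ \<beta>) \<Theta> \<and> P {x \<in> tuples M \<sigma>. x @ b \<in> \<Theta>}}"
  define E where "E \<Theta> = rel3 M \<sigma> \<beta> \<beta> (\<lambda>a y y'. a @ y \<in> \<Theta> \<and> a @ y' \<in> \<Theta>)" for \<Theta>
  define Bad where "Bad = rel3 M \<sigma> \<beta> \<beta> (\<lambda>a y y'. germ y y' \<and> \<not> agree a y y')"
  let ?\<Gamma> = "(\<lambda>_. \<beta>)(0 := \<sigma>)"
  have defE: "definable M A (\<sigma> @ \<beta> @ \<beta>) (E \<Theta>)" if "\<Theta> \<in> T" for \<Theta>
    unfolding E_def
    by (rule Def_set3[where \<Gamma> = ?\<Gamma> and i = 0 and j = "Suc 0" and k = 2, OF struct])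
      (simp, simp, simp, simp, simp, simp, intro Def_conj[OF struct] Def_mem2[OF struct], use that in \<open>simp_all add: T_def\<close>)
  have defBad: "definable M A (\<sigma> @ \<beta> @ \<beta>) Bad"
    unfolding Bad_def
    by (rule Def_set3[where \<Gamma> = ?\<Gamma> and i = 0 and j = "Suc 0" and k = 2, OF struct])
      (simp, simp, simp, simp, simp, simp, intro Def_conj[OF struct] Def_neg Def_germ Def_agree, simp_all)
  have "\<exists>F. finite F \<and> F \<subseteq> insert Bad (E ` T) \<and> (\<forall>w\<in>tuples M (\<sigma> @ \<beta> @ \<beta>). \<exists>X\<in>F. w \<notin> X)"
  proof (rule compactness[OF smallA])
    fix X assume "X \<in> insert Bad (E ` T)"
    then show "definable M A (\<sigma> @ \<beta> @ \<beta>) X" using defE defBad by (elim insertE imageE) simp_all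
  next
    fix w assume "w \<in> tuples M (\<sigma> @ \<beta> @ \<beta>)"
    then obtain a u where a: "a \<in> tuples M \<sigma>" "u \<in> tuples M (\<beta> @ \<beta>)" "w = a @ u" by (rule tuples_appendE)
    from a(2) obtain y y' where y: "y \<in> tuples M \<beta>" "y' \<in> tuples M \<beta>" "u = y @ y'" by (rule tuples_appendE)
    show "\<exists>X\<in>insert Bad (E ` T). w \<notin> X"
    proof (rule ccontr)
      assume "\<not> ?thesis"
      then have w: "w \<in> Bad" "\<And>\<Theta>. \<Theta> \<in> T \<Longrightarrow> w \<in> E \<Theta>" by simp_all
      have mem: "a @ y \<in> \<Theta> \<and> a @ y' \<in> \<Theta>" if "definable M A (\<sigma> @ \<beta>) \<Theta>" "P {x \<in> tuples M \<sigma>. x @ b \<in> \<Theta>}" for \<Theta>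
        using w(2)[of \<Theta>] that a y by (simp add: T_def E_def rel3_iff)
      have "eqtp M A b y \<and> Real a (A \<union> set y)" by (rule realize_pair[OF a(1) y(1)]) (use mem in simp)
      moreover have "eqtp M A b y' \<and> Real a (A \<union> set y')" by (rule realize_pair[OF a(1) y(2)]) (use mem in simp)
      moreover have "germ y y'" "\<not> agree a y y'" using w(1) a y by (simp_all add: Bad_def rel3_iff)
      ultimately show False using strong_germs by simp
    qed
  qed
  then obtain F where F: "finite F \<and> F \<subseteq> insert Bad (E ` T) \<and> (\<forall>w\<in>tuples M (\<sigma> @ \<beta> @ \<beta>). \<exists>X\<in>F. w \<notin> X)" ..
  have "finite (F - {Bad})" "F - {Bad} \<subseteq> E ` T" using F by auto
  from finite_subset_image[OF this] obtain K where K: "K \<subseteq> T" "finite K" "F - {Bad} = E ` K" by (elim exE conjE)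
  let ?\<Theta> = "{w \<in> tuples M (\<sigma> @ \<beta>). \<forall>\<Theta>\<in>K. w \<in> \<Theta>}"
  have KT: "definable M A (\<sigma> @ \<beta>) \<Theta> \<and> P {x \<in> tuples M \<sigma>. x @ b \<in> \<Theta>}" if "\<Theta> \<in> K" for \<Theta>
    using subsetD[OF K(1) that] by (simp add: T_def)
  show ?thesis
  proof (intro exI[of _ ?\<Theta>] conjI ballI impI)
    show "definable M A (\<sigma> @ \<beta>) ?\<Theta>" by (rule finite_intersection_definable[OF K(2)]) (use KT in simp)
    show "P {x \<in> tuples M \<sigma>. x @ b \<in> ?\<Theta>}" by (rule P_Inter_fibre[OF K(2) KT tuples_self])
    fix a y y' assume *: "a \<in> tuples M \<sigma>" "y \<in> tuples M \<beta>" "y' \<in> tuples M \<beta>" "a @ y \<in> ?\<Theta>" "a @ y' \<in> ?\<Theta>" "germ y y'"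
    show "agree a y y'"
    proof (rule ccontr)
      assume "\<not> agree a y y'"
      then have "a @ y @ y' \<in> Bad" using * by (simp add: Bad_def rel3_iff)
      moreover have "a @ y @ y' \<in> E \<Theta>" if "\<Theta> \<in> K" for \<Theta> using * that by (simp add: E_def rel3_iff)
      moreover have "a @ y @ y' \<in> tuples M (\<sigma> @ \<beta> @ \<beta>)" using *(1-3) by blast
      then obtain X where X: "X \<in> F" "a @ y @ y' \<notin> X" using F by metis
      ultimately show False using K(3) by blast
    qed
  qed
qed

end

section \<open>Canonical parameters of the fibres of a definable set\<close>

text \<open>
  Elimination of imaginaries is about equivalence relations without parameters, so the parameters
  \<open>\<alpha>\<close> of \<open>H\<close> become variables: \<open>R\<close> relates \<open>(a, \<alpha>')\<close> to \<open>(a', \<alpha>')\<close> if the fibres over \<open>a\<close> and \<open>a'\<close>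
  of the instance of \<open>H\<close> at \<open>\<alpha>'\<close> coincide.  The formula that codes the class of one realization of
  \<open>p\<close> codes the classes of all realizations over \<open>A\<close>, since these have the same type; the domain
  \<open>X\<close> consists of all tuples whose class the formula codes.
\<close>

theorem (in generic_type) canonical_parameters:
  assumes EI: "eliminates_imaginaries M" and H: "definable M A (\<sigma> @ \<pi>) H"
  shows "\<exists>\<tau> X h. definable_fun M A \<sigma> X \<tau> h \<and> (\<forall>a. Real a A \<longrightarrow> a \<in> X) \<and>
    (\<forall>a\<in>X. \<forall>a'\<in>X. h a = h a' \<longleftrightarrow> (\<forall>u\<in>tuples M \<pi>. a @ u \<in> H \<longleftrightarrow> a' @ u \<in> H))"
proof -
  obtain \<alpha> where \<alpha>: "set \<alpha> \<subseteq> A" "definable M (set \<alpha>) (\<sigma> @ \<pi>) H"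
    using definable_finite_parameters[OF H] by (elim exE conjE)
  let ?\<gamma> = "map (srt M) \<alpha>"
  have "definable M ({} \<union> set \<alpha>) (\<sigma> @ \<pi>) H" using \<alpha>(2) by simp
  from definable_abstract[OF this] obtain H0 where
    H0: "definable M {} ((\<sigma> @ \<pi>) @ ?\<gamma>) H0" "H = {w \<in> tuples M (\<sigma> @ \<pi>). w @ \<alpha> \<in> H0}" by (elim exE conjE)
  have H0': "definable M {} (\<sigma> @ \<pi> @ ?\<gamma>) H0" using H0(1) by simp
  define E where "E a \<alpha>' a' \<longleftrightarrow> (\<forall>u\<in>tuples M \<pi>. a @ u @ \<alpha>' \<in> H0 \<longleftrightarrow> a' @ u @ \<alpha>' \<in> H0)" for a \<alpha>' a'
  have E\<alpha>: "E a \<alpha> a' \<longleftrightarrow> (\<forall>u\<in>tuples M \<pi>. a @ u \<in> H \<longleftrightarrow> a' @ u \<in> H)"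
    if "a \<in> tuples M \<sigma>" "a' \<in> tuples M \<sigma>" for a a'
    using that unfolding E_def H0(2) by (simp add: tuples_appendI)
  define R where "R = {(a @ \<alpha>', a' @ \<alpha>') |a a' \<alpha>'. a \<in> tuples M \<sigma> \<and> a' \<in> tuples M \<sigma> \<and> \<alpha>' \<in> tuples M ?\<gamma> \<and> E a \<alpha>' a'}"
  have R_iff: "(a @ \<alpha>1, a' @ \<alpha>2) \<in> R \<longleftrightarrow> \<alpha>2 = \<alpha>1 \<and> \<alpha>1 \<in> tuples M ?\<gamma> \<and> E a \<alpha>1 a'"
    if "a \<in> tuples M \<sigma>" "a' \<in> tuples M \<sigma>" for a a' \<alpha>1 \<alpha>2
  proof
    assume "(a @ \<alpha>1, a' @ \<alpha>2) \<in> R"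
    then obtain c c' \<alpha>' where c: "a @ \<alpha>1 = c @ \<alpha>'" "a' @ \<alpha>2 = c' @ \<alpha>'" "c \<in> tuples M \<sigma>" "c' \<in> tuples M \<sigma>"
      "\<alpha>' \<in> tuples M ?\<gamma>" "E c \<alpha>' c'" unfolding R_def by blast
    then show "\<alpha>2 = \<alpha>1 \<and> \<alpha>1 \<in> tuples M ?\<gamma> \<and> E a \<alpha>1 a'"
      using append_tuples_eq[OF that(1) c(3)] append_tuples_eq[OF that(2) c(4)] by simp
  qed (use that in \<open>auto simp: R_def\<close>)
  have R_sub: "R \<subseteq> tuples M (\<sigma> @ ?\<gamma>) \<times> tuples M (\<sigma> @ ?\<gamma>)" by (auto simp: R_def)
  have eqv: "equiv (tuples M (\<sigma> @ ?\<gamma>)) R"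
  proof (rule equivI)
    show "refl_on (tuples M (\<sigma> @ ?\<gamma>)) R"
    proof (rule refl_onI)
      fix x assume "x \<in> tuples M (\<sigma> @ ?\<gamma>)"
      then obtain a \<alpha>' where "a \<in> tuples M \<sigma>" "\<alpha>' \<in> tuples M ?\<gamma>" "x = a @ \<alpha>'" by (rule tuples_appendE)
      then show "(x, x) \<in> R" by (simp add: R_iff E_def)
    qed
    show "sym R" by (rule symI) (auto simp: R_def E_def)
    show "trans R"
    proof (rule transI)
      fix x y z assume xy: "(x, y) \<in> R" and yz: "(y, z) \<in> R"
      obtain a a' \<alpha>' where 1: "x = a @ \<alpha>'" "y = a' @ \<alpha>'" "a \<in> tuples M \<sigma>" "a' \<in> tuples M \<sigma>"
        "\<alpha>' \<in> tuples M ?\<gamma>" "E a \<alpha>' a'" using xy unfolding R_def by blast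
      obtain a'' \<alpha>'' where 2: "z = a'' @ \<alpha>''" "a'' \<in> tuples M \<sigma>"
        using yz unfolding R_def by blast
      have "\<alpha>'' = \<alpha>'" "E a' \<alpha>' a''" using yz R_iff[OF 1(4) 2(2)] 1 2 by simp_all
      then show "(x, z) \<in> R" using 1 2 by (simp add: R_iff E_def)
    qed
    show "R \<subseteq> tuples M (\<sigma> @ ?\<gamma>) \<times> tuples M (\<sigma> @ ?\<gamma>)" by (rule R_sub)
  qed
  have defR: "definable M {} ((\<sigma> @ ?\<gamma>) @ (\<sigma> @ ?\<gamma>)) {x @ x' |x x'. (x, x') \<in> R}"
  proof -
    let ?\<Gamma> = "(\<lambda>_. \<pi>)(0 := \<sigma>, Suc 0 := ?\<gamma>, 2 := \<sigma>, 3 := ?\<gamma>)"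
    have "definable M {} (\<sigma> @ ?\<gamma> @ \<sigma> @ ?\<gamma>) (rel4 M \<sigma> ?\<gamma> \<sigma> ?\<gamma> (\<lambda>a \<alpha>1 a' \<alpha>2. \<alpha>1 = \<alpha>2 \<and> E a \<alpha>1 a'))"
      unfolding E_def
      by (rule Def_set4[where \<Gamma> = ?\<Gamma>, OF struct], simp, simp, simp, simp,
          intro Def_conj[OF struct] Def_eq[OF struct]
            Def_all[where i = 4 and Q = "\<lambda>v u. v 0 @ u @ v (Suc 0) \<in> H0 \<longleftrightarrow> v 2 @ u @ v (Suc 0) \<in> H0", OF struct]
            Def_iff[OF struct] Def_mem3[OF struct])
        (use H0' in simp_all)
    also have "rel4 M \<sigma> ?\<gamma> \<sigma> ?\<gamma> (\<lambda>a \<alpha>1 a' \<alpha>2. \<alpha>1 = \<alpha>2 \<and> E a \<alpha>1 a') = {x @ x' |x x'. (x, x') \<in> R}"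
    proof (intro equalityI subsetI)
      fix w assume "w \<in> rel4 M \<sigma> ?\<gamma> \<sigma> ?\<gamma> (\<lambda>a \<alpha>1 a' \<alpha>2. \<alpha>1 = \<alpha>2 \<and> E a \<alpha>1 a')"
      then obtain a \<alpha>1 a' where w: "w = a @ \<alpha>1 @ a' @ \<alpha>1" "a \<in> tuples M \<sigma>" "\<alpha>1 \<in> tuples M ?\<gamma>"
        "a' \<in> tuples M \<sigma>" "E a \<alpha>1 a'" unfolding rel4_def by auto
      then have "w = (a @ \<alpha>1) @ (a' @ \<alpha>1)" "(a @ \<alpha>1, a' @ \<alpha>1) \<in> R" by (simp_all add: R_iff)
      then show "w \<in> {x @ x' |x x'. (x, x') \<in> R}" by (intro CollectI exI conjI)
    next
      fix w assume "w \<in> {x @ x' |x x'. (x, x') \<in> R}"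
      then obtain a a' \<alpha>' where w: "w = (a @ \<alpha>') @ a' @ \<alpha>'" "a \<in> tuples M \<sigma>" "a' \<in> tuples M \<sigma>"
        "\<alpha>' \<in> tuples M ?\<gamma>" "E a \<alpha>' a'" unfolding R_def by auto
      then show "w \<in> rel4 M \<sigma> ?\<gamma> \<sigma> ?\<gamma> (\<lambda>a \<alpha>1 a' \<alpha>2. \<alpha>1 = \<alpha>2 \<and> E a \<alpha>1 a')"
        unfolding rel4_def by (intro CollectI exI conjI) (auto simp: append_assoc)
    qed
    finally show ?thesis by simp
  qed
  obtain a0 where a0: "Real a0 A" using real_exists[OF smallA] ..
  have a0t: "a0 \<in> tuples M \<sigma>" by (rule real_tuples[OF a0])
  have a0\<alpha>: "a0 @ \<alpha> \<in> tuples M (\<sigma> @ ?\<gamma>)" using a0t by (intro tuples_appendI tuples_self)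
  from EI[unfolded eliminates_imaginaries_def, rule_format, OF conjI[OF eqv conjI[OF R_sub defR]] a0\<alpha>]
  obtain \<tau> \<phi> where \<phi>: "\<phi> \<in> fms M {} ((\<sigma> @ ?\<gamma>) @ \<tau>)"
    "\<exists>!e. e \<in> tuples M \<tau> \<and> R `` {a0 @ \<alpha>} = {x \<in> tuples M (\<sigma> @ ?\<gamma>). holds M \<phi> (x @ e)}"
    by (elim exE bexE)
  define \<Phi> where "\<Phi> = {w \<in> tuples M ((\<sigma> @ ?\<gamma>) @ \<tau>). holds M \<phi> w}"
  have def\<Phi>: "definable M {} (\<sigma> @ ?\<gamma> @ \<tau>) \<Phi>"
    using \<phi>(1) unfolding definable_def \<Phi>_def by auto
  \<comment> \<open>\<open>C a e\<close> says that \<open>e\<close> codes the class of \<open>(a, \<alpha>)\<close>.\<close>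
  define C where "C a e \<longleftrightarrow> (\<forall>a'\<in>tuples M \<sigma>. \<forall>\<alpha>'\<in>tuples M ?\<gamma>.
    (\<alpha>' \<in> {\<alpha>} \<and> (\<forall>u\<in>tuples M \<pi>. a @ u \<in> H \<longleftrightarrow> a' @ u \<in> H)) \<longleftrightarrow> a' @ \<alpha>' @ e \<in> \<Phi>)" for a e
  have C_iff: "C a e \<longleftrightarrow> R `` {a @ \<alpha>} = {x \<in> tuples M (\<sigma> @ ?\<gamma>). holds M \<phi> (x @ e)}"
    if a: "a \<in> tuples M \<sigma>" and e: "e \<in> tuples M \<tau>" for a e
  proof -
    have mem: "a' @ \<alpha>' @ e \<in> \<Phi> \<longleftrightarrow> a' @ \<alpha>' \<in> {x \<in> tuples M (\<sigma> @ ?\<gamma>). holds M \<phi> (x @ e)}"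
      if "a' \<in> tuples M \<sigma>" "\<alpha>' \<in> tuples M ?\<gamma>" for a' \<alpha>'
      using that e unfolding \<Phi>_def by (simp add: tuples_appendI)
    have rel: "a' @ \<alpha>' \<in> R `` {a @ \<alpha>} \<longleftrightarrow> \<alpha>' \<in> {\<alpha>} \<and> (\<forall>u\<in>tuples M \<pi>. a @ u \<in> H \<longleftrightarrow> a' @ u \<in> H)"
      if "a' \<in> tuples M \<sigma>" for a' \<alpha>'
      using R_iff[OF a that] E\<alpha>[OF a that] by auto
    show ?thesis
    proof
      assume C: "C a e"
      show "R `` {a @ \<alpha>} = {x \<in> tuples M (\<sigma> @ ?\<gamma>). holds M \<phi> (x @ e)}"
      proof (rule set_eqI)
        fix x
        show "x \<in> R `` {a @ \<alpha>} \<longleftrightarrow> x \<in> {x \<in> tuples M (\<sigma> @ ?\<gamma>). holds M \<phi> (x @ e)}"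
        proof (cases "x \<in> tuples M (\<sigma> @ ?\<gamma>)")
          case True
          then obtain a' \<alpha>' where x: "a' \<in> tuples M \<sigma>" "\<alpha>' \<in> tuples M ?\<gamma>" "x = a' @ \<alpha>'" by (rule tuples_appendE)
          show ?thesis unfolding x(3) rel[OF x(1)] mem[OF x(1,2), symmetric] using C x(1,2) unfolding C_def by blast
        next
          case False then show ?thesis using R_sub by blast
        qed
      qed
    next
      assume eq: "R `` {a @ \<alpha>} = {x \<in> tuples M (\<sigma> @ ?\<gamma>). holds M \<phi> (x @ e)}"
      show "C a e" unfolding C_def
      proof (intro ballI)
        fix a' \<alpha>' assume x: "a' \<in> tuples M \<sigma>" "\<alpha>' \<in> tuples M ?\<gamma>"
        show "(\<alpha>' \<in> {\<alpha>} \<and> (\<forall>u\<in>tuples M \<pi>. a @ u \<in> H \<longleftrightarrow> a' @ u \<in> H)) \<longleftrightarrow> a' @ \<alpha>' @ e \<in> \<Phi>"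
          unfolding mem[OF x] rel[OF x(1), symmetric] eq ..
      qed
    qed
  qed
  have defC: "definable M A (\<sigma> @ \<tau>) (rel2 M \<sigma> \<tau> C)"
  proof -
    let ?\<Gamma> = "(\<lambda>_. \<pi>)(0 := \<sigma>, Suc 0 := \<tau>, 2 := \<sigma>, 3 := ?\<gamma>)"
    have sing: "definable M A ?\<gamma> {\<alpha>}" by (rule definable_singleton[OF struct tuples_self \<alpha>(1)])
    have \<Phi>A: "definable M A (\<sigma> @ ?\<gamma> @ \<tau>) \<Phi>" by (rule definable_mono[OF def\<Phi>]) simp
    have "Def M A ?\<Gamma> (\<lambda>v. (v 3 \<in> {\<alpha>} \<and> (\<forall>u\<in>tuples M \<pi>. v 0 @ u \<in> H \<longleftrightarrow> v 2 @ u \<in> H)) \<longleftrightarrow> v 2 @ v 3 @ v (Suc 0) \<in> \<Phi>)"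
    proof (intro Def_iff[OF struct] Def_conj[OF struct] Def_mem3[OF struct] Def_mem1[OF struct]
        Def_all[where i = 4 and Q = "\<lambda>v u. v 0 @ u \<in> H \<longleftrightarrow> v 2 @ u \<in> H", OF struct] Def_mem2[OF struct])
    qed (use H sing \<Phi>A in simp_all)
    then have "Def M A ?\<Gamma> (\<lambda>v. \<forall>\<alpha>'\<in>tuples M ?\<gamma>. (\<alpha>' \<in> {\<alpha>} \<and> (\<forall>u\<in>tuples M \<pi>. v 0 @ u \<in> H \<longleftrightarrow> v 2 @ u \<in> H)) \<longleftrightarrow>
        v 2 @ \<alpha>' @ v (Suc 0) \<in> \<Phi>)"
      by (rule Def_all[where i = 3 and Q = "\<lambda>v \<alpha>'. (\<alpha>' \<in> {\<alpha>} \<and> (\<forall>u\<in>tuples M \<pi>. v 0 @ u \<in> H \<longleftrightarrow> v 2 @ u \<in> H)) \<longleftrightarrow>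
        v 2 @ \<alpha>' @ v (Suc 0) \<in> \<Phi>", OF struct, rotated]) simp_all
    then have "Def M A ?\<Gamma> (\<lambda>v. C (v 0) (v (Suc 0)))" unfolding C_def
      by (rule Def_all[where i = 2 and Q = "\<lambda>v a'. \<forall>\<alpha>'\<in>tuples M ?\<gamma>. (\<alpha>' \<in> {\<alpha>} \<and> (\<forall>u\<in>tuples M \<pi>. v 0 @ u \<in> H \<longleftrightarrow> a' @ u \<in> H)) \<longleftrightarrow>
        a' @ \<alpha>' @ v (Suc 0) \<in> \<Phi>", OF struct, rotated]) simp_all
    then show ?thesis by (rule Def_set2[where \<Gamma> = ?\<Gamma> and i = 0 and j = "Suc 0", OF struct, rotated 3]) simp_all
  qed
  let ?\<Delta> = "(\<lambda>_. \<tau>)(0 := \<sigma>)"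
  have DC: "Def M A ?\<Delta> (\<lambda>v. C (v 0) (v i))" if "i \<noteq> 0" for i
    by (rule Def_rel2[OF struct defC]) (use that in simp_all)
  define X where "X = {a \<in> tuples M \<sigma>. (\<exists>e\<in>tuples M \<tau>. C a e) \<and> (\<forall>e\<in>tuples M \<tau>. \<forall>e'\<in>tuples M \<tau>. C a e \<and> C a e' \<longrightarrow> e = e')}"
  have defX: "definable M A \<sigma> X" unfolding X_def
  proof (rule Def_set1[where \<Gamma> = ?\<Delta> and i = 0, OF struct])
    have 1: "Def M A ?\<Delta> (\<lambda>v. \<exists>e\<in>tuples M \<tau>. C (v 0) e)"
      by (rule Def_ex[where i = 1 and Q = "\<lambda>v e. C (v 0) e", OF struct _ DC]) simp_all
    have "Def M A ?\<Delta> (\<lambda>v. C (v 0) (v 1) \<and> C (v 0) (v 2) \<longrightarrow> v 1 = v 2)"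
      by (intro Def_imp[OF struct] Def_conj[OF struct] DC Def_eq[OF struct]) simp_all
    then have "Def M A ?\<Delta> (\<lambda>v. \<forall>e'\<in>tuples M \<tau>. C (v 0) (v 1) \<and> C (v 0) e' \<longrightarrow> v 1 = e')"
      by (rule Def_all[where i = 2 and Q = "\<lambda>v e'. C (v 0) (v 1) \<and> C (v 0) e' \<longrightarrow> v 1 = e'", OF struct, rotated]) simp_all
    then have 2: "Def M A ?\<Delta> (\<lambda>v. \<forall>e\<in>tuples M \<tau>. \<forall>e'\<in>tuples M \<tau>. C (v 0) e \<and> C (v 0) e' \<longrightarrow> e = e')"
      by (rule Def_all[where i = 1 and Q = "\<lambda>v e. \<forall>e'\<in>tuples M \<tau>. C (v 0) e \<and> C (v 0) e' \<longrightarrow> e = e'", OF struct, rotated]) simp_all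
    show "Def M A ?\<Delta> (\<lambda>v. (\<exists>e\<in>tuples M \<tau>. C (v 0) e) \<and>
      (\<forall>e\<in>tuples M \<tau>. \<forall>e'\<in>tuples M \<tau>. C (v 0) e \<and> C (v 0) e' \<longrightarrow> e = e'))"
      by (rule Def_conj[OF struct 1 2])
  qed simp
  have "a0 \<in> X"
  proof -
    have "e \<in> tuples M \<tau> \<and> R `` {a0 @ \<alpha>} = {x \<in> tuples M (\<sigma> @ ?\<gamma>). holds M \<phi> (x @ e)} \<longleftrightarrow>
        e \<in> tuples M \<tau> \<and> C a0 e" for e
      using C_iff[OF a0t] by (intro conj_cong refl) simp
    then have "\<exists>!e. e \<in> tuples M \<tau> \<and> C a0 e" using \<phi>(2) by (simp only:)
    then show ?thesis using a0t unfolding X_def by blast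
  qed
  then have real_X: "a \<in> X" if "Real a A" for a
    using real_mem[OF a0 defX] real_mem[OF that defX] by simp
  define h where "h a = (THE e. e \<in> tuples M \<tau> \<and> C a e)" for a
  have h: "h a \<in> tuples M \<tau> \<and> C a (h a)" if "a \<in> X" for a
  proof -
    have "\<exists>!e. e \<in> tuples M \<tau> \<and> C a e" using that unfolding X_def by blast
    then show ?thesis unfolding h_def by (rule theI')
  qed
  have h_eq: "C a e \<Longrightarrow> e \<in> tuples M \<tau> \<Longrightarrow> h a = e" if "a \<in> X" for a e
    using that h[OF that] unfolding X_def by blast
  have "definable_fun M A \<sigma> X \<tau> h" unfolding definable_fun_def
  proof (intro conjI)
    show "h ` X \<subseteq> tuples M \<tau>" using h by blast
    have "definable M A (\<sigma> @ \<tau>) (rel2 M \<sigma> \<tau> (\<lambda>a e. a \<in> X \<and> C a e))"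
      by (rule Def_set2[where \<Gamma> = ?\<Delta> and i = 0 and j = 1, OF struct], simp, simp, simp,
          rule Def_conj[OF struct Def_mem1[OF struct] DC]) (use defX in simp_all)
    also have "rel2 M \<sigma> \<tau> (\<lambda>a e. a \<in> X \<and> C a e) = (\<lambda>a. a @ h a) ` X"
    proof (intro equalityI subsetI)
      fix w assume "w \<in> rel2 M \<sigma> \<tau> (\<lambda>a e. a \<in> X \<and> C a e)"
      then obtain a e where "w = a @ e" "e \<in> tuples M \<tau>" "a \<in> X" "C a e" unfolding rel2_def by blast
      then show "w \<in> (\<lambda>a. a @ h a) ` X" using h_eq by blast
    next
      fix w assume "w \<in> (\<lambda>a. a @ h a) ` X"
      then obtain a where a: "a \<in> X" "w = a @ h a" by blast
      moreover have "a \<in> tuples M \<sigma>" using a(1) unfolding X_def by blast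
      ultimately show "w \<in> rel2 M \<sigma> \<tau> (\<lambda>a e. a \<in> X \<and> C a e)" using h by (simp add: rel2_iff)
    qed
    finally show "definable M A (\<sigma> @ \<tau>) ((\<lambda>a. a @ h a) ` X)" .
  qed (rule defX)
  moreover have "h a = h a' \<longleftrightarrow> (\<forall>u\<in>tuples M \<pi>. a @ u \<in> H \<longleftrightarrow> a' @ u \<in> H)" if a: "a \<in> X" and a': "a' \<in> X" for a a'
  proof -
    have t: "a \<in> tuples M \<sigma>" "a' \<in> tuples M \<sigma>" using a a' unfolding X_def by blast+
    show ?thesis
    proof
      assume eq: "h a = h a'"
      have "a' @ \<alpha> @ h a' \<in> \<Phi>" using h[OF a'] t(2) tuples_self[of \<alpha>] unfolding C_def by blast
      then show "\<forall>u\<in>tuples M \<pi>. a @ u \<in> H \<longleftrightarrow> a' @ u \<in> H"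
        using h[OF a] t(2) tuples_self[of \<alpha> M] unfolding C_def eq by blast
    next
      assume eq: "\<forall>u\<in>tuples M \<pi>. a @ u \<in> H \<longleftrightarrow> a' @ u \<in> H"
      have "C a (h a')" using h[OF a'] unfolding C_def using eq by simp
      then show "h a = h a'" using h_eq[OF a] h[OF a'] by simp
    qed
  qed
  ultimately show ?thesis using real_X by (intro exI[of _ \<tau>] exI[of _ X] exI[of _ h]) simp
qed

section \<open>Internal sets\<close>

context monster
begin

lemma concat_replicate: "concat (map (\<lambda>_. \<rho>) [0..<n]) = concat (replicate n \<rho>)"
  by (simp add: map_replicate_const)

lemma set_power_tuples: "S \<subseteq> tuples M \<rho> \<Longrightarrow> set_power S n \<subseteq> tuples M (concat (replicate n \<rho>))"
proof
  fix w assume S: "S \<subseteq> tuples M \<rho>" and "w \<in> set_power S n"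
  then obtain as where "w = concat as" "length as = n" "set as \<subseteq> S" unfolding set_power_def by blast
  then show "w \<in> tuples M (concat (replicate n \<rho>))"
    using S by (induction as arbitrary: n w) (auto intro!: tuples_appendI)
qed

lemma set_power_append: "s \<in> set_power S m \<Longrightarrow> t \<in> set_power S n \<Longrightarrow> s @ t \<in> set_power S (m + n)"
proof -
  assume "s \<in> set_power S m" "t \<in> set_power S n"
  then obtain as bs where "s = concat as" "length as = m" "set as \<subseteq> S" "t = concat bs" "length bs = n" "set bs \<subseteq> S"
    unfolding set_power_def by blast
  then have "s @ t = concat (as @ bs)" "length (as @ bs) = m + n" "set (as @ bs) \<subseteq> S" by simp_all
  then show ?thesis unfolding set_power_def by blast
qed

lemma set_power_split:
  assumes "w \<in> set_power S (m + n)"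
  obtains s t where "s \<in> set_power S m" "t \<in> set_power S n" "w = s @ t"
proof -
  obtain as where as: "w = concat as" "length as = m + n" "set as \<subseteq> S" using assms unfolding set_power_def by blast
  have "concat (take m as) \<in> set_power S m" "concat (drop m as) \<in> set_power S n"
    unfolding set_power_def using as set_take_subset[of m as] set_drop_subset[of m as] by fastforce+
  moreover have "w = concat (take m as) @ concat (drop m as)" using as(1) by (metis append_take_drop_id concat_append)
  ultimately show ?thesis using that by blast
qed

lemma set_power_1: "set_power S 1 = S"
proof (intro equalityI subsetI)
  fix x assume "x \<in> S"
  then have "x = concat [x]" "length [x] = 1" "set [x] \<subseteq> S" by simp_all
  then show "x \<in> set_power S 1" unfolding set_power_def by blast
qed (auto simp: set_power_def length_Suc_conv)

lemma set_power_0: "set_power S 0 = {[]}"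
  unfolding set_power_def by auto

lemma definable_set_power:
  assumes S: "definable M B \<rho> S" shows "definable M B (concat (replicate n \<rho>)) (set_power S n)"
proof -
  let ?\<Gamma> = "\<lambda>_::nat. \<rho>"
  have "Def M B ?\<Gamma> (\<lambda>v. \<forall>i\<in>{..<n}. v i \<in> S)"
    by (rule Def_Ball[OF struct]) (simp, rule Def_mem1[OF struct S])
  then have "definable M B (concat (map ?\<Gamma> [0..<n])) {concat (map v [0..<n]) |v. blocks M ?\<Gamma> v \<and> (\<forall>i\<in>{..<n}. v i \<in> S)}"
    by (rule Def_image[OF struct]) simp
  also have "{concat (map v [0..<n]) |v. blocks M ?\<Gamma> v \<and> (\<forall>i\<in>{..<n}. v i \<in> S)} = set_power S n"
  proof (intro equalityI subsetI)
    fix w assume "w \<in> {concat (map v [0..<n]) |v. blocks M ?\<Gamma> v \<and> (\<forall>i\<in>{..<n}. v i \<in> S)}"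
    then obtain v where "w = concat (map v [0..<n])" "\<forall>i\<in>{..<n}. v i \<in> S" by blast
    then show "w \<in> set_power S n" unfolding set_power_def by (auto intro!: exI[of _ "map v [0..<n]"])
  next
    fix w assume "w \<in> set_power S n"
    then obtain as where as: "w = concat as" "length as = n" "set as \<subseteq> S" unfolding set_power_def by blast
    obtain c where c: "c \<in> tuples M \<rho>" using tuples_nonempty[OF struct] ..
    define v where "v i = (if i < n then as ! i else c)" for i
    have vS: "v i \<in> S" if "i < n" for i using that as nth_mem by (auto simp: v_def)
    then have "blocks M ?\<Gamma> v" unfolding blocks_def using definable_sub[OF S] c by (auto simp: v_def)
    moreover have "map v [0..<n] = as" by (rule nth_equalityI) (use as in \<open>simp_all add: v_def\<close>)
    ultimately show "w \<in> {concat (map v [0..<n]) |v. blocks M ?\<Gamma> v \<and> (\<forall>i\<in>{..<n}. v i \<in> S)}"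
      using as(1) vS by (intro CollectI exI[of _ v]) simp
  qed
  finally show ?thesis by (simp only: concat_replicate)
qed

text \<open>Internality from the graph \<open>R\<close> of a surjection, so that the function itself need not be named.\<close>

lemma internalI:
  assumes S: "definable M UNIV \<rho> S"
    and R: "definable M UNIV (concat (replicate m \<rho>) @ \<tau>) R"
    and uniq: "\<And>t. t \<in> set_power S m \<Longrightarrow> \<exists>!e. t @ e \<in> R"
    and X: "X = {e. \<exists>t\<in>set_power S m. t @ e \<in> R}"
  shows "internal M \<rho> S \<tau> X"
proof -
  let ?\<pi> = "concat (replicate m \<rho>)"
  have T: "definable M UNIV ?\<pi> (set_power S m)" by (rule definable_set_power[OF S])
  have tup: "t \<in> tuples M ?\<pi>" if "t \<in> set_power S m" for t using definable_sub[OF T] that by blast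
  define g where "g t = (THE e. t @ e \<in> R)" for t
  have g: "t @ g t \<in> R" if "t \<in> set_power S m" for t unfolding g_def by (rule theI'[OF uniq[OF that]])
  have g_eq: "e = g t" if "t \<in> set_power S m" "t @ e \<in> R" for t e using uniq[OF that(1)] g[OF that(1)] that(2) by blast
  have e_tup: "e \<in> tuples M \<tau>" if "t \<in> set_power S m" "t @ e \<in> R" for t e
    using subsetD[OF definable_sub[OF R] that(2)] tup[OF that(1)] tuples_append_iff[of t ?\<pi> e M \<tau>] by (simp add: tuples_length)
  have "definable_fun M UNIV ?\<pi> (set_power S m) \<tau> g" unfolding definable_fun_def
  proof (intro conjI T)
    show "g ` set_power S m \<subseteq> tuples M \<tau>" using e_tup g by blast
    have "definable M UNIV (?\<pi> @ \<tau>) (rel2 M ?\<pi> \<tau> (\<lambda>t e. t \<in> set_power S m \<and> t @ e \<in> R))"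
      by (rule Def_set2[where \<Gamma> = "(\<lambda>_. \<tau>)(0 := ?\<pi>)" and i = 0 and j = 1, OF struct], simp, simp, simp,
          rule Def_conj[OF struct Def_mem1[OF struct] Def_mem2[OF struct]]) (use T R in simp_all)
    also have "rel2 M ?\<pi> \<tau> (\<lambda>t e. t \<in> set_power S m \<and> t @ e \<in> R) = (\<lambda>t. t @ g t) ` set_power S m"
    proof (intro equalityI subsetI)
      fix w assume "w \<in> rel2 M ?\<pi> \<tau> (\<lambda>t e. t \<in> set_power S m \<and> t @ e \<in> R)"
      then obtain t e where "w = t @ e" "t \<in> set_power S m" "t @ e \<in> R" unfolding rel2_def by blast
      then show "w \<in> (\<lambda>t. t @ g t) ` set_power S m" using g_eq by blast
    next
      fix w assume "w \<in> (\<lambda>t. t @ g t) ` set_power S m"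
      then obtain t where t: "t \<in> set_power S m" "w = t @ g t" by blast
      then show "w \<in> rel2 M ?\<pi> \<tau> (\<lambda>t e. t \<in> set_power S m \<and> t @ e \<in> R)"
        using g[OF t(1)] tup[OF t(1)] e_tup[OF t(1)] by (simp add: rel2_iff)
    qed
    finally show "definable M UNIV (?\<pi> @ \<tau>) ((\<lambda>t. t @ g t) ` set_power S m)" .
  qed
  moreover have "g ` set_power S m = X" unfolding X using g g_eq by blast
  ultimately show ?thesis unfolding internal_def by blast
qed

text \<open>
  A surjection onto the union takes two further coordinates from \<open>S\<close>; whether they are equal selects
  one of the two surjections, and both outcomes occur once \<open>S\<close> has two elements.
\<close>

lemma internal_Un:
  assumes S: "definable M UNIV \<rho> S" and s: "s \<in> S" "s' \<in> S" "s \<noteq> s'"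
    and X: "internal M \<rho> S \<tau> X" and Y: "internal M \<rho> S \<tau> Y"
  shows "internal M \<rho> S \<tau> (X \<union> Y)"
proof (cases "X = {} \<or> Y = {}")
  case True then show ?thesis using X Y by auto
next
  case False
  obtain m g where g: "definable_fun M UNIV (concat (replicate m \<rho>)) (set_power S m) \<tau> g" "g ` set_power S m = X"
    using X False unfolding internal_def by blast
  obtain n k where k: "definable_fun M UNIV (concat (replicate n \<rho>)) (set_power S n) \<tau> k" "k ` set_power S n = Y"
    using Y False unfolding internal_def by blast
  let ?m = "concat (replicate m \<rho>)" and ?n = "concat (replicate n \<rho>)"
  define R1 where "R1 = (\<lambda>t. t @ g t) ` set_power S m"
  define R2 where "R2 = (\<lambda>t. t @ k t) ` set_power S n"
  have def1: "definable M UNIV (?m @ \<tau>) R1" and def2: "definable M UNIV (?n @ \<tau>) R2"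
    using g(1) k(1) unfolding definable_fun_def R1_def R2_def by simp_all
  have defm: "definable M UNIV ?m (set_power S m)" and defn: "definable M UNIV ?n (set_power S n)"
    by (rule definable_set_power[OF S])+
  have tm: "t \<in> tuples M ?m" if "t \<in> set_power S m" for t using definable_sub[OF defm] that by blast
  have tn: "t \<in> tuples M ?n" if "t \<in> set_power S n" for t using definable_sub[OF defn] that by blast
  have tS: "t \<in> tuples M \<rho>" if "t \<in> S" for t using definable_sub[OF S] that by blast
  have R1: "t @ e \<in> R1 \<longleftrightarrow> e = g t" if "t \<in> set_power S m" for t e
    unfolding R1_def using that tm append_tuples_eq[OF tm[OF that] tm] by blast
  have R2: "t @ e \<in> R2 \<longleftrightarrow> e = k t" if "t \<in> set_power S n" for t e
    unfolding R2_def using that tn append_tuples_eq[OF tn[OF that] tn] by blast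
  let ?\<Gamma> = "(\<lambda>_. \<rho>)(0 := ?m, Suc 0 := ?n, 4 := \<tau>)"
  let ?j = "[0, Suc 0, 2, 3, 4]"
  define Q where "Q v \<longleftrightarrow> v 0 \<in> set_power S m \<and> v (Suc 0) \<in> set_power S n \<and> v 2 \<in> S \<and> v 3 \<in> S \<and>
    (v 2 = v 3 \<and> v 0 @ v 4 \<in> R1 \<or> v 2 \<noteq> v 3 \<and> v (Suc 0) @ v 4 \<in> R2)" for v :: "nat \<Rightarrow> 'm list"
  define R where "R = {concat (map v ?j) |v. blocks M ?\<Gamma> v \<and> Q v}"
  have "Def M UNIV ?\<Gamma> Q" unfolding Q_def
    by (intro Def_conj[OF struct] Def_disj[OF struct] Def_mem1[OF struct] Def_mem2[OF struct] Def_neg Def_eq[OF struct])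
      (simp_all add: S defm defn def1 def2)
  then have "definable M UNIV (concat (map ?\<Gamma> ?j)) R" unfolding R_def by (rule Def_image[OF struct]) simp
  moreover have rep: "concat (replicate (m + (n + 2)) \<rho>) = ?m @ ?n @ \<rho> @ \<rho>"
    by (simp only: replicate_add concat_append numeral_2_eq_2) simp
  ultimately have defR: "definable M UNIV (concat (replicate (m + (n + 2)) \<rho>) @ \<tau>) R" by simp
  have R_iff: "(t @ t' @ q @ q') @ e \<in> R \<longleftrightarrow> (q = q' \<and> e = g t \<or> q \<noteq> q' \<and> e = k t')"
    if t: "t \<in> set_power S m" "t' \<in> set_power S n" "q \<in> S" "q' \<in> S" for t t' q q' e
  proof
    assume "(t @ t' @ q @ q') @ e \<in> R"
    then obtain v where v: "blocks M ?\<Gamma> v" "Q v" "t @ t' @ q @ q' @ e = v 0 @ v (Suc 0) @ v 2 @ v 3 @ v 4"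
      unfolding R_def by auto
    have b: "v 0 \<in> tuples M ?m" "v (Suc 0) \<in> tuples M ?n" "v 2 \<in> tuples M \<rho>" "v 3 \<in> tuples M \<rho>"
      using blocksD[OF v(1), of 0] blocksD[OF v(1), of "Suc 0"] blocksD[OF v(1), of 2] blocksD[OF v(1), of 3] by simp_all
    have 0: "t = v 0" "t' @ q @ q' @ e = v (Suc 0) @ v 2 @ v 3 @ v 4"
      using v(3) append_tuples_eq[OF tm[OF t(1)] b(1)] by blast+
    have 1: "t' = v (Suc 0)" "q @ q' @ e = v 2 @ v 3 @ v 4" using 0(2) append_tuples_eq[OF tn[OF t(2)] b(2)] by blast+
    have 2: "q = v 2" "q' @ e = v 3 @ v 4" using 1(2) append_tuples_eq[OF tS[OF t(3)] b(3)] by blast+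
    have 3: "q' = v 3" "e = v 4" using 2(2) append_tuples_eq[OF tS[OF t(4)] b(4)] by blast+
    show "q = q' \<and> e = g t \<or> q \<noteq> q' \<and> e = k t'"
      using v(2) R1[OF t(1)] R2[OF t(2)] unfolding Q_def by (simp flip: 0(1) 1(1) 2(1) 3)
  next
    assume e: "q = q' \<and> e = g t \<or> q \<noteq> q' \<and> e = k t'"
    have "e \<in> tuples M \<tau>" using e g(1) k(1) t unfolding definable_fun_def by blast
    let ?v = "(\<lambda>_. q)(0 := t, Suc 0 := t', 2 := q, 3 := q', 4 := e)"
    have "blocks M ?\<Gamma> ?v" unfolding blocks_def using t tm tn tS \<open>e \<in> tuples M \<tau>\<close> by simp
    moreover have "Q ?v" unfolding Q_def using t R1[OF t(1)] R2[OF t(2)] e by simp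
    moreover have "concat (map ?v ?j) = (t @ t' @ q @ q') @ e" by simp
    ultimately show "(t @ t' @ q @ q') @ e \<in> R" unfolding R_def by (intro CollectI exI[of _ ?v] conjI) simp_all
  qed
  have split: "\<exists>t t' q q'. t \<in> set_power S m \<and> t' \<in> set_power S n \<and> q \<in> S \<and> q' \<in> S \<and> w = t @ t' @ q @ q'"
    if w: "w \<in> set_power S (m + (n + 2))" for w
  proof -
    obtain t u where 1: "t \<in> set_power S m" "u \<in> set_power S (n + 2)" "w = t @ u" by (rule set_power_split[OF w])
    obtain t' x where 2: "t' \<in> set_power S n" "x \<in> set_power S 2" "u = t' @ x" by (rule set_power_split[OF 1(2)])
    have "x \<in> set_power S (1 + 1)" using 2(2) by (simp add: numeral_2_eq_2)
    then obtain q q' where "q \<in> set_power S 1" "q' \<in> set_power S 1" "x = q @ q'" by (rule set_power_split)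
    then show ?thesis using 1 2 unfolding set_power_1 by blast
  qed
  have join: "t @ t' @ q @ q' \<in> set_power S (m + (n + 2))"
    if "t \<in> set_power S m" "t' \<in> set_power S n" "q \<in> S" "q' \<in> S" for t t' q q'
  proof -
    have "q @ q' \<in> set_power S (1 + 1)" by (rule set_power_append) (use that set_power_1 in auto)
    then have "q @ q' \<in> set_power S 2" by (simp add: numeral_2_eq_2)
    then show ?thesis using that by (intro set_power_append)
  qed
  show ?thesis
  proof (rule internalI[OF S defR])
    fix w assume "w \<in> set_power S (m + (n + 2))"
    from split[OF this] obtain t t' q q' where t: "t \<in> set_power S m" "t' \<in> set_power S n" "q \<in> S" "q' \<in> S" "w = t @ t' @ q @ q'"
      by (elim exE conjE)
    show "\<exists>!e. w @ e \<in> R" unfolding t(5) R_iff[OF t(1-4)] by auto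
  next
    obtain t0 where t0: "t0 \<in> set_power S m" using False g(2) by blast
    obtain t1 where t1: "t1 \<in> set_power S n" using False k(2) by blast
    show "X \<union> Y = {e. \<exists>t\<in>set_power S (m + (n + 2)). t @ e \<in> R}"
    proof (intro equalityI subsetI)
      fix e assume "e \<in> X \<union> Y"
      then consider t where "t \<in> set_power S m" "e = g t" | t where "t \<in> set_power S n" "e = k t" using g(2) k(2) by blast
      then show "e \<in> {e. \<exists>t\<in>set_power S (m + (n + 2)). t @ e \<in> R}"
      proof cases
        case 1
        then have "(t @ t1 @ s @ s) @ e \<in> R" using R_iff[OF 1(1) t1 s(1) s(1)] by simp
        then show ?thesis using join[OF 1(1) t1 s(1) s(1)] by blast
      next
        case 2
        then have "(t0 @ t @ s @ s') @ e \<in> R" using R_iff[OF t0 2(1) s(1,2)] s(3) by simp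
        then show ?thesis using join[OF t0 2(1) s(1,2)] by blast
      qed
    next
      fix e assume "e \<in> {e. \<exists>t\<in>set_power S (m + (n + 2)). t @ e \<in> R}"
      then obtain w where w: "w \<in> set_power S (m + (n + 2))" "w @ e \<in> R" by blast
      from split[OF w(1)] obtain t t' q q' where t: "t \<in> set_power S m" "t' \<in> set_power S n" "q \<in> S" "q' \<in> S" "w = t @ t' @ q @ q'"
        by (elim exE conjE)
      then have "q = q' \<and> e = g t \<or> q \<noteq> q' \<and> e = k t'" using w(2) R_iff[OF t(1-4)] by simp
      then show "e \<in> X \<union> Y" using t g(2) k(2) by blast
    qed
  qed
qed

lemma internal_Union:
  assumes S: "definable M UNIV \<rho> S" and s: "s \<in> S" "s' \<in> S" "s \<noteq> s'"
  shows "finite F \<Longrightarrow> (\<And>X. X \<in> F \<Longrightarrow> internal M \<rho> S \<tau> X) \<Longrightarrow> internal M \<rho> S \<tau> (\<Union>F)"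
proof (induction F rule: finite_induct)
  case empty then show ?case by (simp add: internal_def)
next
  case (insert X F)
  then have "internal M \<rho> S \<tau> (X \<union> \<Union>F)" by (intro internal_Un[OF S s]) auto
  then show ?case by simp
qed

lemma internal_singleton:
  assumes S: "definable M UNIV \<rho> S" and e: "e \<in> tuples M \<tau>" shows "internal M \<rho> S \<tau> {e}"
proof (rule internalI[OF S, where m = 0])
  show "definable M UNIV (concat (replicate 0 \<rho>) @ \<tau>) {e}" using definable_singleton[OF struct e] by simp
qed (auto simp: set_power_0)

end

section \<open>The code of the values of a definable family\<close>

text \<open>\<open>\<Theta>\<close> is the definable condition in \<open>p\<close> under which the value of a function at \<open>a\<close> depends only on its germ.\<close>

locale coded_family = family \<kappa> M A \<sigma> p \<rho> S G b
  for \<kappa> :: "'k rel" and M :: "('s, 'f, 'r, 'm) struct" and A \<sigma> p \<rho> S G b +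
  fixes \<Theta> :: "'m list set"
  assumes def\<Theta>: "definable M A (\<sigma> @ map (srt M) b) \<Theta>"
    and P\<Theta>: "P {x \<in> tuples M \<sigma>. x @ b \<in> \<Theta>}"
    and agree\<Theta>: "\<And>a y y'. a \<in> tuples M \<sigma> \<Longrightarrow> y \<in> tuples M (map (srt M) b) \<Longrightarrow> y' \<in> tuples M (map (srt M) b) \<Longrightarrow>
      a @ y \<in> \<Theta> \<Longrightarrow> a @ y' \<in> \<Theta> \<Longrightarrow> germ y y' \<Longrightarrow> agree a y y'"
    and SE: "stably_embedded M A \<rho> S" and EI: "eliminates_imaginaries M"
begin

text \<open>
  The value at \<open>a\<close> of the germ of \<open>y\<close>.  Passing to any \<open>y'\<close> with that germ and \<open>\<Theta>(a, y')\<close> makes it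
  a function of the germ; at a generic argument it is the value \<open>f\<^sub>y(a)\<close>.
\<close>

definition H :: "'m list \<Rightarrow> 'm list \<Rightarrow> 'm list \<Rightarrow> bool" where
  "H a y z \<longleftrightarrow> (\<exists>y'\<in>tuples M \<beta>. germ y y' \<and> a @ y' \<in> \<Theta> \<and> Gr a z y')"

lemma H_tuples: "H a y z \<Longrightarrow> a \<in> tuples M \<sigma> \<and> y \<in> tuples M \<beta> \<and> z \<in> tuples M \<rho>"
  unfolding H_def Gr_def using germ_tuples by blast

lemma H_S: "H a y z \<Longrightarrow> z \<in> S"
  unfolding H_def using Gr_S by blast

lemma H_germ: "H a y z \<Longrightarrow> germ y y1 \<Longrightarrow> H a y1 z"
  unfolding H_def using germ_sym germ_trans by blast

lemma H_germ_refl: "H a y z \<Longrightarrow> germ y y"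
  unfolding H_def using germ_sym germ_trans by blast

lemma H_iff:
  assumes y: "eqtp M A b y" and a: "Real a (A \<union> set y)" shows "H a y z \<longleftrightarrow> Gr a z y"
proof -
  have yt: "y \<in> tuples M \<beta>" using eqtp_tuples[OF y] tuples_self by blast
  have "P {x \<in> tuples M \<sigma>. x @ y \<in> \<Theta>}" by (rule P_fibre_eqtp[OF def\<Theta> y P\<Theta>])
  then have ay: "a @ y \<in> \<Theta>" using real_mem[OF a P_fibre_definable[OF def\<Theta> yt]] by simp
  show ?thesis
  proof
    assume "H a y z"
    then obtain y' where y': "y' \<in> tuples M \<beta>" "germ y y'" "a @ y' \<in> \<Theta>" "Gr a z y'" unfolding H_def by blast
    have "agree a y y'" by (rule agree\<Theta>[OF real_tuples[OF a] yt y'(1) ay y'(3,2)])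
    then obtain z' where "Gr a z' y" "Gr a z' y'" unfolding agree_def by blast
    then show "Gr a z y" using Gr_fun[OF y'(4)] by simp
  next
    assume "Gr a z y"
    then show "H a y z" unfolding H_def using yt germ_refl[OF y] ay by blast
  qed
qed

lemma definable_H: "definable M A (\<sigma> @ \<beta> @ \<rho>) (rel3 M \<sigma> \<beta> \<rho> H)"
proof (rule Def_set3[where \<Gamma> = "(\<lambda>_. \<beta>)(0 := \<sigma>, 2 := \<rho>)" and i = 0 and j = "Suc 0" and k = 2, OF struct])
  let ?\<Gamma> = "(\<lambda>_. \<beta>)(0 := \<sigma>, 2 := \<rho>)"
  show "Def M A ?\<Gamma> (\<lambda>v. H (v 0) (v (Suc 0)) (v 2))"
    unfolding H_def
    by (rule Def_ex[where i = 3 and Q = "\<lambda>v y'. germ (v (Suc 0)) y' \<and> v 0 @ y' \<in> \<Theta> \<and> Gr (v 0) (v 2) y'", OF struct])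
      (simp, intro Def_conj[OF struct] Def_germ Def_mem2[OF struct] Def_Gr, use def\<Theta> in simp_all)
qed simp_all

lemma Def_H: "\<Gamma> i = \<sigma> \<Longrightarrow> \<Gamma> j = \<beta> \<Longrightarrow> \<Gamma> k = \<rho> \<Longrightarrow> Def M A \<Gamma> (\<lambda>v. H (v i) (v j) (v k))"
  by (rule Def_rel3[OF struct definable_H])

text \<open>
  The parameters from \<open>S\<close> are arranged as one tuple \<open>t\<close> of a power of \<open>S\<close>, which can then be
  varied, while \<open>\<Delta>\<close> is over \<open>A\<close>.
\<close>

lemma stably_embedded_parameters:
  assumes X: "X \<subseteq> set_power S n" "definable M UNIV (concat (replicate n \<rho>)) X"
  shows "\<exists>m \<Delta>. \<exists>t\<in>set_power S m. definable M A (concat (replicate n \<rho>) @ concat (replicate m \<rho>)) \<Delta> \<and>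
    (\<forall>w\<in>tuples M (concat (replicate n \<rho>)). w \<in> X \<longleftrightarrow> w @ t \<in> \<Delta>)"
proof -
  have "definable M (A \<union> (\<Union>s\<in>S. set s)) (concat (replicate n \<rho>)) X"
    using SE X unfolding stably_embedded_def by blast
  from definable_finite_parameters[OF this] obtain d where
    d: "set d \<subseteq> A \<union> (\<Union>s\<in>S. set s)" "definable M (set d) (concat (replicate n \<rho>)) X" by (elim exE conjE)
  have "\<exists>ts. set ts \<subseteq> S \<and> set d \<subseteq> A \<union> set (concat ts)" using d(1)
  proof (induction d)
    case Nil
    have "set [] \<subseteq> S \<and> set [] \<subseteq> A \<union> set (concat [])" by simp
    then show ?case by blast
  next
    case (Cons x d)
    then obtain ts where ts: "set ts \<subseteq> S" "set d \<subseteq> A \<union> set (concat ts)" by auto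
    show ?case
    proof (cases "x \<in> A")
      case True then show ?thesis using ts by (intro exI[of _ ts]) auto
    next
      case False
      then obtain s where "s \<in> S" "x \<in> set s" using Cons.prems by auto
      then show ?thesis using ts by (intro exI[of _ "s # ts"]) auto
    qed
  qed
  then obtain ts where ts: "set ts \<subseteq> S" "set d \<subseteq> A \<union> set (concat ts)" by (elim exE conjE)
  have "definable M (A \<union> set (concat ts)) (concat (replicate n \<rho>)) X" by (rule definable_mono[OF d(2) ts(2)])
  from definable_abstract[OF this] obtain \<Delta> where
    \<Delta>: "definable M A (concat (replicate n \<rho>) @ map (srt M) (concat ts)) \<Delta>"
      "X = {w \<in> tuples M (concat (replicate n \<rho>)). w @ concat ts \<in> \<Delta>}" by (elim exE conjE)
  have t: "concat ts \<in> set_power S (length ts)" using ts(1) unfolding set_power_def by blast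
  then have "concat ts \<in> tuples M (concat (replicate (length ts) \<rho>))"
    using set_power_tuples[OF definable_sub[OF defS]] by blast
  then have "map (srt M) (concat ts) = concat (replicate (length ts) \<rho>)" by (simp only: tuples_def mem_Collect_eq)
  then have "definable M A (concat (replicate n \<rho>) @ concat (replicate (length ts) \<rho>)) \<Delta>" using \<Delta>(1) by (simp only:)
  then show ?thesis using t \<Delta>(2) by (intro exI[of _ "length ts"] exI[of _ \<Delta>] bexI[of _ "concat ts"]) simp_all
qed

text \<open>
  Let \<open>c\<close> be a finite Morley sequence.  A tuple \<open>v\<close> of elements of \<open>S\<close> codes the germ of \<open>y\<close> if
  \<open>f\<^sub>y(c\<^sub>i) = v\<^sub>i\<close> for all \<open>i\<close> with few exceptions.  Every germ has a code, and a code determines its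
  germ.  So the fibre of \<open>H\<close> over \<open>a\<close> is determined by the set \<open>D a\<close> of all concatenations of a code
  of \<open>y\<close> and a \<open>z\<close> with \<open>H(a, y, z)\<close>.  This is a subset of a power of \<open>S\<close>, and by stable
  embeddedness it equals \<open>{w. w @ t \<in> \<Delta>}\<close> for some \<open>\<Delta>\<close> over \<open>A\<close> and some \<open>t\<close> in a power of \<open>S\<close>.
  For fixed \<open>\<Delta>\<close> the tuple \<open>t\<close> determines \<open>h a\<close>, so the values of \<open>h\<close> that come from \<open>\<Delta>\<close> are
  internal to \<open>S\<close>.  By compactness finitely many \<open>\<Delta>\<close> suffice, and it remains to take a finite union.
  If \<open>S\<close> has at most one element, such unions need not be internal, but then \<open>h\<close> is constant.
\<close>

theorem internal_code:
  assumes h: "definable_fun M A \<sigma> X \<tau> h"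
    and h_eq: "\<And>a a'. a \<in> X \<Longrightarrow> a' \<in> X \<Longrightarrow> (\<And>y z. H a y z \<longleftrightarrow> H a' y z) \<Longrightarrow> h a = h a'"
    and ne: "\<And>a. a \<in> X \<Longrightarrow> \<exists>y z. H a y z"
  shows "internal M \<rho> S \<tau> (h ` X)"
proof -
  have defX: "definable M A \<sigma> X" using h unfolding definable_fun_def by blast
  have Xt: "X \<subseteq> tuples M \<sigma>" by (rule definable_sub[OF defX])
  have St: "S \<subseteq> tuples M \<rho>" by (rule definable_sub[OF defS])
  obtain N1 where N1: "\<forall>y y' as. mor A as \<and> germ y y' \<longrightarrow> length (filter (\<lambda>a. \<not> agree a y y') as) \<le> N1"
    using disagree_bound ..
  obtain N2 where N2: "\<forall>y y' as. mor A as \<and> y \<in> tuples M \<beta> \<and> y' \<in> tuples M \<beta> \<and> \<not> germ y y' \<longrightarrow>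
    length (filter (\<lambda>a. agree a y y') as) \<le> N2" using agree_bound ..
  define N where "N = N1 + N2"
  \<comment> \<open>Two germs with a common code agree at all but \<open>2 * N\<close> places, which is more than the \<open>N\<close>
    places at which different germs may agree.  Place \<open>K\<close> of a code is reserved for the value \<open>z\<close>.\<close>
  define K where "K = 3 * N + 1"
  obtain c where c: "length c = K \<and> mor A c" using mor_exists[OF smallA] ..
  have ct: "c ! i \<in> tuples M \<sigma>" if "i < K" for i using mor_real[of A c "c ! i"] c that real_tuples nth_mem by blast
  \<comment> \<open>The exceptions are quantified as a set \<open>J\<close> of indices, one of finitely many, so that
    definability is evident.\<close>
  define codes where "codes v y \<longleftrightarrow> germ y y \<and>
    (\<exists>J\<in>{J \<in> Pow {..<K}. card J \<le> N}. \<forall>i\<in>{..<K}. \<not> Gr (c ! i) (v i) y \<longrightarrow> i \<in> J)" for v y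
  have codes_cong: "codes v y \<longleftrightarrow> codes v' y" if "\<And>i. i < K \<Longrightarrow> v i = v' i" for v v' y
    unfolding codes_def using that by simp
  have codes_germ: "germ y y'" if cy: "codes v y" and cy': "codes v y'" for v y y'
  proof (rule ccontr)
    assume no: "\<not> germ y y'"
    obtain J where J: "J \<subseteq> {..<K}" "card J \<le> N" "\<forall>i\<in>{..<K}. \<not> Gr (c ! i) (v i) y \<longrightarrow> i \<in> J"
      using cy unfolding codes_def by blast
    obtain J' where J': "J' \<subseteq> {..<K}" "card J' \<le> N" "\<forall>i\<in>{..<K}. \<not> Gr (c ! i) (v i) y' \<longrightarrow> i \<in> J'"
      using cy' unfolding codes_def by blast
    have yt: "y \<in> tuples M \<beta>" "y' \<in> tuples M \<beta>" using cy cy' germ_tuples unfolding codes_def by blast+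
    have "agree (c ! i) y y'" if "i \<in> {..<K} - (J \<union> J')" for i
    proof -
      have "Gr (c ! i) (v i) y" "Gr (c ! i) (v i) y'" using that J(3) J'(3) by blast+
      then show ?thesis unfolding agree_def Gr_def by blast
    qed
    then have "{..<K} - (J \<union> J') \<subseteq> {i. i < length c \<and> agree (c ! i) y y'}" using c by auto
    then have "card ({..<K} - (J \<union> J')) \<le> length (filter (\<lambda>a. agree a y y') c)"
      unfolding length_filter_conv_card by (intro card_mono) simp_all
    also have "\<dots> \<le> N2" using N2[rule_format, of c y y'] c yt no by simp
    also have "\<dots> \<le> N" by (simp add: N_def)
    finally have "card ({..<K} - (J \<union> J')) \<le> N" .
    moreover have "K - card (J \<union> J') \<le> card ({..<K} - (J \<union> J'))"
      using diff_card_le_card_Diff[of "J \<union> J'" "{..<K}"] J(1) J'(1) finite_subset[of "J \<union> J'" "{..<K}"] by simp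
    moreover have "card (J \<union> J') \<le> N + N" using card_Un_le[of J J'] J(2) J'(2) by simp
    ultimately show False unfolding K_def by simp
  qed
  have codes_exist: "\<exists>v. (\<forall>i. v i \<in> S) \<and> v K = s \<and> codes v y" if g: "germ y y" and s: "s \<in> S" for y s
  proof -
    \<comment> \<open>The element \<open>s\<close> fills the places at which \<open>f\<^sub>y\<close> is undefined.\<close>
    define v where "v i = (if i < K \<and> (\<exists>z. Gr (c ! i) z y) then (SOME z. Gr (c ! i) z y) else s)" for i
    have v: "Gr (c ! i) (v i) y" if "i < K" "Gr (c ! i) z y" for i z
      using that someI[of "\<lambda>z. Gr (c ! i) z y" z] unfolding v_def by auto
    have "v i \<in> S" for i
    proof (cases "i < K \<and> (\<exists>z. Gr (c ! i) z y)")
      case True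
      then obtain z where "i < K" "Gr (c ! i) z y" by (elim conjE exE)
      then show ?thesis by (rule Gr_S[OF v])
    next
      case False
      then have "v i = s" unfolding v_def by (rule if_not_P)
      then show ?thesis using s by simp
    qed
    moreover have "v K = s" by (simp add: v_def)
    moreover have "codes v y" unfolding codes_def
    proof (intro conjI g)
      let ?J = "{i. i < length c \<and> \<not> agree (c ! i) y y}"
      have "card ?J \<le> N1" using N1[rule_format, of c y y] c g unfolding length_filter_conv_card by simp
      then have "?J \<in> {J \<in> Pow {..<K}. card J \<le> N}" using c by (auto simp: N_def)
      moreover have "\<forall>i\<in>{..<K}. \<not> Gr (c ! i) (v i) y \<longrightarrow> i \<in> ?J"
        using v c unfolding agree_def by auto
      ultimately show "\<exists>J\<in>{J \<in> Pow {..<K}. card J \<le> N}. \<forall>i\<in>{..<K}. \<not> Gr (c ! i) (v i) y \<longrightarrow> i \<in> J" by (rule bexI[rotated])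
    qed
    ultimately show ?thesis by (intro exI[of _ v]) simp
  qed
  let ?\<pi> = "concat (replicate (Suc K) \<rho>)"
  let ?js = "[0..<Suc K]"
  define D where "D a w \<longleftrightarrow> (\<exists>v. w = concat (map v ?js) \<and> (\<forall>i\<in>{..<Suc K}. v i \<in> S) \<and> (\<exists>y\<in>tuples M \<beta>. codes v y \<and> H a y (v K)))" for a w
  have same_v: "v i = v' i" if "concat (map v ?js) = concat (map v' ?js)" "\<forall>i\<in>{..<Suc K}. v i \<in> S"
    "\<forall>i\<in>{..<Suc K}. v' i \<in> S" "i < Suc K" for v v' :: "nat \<Rightarrow> 'm list" and i
  proof -
    have "map v ?js = map v' ?js" by (rule concat_inj[of _ _ M \<rho>]) (use that St in auto)
    then show ?thesis using that(4) by (auto simp: less_Suc_eq)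
  qed
  have D_H: "H a' y z" if D: "\<And>w. D a w \<longleftrightarrow> D a' w" and Hz: "H a y z" for a a' y z
  proof -
    obtain v where v: "\<forall>i. v i \<in> S" "v K = z" "codes v y"
      using codes_exist[OF H_germ_refl[OF Hz] H_S[OF Hz]] by (elim exE conjE)
    have "D a (concat (map v ?js))" unfolding D_def
      by (rule exI[of _ v]) (use v Hz H_tuples[OF Hz] in blast)
    then obtain v' y' where v': "concat (map v ?js) = concat (map v' ?js)" "\<forall>i\<in>{..<Suc K}. v' i \<in> S"
      "codes v' y'" "H a' y' (v' K)" using D unfolding D_def by blast
    have eq: "v i = v' i" if "i < Suc K" for i by (rule same_v[OF v'(1) _ v'(2) that]) (use v(1) in simp)
    then have "codes v y'" using v'(3) codes_cong[of v v' y'] by simp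
    then have "germ y' y" using v(3) codes_germ by blast
    then show ?thesis using H_germ[OF v'(4)] eq[of K] v(2) by simp
  qed
  have D_h: "h a = h a'" if "a \<in> X" "a' \<in> X" "\<And>w. D a w \<longleftrightarrow> D a' w" for a a'
    using that D_H[of a a'] D_H[of a' a] by (intro h_eq) blast+
  have D_sub: "w \<in> set_power S (Suc K)" if Dw: "D a w" for a w
  proof -
    obtain v where "w = concat (map v ?js)" "\<forall>i\<in>{..<Suc K}. v i \<in> S" using Dw unfolding D_def by blast
    moreover have "length (map v ?js) = Suc K" by simp
    moreover have "set (map v ?js) \<subseteq> S" using calculation(2) by auto
    ultimately show ?thesis unfolding set_power_def by blast
  qed
  define B where "B = A \<union> set (concat c)"
  have smallB: "small \<kappa> B" unfolding B_def by (rule small_list_Un[OF smallA])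
  have AB: "A \<subseteq> B" unfolding B_def by simp
  have defD: "definable M B (\<sigma> @ ?\<pi>) (rel2 M \<sigma> ?\<pi> D)"
  proof -
    let ?\<Gamma> = "(\<lambda>_. \<rho>)(Suc K := \<beta>, K + 2 := \<sigma>)"
    define Q where "Q v \<longleftrightarrow> (\<forall>i\<in>{..<Suc K}. v i \<in> S) \<and> (\<exists>y\<in>tuples M \<beta>. codes v y \<and> H (v (K + 2)) y (v K))" for v
    have 1: "Def M B ?\<Gamma> (\<lambda>v. \<forall>i\<in>{..<Suc K}. v i \<in> S)"
      by (rule Def_Ball[OF struct]) (simp, rule Def_mem1[OF struct], use definable_mono[OF defS AB] in auto)
    have Gr_i: "Def M B ?\<Gamma> (\<lambda>v. Gr (c ! i) (v i) (v (Suc K)))" if i: "i < K" for i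
    proof (rule Def_param[where Q = "\<lambda>v x. Gr x (v i) (v (Suc K))" and i = "K + 2" and \<tau> = \<sigma>, OF struct _ ct[OF i]])
      show "set (c ! i) \<subseteq> B" using nth_mem[of i c] i c unfolding B_def by auto
      show "Def M B ?\<Gamma> (\<lambda>v. Gr (v (K + 2)) (v i) (v (Suc K)))"
        by (rule Def_mono[OF Def_Gr AB]) (use i in simp_all)
    qed (use i in simp_all)
    have 2: "Def M B ?\<Gamma> (\<lambda>v. codes v (v (Suc K)))" unfolding codes_def
      by (intro Def_conj[OF struct] Def_Bex[OF struct] Def_Ball[OF struct] Def_imp[OF struct] Def_neg Gr_i Def_const[OF struct]
          Def_mono[OF Def_germ AB]) simp_all
    have "Def M B ?\<Gamma> (\<lambda>v. codes v (v (Suc K)) \<and> H (v (K + 2)) (v (Suc K)) (v K))"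
      by (rule Def_conj[OF struct 2 Def_mono[OF Def_H AB]]) simp_all
    then have 3: "Def M B ?\<Gamma> (\<lambda>v. \<exists>y\<in>tuples M \<beta>. codes v y \<and> H (v (K + 2)) y (v K))"
    proof (rule Def_ex[where i = "Suc K" and Q = "\<lambda>v y. codes v y \<and> H (v (K + 2)) y (v K)", OF struct, rotated])
      fix v y d
      have "codes (v(Suc K := d)) y \<longleftrightarrow> codes v y" by (rule codes_cong) simp
      then show "codes (v(Suc K := d)) y \<and> H ((v(Suc K := d)) (K + 2)) y ((v(Suc K := d)) K) \<longleftrightarrow>
        codes v y \<and> H (v (K + 2)) y (v K)" by simp
    qed simp
    have "Def M B ?\<Gamma> Q" unfolding Q_def by (rule Def_conj[OF struct 1 3])
    then have "definable M B (concat (map ?\<Gamma> ((K + 2) # ?js))) {concat (map v ((K + 2) # ?js)) |v. blocks M ?\<Gamma> v \<and> Q v}"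
      by (rule Def_image[OF struct]) simp
    also have "map ?\<Gamma> ((K + 2) # ?js) = \<sigma> # map (\<lambda>_. \<rho>) ?js" by (simp del: upt_Suc)
    also have "concat (\<sigma> # map (\<lambda>_. \<rho>) ?js) = \<sigma> @ ?\<pi>" by (simp only: concat.simps concat_replicate)
    also have "{concat (map v ((K + 2) # ?js)) |v. blocks M ?\<Gamma> v \<and> Q v} = rel2 M \<sigma> ?\<pi> D"
    proof (intro equalityI subsetI)
      fix w assume "w \<in> {concat (map v ((K + 2) # ?js)) |v. blocks M ?\<Gamma> v \<and> Q v}"
      then obtain v where v: "w = v (K + 2) @ concat (map v ?js)" "blocks M ?\<Gamma> v" "Q v" by auto
      have "D (v (K + 2)) (concat (map v ?js))" using v(3) unfolding Q_def D_def by blast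
      moreover have "v (K + 2) \<in> tuples M \<sigma>" using blocksD[OF v(2), of "K + 2"] by simp
      moreover have "concat (map v ?js) \<in> tuples M ?\<pi>"
        using D_sub[OF calculation(1)] set_power_tuples[OF St] by blast
      ultimately show "w \<in> rel2 M \<sigma> ?\<pi> D" using v(1) by (simp add: rel2_iff)
    next
      fix w assume "w \<in> rel2 M \<sigma> ?\<pi> D"
      then obtain a u where w: "w = a @ u" "a \<in> tuples M \<sigma>" "D a u" unfolding rel2_def by blast
      obtain v y where v: "u = concat (map v ?js)" "\<forall>i\<in>{..<Suc K}. v i \<in> S" "y \<in> tuples M \<beta>" "codes v y" "H a y (v K)"
        using w(3) unfolding D_def by blast
      let ?v = "(\<lambda>i. if i < Suc K then v i else v K)(Suc K := b, K + 2 := a)"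
      have "blocks M ?\<Gamma> ?v" unfolding blocks_def using v(2) St w(2) by auto
      moreover have "codes ?v y" using v(4) codes_cong[of ?v v y] by simp
      then have "Q ?v" unfolding Q_def using v(2,3,5) by auto
      moreover have "map ?v ?js = map v ?js" by (intro map_cong) auto
      then have "w = concat (map ?v ((K + 2) # ?js))" using w(1) v(1) by (simp del: upt_Suc map_eq_conv)
      ultimately show "w \<in> {concat (map v ((K + 2) # ?js)) |v. blocks M ?\<Gamma> v \<and> Q v}" by blast
    qed
    finally show ?thesis .
  qed
  \<comment> \<open>The arguments for which \<open>\<Delta>\<close> defines \<open>D a\<close> with some parameter from \<open>set_power S m\<close>.\<close>
  define V where "V m \<Delta> = {a \<in> tuples M \<sigma>. a \<in> X \<and> (\<exists>t\<in>tuples M (concat (replicate m \<rho>)). t \<in> set_power S m \<and>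
    (\<forall>w\<in>tuples M ?\<pi>. D a w \<longleftrightarrow> w @ t \<in> \<Delta>))}" for m \<Delta>
  define QQ where "QQ = {(m, \<Delta>). definable M A (?\<pi> @ concat (replicate m \<rho>)) \<Delta>}"
  have defE: "Def M B \<Gamma> (\<lambda>v. \<forall>w\<in>tuples M ?\<pi>. D (v i) w \<longleftrightarrow> w @ v j \<in> \<Delta>)"
    if "definable M A (?\<pi> @ concat (replicate m \<rho>)) \<Delta>" "\<Gamma> i = \<sigma>" "\<Gamma> j = concat (replicate m \<rho>)" "\<Gamma> k = ?\<pi>" "k \<noteq> i" "k \<noteq> j"
    for m \<Delta> \<Gamma> and i j k :: nat
  proof (rule Def_all[where i = k and Q = "\<lambda>v w. D (v i) w \<longleftrightarrow> w @ v j \<in> \<Delta>", OF struct])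
    show "\<Gamma> k = ?\<pi>" by (rule that(4))
    show "Def M B \<Gamma> (\<lambda>v. D (v i) (v k) \<longleftrightarrow> v k @ v j \<in> \<Delta>)"
      by (rule Def_iff[OF struct Def_rel2[OF struct defD that(2,4)] Def_mem2[OF struct]])
        (use definable_mono[OF that(1) AB] that(3,4) in simp)
  qed (use that(5,6) in simp)
  have defV: "definable M B \<sigma> (V m \<Delta>)" if "(m, \<Delta>) \<in> QQ" for m \<Delta>
    unfolding V_def
  proof (rule Def_set1[where \<Gamma> = "(\<lambda>_. ?\<pi>)(0 := \<sigma>, Suc 0 := concat (replicate m \<rho>))" and i = 0, OF struct])
    let ?\<Gamma> = "(\<lambda>_. ?\<pi>)(0 := \<sigma>, Suc 0 := concat (replicate m \<rho>))"
    have \<Delta>: "definable M A (?\<pi> @ concat (replicate m \<rho>)) \<Delta>" using that by (simp add: QQ_def)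
    have E: "Def M B ?\<Gamma> (\<lambda>v. \<forall>w\<in>tuples M ?\<pi>. D (v 0) w \<longleftrightarrow> w @ v (Suc 0) \<in> \<Delta>)"
      by (rule defE[OF \<Delta>, where k = 2]) simp_all
    have T: "Def M B ?\<Gamma> (\<lambda>v. v (Suc 0) \<in> set_power S m)"
      by (rule Def_mem1[OF struct]) (use definable_set_power[OF definable_mono[OF defS AB]] in simp)
    have "Def M B ?\<Gamma> (\<lambda>v. \<exists>t\<in>tuples M (concat (replicate m \<rho>)). t \<in> set_power S m \<and>
        (\<forall>w\<in>tuples M ?\<pi>. D (v 0) w \<longleftrightarrow> w @ t \<in> \<Delta>))"
      by (rule Def_ex[where i = "Suc 0" and Q = "\<lambda>v t. t \<in> set_power S m \<and> (\<forall>w\<in>tuples M ?\<pi>. D (v 0) w \<longleftrightarrow> w @ t \<in> \<Delta>)",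
            OF struct _ Def_conj[OF struct T E]]) simp_all
    then show "Def M B ?\<Gamma> (\<lambda>v. v 0 \<in> X \<and> (\<exists>t\<in>tuples M (concat (replicate m \<rho>)). t \<in> set_power S m \<and>
        (\<forall>w\<in>tuples M ?\<pi>. D (v 0) w \<longleftrightarrow> w @ t \<in> \<Delta>)))"
      by (intro Def_conj[OF struct Def_mem1[OF struct]]) (use definable_mono[OF defX AB] in simp_all)
  qed simp
  have coverV: "\<exists>m \<Delta>. (m, \<Delta>) \<in> QQ \<and> a \<in> V m \<Delta>" if a: "a \<in> X" for a
  proof -
    have at: "a \<in> tuples M \<sigma>" using a Xt by blast
    let ?Y = "{w \<in> tuples M ?\<pi>. a @ w \<in> rel2 M \<sigma> ?\<pi> D}"
    have Y: "w \<in> ?Y \<longleftrightarrow> D a w" if "w \<in> tuples M ?\<pi>" for w using that at by (simp add: rel2_iff)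
    have defY: "definable M UNIV ?\<pi> ?Y" by (rule definable_fibre_left[OF struct defD at]) simp
    have "?Y \<subseteq> set_power S (Suc K)" using Y D_sub by blast
    from stably_embedded_parameters[OF this defY] obtain m \<Delta> t where \<Delta>: "t \<in> set_power S m" "definable M A (?\<pi> @ concat (replicate m \<rho>)) \<Delta>"
      "\<forall>w\<in>tuples M ?\<pi>. w \<in> ?Y \<longleftrightarrow> w @ t \<in> \<Delta>" by (elim exE bexE conjE)
    have "a \<in> V m \<Delta>" unfolding V_def using at a \<Delta>(1,3) Y set_power_tuples[OF St, of m] by blast
    then show ?thesis using \<Delta>(2) unfolding QQ_def by blast
  qed
  have "\<exists>F. finite F \<and> F \<subseteq> insert X ((\<lambda>q. tuples M \<sigma> - V (fst q) (snd q)) ` QQ) \<and> (\<forall>a\<in>tuples M \<sigma>. \<exists>Y\<in>F. a \<notin> Y)"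
  proof (rule compactness[OF smallB])
    fix Y assume "Y \<in> insert X ((\<lambda>q. tuples M \<sigma> - V (fst q) (snd q)) ` QQ)"
    then show "definable M B \<sigma> Y"
      using definable_mono[OF defX AB] definable_Diff[OF defV] by (elim insertE imageE) simp_all
  next
    fix a assume "a \<in> tuples M \<sigma>"
    show "\<exists>Y\<in>insert X ((\<lambda>q. tuples M \<sigma> - V (fst q) (snd q)) ` QQ). a \<notin> Y"
    proof (cases "a \<in> X")
      case True
      then obtain m \<Delta> where "(m, \<Delta>) \<in> QQ" "a \<in> V m \<Delta>" using coverV by blast
      then have "a \<notin> tuples M \<sigma> - V (fst (m, \<Delta>)) (snd (m, \<Delta>))" by simp
      then show ?thesis using imageI[OF \<open>(m, \<Delta>) \<in> QQ\<close>] by (rule bexI[OF _ insertI2])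
    qed simp
  qed
  then obtain F where F: "finite F \<and> F \<subseteq> insert X ((\<lambda>q. tuples M \<sigma> - V (fst q) (snd q)) ` QQ) \<and>
    (\<forall>a\<in>tuples M \<sigma>. \<exists>Y\<in>F. a \<notin> Y)" ..
  have "finite (F - {X})" "F - {X} \<subseteq> (\<lambda>q. tuples M \<sigma> - V (fst q) (snd q)) ` QQ" using F by auto
  from finite_subset_image[OF this] obtain Q where
    Q: "Q \<subseteq> QQ" "finite Q" "F - {X} = (\<lambda>q. tuples M \<sigma> - V (fst q) (snd q)) ` Q" by (elim exE conjE)
  have hX: "h ` X = \<Union>((\<lambda>q. h ` V (fst q) (snd q)) ` Q)"
  proof (intro equalityI subsetI)
    fix e assume "e \<in> h ` X"
    then obtain a where a: "a \<in> X" "e = h a" by blast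
    then obtain Y where Y: "Y \<in> F" "a \<notin> Y" using F Xt by (metis subsetD)
    then have "Y \<in> F - {X}" using a by blast
    then obtain q where "q \<in> Q" "Y = tuples M \<sigma> - V (fst q) (snd q)" unfolding Q(3) by (elim imageE)
    then show "e \<in> \<Union>((\<lambda>q. h ` V (fst q) (snd q)) ` Q)" using Y(2) a Xt by blast
  qed (auto simp: V_def)
  let ?G = "(\<lambda>a. a @ h a) ` X"
  have defG: "definable M A (\<sigma> @ \<tau>) ?G" and ht: "h ` X \<subseteq> tuples M \<tau>" using h unfolding definable_fun_def by blast+
  have SU: "definable M UNIV \<rho> S" by (rule definable_mono[OF defS]) simp
  have internal_V: "internal M \<rho> S \<tau> (h ` V m \<Delta>)" if q: "(m, \<Delta>) \<in> QQ" for m \<Delta>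
  proof (cases "V m \<Delta> = {}")
    case True then show ?thesis by (simp add: internal_def)
  next
    case False
    then obtain a0 where a0: "a0 \<in> V m \<Delta>" by blast
    have a0X: "a0 \<in> X" using a0 unfolding V_def by blast
    have h0: "h a0 \<in> tuples M \<tau>" using a0X ht by blast
    have \<Delta>: "definable M A (?\<pi> @ concat (replicate m \<rho>)) \<Delta>" using q by (simp add: QQ_def)
    let ?m = "concat (replicate m \<rho>)"
    define E where "E a t \<longleftrightarrow> (\<forall>w\<in>tuples M ?\<pi>. D a w \<longleftrightarrow> w @ t \<in> \<Delta>)" for a t
    \<comment> \<open>The surjection sends \<open>t\<close> to \<open>h a\<close> if \<open>t\<close> is the parameter of some \<open>a\<close>, and to the fixed value
      \<open>h a0\<close> otherwise.\<close>
    define R where "R = rel2 M ?m \<tau> (\<lambda>t e. (\<exists>a\<in>tuples M \<sigma>. (a \<in> X \<and> E a t) \<and> a @ e \<in> ?G) \<or>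
      \<not> (\<exists>a\<in>tuples M \<sigma>. a \<in> X \<and> E a t) \<and> e \<in> {h a0})"
    let ?\<Gamma> = "(\<lambda>_. ?\<pi>)(0 := ?m, Suc 0 := \<tau>, 2 := \<sigma>)"
    have XE: "Def M UNIV ?\<Gamma> (\<lambda>v. v 2 \<in> X \<and> E (v 2) (v 0))"
    proof (rule Def_conj[OF struct Def_mem1[OF struct]])
      show "definable M UNIV (?\<Gamma> 2) X" using definable_mono[OF defX subset_UNIV] by simp
      show "Def M UNIV ?\<Gamma> (\<lambda>v. E (v 2) (v 0))" unfolding E_def
        by (rule Def_mono[OF defE[OF \<Delta>, where k = 3]]) simp_all
    qed
    have defR: "definable M UNIV (?m @ \<tau>) R" unfolding R_def
    proof (rule Def_set2[where \<Gamma> = ?\<Gamma> and i = 0 and j = "Suc 0", OF struct])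
      have 1: "Def M UNIV ?\<Gamma> (\<lambda>v. v 2 @ v (Suc 0) \<in> ?G)"
        by (rule Def_mem2[OF struct]) (use definable_mono[OF defG subset_UNIV] in simp)
      have 2: "Def M UNIV ?\<Gamma> (\<lambda>v. \<exists>a\<in>tuples M \<sigma>. (a \<in> X \<and> E a (v 0)) \<and> a @ v (Suc 0) \<in> ?G)"
        by (rule Def_ex[where i = 2 and Q = "\<lambda>v a. (a \<in> X \<and> E a (v 0)) \<and> a @ v (Suc 0) \<in> ?G",
              OF struct _ Def_conj[OF struct XE 1]]) simp_all
      have 3: "Def M UNIV ?\<Gamma> (\<lambda>v. \<exists>a\<in>tuples M \<sigma>. a \<in> X \<and> E a (v 0))"
        by (rule Def_ex[where i = 2 and Q = "\<lambda>v a. a \<in> X \<and> E a (v 0)", OF struct _ XE]) simp_all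
      have 4: "Def M UNIV ?\<Gamma> (\<lambda>v. v (Suc 0) \<in> {h a0})"
        by (rule Def_mem1[OF struct]) (use definable_singleton[OF struct h0] in simp)
      show "Def M UNIV ?\<Gamma> (\<lambda>v. (\<exists>a\<in>tuples M \<sigma>. (a \<in> X \<and> E a (v 0)) \<and> a @ v (Suc 0) \<in> ?G) \<or>
        \<not> (\<exists>a\<in>tuples M \<sigma>. a \<in> X \<and> E a (v 0)) \<and> v (Suc 0) \<in> {h a0})"
        by (rule Def_disj[OF struct 2 Def_conj[OF struct Def_neg[OF 3] 4]])
    qed simp_all
    have E_h: "h a = h a'" if "a \<in> X" "a' \<in> X" "E a t" "E a' t" for a a' t
    proof (rule D_h[OF that(1,2)])
      fix w show "D a w \<longleftrightarrow> D a' w"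
        using that(3,4) D_sub[of a w] D_sub[of a' w] set_power_tuples[OF St, of "Suc K"] unfolding E_def by blast
    qed
    have tm: "t \<in> tuples M ?m" if "t \<in> set_power S m" for t using that set_power_tuples[OF St] by blast
    have R1: "t @ e \<in> R \<longleftrightarrow> e = h a" if "t \<in> set_power S m" "a \<in> X" "E a t" for t e a
    proof -
      have "t @ e \<in> R \<longleftrightarrow> e \<in> tuples M \<tau> \<and> (\<exists>a\<in>tuples M \<sigma>. (a \<in> X \<and> E a t) \<and> a @ e \<in> ?G)"
        unfolding R_def rel2_iff[OF tm[OF that(1)]] using that(2,3) Xt by blast
      also have "\<dots> \<longleftrightarrow> e = h a"
      proof
        assume "e \<in> tuples M \<tau> \<and> (\<exists>a\<in>tuples M \<sigma>. (a \<in> X \<and> E a t) \<and> a @ e \<in> ?G)"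
        then obtain a' where "a' \<in> X" "E a' t" "a' @ e \<in> ?G" by (elim conjE bexE)
        then show "e = h a" using graph_iff[OF h, of a' e] E_h[of a' a t] that(2,3) by simp
      next
        assume e: "e = h a"
        then have "a @ e \<in> ?G" "e \<in> tuples M \<tau>" "a \<in> tuples M \<sigma>" using that(2) ht Xt by blast+
        then show "e \<in> tuples M \<tau> \<and> (\<exists>a\<in>tuples M \<sigma>. (a \<in> X \<and> E a t) \<and> a @ e \<in> ?G)" using that(2,3) by blast
      qed
      finally show ?thesis .
    qed
    have R2: "t @ e \<in> R \<longleftrightarrow> e = h a0" if "t \<in> set_power S m" "\<not> (\<exists>a\<in>X. E a t)" for t e
      unfolding R_def rel2_iff[OF tm[OF that(1)]] using that(2) h0 by blast
    show ?thesis
    proof (rule internalI[OF SU defR])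
      fix t assume t: "t \<in> set_power S m"
      show "\<exists>!e. t @ e \<in> R"
      proof (cases "\<exists>a\<in>X. E a t")
        case True
        then obtain a where "a \<in> X" "E a t" ..
        then show ?thesis using R1[OF t] by simp
      next
        case False then show ?thesis using R2[OF t] by simp
      qed
    next
      show "h ` V m \<Delta> = {e. \<exists>t\<in>set_power S m. t @ e \<in> R}"
      proof (intro equalityI subsetI)
        fix e assume "e \<in> h ` V m \<Delta>"
        then obtain a t where a: "e = h a" "a \<in> X" "t \<in> set_power S m" "E a t" unfolding V_def E_def by blast
        then have "t @ e \<in> R" using R1[OF a(3,2,4)] by simp
        then show "e \<in> {e. \<exists>t\<in>set_power S m. t @ e \<in> R}" using a(3) by blast
      next
        fix e assume "e \<in> {e. \<exists>t\<in>set_power S m. t @ e \<in> R}"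
        then obtain t where t: "t \<in> set_power S m" "t @ e \<in> R" by blast
        show "e \<in> h ` V m \<Delta>"
        proof (cases "\<exists>a\<in>X. E a t")
          case True
          then obtain a where a: "a \<in> X" "E a t" ..
          then have "a \<in> V m \<Delta>" unfolding V_def using Xt t(1) tm[OF t(1)] unfolding E_def by blast
          then show ?thesis using R1[OF t(1) a] t(2) by blast
        next
          case False then show ?thesis using R2[OF t(1)] t(2) a0 by blast
        qed
      qed
    qed
  qed
  show ?thesis
  proof (cases "\<exists>s\<in>S. \<exists>s'\<in>S. s \<noteq> s'")
    case True
    then obtain s s' where s: "s \<in> S" "s' \<in> S" "s \<noteq> s'" by (elim bexE)
    show ?thesis unfolding hX
    proof (rule internal_Union[OF SU s])
      fix Y assume "Y \<in> (\<lambda>q. h ` V (fst q) (snd q)) ` Q"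
      then obtain q where "q \<in> QQ" "Y = h ` V (fst q) (snd q)" using Q(1) by blast
      then show "internal M \<rho> S \<tau> Y" using internal_V[of "fst q" "snd q"] by simp
    qed (use Q(2) in simp)
  next
    case False
    \<comment> \<open>If \<open>S\<close> has at most one element, then so has every power of \<open>S\<close>, and all \<open>D a\<close> are equal.\<close>
    have one: "h a = h a'" if aX: "a \<in> X" and a'X: "a' \<in> X" for a a'
    proof (rule D_h[OF that])
      have "D a' w" if D: "D a w" and a': "a' \<in> X" for a a' w
      proof -
        obtain v where v: "w = concat (map v ?js)" "\<forall>i\<in>{..<Suc K}. v i \<in> S" using D unfolding D_def by blast
        obtain y z where Hz: "H a' y z" using ne[OF a'] by (elim exE)
        obtain v' where v': "\<forall>i. v' i \<in> S" "v' K = z" "codes v' y"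
          using codes_exist[OF H_germ_refl[OF Hz] H_S[OF Hz]] by (elim exE conjE)
        have "v i = v' i" if "i < Suc K" for i using False v(2) v'(1) that by (metis lessThan_iff)
        then have "map v ?js = map v' ?js" by (intro map_cong) auto
        then have "w = concat (map v' ?js)" using v(1) by (simp only:)
        then show ?thesis unfolding D_def
          by (intro exI[of _ v']) (use v' Hz H_tuples[OF Hz] in blast)
      qed
      then show "D a w \<longleftrightarrow> D a' w" for w using that by blast
    qed
    show ?thesis
    proof (cases "X = {}")
      case True then show ?thesis by (simp add: internal_def)
    next
      case False
      then obtain a where a: "a \<in> X" by blast
      have "h ` X = {h a}"
      proof (intro equalityI subsetI)
        fix e assume "e \<in> h ` X"
        then obtain a' where "a' \<in> X" "e = h a'" by blast
        then show "e \<in> {h a}" using one[OF _ a] by simp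
      qed (use a in simp)
      then show ?thesis using internal_singleton[OF SU, of "h a" \<tau>] a ht by auto
    qed
  qed
qed

text \<open>
  The domain of the canonical parameter is restricted to the arguments with nonempty fibre.  As
  \<open>f\<^sub>b\<close> is defined at the realizations of \<open>p\<close> over \<open>Ab\<close>, these lie in the new domain; it is
  definable over \<open>A\<close>, and so contains all realizations of \<open>p\<close> over \<open>A\<close>.
\<close>

theorem code_function:
  "\<exists>\<tau> X h. definable_fun M A \<sigma> X \<tau> h \<and> (\<forall>a. Real a A \<longrightarrow> a \<in> X) \<and> (\<forall>a\<in>X. h a \<in> Int_set M \<rho> S A) \<and>
    (\<forall>a\<in>X. \<forall>a'\<in>X. h a = h a' \<longrightarrow> (\<forall>y z. H a y z \<longleftrightarrow> H a' y z))"
proof -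
  obtain \<tau> X0 h where h: "definable_fun M A \<sigma> X0 \<tau> h" "\<forall>a. Real a A \<longrightarrow> a \<in> X0"
    "\<forall>a\<in>X0. \<forall>a'\<in>X0. h a = h a' \<longleftrightarrow> (\<forall>u\<in>tuples M (\<beta> @ \<rho>). a @ u \<in> rel3 M \<sigma> \<beta> \<rho> H \<longleftrightarrow> a' @ u \<in> rel3 M \<sigma> \<beta> \<rho> H)"
    using canonical_parameters[OF EI definable_H] by (elim exE conjE)
  have defX0: "definable M A \<sigma> X0" using h(1) unfolding definable_fun_def by blast
  have X0t: "X0 \<subseteq> tuples M \<sigma>" by (rule definable_sub[OF defX0])
  have h_eq: "h a = h a' \<longleftrightarrow> (\<forall>y z. H a y z \<longleftrightarrow> H a' y z)" if a: "a \<in> X0" "a' \<in> X0" for a a'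
  proof -
    have t: "a \<in> tuples M \<sigma>" "a' \<in> tuples M \<sigma>" using a X0t by blast+
    have iff: "x @ y @ z \<in> rel3 M \<sigma> \<beta> \<rho> H \<longleftrightarrow> H x y z" if "x \<in> tuples M \<sigma>" "y \<in> tuples M \<beta>" "z \<in> tuples M \<rho>" for x y z
      using that by (simp add: rel3_iff)
    have "(\<forall>u\<in>tuples M (\<beta> @ \<rho>). a @ u \<in> rel3 M \<sigma> \<beta> \<rho> H \<longleftrightarrow> a' @ u \<in> rel3 M \<sigma> \<beta> \<rho> H) \<longleftrightarrow> (\<forall>y z. H a y z \<longleftrightarrow> H a' y z)"
    proof
      assume *: "\<forall>u\<in>tuples M (\<beta> @ \<rho>). a @ u \<in> rel3 M \<sigma> \<beta> \<rho> H \<longleftrightarrow> a' @ u \<in> rel3 M \<sigma> \<beta> \<rho> H"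
      show "\<forall>y z. H a y z \<longleftrightarrow> H a' y z"
      proof (intro allI)
        fix y z
        show "H a y z \<longleftrightarrow> H a' y z"
        proof (cases "y \<in> tuples M \<beta> \<and> z \<in> tuples M \<rho>")
          case True
          then have "y @ z \<in> tuples M (\<beta> @ \<rho>)" by blast
          then show ?thesis using * iff[OF t(1)] iff[OF t(2)] True by blast
        next
          case False then show ?thesis using H_tuples by blast
        qed
      qed
    next
      assume *: "\<forall>y z. H a y z \<longleftrightarrow> H a' y z"
      show "\<forall>u\<in>tuples M (\<beta> @ \<rho>). a @ u \<in> rel3 M \<sigma> \<beta> \<rho> H \<longleftrightarrow> a' @ u \<in> rel3 M \<sigma> \<beta> \<rho> H"
      proof
        fix u assume "u \<in> tuples M (\<beta> @ \<rho>)"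
        then obtain y z where "y \<in> tuples M \<beta>" "z \<in> tuples M \<rho>" "u = y @ z" by (rule tuples_appendE)
        then show "a @ u \<in> rel3 M \<sigma> \<beta> \<rho> H \<longleftrightarrow> a' @ u \<in> rel3 M \<sigma> \<beta> \<rho> H" using iff t * by simp
      qed
    qed
    then show ?thesis using h(3) a by simp
  qed
  define X where "X = {a \<in> tuples M \<sigma>. a \<in> X0 \<and> (\<exists>y\<in>tuples M \<beta>. \<exists>z\<in>tuples M \<rho>. H a y z)}"
  have defX: "definable M A \<sigma> X" unfolding X_def
  proof (rule Def_set1[where \<Gamma> = "(\<lambda>_. \<beta>)(0 := \<sigma>, 2 := \<rho>)" and i = 0, OF struct])
    let ?\<Gamma> = "(\<lambda>_. \<beta>)(0 := \<sigma>, 2 := \<rho>)"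
    have "Def M A ?\<Gamma> (\<lambda>v. H (v 0) (v (Suc 0)) (v 2))" by (rule Def_H) simp_all
    then have "Def M A ?\<Gamma> (\<lambda>v. \<exists>z\<in>tuples M \<rho>. H (v 0) (v (Suc 0)) z)"
      by (rule Def_ex[where i = 2 and Q = "\<lambda>v z. H (v 0) (v (Suc 0)) z", OF struct, rotated]) simp_all
    then have "Def M A ?\<Gamma> (\<lambda>v. \<exists>y\<in>tuples M \<beta>. \<exists>z\<in>tuples M \<rho>. H (v 0) y z)"
      by (rule Def_ex[where i = "Suc 0" and Q = "\<lambda>v y. \<exists>z\<in>tuples M \<rho>. H (v 0) y z", OF struct, rotated]) simp_all
    then show "Def M A ?\<Gamma> (\<lambda>v. v 0 \<in> X0 \<and> (\<exists>y\<in>tuples M \<beta>. \<exists>z\<in>tuples M \<rho>. H (v 0) y z))"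
      by (intro Def_conj[OF struct Def_mem1[OF struct]]) (use defX0 in simp_all)
  qed simp
  have XX0: "X \<subseteq> X0" unfolding X_def by blast
  have hX: "definable_fun M A \<sigma> X \<tau> h" by (rule definable_fun_restrict[OF struct h(1) defX XX0])
  have real_X: "a \<in> X" if a: "Real a A" for a
  proof -
    obtain c where c: "Real c (A \<union> set b)" using real_exists[OF small_list_Un[OF smallA]] ..
    have cA: "Real c A" by (rule real_mono[OF c]) simp
    have bb: "eqtp M A b b" by (simp add: eqtp_def)
    obtain z where z: "Gr c z b" using Gr_total[OF bb c] ..
    then have "H c b z" using H_iff[OF bb c] by simp
    then have "c \<in> X" unfolding X_def using H_tuples h(2) cA by blast
    then show ?thesis using real_mem[OF cA defX] real_mem[OF a defX] by simp
  qed
  have int: "internal M \<rho> S \<tau> (h ` X)"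
  proof (rule internal_code[OF hX])
    fix a a' assume "a \<in> X" "a' \<in> X" "\<And>y z. H a y z \<longleftrightarrow> H a' y z"
    then show "h a = h a'" using h_eq XX0 by blast
  qed (auto simp: X_def)
  have "definable M A \<tau> {e \<in> tuples M \<tau>. \<exists>a\<in>tuples M \<sigma>. a @ e \<in> (\<lambda>a. a @ h a) ` X}"
  proof (rule Def_set1[where \<Gamma> = "(\<lambda>_. \<tau>)(0 := \<sigma>)" and i = 1, OF struct])
    show "Def M A ((\<lambda>_. \<tau>)(0 := \<sigma>)) (\<lambda>v. \<exists>a\<in>tuples M \<sigma>. a @ v 1 \<in> (\<lambda>a. a @ h a) ` X)"
      by (rule Def_ex[where i = 0 and Q = "\<lambda>v a. a @ v 1 \<in> (\<lambda>a. a @ h a) ` X", OF struct _ Def_mem2[OF struct]])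
        (use hX in \<open>simp_all add: definable_fun_def\<close>)
  qed simp
  also have "{e \<in> tuples M \<tau>. \<exists>a\<in>tuples M \<sigma>. a @ e \<in> (\<lambda>a. a @ h a) ` X} = h ` X"
  proof (intro equalityI subsetI)
    fix e assume "e \<in> {e \<in> tuples M \<tau>. \<exists>a\<in>tuples M \<sigma>. a @ e \<in> (\<lambda>a. a @ h a) ` X}"
    then obtain a x where a: "a \<in> tuples M \<sigma>" "a @ e = x @ h x" "x \<in> X" by blast
    then have "e = h x" using append_tuples_eq[OF a(1), of x e "h x"] X0t XX0 by blast
    then show "e \<in> h ` X" using a(3) by blast
  next
    fix e assume "e \<in> h ` X"
    then obtain a where a: "a \<in> X" "e = h a" by blast
    moreover have "a \<in> tuples M \<sigma>" "e \<in> tuples M \<tau>" using a X0t XX0 hX unfolding definable_fun_def by blast+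
    ultimately show "e \<in> {e \<in> tuples M \<tau>. \<exists>a\<in>tuples M \<sigma>. a @ e \<in> (\<lambda>a. a @ h a) ` X}" by blast
  qed
  finally have "definable M A \<tau> (h ` X)" .
  then have "h ` X \<subseteq> Int_set M \<rho> S A" using int unfolding Int_set_def by blast
  then show ?thesis using hX real_X h_eq XX0
    by (intro exI[of _ \<tau>] exI[of _ X] exI[of _ h]) blast
qed

end

section \<open>Pushforwards and graphs\<close>

context generic_type
begin

lemma pushforward_realD:
  assumes w: "realizes M \<tau> w (pushforward M \<sigma> p \<tau> h) B" and \<Psi>: "definable M B \<tau> \<Psi>"
    and Y: "P Y" "\<And>x. x \<in> Y \<Longrightarrow> h x \<in> \<Psi>"
  shows "w \<in> \<Psi>"
proof -
  obtain \<psi> where \<psi>: "\<psi> \<in> fms M B \<tau>" "\<Psi> = {w \<in> tuples M \<tau>. holds M \<psi> w}"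
    using \<Psi> unfolding definable_def by blast
  obtain \<phi> where \<phi>: "\<phi> \<in> p" "Y = {a \<in> tuples M \<sigma>. holds M \<phi> a}" using Y(1) unfolding P_def by blast
  have "\<forall>a\<in>tuples M \<sigma>. holds M \<phi> a \<longrightarrow> holds M \<psi> (h a)" using Y(2) \<phi>(2) \<psi>(2) by blast
  moreover have "\<psi> \<in> fms M UNIV \<tau>" using \<psi>(1) by (simp add: fms_def)
  ultimately have "\<psi> \<in> pushforward M \<sigma> p \<tau> h" unfolding pushforward_def using \<phi>(1) by blast
  then show ?thesis using w fmsD(2)[OF \<psi>(1)] \<psi>(2) unfolding realizes_def by blast
qed

text \<open>
  Formulas of the pushforward may be tested on any set of \<open>p\<close> on which \<open>h\<close> has values of the right
  sorts; intersecting with \<open>Y0\<close> leaves \<open>p\<close> unaffected by the arbitrary values of \<open>h\<close> elsewhere.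
\<close>

lemma pushforward_realI:
  assumes w: "w \<in> tuples M \<tau>" and Y0: "P Y0" "\<And>x. x \<in> Y0 \<Longrightarrow> h x \<in> tuples M \<tau>"
    and all: "\<And>\<Psi> Y. definable M B \<tau> \<Psi> \<Longrightarrow> P Y \<Longrightarrow> (\<And>x. x \<in> Y \<Longrightarrow> h x \<in> \<Psi>) \<Longrightarrow> w \<in> \<Psi>"
  shows "realizes M \<tau> w (pushforward M \<sigma> p \<tau> h) B"
  unfolding realizes_def
proof (intro conjI ballI impI w)
  fix \<psi> assume \<psi>: "\<psi> \<in> pushforward M \<sigma> p \<tau> h" "pars \<psi> \<subseteq> B"
  obtain \<phi> where \<phi>: "\<psi> \<in> fms M UNIV \<tau>" "\<phi> \<in> p" "\<forall>a\<in>tuples M \<sigma>. holds M \<phi> a \<longrightarrow> holds M \<psi> (h a)"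
    using \<psi>(1) unfolding pushforward_def by blast
  let ?\<Psi> = "{w \<in> tuples M \<tau>. holds M \<psi> w}"
  have "\<psi> \<in> fms M B \<tau>" using \<phi>(1) \<psi>(2) by (simp add: fms_def)
  then have "definable M B \<tau> ?\<Psi>" unfolding definable_def by blast
  moreover have "P {a \<in> tuples M \<sigma>. holds M \<phi> a}" unfolding P_def using \<phi>(2) by blast
  then have "P ({a \<in> tuples M \<sigma>. holds M \<phi> a} \<inter> Y0)" by (rule P_Int[OF _ Y0(1)])
  ultimately have "w \<in> ?\<Psi>" by (rule all) (use \<phi>(3) Y0(2) in simp)
  then show "holds M \<psi> w" by simp
qed

text \<open>
  Replacing \<open>b\<close> by a variable in the graph of \<open>f\<close> may give relations that are not functions into
  \<open>S\<close>.  They are cut down to the points of \<open>S\<close> that are the only value, which does not change the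
  fibre over \<open>b\<close> at generic arguments.
\<close>

lemma graph_family:
  assumes defS: "definable M A \<rho> S" and f: "definable_fun M (A \<union> set b) \<sigma> Xf \<rho> f"
    and realXf: "\<forall>a. Real a (A \<union> set b) \<longrightarrow> a \<in> Xf" and fS: "\<forall>a. Real a (A \<union> set b) \<longrightarrow> f a \<in> S"
  shows "\<exists>G. definable M A (\<sigma> @ \<rho> @ map (srt M) b) G \<and>
    (\<forall>x\<in>tuples M \<sigma>. \<forall>y\<in>tuples M (map (srt M) b). \<forall>z\<in>tuples M \<rho>. x @ z @ y \<in> G \<longrightarrow>
      z \<in> S \<and> (\<forall>z'\<in>tuples M \<rho>. x @ z' @ y \<in> G \<longrightarrow> z' = z)) \<and>
    (\<forall>a. Real a (A \<union> set b) \<longrightarrow> (\<forall>z\<in>tuples M \<rho>. a @ z @ b \<in> G \<longleftrightarrow> z = f a))"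
proof -
  let ?\<beta> = "map (srt M) b"
  have "definable M (A \<union> set b) (\<sigma> @ \<rho>) ((\<lambda>a. a @ f a) ` Xf)" using f unfolding definable_fun_def by blast
  from definable_abstract[OF this] obtain Z where
    Z: "definable M A ((\<sigma> @ \<rho>) @ ?\<beta>) Z" "(\<lambda>a. a @ f a) ` Xf = {w \<in> tuples M (\<sigma> @ \<rho>). w @ b \<in> Z}" by (elim exE conjE)
  define G where "G = rel3 M \<sigma> \<rho> ?\<beta> (\<lambda>x z y. (x @ z @ y \<in> Z \<and> z \<in> S) \<and> (\<forall>z'\<in>tuples M \<rho>. x @ z' @ y \<in> Z \<and> z' \<in> S \<longrightarrow> z' = z))"
  have G1: "definable M A (\<sigma> @ \<rho> @ ?\<beta>) G" unfolding G_def
  proof (rule Def_set3[where \<Gamma> = "(\<lambda>_. \<rho>)(0 := \<sigma>, 2 := ?\<beta>)" and i = 0 and j = "Suc 0" and k = 2, OF struct])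
    let ?\<Gamma> = "(\<lambda>_. \<rho>)(0 := \<sigma>, 2 := ?\<beta>)"
    have Z': "definable M A (\<sigma> @ \<rho> @ ?\<beta>) Z" using Z(1) by simp
    have 1: "Def M A ?\<Gamma> (\<lambda>v. v 0 @ v i @ v 2 \<in> Z \<and> v i \<in> S)" if "i = 1 \<or> i = 3" for i
      by (intro Def_conj[OF struct] Def_mem3[OF struct] Def_mem1[OF struct]) (use that Z' defS in auto)
    have "Def M A ?\<Gamma> (\<lambda>v. v 0 @ v 3 @ v 2 \<in> Z \<and> v 3 \<in> S \<longrightarrow> v 3 = v (Suc 0))"
      by (intro Def_imp[OF struct] 1 Def_eq[OF struct]) simp_all
    then have 2: "Def M A ?\<Gamma> (\<lambda>v. \<forall>z'\<in>tuples M \<rho>. v 0 @ z' @ v 2 \<in> Z \<and> z' \<in> S \<longrightarrow> z' = v (Suc 0))"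
      by (rule Def_all[where i = 3 and Q = "\<lambda>v z'. v 0 @ z' @ v 2 \<in> Z \<and> z' \<in> S \<longrightarrow> z' = v (Suc 0)", OF struct, rotated]) simp_all
    show "Def M A ?\<Gamma> (\<lambda>v. (v 0 @ v (Suc 0) @ v 2 \<in> Z \<and> v (Suc 0) \<in> S) \<and>
      (\<forall>z'\<in>tuples M \<rho>. v 0 @ z' @ v 2 \<in> Z \<and> z' \<in> S \<longrightarrow> z' = v (Suc 0)))"
      by (rule Def_conj[OF struct _ 2]) (use 1[of 1] in simp)
  qed simp_all
  have G_iff: "x @ z @ y \<in> G \<longleftrightarrow> (x @ z @ y \<in> Z \<and> z \<in> S) \<and> (\<forall>z'\<in>tuples M \<rho>. x @ z' @ y \<in> Z \<and> z' \<in> S \<longrightarrow> z' = z)"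
    if "x \<in> tuples M \<sigma>" "z \<in> tuples M \<rho>" "y \<in> tuples M ?\<beta>" for x y z
    unfolding G_def rel3_iff[OF that(1,2)] using that(3) by blast
  have G2: "a @ z @ b \<in> G \<longleftrightarrow> z = f a" if a: "Real a (A \<union> set b)" and z: "z \<in> tuples M \<rho>" for a z
  proof -
    have Z_iff: "a @ u @ b \<in> Z \<longleftrightarrow> u = f a" if "u \<in> tuples M \<rho>" for u
    proof -
      have "a @ u @ b \<in> Z \<longleftrightarrow> a @ u \<in> (\<lambda>a. a @ f a) ` Xf"
        unfolding Z(2) using real_tuples[OF a] that by (simp add: tuples_appendI)
      then show ?thesis using graph_iff[OF f, of a u] realXf a by simp
    qed
    show ?thesis unfolding G_iff[OF real_tuples[OF a] z tuples_self] using Z_iff z fS[rule_format, OF a] by auto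
  qed
  show ?thesis
  proof (intro exI[of _ G] conjI G1 ballI allI impI)
    fix x y z assume *: "x \<in> tuples M \<sigma>" "y \<in> tuples M ?\<beta>" "z \<in> tuples M \<rho>" "x @ z @ y \<in> G"
    then show "z \<in> S" using G_iff by blast
    fix z' assume z': "z' \<in> tuples M \<rho>" "x @ z' @ y \<in> G"
    have "x @ z' @ y \<in> Z \<and> z' \<in> S" using z' G_iff[OF *(1) z'(1) *(2)] by blast
    then show "z' = z" using *(4) z'(1) G_iff[OF *(1,3,2)] by blast
  qed (rule G2)
qed

end

section \<open>Descent of domination along conjugates\<close>

text \<open>
  The function \<open>h\<close> is any \<open>A\<close>-definable function on \<open>p\<close> that determines the fibre of \<open>H\<close> over its
  argument.
\<close>

locale descent = coded_family \<kappa> M A \<sigma> p \<rho> S G b \<Theta>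
  for \<kappa> :: "'k rel" and M :: "('s, 'f, 'r, 'm) struct" and A \<sigma> p \<rho> S G b \<Theta> +
  fixes f :: "'m list \<Rightarrow> 'm list" and Xf :: "'m list set" and \<tau> :: "'s list" and X :: "'m list set" and h :: "'m list \<Rightarrow> 'm list"
  assumes f: "definable_fun M (A \<union> set b) \<sigma> Xf \<rho> f"
    and realXf: "\<And>a. Real a (A \<union> set b) \<Longrightarrow> a \<in> Xf"
    and Gf: "\<And>a z. Real a (A \<union> set b) \<Longrightarrow> z \<in> tuples M \<rho> \<Longrightarrow> a @ z @ b \<in> G \<longleftrightarrow> z = f a"
    and dom: "dominated M (A \<union> set b) \<sigma> p \<rho> f"
    and h: "definable_fun M A \<sigma> X \<tau> h"
    and realX: "\<And>a. Real a A \<Longrightarrow> a \<in> X"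
    and h_code: "\<And>a a' y z. a \<in> X \<Longrightarrow> a' \<in> X \<Longrightarrow> h a = h a' \<Longrightarrow> H a y z \<longleftrightarrow> H a' y z"
begin

text \<open>Membership in \<open>h(p)\<close>, in the way \<open>P\<close> is membership in \<open>p\<close>.\<close>

definition PH :: "'m list set \<Rightarrow> bool" where
  "PH \<Psi> \<longleftrightarrow> P {x \<in> tuples M \<sigma>. x \<in> X \<and> h x \<in> \<Psi>}"

lemma defX: "definable M A \<sigma> X" using h unfolding definable_fun_def by blast
lemma Xt: "X \<subseteq> tuples M \<sigma>" by (rule definable_sub[OF defX])
lemma ht: "a \<in> X \<Longrightarrow> h a \<in> tuples M \<tau>" using h unfolding definable_fun_def by blast
lemma graph_h: "definable M A (\<sigma> @ \<tau>) ((\<lambda>a. a @ h a) ` X)" using h unfolding definable_fun_def by blast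

lemma Gr_f: "Real a (A \<union> set b) \<Longrightarrow> Gr a z b \<longleftrightarrow> z = f a"
proof -
  assume a: "Real a (A \<union> set b)"
  have "f a \<in> tuples M \<rho>" using f realXf[OF a] unfolding definable_fun_def by blast
  then show ?thesis unfolding Gr_def using Gf[OF a] real_tuples[OF a] tuples_self[of b M] by blast
qed

lemma definable_preimage:
  assumes k: "definable_fun M B \<sigma> Y \<tau>' k" and \<Psi>: "definable M B' (\<tau>' @ \<xi>) \<Psi>" and BB: "B \<subseteq> B'"
  shows "definable M B' (\<sigma> @ \<xi>) (rel2 M \<sigma> \<xi> (\<lambda>x c. x \<in> Y \<and> k x @ c \<in> \<Psi>))"
proof -
  let ?\<Gamma> = "(\<lambda>_. \<tau>')(0 := \<sigma>, Suc 0 := \<xi>)"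
  have g: "definable M B' (\<sigma> @ \<tau>') ((\<lambda>a. a @ k a) ` Y)" and Yt: "Y \<subseteq> tuples M \<sigma>" and kt: "k ` Y \<subseteq> tuples M \<tau>'"
    using k definable_mono[OF _ BB] definable_sub[of M B \<sigma> Y] unfolding definable_fun_def by blast+
  have "definable M B' (\<sigma> @ \<xi>) (rel2 M \<sigma> \<xi> (\<lambda>x c. \<exists>w\<in>tuples M \<tau>'. x @ w \<in> (\<lambda>a. a @ k a) ` Y \<and> w @ c \<in> \<Psi>))"
  proof (rule Def_set2[where \<Gamma> = ?\<Gamma> and i = 0 and j = "Suc 0", OF struct])
    show "Def M B' ?\<Gamma> (\<lambda>v. \<exists>w\<in>tuples M \<tau>'. v 0 @ w \<in> (\<lambda>a. a @ k a) ` Y \<and> w @ v (Suc 0) \<in> \<Psi>)"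
      by (rule Def_ex[where i = 2 and Q = "\<lambda>v w. v 0 @ w \<in> (\<lambda>a. a @ k a) ` Y \<and> w @ v (Suc 0) \<in> \<Psi>",
            OF struct _ Def_conj[OF struct Def_mem2[OF struct] Def_mem2[OF struct]]]) (use g \<Psi> in simp_all)
  qed simp_all
  also have "rel2 M \<sigma> \<xi> (\<lambda>x c. \<exists>w\<in>tuples M \<tau>'. x @ w \<in> (\<lambda>a. a @ k a) ` Y \<and> w @ c \<in> \<Psi>) =
    rel2 M \<sigma> \<xi> (\<lambda>x c. x \<in> Y \<and> k x @ c \<in> \<Psi>)"
  proof -
    have "(\<exists>w\<in>tuples M \<tau>'. x @ w \<in> (\<lambda>a. a @ k a) ` Y \<and> w @ c \<in> \<Psi>) \<longleftrightarrow> x \<in> Y \<and> k x @ c \<in> \<Psi>"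
      if x: "x \<in> tuples M \<sigma>" for x c
    proof
      assume "\<exists>w\<in>tuples M \<tau>'. x @ w \<in> (\<lambda>a. a @ k a) ` Y \<and> w @ c \<in> \<Psi>"
      then obtain w x' where w: "x @ w = x' @ k x'" "x' \<in> Y" "w @ c \<in> \<Psi>" by blast
      then have "x = x'" "w = k x'" using append_tuples_eq[OF x, of x' w "k x'"] Yt by blast+
      then show "x \<in> Y \<and> k x @ c \<in> \<Psi>" using w by simp
    qed (use kt in blast)
    then show ?thesis unfolding rel2_def by blast
  qed
  finally show ?thesis .
qed

lemma definable_preimage1:
  assumes k: "definable_fun M B \<sigma> Y \<tau>' k" and \<Psi>: "definable M B' \<tau>' \<Psi>" and BB: "B \<subseteq> B'"
  shows "definable M B' \<sigma> {x \<in> tuples M \<sigma>. x \<in> Y \<and> k x \<in> \<Psi>}"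
proof -
  have "definable M B' (\<sigma> @ []) (rel2 M \<sigma> [] (\<lambda>x c. x \<in> Y \<and> k x @ c \<in> \<Psi>))"
    by (rule definable_preimage[OF k _ BB]) (use \<Psi> in simp)
  moreover have "rel2 M \<sigma> [] (\<lambda>x c. x \<in> Y \<and> k x @ c \<in> \<Psi>) = {x \<in> tuples M \<sigma>. x \<in> Y \<and> k x \<in> \<Psi>}"
    unfolding rel2_def by auto
  ultimately show ?thesis by simp
qed

lemma real_PH:
  assumes "Real x B" "A \<subseteq> B" "definable M B \<tau> \<Psi>" shows "h x \<in> \<Psi> \<longleftrightarrow> PH \<Psi>"
  using real_mem[OF assms(1) definable_preimage1[OF h assms(3,2)]] real_tuples[OF assms(1)]
    realX[OF real_mono[OF assms(1,2)]] unfolding PH_def by simp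

text \<open>
  An automorphism over \<open>A\<close> that takes \<open>b'\<close> to \<open>b\<close> carries the hypothesis of domination from \<open>b\<close> to
  \<open>b'\<close>, so it is enough that \<open>f\<^sub>b\<^sub>'(a)\<close> is generic over \<open>Adb'\<close>.  As \<open>a\<close> is generic over \<open>Ab'\<close>, this
  value is the \<open>z\<close> with \<open>H(a, b', z)\<close>, and \<open>H(a, b', \<cdot>)\<close> depends only on \<open>h(a)\<close>.  A condition on
  \<open>f\<^sub>b\<^sub>'(a)\<close> thus becomes a condition \<open>\<Xi>\<close> on \<open>h(a)\<close> over \<open>Adb'\<close>, and \<open>h(a)\<close> is generic over \<open>Adb'\<close>.
\<close>

lemma dominated_conjugate:
  assumes b': "eqtp M A b b'" and a: "Real a (A \<union> set b')"
    and ha: "\<And>\<Psi>. definable M (A \<union> set d \<union> set b') \<tau> \<Psi> \<Longrightarrow> PH \<Psi> \<Longrightarrow> h a \<in> \<Psi>"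
  shows "Real a (A \<union> set d)"
proof -
  obtain g where g: "fixes_aut M A g" "map g b' = b" "Real (map g a) (A \<union> set b)"
    by (rule real_conjugate[OF b' a])
  have gi: "fixes_aut M A (inv g)" by (rule fixes_aut_inv[OF g(1)])
  have gig: "map (inv g) (map g u) = u" for u by (rule fixes_aut_map_inv[OF g(1) refl])
  have ggi: "map g (map (inv g) u) = u" for u
    using g(1) by (simp add: o_def fixes_aut_def automorphism_def bij_def surj_f_inv_f)
  have aA: "Real a A" by (rule real_mono[OF a]) simp
  let ?B = "A \<union> set b \<union> set (map g d)"
  let ?B' = "A \<union> set d \<union> set b'"
  have setb: "g ` set b' = set b" using g(2) by (metis list.set_map)
  have imB': "g ` ?B' = ?B" using fixes_aut_image[OF g(1), of "set d \<union> set b'"] setb by (simp add: image_Un Un_ac)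
  have imB: "inv g ` ?B = ?B'" using inv_image_aut[OF g(1), of ?B'] imB' by simp
  have fa: "Gr (map g a) (f (map g a)) b" using Gr_f[OF g(3)] by simp
  have "realizes M \<rho> (f (map g a)) (pushforward M \<sigma> p \<rho> f) ?B"
  proof (rule pushforward_realI)
    show "f (map g a) \<in> tuples M \<rho>" using fa unfolding Gr_def by blast
    have defXf: "definable M (A \<union> set b) \<sigma> Xf" using f unfolding definable_fun_def by blast
    show PXf: "P Xf" by (rule P_real[OF small_list_Un[OF smallA] defXf realXf])
    show "f x \<in> tuples M \<rho>" if "x \<in> Xf" for x using f that unfolding definable_fun_def by blast
    fix \<Psi> Y assume \<Psi>: "definable M ?B \<rho> \<Psi>" and Y: "P Y" "\<And>x. x \<in> Y \<Longrightarrow> f x \<in> \<Psi>"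
    let ?U = "{x \<in> tuples M \<sigma>. x \<in> Xf \<and> f x \<in> \<Psi>}"
    have defU: "definable M ?B \<sigma> ?U" by (rule definable_preimage1[OF f \<Psi>]) blast
    have PU: "P ?U"
      by (rule P_mono[OF P_Int[OF Y(1) PXf]]) (use Y(2) P_sub[OF PXf] definable_mono[OF defU subset_UNIV] in blast)+
    define \<Psi>' where "\<Psi>' = map (inv g) ` \<Psi>"
    have \<Psi>': "definable M ?B' \<rho> \<Psi>'" unfolding \<Psi>'_def using image_definable[OF gi \<Psi>] imB by simp
    define U' where "U' = {x \<in> tuples M \<sigma>. \<exists>z\<in>tuples M \<rho>. z \<in> \<Psi>' \<and> H x b' z}"
    have b't: "b' \<in> tuples M \<beta>" using eqtp_tuples[OF b'] tuples_self by blast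
    have defU': "definable M ?B' \<sigma> U'" unfolding U'_def
    proof (rule Def_set1[where \<Gamma> = "(\<lambda>_. \<beta>)(0 := \<sigma>, Suc 0 := \<rho>)" and i = 0, OF struct])
      let ?\<Gamma> = "(\<lambda>_. \<beta>)(0 := \<sigma>, Suc 0 := \<rho>)"
      have AB: "A \<subseteq> ?B'" by blast
      have 1: "Def M ?B' ?\<Gamma> (\<lambda>v. H (v 0) b' (v (Suc 0)))"
      proof (rule Def_param[where Q = "\<lambda>v y. H (v 0) y (v (Suc 0))" and i = 2 and \<tau> = \<beta>, OF struct _ b't])
        show "Def M ?B' ?\<Gamma> (\<lambda>v. H (v 0) (v 2) (v (Suc 0)))" by (rule Def_mono[OF Def_H AB]) simp_all
      qed simp_all
      have 2: "Def M ?B' ?\<Gamma> (\<lambda>v. v (Suc 0) \<in> \<Psi>')" by (rule Def_mem1[OF struct]) (use \<Psi>' in simp)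
      show "Def M ?B' ?\<Gamma> (\<lambda>v. \<exists>z\<in>tuples M \<rho>. z \<in> \<Psi>' \<and> H (v 0) b' z)"
        by (rule Def_ex[where i = "Suc 0" and Q = "\<lambda>v z. z \<in> \<Psi>' \<and> H (v 0) b' z", OF struct _ Def_conj[OF struct 2 1]]) simp_all
    qed simp
    define \<Xi> where "\<Xi> = {w \<in> tuples M \<tau>. \<exists>x\<in>tuples M \<sigma>. x \<in> U' \<and> x @ w \<in> (\<lambda>a. a @ h a) ` X}"
    have def\<Xi>: "definable M ?B' \<tau> \<Xi>" unfolding \<Xi>_def
    proof (rule Def_set1[where \<Gamma> = "(\<lambda>_. \<tau>)(0 := \<sigma>)" and i = 1, OF struct])
      show "Def M ?B' ((\<lambda>_. \<tau>)(0 := \<sigma>)) (\<lambda>v. \<exists>x\<in>tuples M \<sigma>. x \<in> U' \<and> x @ v 1 \<in> (\<lambda>a. a @ h a) ` X)"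
        by (rule Def_ex[where i = 0 and Q = "\<lambda>v x. x \<in> U' \<and> x @ v 1 \<in> (\<lambda>a. a @ h a) ` X", OF struct _
              Def_conj[OF struct Def_mem1[OF struct] Def_mem2[OF struct]]])
          (use defU' definable_mono[OF graph_h, of ?B'] in auto)
    qed simp
    have "PH \<Xi>" unfolding PH_def
    proof (rule P_real)
      show "small \<kappa> ?B'" by (intro small_list_Un smallA)
      show "definable M ?B' \<sigma> {x \<in> tuples M \<sigma>. x \<in> X \<and> h x \<in> \<Xi>}" by (rule definable_preimage1[OF h def\<Xi>]) blast
      fix x assume x: "Real x ?B'"
      have xX: "x \<in> X" by (rule realX[OF real_mono[OF x]]) blast
      have xb': "Real x (A \<union> set b')" by (rule real_mono[OF x]) blast
      have gx: "Real (map g x) ?B" using real_aut[OF g(1) x] imB' by simp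
      then have fU: "map g x \<in> ?U" using real_mem[OF gx defU] PU by simp
      let ?z = "map (inv g) (f (map g x))"
      have "Gr (map g x) (f (map g x)) b" using Gr_f[OF real_mono[OF gx], of "f (map g x)"] by blast
      then have "Gr x ?z b'" using Gr_aut[OF g(1), of x ?z b'] ggi g(2) by simp
      then have "H x b' ?z" using H_iff[OF b' xb'] by simp
      moreover have "?z \<in> \<Psi>'" unfolding \<Psi>'_def using fU by blast
      ultimately have "x \<in> U'" unfolding U'_def using H_tuples by blast
      then have "h x \<in> \<Xi>" unfolding \<Xi>_def using xX ht Xt by blast
      then show "x \<in> {x \<in> tuples M \<sigma>. x \<in> X \<and> h x \<in> \<Xi>}" using xX Xt by blast
    qed
    then have "h a \<in> \<Xi>" by (rule ha[OF def\<Xi>])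
    then obtain x where x: "x \<in> U'" "x @ h a \<in> (\<lambda>a. a @ h a) ` X" unfolding \<Xi>_def by blast
    then obtain x' where "x' \<in> X" "x @ h a = x' @ h x'" by blast
    moreover have "x \<in> tuples M \<sigma>" using x(1) unfolding U'_def by blast
    ultimately have xX: "x \<in> X" "h a = h x" using append_tuples_eq[of x M \<sigma> x' "h a" "h x'"] Xt by blast+
    obtain z where z: "z \<in> \<Psi>'" "H x b' z" using x(1) unfolding U'_def by blast
    have "H a b' z" using h_code[OF realX[OF aA] xX] z(2) by simp
    then have "Gr a z b'" using H_iff[OF b' a] by simp
    then have "Gr (map g a) (map g z) b" using Gr_aut[OF g(1), of a z b'] g(2) by simp
    then have "map g z = f (map g a)" using Gr_f[OF g(3)] by simp
    moreover have "map g z \<in> \<Psi>" using z(1) ggi unfolding \<Psi>'_def by auto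
    ultimately show "f (map g a) \<in> \<Psi>" by simp
  qed
  then have "Real (map g a) ?B" using dom g(3) unfolding dominated_def by blast
  then have "Real (map (inv g) (map g a)) (inv g ` ?B)" by (rule real_aut[OF gi])
  then have "Real a ?B'" unfolding gig imB .
  then show ?thesis by (rule real_mono) blast
qed

text \<open>The pullback of a relation along \<open>h\<close> in its first argument; it turns statements on \<open>h(p)\<close> into statements on \<open>p\<close>.\<close>

definition Z :: "'s list \<Rightarrow> 'm list set \<Rightarrow> 'm list set" where
  "Z \<xi> \<Psi> = rel2 M \<sigma> \<xi> (\<lambda>x c. x \<in> X \<and> h x @ c \<in> \<Psi>)"

lemma definable_Z: "definable M A (\<tau> @ \<xi>) \<Psi> \<Longrightarrow> definable M A (\<sigma> @ \<xi>) (Z \<xi> \<Psi>)"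
  unfolding Z_def by (rule definable_preimage[OF h _ subset_refl])

lemma Z_iff: "x \<in> tuples M \<sigma> \<Longrightarrow> c \<in> tuples M \<xi> \<Longrightarrow> x @ c \<in> Z \<xi> \<Psi> \<longleftrightarrow> x \<in> X \<and> h x @ c \<in> \<Psi>"
  unfolding Z_def by (simp add: rel2_iff)

lemma real_in_Z:
  assumes "Real x (A \<union> set c)" "c \<in> tuples M \<xi>" "definable M A (\<tau> @ \<xi>) \<Psi>" "P {x \<in> tuples M \<sigma>. x @ c \<in> Z \<xi> \<Psi>}"
  shows "h x @ c \<in> \<Psi>"
  using real_mem[OF assms(1) P_fibre_definable[OF definable_Z[OF assms(3)] assms(2)]] assms(4)
    real_tuples[OF assms(1)] Z_iff[OF _ assms(2)] by simp

text \<open>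
  A tuple \<open>b'\<close> as needed for \<open>dominated_conjugate\<close> is one that satisfies \<open>\<Theta>'(a, b')\<close> whenever
  \<open>\<Theta>'(x, b) \<in> p\<close>, and \<open>\<Psi>(h(a), d, b')\<close> whenever \<open>\<Psi>(w, d, b') \<in> h(p)\<close>.  The latter is a definable
  condition on \<open>b'\<close> because \<open>p\<close> is definable.  Conditions of the first kind are closed under
  intersection, so one of them and finitely many of the second kind have to be satisfied together.
\<close>

lemma dominated_if_consistent:
  assumes a: "Real a A"
    and fin: "\<And>\<Theta>' L. definable M A (\<sigma> @ \<beta>) \<Theta>' \<Longrightarrow> P {x \<in> tuples M \<sigma>. x @ b \<in> \<Theta>'} \<Longrightarrow> finite L \<Longrightarrow>
      (\<And>\<Psi>. \<Psi> \<in> L \<Longrightarrow> definable M A (\<tau> @ map (srt M) d @ \<beta>) \<Psi>) \<Longrightarrow>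
      \<exists>y\<in>tuples M \<beta>. a @ y \<in> \<Theta>' \<and>
        (\<forall>\<Psi>\<in>L. P {x \<in> tuples M \<sigma>. x @ d @ y \<in> Z (map (srt M) d @ \<beta>) \<Psi>} \<longrightarrow> h a @ d @ y \<in> \<Psi>)"
  shows "Real a (A \<union> set d)"
proof -
  let ?\<delta> = "map (srt M) d"
  have at: "a \<in> tuples M \<sigma>" by (rule real_tuples[OF a])
  have hat: "h a \<in> tuples M \<tau>" by (rule ht[OF realX[OF a]])
  define T where "T = {\<Theta>'. definable M A (\<sigma> @ \<beta>) \<Theta>' \<and> P {x \<in> tuples M \<sigma>. x @ b \<in> \<Theta>'}}"
  define Q where "Q = {\<Psi>. definable M A (\<tau> @ ?\<delta> @ \<beta>) \<Psi>}"
  define E1 where "E1 \<Theta>' = {y \<in> tuples M \<beta>. a @ y \<in> \<Theta>'}" for \<Theta>'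
  define E2 where "E2 \<Psi> = {y \<in> tuples M \<beta>. P {x \<in> tuples M \<sigma>. x @ d @ y \<in> Z (?\<delta> @ \<beta>) \<Psi>} \<longrightarrow> h a @ d @ y \<in> \<Psi>}" for \<Psi>
  let ?B = "A \<union> set a \<union> set d \<union> set (h a)"
  have "\<exists>y\<in>tuples M \<beta>. \<forall>Y\<in>E1 ` T \<union> E2 ` Q. y \<in> Y"
  proof (rule saturation)
    show "small \<kappa> ?B" by (intro small_list_Un smallA)
    fix Y assume "Y \<in> E1 ` T \<union> E2 ` Q"
    then show "definable M ?B \<beta> Y"
    proof (elim UnE imageE)
      fix \<Theta>' assume "Y = E1 \<Theta>'" "\<Theta>' \<in> T"
      then show ?thesis unfolding E1_def T_def
        by (simp add: definable_fibre_left[OF struct _ at, of A \<beta> \<Theta>' ?B] le_supI1)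
    next
      fix \<Psi> assume \<Psi>: "Y = E2 \<Psi>" "\<Psi> \<in> Q"
      have def\<Psi>: "definable M A (\<tau> @ ?\<delta> @ \<beta>) \<Psi>" using \<Psi>(2) by (simp add: Q_def)
      have "definable M A (?\<delta> @ \<beta>) {c \<in> tuples M (?\<delta> @ \<beta>). P {x \<in> tuples M \<sigma>. x @ c \<in> Z (?\<delta> @ \<beta>) \<Psi>}}"
        by (rule P_fibre_set_definable[OF definable_Z[OF def\<Psi>]])
      from definable_fibre_left[OF struct this tuples_self, of ?B]
      have 1: "definable M ?B \<beta> {y \<in> tuples M \<beta>. d @ y \<in> {c \<in> tuples M (?\<delta> @ \<beta>). P {x \<in> tuples M \<sigma>. x @ c \<in> Z (?\<delta> @ \<beta>) \<Psi>}}}"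
        by blast
      have "definable M A ((\<tau> @ ?\<delta>) @ \<beta>) \<Psi>" using def\<Psi> by simp
      moreover have "h a @ d \<in> tuples M (\<tau> @ ?\<delta>)" using hat by (intro tuples_appendI tuples_self)
      ultimately have 2: "definable M ?B \<beta> {y \<in> tuples M \<beta>. (h a @ d) @ y \<in> \<Psi>}"
        by (rule definable_fibre_left[OF struct]) auto
      have "E2 \<Psi> = {y \<in> tuples M \<beta>. y \<in> {y \<in> tuples M \<beta>. d @ y \<in> {c \<in> tuples M (?\<delta> @ \<beta>). P {x \<in> tuples M \<sigma>. x @ c \<in> Z (?\<delta> @ \<beta>) \<Psi>}}}
          \<longrightarrow> y \<in> {y \<in> tuples M \<beta>. (h a @ d) @ y \<in> \<Psi>}}"
        unfolding E2_def by (rule Collect_cong) (auto simp: tuples_appendI)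
      moreover have "definable M ?B \<beta> \<dots>"
        by (rule Def_set1[where \<Gamma> = "\<lambda>_. \<beta>" and i = 0, OF struct refl])
          (rule Def_imp[OF struct Def_mem1[OF struct 1] Def_mem1[OF struct 2]])
      ultimately show ?thesis using \<Psi>(1) by simp
    qed
  next
    fix F assume F: "finite F" "F \<subseteq> E1 ` T \<union> E2 ` Q"
    have f1: "finite (F \<inter> E1 ` T)" "F \<inter> E1 ` T \<subseteq> E1 ` T" and f2: "finite (F \<inter> E2 ` Q)" "F \<inter> E2 ` Q \<subseteq> E2 ` Q" using F(1) by auto
    from finite_subset_image[OF f1] obtain K where K: "K \<subseteq> T" "finite K" "F \<inter> E1 ` T = E1 ` K" by (elim exE conjE)
    from finite_subset_image[OF f2] obtain L where L: "L \<subseteq> Q" "finite L" "F \<inter> E2 ` Q = E2 ` L" by (elim exE conjE)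
    let ?\<Theta>' = "{w \<in> tuples M (\<sigma> @ \<beta>). \<forall>\<Theta>'\<in>K. w \<in> \<Theta>'}"
    have KT: "definable M A (\<sigma> @ \<beta>) \<Theta>' \<and> P {x \<in> tuples M \<sigma>. x @ b \<in> \<Theta>'}" if "\<Theta>' \<in> K" for \<Theta>'
      using subsetD[OF K(1) that] by (simp add: T_def)
    have "\<exists>y\<in>tuples M \<beta>. a @ y \<in> ?\<Theta>' \<and>
        (\<forall>\<Psi>\<in>L. P {x \<in> tuples M \<sigma>. x @ d @ y \<in> Z (?\<delta> @ \<beta>) \<Psi>} \<longrightarrow> h a @ d @ y \<in> \<Psi>)"
    proof (rule fin)
      show "definable M A (\<sigma> @ \<beta>) ?\<Theta>'" by (rule finite_intersection_definable[OF K(2)]) (use KT in simp)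
      show "P {x \<in> tuples M \<sigma>. x @ b \<in> ?\<Theta>'}" by (rule P_Inter_fibre[OF K(2) KT tuples_self])
      show "definable M A (\<tau> @ ?\<delta> @ \<beta>) \<Psi>" if "\<Psi> \<in> L" for \<Psi> using subsetD[OF L(1) that] by (simp add: Q_def)
    qed (rule L(2))
    then obtain y where y: "y \<in> tuples M \<beta>" "a @ y \<in> ?\<Theta>'"
      "\<forall>\<Psi>\<in>L. P {x \<in> tuples M \<sigma>. x @ d @ y \<in> Z (?\<delta> @ \<beta>) \<Psi>} \<longrightarrow> h a @ d @ y \<in> \<Psi>" by (elim bexE conjE)
    have "y \<in> Y" if "Y \<in> F" for Y
    proof -
      from subsetD[OF F(2) that] have "Y \<in> F \<inter> E1 ` T \<or> Y \<in> F \<inter> E2 ` Q" using that by (elim UnE) simp_all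
      then show ?thesis unfolding K(3) L(3)
      proof (elim disjE imageE)
        fix \<Theta>' assume "Y = E1 \<Theta>'" "\<Theta>' \<in> K" then show ?thesis using y by (simp add: E1_def)
      next
        fix \<Psi> assume "Y = E2 \<Psi>" "\<Psi> \<in> L" then show ?thesis using y by (simp add: E2_def)
      qed
    qed
    then show "\<exists>y\<in>tuples M \<beta>. \<forall>Y\<in>F. y \<in> Y" using y(1) by (intro bexI[of _ y] ballI)
  qed
  then obtain y where y: "y \<in> tuples M \<beta>" "\<forall>Y\<in>E1 ` T \<union> E2 ` Q. y \<in> Y" ..
  have "eqtp M A b y \<and> Real a (A \<union> set y)"
  proof (rule realize_pair[OF at y(1)])
    fix \<Theta>' assume "definable M A (\<sigma> @ \<beta>) \<Theta>'" "P {x \<in> tuples M \<sigma>. x @ b \<in> \<Theta>'}"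
    then have "\<Theta>' \<in> T" by (simp add: T_def)
    then have "y \<in> E1 \<Theta>'" using y(2) by blast
    then show "a @ y \<in> \<Theta>'" by (simp add: E1_def)
  qed
  then have ey: "eqtp M A b y" and ry: "Real a (A \<union> set y)" by simp_all
  show ?thesis
  proof (rule dominated_conjugate[OF ey ry])
    fix \<Psi> assume \<Psi>: "definable M (A \<union> set d \<union> set y) \<tau> \<Psi>" "PH \<Psi>"
    have "definable M (A \<union> set (d @ y)) \<tau> \<Psi>" using \<Psi>(1) by (simp add: Un_assoc)
    from definable_abstract[OF this] obtain \<Psi>0 where
      \<Psi>0: "definable M A (\<tau> @ map (srt M) (d @ y)) \<Psi>0" "\<Psi> = {w \<in> tuples M \<tau>. w @ d @ y \<in> \<Psi>0}" by (elim exE conjE)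
    have "map (srt M) y = \<beta>" using y(1) by (simp add: tuples_def)
    then have "\<Psi>0 \<in> Q" using \<Psi>0(1) by (simp add: Q_def)
    then have "y \<in> E2 \<Psi>0" using y(2) by blast
    moreover have "{x \<in> tuples M \<sigma>. x @ d @ y \<in> Z (?\<delta> @ \<beta>) \<Psi>0} = {x \<in> tuples M \<sigma>. x \<in> X \<and> h x \<in> \<Psi>}"
    proof (rule Collect_cong, rule conj_cong[OF refl])
      fix x assume x: "x \<in> tuples M \<sigma>"
      have "d @ y \<in> tuples M (?\<delta> @ \<beta>)" using y(1) by (intro tuples_appendI tuples_self)
      then show "x @ d @ y \<in> Z (?\<delta> @ \<beta>) \<Psi>0 \<longleftrightarrow> x \<in> X \<and> h x \<in> \<Psi>"
        using Z_iff[OF x, of "d @ y"] ht[of x] \<Psi>0(2) by auto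
    qed
    ultimately have "h a @ d @ y \<in> \<Psi>0" using \<Psi>(2) by (simp add: E2_def PH_def)
    then show "h a \<in> \<Psi>" using \<Psi>0(2) hat by simp
  qed
qed

end

section \<open>Generic conjugates when the type does not fork\<close>

context generic_type
begin

text \<open>
  Dividing is defined for formulas without parameters at a tuple, so the parameters of \<open>U\<close> from \<open>A\<close>
  are appended to \<open>c\<close>; being fixed by automorphisms over \<open>A\<close>, they do not affect the types.
\<close>

lemma divides_witness:
  assumes U: "definable M A (\<beta> @ \<xi>) U" and c: "c \<in> tuples M \<xi>" and cs: "\<And>i. eqtp M A c (cs i)"
    and inc: "\<And>I y. finite I \<Longrightarrow> card I = k \<Longrightarrow> y \<in> tuples M \<beta> \<Longrightarrow> (\<And>i::nat. i \<in> I \<Longrightarrow> y @ cs i \<in> U) \<Longrightarrow> False"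
  shows "\<exists>\<phi> c'. \<phi> \<in> fms M {} (\<beta> @ map (srt M) c') \<and> divides M A \<beta> \<phi> c' \<and>
    (\<forall>y\<in>tuples M \<beta>. holds M \<phi> (y @ c') \<longleftrightarrow> y @ c \<in> U)"
proof -
  obtain \<alpha> where \<alpha>: "set \<alpha> \<subseteq> A" "definable M (set \<alpha>) (\<beta> @ \<xi>) U"
    using definable_finite_parameters[OF U] by (elim exE conjE)
  have "definable M ({} \<union> set \<alpha>) (\<beta> @ \<xi>) U" using \<alpha>(2) by simp
  from definable_abstract[OF this] obtain U0 where
    U0: "definable M {} ((\<beta> @ \<xi>) @ map (srt M) \<alpha>) U0" "U = {w \<in> tuples M (\<beta> @ \<xi>). w @ \<alpha> \<in> U0}" by (elim exE conjE)
  obtain \<phi> where \<phi>: "\<phi> \<in> fms M {} ((\<beta> @ \<xi>) @ map (srt M) \<alpha>)"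
    "U0 = {w \<in> tuples M ((\<beta> @ \<xi>) @ map (srt M) \<alpha>). holds M \<phi> w}" using U0(1) unfolding definable_def by blast
  have mc: "map (srt M) c = \<xi>" using c by (simp add: tuples_def)
  have iff: "holds M \<phi> (y @ e @ \<alpha>) \<longleftrightarrow> y @ e \<in> U" if "y \<in> tuples M \<beta>" "e \<in> tuples M \<xi>" for y e
  proof -
    have "y @ e \<in> tuples M (\<beta> @ \<xi>)" using that by (rule tuples_appendI)
    moreover then have "(y @ e) @ \<alpha> \<in> tuples M ((\<beta> @ \<xi>) @ map (srt M) \<alpha>)" using tuples_self by (rule tuples_appendI)
    ultimately show ?thesis unfolding U0(2) \<phi>(2) by simp
  qed
  have "divides M A \<beta> \<phi> (c @ \<alpha>)" unfolding divides_def
  proof (intro exI[of _ k] exI[of _ "\<lambda>i. cs i @ \<alpha>"] conjI allI impI)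
    fix i
    obtain g where g: "fixes_aut M A g" "map g c = cs i" using homogeneity[OF cs[of i] smallA] by (elim exE conjE)
    have "map g (c @ \<alpha>) = cs i @ \<alpha>" using g(2) fixes_aut_map_id[OF g(1) \<alpha>(1)] by simp
    then have "eqtp M A (c @ \<alpha>) (cs i @ \<alpha>)" using fixes_aut_eqtp[OF struct g(1), of "c @ \<alpha>"] by simp
    then show "tp M A (cs i @ \<alpha>) = tp M A (c @ \<alpha>)" using eqtp_tp by metis
  next
    fix I :: "nat set" assume I: "finite I \<and> card I = k"
    show "\<not> (\<exists>y\<in>tuples M \<beta>. \<forall>i\<in>I. holds M \<phi> (y @ cs i @ \<alpha>))"
    proof
      assume "\<exists>y\<in>tuples M \<beta>. \<forall>i\<in>I. holds M \<phi> (y @ cs i @ \<alpha>)"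
      then obtain y where y: "y \<in> tuples M \<beta>" "\<forall>i\<in>I. holds M \<phi> (y @ cs i @ \<alpha>)" ..
      show False
      proof (rule inc[OF conjunct1[OF I] conjunct2[OF I] y(1)])
        fix i assume "i \<in> I"
        moreover have "cs i \<in> tuples M \<xi>" using eqtp_tuples[OF cs] c by blast
        ultimately show "y @ cs i \<in> U" using iff[OF y(1)] y(2) by blast
      qed
    qed
  qed
  moreover have "\<phi> \<in> fms M {} (\<beta> @ map (srt M) (c @ \<alpha>))" using \<phi>(1) mc by simp
  ultimately show ?thesis using iff[OF _ c] by (intro exI[of _ \<phi>] exI[of _ "c @ \<alpha>"]) simp
qed

lemma morley_inconsistent:
  assumes N: "\<forall>c\<in>tuples M \<xi>. \<forall>as. mor A as \<and> P {a \<in> tuples M \<sigma>. a @ c \<in> Z} \<longrightarrow> length (filter (\<lambda>a. a @ c \<notin> Z) as) \<le> N"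
    and e: "\<And>n. mor A (map e [0..<n])" and I: "finite I" "card I = Suc N"
    and c: "c \<in> tuples M \<xi>" "P {a \<in> tuples M \<sigma>. a @ c \<in> Z}" and fail: "\<And>i. i \<in> I \<Longrightarrow> e i @ c \<notin> Z"
  shows False
proof -
  obtain n where n: "\<forall>i\<in>I. i < n" using I(1) finite_nat_set_iff_bounded by blast
  have "card I \<le> card {i. i < length (map e [0..<n]) \<and> map e [0..<n] ! i @ c \<notin> Z}"
    by (rule card_mono) (use n fail in auto)
  also have "\<dots> = length (filter (\<lambda>a. a @ c \<notin> Z) (map e [0..<n]))" by (rule length_filter_conv_card[symmetric])
  also have "\<dots> \<le> N" using N c e by blast
  finally show False using I(2) by simp
qed

end

text \<open>
  Let \<open>U1(y, a)\<close> say that \<open>\<Theta>'(x, y)\<close> is in \<open>p\<close> but fails at \<open>a\<close>, and let \<open>U2 \<Psi> (y, h(a), d)\<close> say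
  that \<open>\<Psi>(w, d, y)\<close> is in \<open>h(p)\<close> but fails at \<open>h(a)\<close>.  These formulas divide over \<open>A\<close>: for a Morley
  sequence \<open>e\<close> over \<open>A\<close>, respectively over \<open>Ad\<close>, the tuples \<open>e\<^sub>i\<close>, respectively \<open>h(e\<^sub>i)d\<close>, are
  conjugates over \<open>A\<close> of \<open>a\<close> and \<open>h(a)d\<close>, and no \<open>y\<close> fails at \<open>N + 1\<close> of them.  A type that does
  not fork over \<open>A\<close> has a realization that avoids finitely many such formulas.
\<close>

lemma (in descent) consistent_if_nonforking:
  assumes nf: "\<not> forks M A \<beta> (tp M A b)" and a: "Real a A"
    and ha: "\<And>\<Psi>. definable M (A \<union> set d) \<tau> \<Psi> \<Longrightarrow> PH \<Psi> \<Longrightarrow> h a \<in> \<Psi>"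
    and \<Theta>': "definable M A (\<sigma> @ \<beta>) \<Theta>'" "P {x \<in> tuples M \<sigma>. x @ b \<in> \<Theta>'}" and L: "finite L"
    and L_def: "\<And>\<Psi>. \<Psi> \<in> L \<Longrightarrow> definable M A (\<tau> @ map (srt M) d @ \<beta>) \<Psi>"
  shows "\<exists>y\<in>tuples M \<beta>. a @ y \<in> \<Theta>' \<and>
    (\<forall>\<Psi>\<in>L. P {x \<in> tuples M \<sigma>. x @ d @ y \<in> Z (map (srt M) d @ \<beta>) \<Psi>} \<longrightarrow> h a @ d @ y \<in> \<Psi>)"
proof -
  let ?\<delta> = "map (srt M) d"
  have at: "a \<in> tuples M \<sigma>" by (rule real_tuples[OF a])
  have hat: "h a \<in> tuples M \<tau>" by (rule ht[OF realX[OF a]])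
  define U1 where "U1 = rel2 M \<beta> \<sigma> (\<lambda>y x. y \<in> {y \<in> tuples M \<beta>. P {x \<in> tuples M \<sigma>. x @ y \<in> \<Theta>'}} \<and> x @ y \<notin> \<Theta>')"
  have defU1: "definable M A (\<beta> @ \<sigma>) U1" unfolding U1_def
    by (rule Def_set2[where \<Gamma> = "(\<lambda>_. \<sigma>)(0 := \<beta>)" and i = 0 and j = 1, OF struct], simp, simp, simp,
        rule Def_conj[OF struct Def_mem1[OF struct] Def_neg[OF Def_mem2[OF struct]]])
      (use P_fibre_set_definable[OF \<Theta>'(1)] \<Theta>'(1) in simp_all)
  have "\<exists>\<phi> c. \<phi> \<in> fms M {} (\<beta> @ map (srt M) c) \<and> divides M A \<beta> \<phi> c \<and>
    (\<forall>y\<in>tuples M \<beta>. holds M \<phi> (y @ c) \<longleftrightarrow> y @ a \<in> U1)"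
  proof -
    obtain e where e: "\<forall>n. mor A (map e [0..<n])" using mor_sequence[OF smallA] ..
    have re: "Real (e i) A" for i by (rule real_mono[OF mor_map_nth]) (use e in auto)
    obtain N where N: "\<forall>c\<in>tuples M \<beta>. \<forall>as. mor A as \<and> P {a \<in> tuples M \<sigma>. a @ c \<in> \<Theta>'} \<longrightarrow>
      length (filter (\<lambda>a. a @ c \<notin> \<Theta>') as) \<le> N" using failure_bound[OF \<Theta>'(1)] ..
    show ?thesis
    proof (rule divides_witness[OF defU1 at, where cs = e and k = "Suc N"])
      show "eqtp M A a (e i)" for i by (rule real_eqtp[OF a re])
      fix I y assume I: "finite I" "card I = Suc N" and y: "y \<in> tuples M \<beta>" and U: "\<And>i. i \<in> I \<Longrightarrow> y @ e i \<in> U1"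
      have U': "P {x \<in> tuples M \<sigma>. x @ y \<in> \<Theta>'} \<and> e i @ y \<notin> \<Theta>'" if "i \<in> I" for i
        using U[OF that] y by (simp add: U1_def rel2_iff)
      obtain i where "i \<in> I" using I by fastforce
      show False by (rule morley_inconsistent[OF N _ I y]) (use e U' \<open>i \<in> I\<close> in blast)+
    qed
  qed
  then obtain \<phi>1 c1 where 1: "\<phi>1 \<in> fms M {} (\<beta> @ map (srt M) c1)" "divides M A \<beta> \<phi>1 c1"
    "\<forall>y\<in>tuples M \<beta>. holds M \<phi>1 (y @ c1) \<longleftrightarrow> y @ a \<in> U1" by (elim exE conjE)
  define U2 where "U2 \<Psi> = rel3 M \<beta> \<tau> ?\<delta> (\<lambda>y w d'. d' @ y \<in> {c \<in> tuples M (?\<delta> @ \<beta>). P {x \<in> tuples M \<sigma>. x @ c \<in> Z (?\<delta> @ \<beta>) \<Psi>}} \<and>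
    w @ d' @ y \<notin> \<Psi>)" for \<Psi>
  have "\<exists>\<phi> c. \<phi> \<in> fms M {} (\<beta> @ map (srt M) c) \<and> divides M A \<beta> \<phi> c \<and>
    (\<forall>y\<in>tuples M \<beta>. holds M \<phi> (y @ c) \<longleftrightarrow> y @ (h a @ d) \<in> U2 \<Psi>)" if \<Psi>L: "\<Psi> \<in> L" for \<Psi>
  proof -
    have \<Psi>: "definable M A (\<tau> @ ?\<delta> @ \<beta>) \<Psi>" by (rule L_def[OF \<Psi>L])
    have defU2: "definable M A (\<beta> @ \<tau> @ ?\<delta>) (U2 \<Psi>)" unfolding U2_def
      by (rule Def_set3[where \<Gamma> = "(\<lambda>_. \<tau>)(0 := \<beta>, 2 := ?\<delta>)" and i = 0 and j = 1 and k = 2, OF struct],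
          simp, simp, simp, simp, simp, simp,
          rule Def_conj[OF struct Def_mem2[OF struct] Def_neg[OF Def_mem3[OF struct]]])
        (use P_fibre_set_definable[OF definable_Z[OF \<Psi>]] \<Psi> in simp_all)
    have smallAd: "small \<kappa> (A \<union> set d)" by (rule small_list_Un[OF smallA])
    obtain e where e: "\<forall>n. mor (A \<union> set d) (map e [0..<n])" using mor_sequence[OF smallAd] ..
    have re: "Real (e i) (A \<union> set d)" for i by (rule real_mono[OF mor_map_nth]) (use e in auto)
    have eA: "mor A (map e [0..<n])" for n by (rule mor_mono[OF e[rule_format]]) simp
    obtain N where N: "\<forall>c\<in>tuples M (?\<delta> @ \<beta>). \<forall>as. mor A as \<and> P {a \<in> tuples M \<sigma>. a @ c \<in> Z (?\<delta> @ \<beta>) \<Psi>} \<longrightarrow>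
      length (filter (\<lambda>a. a @ c \<notin> Z (?\<delta> @ \<beta>) \<Psi>) as) \<le> N" using failure_bound[OF definable_Z[OF \<Psi>]] ..
    have hadt: "h a @ d \<in> tuples M (\<tau> @ ?\<delta>)" using hat by (intro tuples_appendI tuples_self)
    show ?thesis
    proof (rule divides_witness[OF defU2 hadt, where cs = "\<lambda>i. h (e i) @ d" and k = "Suc N"])
      fix i
      have het: "h (e i) \<in> tuples M \<tau>" by (rule ht[OF realX[OF real_mono[OF re]]]) simp
      have in_iff: "h a \<in> \<Xi> \<longleftrightarrow> h (e i) \<in> \<Xi>" if \<Xi>: "definable M (A \<union> set d) \<tau> \<Xi>" for \<Xi>
      proof -
        have e1: "h (e i) \<in> \<Xi> \<longleftrightarrow> PH \<Xi>" by (rule real_PH[OF re _ \<Xi>]) simp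
        have e2: "h (e i) \<in> tuples M \<tau> - \<Xi> \<longleftrightarrow> PH (tuples M \<tau> - \<Xi>)" by (rule real_PH[OF re _ definable_Diff[OF \<Xi>]]) simp
        show ?thesis using e1 e2 ha[OF \<Xi>] ha[OF definable_Diff[OF \<Xi>]] het by blast
      qed
      have "eqtp M (A \<union> set d) (h a) (h (e i))" unfolding eqtp_def
        using hat het in_iff by (simp add: tuples_def)
      then obtain g where g: "fixes_aut M (A \<union> set d) g" "map g (h a) = h (e i)"
        using homogeneity[OF _ smallAd] by blast
      have "map g (h a @ d) = h (e i) @ d" using g(2) fixes_aut_map_id[OF g(1), of d] by simp
      moreover have "fixes_aut M A g" by (rule fixes_aut_mono[OF g(1)]) simp
      ultimately show "eqtp M A (h a @ d) (h (e i) @ d)" using fixes_aut_eqtp[OF struct, of A g "h a @ d"] by simp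
    next
      fix I y assume I: "finite I" "card I = Suc N" and y: "y \<in> tuples M \<beta>"
        and U: "\<And>i. i \<in> I \<Longrightarrow> y @ (h (e i) @ d) \<in> U2 \<Psi>"
      have dy: "d @ y \<in> tuples M (?\<delta> @ \<beta>)" using y by (intro tuples_appendI tuples_self)
      have U': "P {x \<in> tuples M \<sigma>. x @ (d @ y) \<in> Z (?\<delta> @ \<beta>) \<Psi>} \<and> e i @ (d @ y) \<notin> Z (?\<delta> @ \<beta>) \<Psi>" if "i \<in> I" for i
      proof -
        have "h (e i) \<in> tuples M \<tau>" by (rule ht[OF realX[OF real_mono[OF re]]]) simp
        then have "d @ y \<in> {c \<in> tuples M (?\<delta> @ \<beta>). P {x \<in> tuples M \<sigma>. x @ c \<in> Z (?\<delta> @ \<beta>) \<Psi>}} \<and> h (e i) @ d @ y \<notin> \<Psi>"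
          using U[OF that] unfolding U2_def by (simp only: rel3_iff[OF y]) simp
        then show ?thesis using Z_iff[OF real_tuples[OF re] dy] by simp
      qed
      obtain i where i: "i \<in> I" using I by fastforce
      show False
        by (rule morley_inconsistent[OF N eA I dy conjunct1[OF U'[OF i]]]) (use U' in simp)
    qed
  qed
  then have "\<forall>\<Psi>\<in>L. \<exists>r. fst r \<in> fms M {} (\<beta> @ map (srt M) (snd r)) \<and> divides M A \<beta> (fst r) (snd r) \<and>
    (\<forall>y\<in>tuples M \<beta>. holds M (fst r) (y @ snd r) \<longleftrightarrow> y @ (h a @ d) \<in> U2 \<Psi>)" by simp
  then obtain R where R: "\<forall>\<Psi>\<in>L. fst (R \<Psi>) \<in> fms M {} (\<beta> @ map (srt M) (snd (R \<Psi>))) \<and> divides M A \<beta> (fst (R \<Psi>)) (snd (R \<Psi>)) \<and>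
    (\<forall>y\<in>tuples M \<beta>. holds M (fst (R \<Psi>)) (y @ snd (R \<Psi>)) \<longleftrightarrow> y @ (h a @ d) \<in> U2 \<Psi>)" by (rule bchoice[THEN exE])
  let ?\<Delta> = "insert (\<phi>1, c1) (R ` L)"
  have fin\<Delta>: "finite ?\<Delta>" using L by simp
  have \<Delta>: "\<forall>(\<phi>, c)\<in>?\<Delta>. \<phi> \<in> fms M {} (\<beta> @ map (srt M) c) \<and> divides M A \<beta> \<phi> c"
    using 1 R by (auto simp: split_beta)
  have "\<not> (\<forall>y\<in>tuples M \<beta>. (\<forall>\<theta>\<in>tp M A b. holds M \<theta> y) \<longrightarrow> (\<exists>(\<phi>, c)\<in>?\<Delta>. holds M \<phi> (y @ c)))"
  proof
    assume "\<forall>y\<in>tuples M \<beta>. (\<forall>\<theta>\<in>tp M A b. holds M \<theta> y) \<longrightarrow> (\<exists>(\<phi>, c)\<in>?\<Delta>. holds M \<phi> (y @ c))"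
    with \<Delta> fin\<Delta> have "forks M A \<beta> (tp M A b)" unfolding forks_def by (intro exI[of _ ?\<Delta>] conjI)
    then show False using nf by simp
  qed
  then obtain y where y: "y \<in> tuples M \<beta>" "\<forall>\<theta>\<in>tp M A b. holds M \<theta> y" "\<not> (\<exists>(\<phi>, c)\<in>?\<Delta>. holds M \<phi> (y @ c))" by auto
  have ey: "eqtp M A b y" by (rule tp_eqtp) (use y in simp_all)
  have "P {x \<in> tuples M \<sigma>. x @ y \<in> \<Theta>'}" by (rule P_fibre_eqtp[OF \<Theta>'(1) ey \<Theta>'(2)])
  moreover have "y @ a \<notin> U1" using y(1,3) 1(3) by auto
  ultimately have "a @ y \<in> \<Theta>'" using y(1) at by (simp add: U1_def rel2_iff)
  moreover have "h a @ d @ y \<in> \<Psi>" if \<Psi>: "\<Psi> \<in> L" and P: "P {x \<in> tuples M \<sigma>. x @ d @ y \<in> Z (?\<delta> @ \<beta>) \<Psi>}" for \<Psi>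
  proof -
    have "\<not> holds M (fst (R \<Psi>)) (y @ snd (R \<Psi>))" using y(3) \<Psi> by (auto simp: split_beta)
    then have "y @ h a @ d \<notin> U2 \<Psi>" using R \<Psi> y(1) by blast
    moreover have "d @ y \<in> tuples M (?\<delta> @ \<beta>)" using y(1) by (intro tuples_appendI tuples_self)
    ultimately show ?thesis using P unfolding U2_def by (simp only: rel3_iff[OF y(1) hat]) simp
  qed
  ultimately show ?thesis using y(1) by blast
qed

section \<open>Covers by conjugates when the tensor powers are generically stable\<close>

text \<open>A definable set that misses all realizations of \<open>tp(r/A)\<close> misses a single member of that type, by compactness.\<close>

lemma (in monster) type_implies:
  assumes A: "small \<kappa> A" and AB: "A \<subseteq> B" and B: "small \<kappa> B" and r: "r \<in> tuples M \<xi>"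
    and F: "definable M B \<xi> F" and no: "\<And>w. eqtp M A r w \<Longrightarrow> w \<notin> F"
  shows "\<exists>\<Lambda>. definable M A \<xi> \<Lambda> \<and> r \<in> \<Lambda> \<and> \<Lambda> \<inter> F = {}"
proof -
  define T where "T = {X. definable M A \<xi> X \<and> r \<in> X}"
  have "\<exists>G. finite G \<and> G \<subseteq> insert F T \<and> (\<forall>w\<in>tuples M \<xi>. \<exists>X\<in>G. w \<notin> X)"
  proof (rule compactness[OF B])
    fix X assume "X \<in> insert F T"
    then show "definable M B \<xi> X" using F definable_mono[OF _ AB] by (auto simp: T_def)
  next
    fix w assume w: "w \<in> tuples M \<xi>"
    show "\<exists>X\<in>insert F T. w \<notin> X"
    proof (rule ccontr)
      assume "\<not> ?thesis"
      then have wF: "w \<in> F" and wT: "\<And>X. X \<in> T \<Longrightarrow> w \<in> X" by simp_all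
      have mr: "map (srt M) r = \<xi>" "map (srt M) w = \<xi>" using r w by (simp_all add: tuples_def)
      have "eqtp M A r w" unfolding eqtp_def
      proof (intro conjI allI impI)
        fix X assume X: "definable M A (map (srt M) r) X"
        have X1: "definable M A \<xi> X" and X2: "definable M A \<xi> (tuples M \<xi> - X)" using X definable_Diff[OF X] mr by simp_all
        show "r \<in> X \<longleftrightarrow> w \<in> X" using wT[of X] wT[of "tuples M \<xi> - X"] X1 X2 r by (auto simp: T_def)
      qed (use mr in simp)
      then show False using no wF by blast
    qed
  qed
  then obtain G where G: "finite G \<and> G \<subseteq> insert F T \<and> (\<forall>w\<in>tuples M \<xi>. \<exists>X\<in>G. w \<notin> X)" ..
  have GT: "definable M A \<xi> X \<and> r \<in> X" if "X \<in> G - {F}" for X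
    using subsetD[OF conjunct1[OF conjunct2[OF G]], of X] that by (auto simp: T_def)
  let ?\<Lambda> = "{w \<in> tuples M \<xi>. \<forall>X\<in>G - {F}. w \<in> X}"
  have "definable M A \<xi> ?\<Lambda>" by (rule finite_intersection_definable) (use G GT in simp_all)
  moreover have "r \<in> ?\<Lambda>" using r GT by simp
  moreover have "w \<notin> F" if w: "w \<in> ?\<Lambda>" for w
  proof
    assume "w \<in> F"
    obtain X where X: "X \<in> G" "w \<notin> X" using G w by auto
    then have "X \<in> G - {F}" using \<open>w \<in> F\<close> by auto
    then show False using w X(2) by simp
  qed
  ultimately show ?thesis by (intro exI[of _ ?\<Lambda>]) auto
qed

lemma (in monster) tuples_split:
  "w \<in> tuples M (concat (replicate n \<sigma>)) \<Longrightarrow> \<exists>as. w = concat as \<and> length as = n \<and> set as \<subseteq> tuples M \<sigma>"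
proof (induction n arbitrary: w)
  case (Suc n)
  have "w \<in> tuples M (\<sigma> @ concat (replicate n \<sigma>))" using Suc.prems by simp
  then obtain a u where a: "a \<in> tuples M \<sigma>" "u \<in> tuples M (concat (replicate n \<sigma>))" "w = a @ u" by (rule tuples_appendE)
  obtain as where "u = concat as" "length as = n" "set as \<subseteq> tuples M \<sigma>" using Suc.IH[OF a(2)] by (elim exE conjE)
  then show ?case using a by (intro exI[of _ "a # as"]) simp
qed simp

text \<open>
  Let \<open>as0\<close> be a Morley sequence of maximal length \<open>n\<close> on which \<open>\<Theta>(x, b)\<close> fails.  Then no Morley
  sequence of length \<open>n + 1\<close> consists of failures, and one formula \<open>\<Lambda>\<close> of its type ensures this.
  For \<open>a\<close> realizing \<open>p\<close> over \<open>A\<close>, the formula \<open>\<Lambda>(w, a)\<close> belongs to the \<open>n\<close>-th power \<open>q\<close> by exchange.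
  Since \<open>q\<close> is generically stable, \<open>\<Lambda>(w, a)\<close> holds for some \<open>w\<close> in a fixed Morley sequence \<open>bs\<close> of
  \<open>q\<close> that is longer than the bound on failures.  If the automorphism \<open>g w\<close> takes \<open>as0\<close> to \<open>w\<close>, then
  \<open>\<Theta>(a, g w b)\<close> holds: otherwise the \<open>n + 1\<close> elements \<open>w, a\<close> would be failures for \<open>g w b\<close> that
  satisfy \<open>\<Lambda>\<close>.
\<close>

lemma (in generic_type) conjugates_cover:
  assumes powers: "\<forall>n. \<exists>q. tensor_power \<kappa> M A \<sigma> p n q \<and> generically_stable M A (concat (replicate n \<sigma>)) q"
    and \<Theta>: "definable M A (\<sigma> @ map (srt M) b) \<Theta>" and P\<Theta>: "P {x \<in> tuples M \<sigma>. x @ b \<in> \<Theta>}"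
  shows "\<exists>ys. (\<forall>y\<in>set ys. eqtp M A b y) \<and> (\<forall>a. Real a A \<longrightarrow> (\<exists>y\<in>set ys. a @ y \<in> \<Theta>))"
proof -
  let ?\<beta> = "map (srt M) b"
  obtain N where N: "\<forall>c\<in>tuples M ?\<beta>. \<forall>as. mor A as \<and> P {a \<in> tuples M \<sigma>. a @ c \<in> \<Theta>} \<longrightarrow>
    length (filter (\<lambda>a. a @ c \<notin> \<Theta>) as) \<le> N" using failure_bound[OF \<Theta>] ..
  define bad where "bad n \<longleftrightarrow> (\<exists>as. length as = n \<and> mor A as \<and> (\<forall>x\<in>set as. x @ b \<notin> \<Theta>))" for n
  have bad0: "bad 0" unfolding bad_def by simp
  have bad_le: "n \<le> N" if badn: "bad n" for n
  proof -
    obtain as where as: "length as = n" "mor A as" "\<forall>x\<in>set as. x @ b \<notin> \<Theta>" using badn unfolding bad_def by (elim exE conjE)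
    have "filter (\<lambda>a. a @ b \<notin> \<Theta>) as = as" using as(3) by (simp add: filter_id_conv)
    moreover have "length (filter (\<lambda>a. a @ b \<notin> \<Theta>) as) \<le> N" using N[rule_format, OF tuples_self conjI[OF as(2) P\<Theta>]] .
    ultimately show ?thesis using as(1) by simp
  qed
  define n where "n = (GREATEST n. bad n)"
  have badn: "bad n" unfolding n_def by (rule GreatestI_nat[of bad 0 N, OF bad0 bad_le])
  have not_bad: "\<not> bad (Suc n)"
  proof
    assume "bad (Suc n)"
    then have "Suc n \<le> (GREATEST n. bad n)" by (rule Greatest_le_nat[of bad "Suc n" N, OF _ bad_le])
    then have "Suc n \<le> n" by (simp only: n_def)
    then show False by simp
  qed
  obtain as0 where as0: "length as0 = n" "mor A as0" "\<forall>x\<in>set as0. x @ b \<notin> \<Theta>"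
    using badn unfolding bad_def by (elim exE conjE)
  obtain q where q: "tensor_power \<kappa> M A \<sigma> p n q" "generically_stable M A (concat (replicate n \<sigma>)) q"
    using powers by blast
  let ?n = "concat (replicate n \<sigma>)"
  interpret Q: generic_type \<kappa> M A ?n q by unfold_locales (rule smallA, rule q(2))
  have Q_real: "Q.Real (concat as) B \<longleftrightarrow> mor B as" if "A \<subseteq> B" "small \<kappa> B" "length as = n" "set as \<subseteq> tuples M \<sigma>" for as B
    using q(1) that unfolding tensor_power_def mor_nth by blast
  have mor_tup: "set as \<subseteq> tuples M \<sigma>" if "mor B as" for as B using mor_real[OF that] real_tuples by blast
  define Fail where "Fail y = {x \<in> tuples M \<sigma>. x @ y \<notin> \<Theta>}" for y
  have n1: "concat (replicate (n + 1) \<sigma>) = ?n @ \<sigma>" by (simp only: replicate_add concat_append) simp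
  obtain as1 where as1: "length as1 = Suc n \<and> mor A as1" using mor_exists[OF smallA] ..
  let ?r = "concat as1"
  have r: "?r \<in> tuples M (?n @ \<sigma>)"
  proof -
    have "?r \<in> set_power (tuples M \<sigma>) (n + 1)" using as1 mor_tup unfolding set_power_def by auto
    then show ?thesis using set_power_tuples[of "tuples M \<sigma>" \<sigma> "n + 1"] unfolding n1 by blast
  qed
  have defFail: "definable M (A \<union> set b) \<sigma> (Fail b)"
  proof -
    have "Fail b = tuples M \<sigma> - {x \<in> tuples M \<sigma>. x @ b \<in> \<Theta>}" unfolding Fail_def by blast
    then show ?thesis using definable_Diff[OF P_fibre_definable[OF \<Theta> tuples_self]] by simp
  qed
  have "\<exists>\<Lambda>. definable M A (?n @ \<sigma>) \<Lambda> \<and> ?r \<in> \<Lambda> \<and> \<Lambda> \<inter> set_power (Fail b) (n + 1) = {}"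
  proof (rule type_implies[OF smallA _ small_list_Un[OF smallA] r])
    show "definable M (A \<union> set b) (?n @ \<sigma>) (set_power (Fail b) (n + 1))"
      using definable_set_power[OF defFail, of "n + 1"] unfolding n1 .
    fix w assume "eqtp M A ?r w"
    then obtain g where g: "fixes_aut M A g" "map g ?r = w" using homogeneity[OF _ smallA] by blast
    show "w \<notin> set_power (Fail b) (n + 1)"
    proof
      assume "w \<in> set_power (Fail b) (n + 1)"
      then obtain as where as: "w = concat as" "length as = n + 1" "set as \<subseteq> Fail b" unfolding set_power_def by blast
      have gi: "g ` A = A" using fixes_aut_image[OF g(1), of "{}"] by simp
      have m: "mor A (map (map g) as1)" using mor_aut[OF g(1), of A as1] as1 gi by simp
      have "map (map g) as1 = as"
      proof (rule concat_inj[of _ _ M \<sigma>])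
        show "concat (map (map g) as1) = concat as" using g(2) as(1) by (simp add: map_concat)
        show "set as \<subseteq> tuples M \<sigma>" using as(3) unfolding Fail_def by blast
      qed (use as1 as(2) mor_tup[OF m] in simp_all)
      then have "bad (Suc n)" unfolding bad_def using m as(2,3) unfolding Fail_def by (intro exI[of _ as]) auto
      then show False using not_bad by simp
    qed
  qed simp
  then obtain \<Lambda> where \<Lambda>: "definable M A (?n @ \<sigma>) \<Lambda>" "?r \<in> \<Lambda>" "\<Lambda> \<inter> set_power (Fail b) (n + 1) = {}" by (elim exE conjE)
  have \<Lambda>_generic: "Q.P {w \<in> tuples M ?n. w @ a \<in> \<Lambda>}" if a: "Real a A" for a
  proof (rule Q.P_real[OF small_list_Un[OF smallA] Q.P_fibre_definable[OF \<Lambda>(1) real_tuples[OF a]]])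
    fix w assume w: "Q.Real w (A \<union> set a)"
    have wt: "w \<in> tuples M ?n" by (rule Q.real_tuples[OF w])
    from tuples_split[OF this] obtain as where as: "w = concat as" "length as = n" "set as \<subseteq> tuples M \<sigma>"
      by (elim exE conjE)
    have m: "mor (A \<union> set a) as" using Q_real[of "A \<union> set a" as] w as small_list_Un[OF smallA] by simp
    have "Real a (A \<union> set (concat as))" by (rule morley_exchange[OF smallA subset_refl a m])
    moreover have "mor A as" by (rule mor_mono[OF m]) simp
    ultimately have m1: "mor A (as @ [a])" by (simp add: mor_append)
    have m2: "mor A as1" and len: "length as1 = length (as @ [a])" using as1 as(2) by simp_all
    obtain g where g: "fixes_aut M A g" "map (map g) as1 = as @ [a]"
      using mor_conjugate[OF smallA subset_refl m2 m1 len] by (elim exE conjE)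
    have "map g ?r = concat (map (map g) as1)" by (simp add: map_concat)
    also have "\<dots> = w @ a" unfolding g(2) as(1) by simp
    finally have "w @ a \<in> \<Lambda>" using fixes_aut_definable[OF struct g(1) \<Lambda>(1), of ?r] \<Lambda>(2) by simp
    then show "w \<in> {w \<in> tuples M ?n. w @ a \<in> \<Lambda>}" using wt by simp
  qed
  obtain N' where N': "\<forall>c\<in>tuples M \<sigma>. \<forall>bs. Q.mor A bs \<and> Q.P {w \<in> tuples M ?n. w @ c \<in> \<Lambda>} \<longrightarrow>
    length (filter (\<lambda>w. w @ c \<notin> \<Lambda>) bs) \<le> N'" using Q.failure_bound[OF \<Lambda>(1)] ..
  obtain bs where bs: "length bs = Suc N' \<and> Q.mor A bs" using Q.mor_exists[OF smallA] ..
  have Q0: "Q.Real (concat as0) A" using Q_real[OF subset_refl smallA as0(1) mor_tup[OF as0(2)]] as0(2) by simp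
  have "\<forall>w\<in>set bs. \<exists>g. fixes_aut M A g \<and> map g (concat as0) = w"
  proof
    fix w assume "w \<in> set bs"
    then have "Q.Real w A" using Q.mor_real bs by blast
    then show "\<exists>g. fixes_aut M A g \<and> map g (concat as0) = w" by (rule homogeneity[OF Q.real_eqtp[OF Q0] smallA])
  qed
  then obtain g where g: "\<forall>w\<in>set bs. fixes_aut M A (g w) \<and> map (g w) (concat as0) = w" by (rule bchoice[THEN exE])
  let ?ys = "map (\<lambda>w. map (g w) b) bs"
  have "eqtp M A b y" if "y \<in> set ?ys" for y
    using that g fixes_aut_eqtp[OF struct] by auto
  moreover have "\<exists>y\<in>set ?ys. a @ y \<in> \<Theta>" if a: "Real a A" for a
  proof -
    have at: "a \<in> tuples M \<sigma>" by (rule real_tuples[OF a])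
    have "length (filter (\<lambda>w. w @ a \<notin> \<Lambda>) bs) \<le> N'" using N' at bs \<Lambda>_generic[OF a] by blast
    have "\<exists>w\<in>set bs. w @ a \<in> \<Lambda>"
    proof (rule ccontr)
      assume "\<not> (\<exists>w\<in>set bs. w @ a \<in> \<Lambda>)"
      then have "filter (\<lambda>w. w @ a \<notin> \<Lambda>) bs = bs" by (simp add: filter_id_conv)
      then show False using \<open>length (filter (\<lambda>w. w @ a \<notin> \<Lambda>) bs) \<le> N'\<close> bs by simp
    qed
    then obtain w where w: "w \<in> set bs" "w @ a \<in> \<Lambda>" ..
    have k: "fixes_aut M A (g w)" "map (g w) (concat as0) = w" using g w(1) by simp_all
    have ki: "fixes_aut M A (inv (g w))" by (rule fixes_aut_inv[OF k(1)])
    have kb: "map (inv (g w)) (map (g w) b) = b" by (rule fixes_aut_map_inv[OF k(1) refl])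
    have kw: "map (inv (g w)) w = concat as0" by (rule fixes_aut_map_inv[OF k])
    let ?a = "map (inv (g w)) a"
    have "a @ map (g w) b \<in> \<Theta>"
    proof (rule ccontr)
      assume no: "a @ map (g w) b \<notin> \<Theta>"
      have "map (inv (g w)) (a @ map (g w) b) \<notin> \<Theta>" using fixes_aut_definable[OF struct ki \<Theta>, of "a @ map (g w) b"] no by simp
      then have "?a @ b \<notin> \<Theta>" using kb by simp
      moreover have "?a \<in> tuples M \<sigma>" using fixes_aut_tuples[OF ki] at by blast
      ultimately have "?a \<in> Fail b" by (simp add: Fail_def)
      moreover have "set as0 \<subseteq> Fail b" using as0(3) mor_tup[OF as0(2)] unfolding Fail_def by blast
      ultimately have "concat (as0 @ [?a]) \<in> set_power (Fail b) (n + 1)"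
        unfolding set_power_def using as0(1) by (intro CollectI exI[of _ "as0 @ [?a]"]) simp
      moreover have "map (inv (g w)) (w @ a) \<in> \<Lambda>" using fixes_aut_definable[OF struct ki \<Lambda>(1), of "w @ a"] w(2) by simp
      then have "concat (as0 @ [?a]) \<in> \<Lambda>" using kw by simp
      ultimately show False using \<Lambda>(3) by blast
    qed
    then show ?thesis using w(1) by auto
  qed
  ultimately show ?thesis by (intro exI[of _ ?ys]) blast
qed

text \<open>
  Take a realization \<open>c\<close> of \<open>p\<close> over \<open>Ad\<close> and the finitely many conjugates \<open>ys\<close> of \<open>b\<close> in the cover.
  As \<open>h(c)\<close> and \<open>h(a)\<close> have the same type over \<open>Ad\<close>, an automorphism over \<open>Ad\<close> takes \<open>h(c)\<close> to \<open>h(a)\<close>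
  and \<open>ys\<close> to a cover over which \<open>h(a)\<close> is generic, also jointly with \<open>d\<close>.  The member of this cover
  that serves for \<open>a\<close> is the required \<open>y\<close>.
\<close>

lemma (in descent) consistent_if_cover:
  assumes powers: "\<forall>n. \<exists>q. tensor_power \<kappa> M A \<sigma> p n q \<and> generically_stable M A (concat (replicate n \<sigma>)) q"
    and a: "Real a A"
    and ha: "\<And>\<Psi>. definable M (A \<union> set d) \<tau> \<Psi> \<Longrightarrow> PH \<Psi> \<Longrightarrow> h a \<in> \<Psi>"
    and \<Theta>': "definable M A (\<sigma> @ \<beta>) \<Theta>'" "P {x \<in> tuples M \<sigma>. x @ b \<in> \<Theta>'}"
    and L_def: "\<And>\<Psi>. \<Psi> \<in> L \<Longrightarrow> definable M A (\<tau> @ map (srt M) d @ \<beta>) \<Psi>"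
  shows "\<exists>y\<in>tuples M \<beta>. a @ y \<in> \<Theta>' \<and>
    (\<forall>\<Psi>\<in>L. P {x \<in> tuples M \<sigma>. x @ d @ y \<in> Z (map (srt M) d @ \<beta>) \<Psi>} \<longrightarrow> h a @ d @ y \<in> \<Psi>)"
proof -
  let ?\<delta> = "map (srt M) d"
  obtain ys where ys: "\<forall>y\<in>set ys. eqtp M A b y" "\<forall>a. Real a A \<longrightarrow> (\<exists>y\<in>set ys. a @ y \<in> \<Theta>')"
    using conjugates_cover[OF powers \<Theta>'] by (elim exE conjE)
  let ?B = "A \<union> set d \<union> set (concat ys)"
  obtain c where c: "Real c ?B" using real_exists[OF small_list_Un[OF small_list_Un[OF smallA]]] ..
  have cAd: "Real c (A \<union> set d)" by (rule real_mono[OF c]) simp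
  have hct: "h c \<in> tuples M \<tau>" by (rule ht[OF realX[OF real_mono[OF c]]]) blast
  have hat: "h a \<in> tuples M \<tau>" by (rule ht[OF realX[OF a]])
  have in_iff: "h c \<in> \<Xi> \<longleftrightarrow> h a \<in> \<Xi>" if \<Xi>: "definable M (A \<union> set d) \<tau> \<Xi>" for \<Xi>
  proof -
    have e1: "h c \<in> \<Xi> \<longleftrightarrow> PH \<Xi>" by (rule real_PH[OF cAd _ \<Xi>]) simp
    have e2: "h c \<in> tuples M \<tau> - \<Xi> \<longleftrightarrow> PH (tuples M \<tau> - \<Xi>)" by (rule real_PH[OF cAd _ definable_Diff[OF \<Xi>]]) simp
    show ?thesis using e1 e2 ha[OF \<Xi>] ha[OF definable_Diff[OF \<Xi>]] hct by blast
  qed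
  have "eqtp M (A \<union> set d) (h c) (h a)" unfolding eqtp_def using hat hct in_iff by (simp add: tuples_def)
  from homogeneity[OF this small_list_Un[OF smallA]]
  obtain g where g: "fixes_aut M (A \<union> set d) g" "map g (h c) = h a" by (elim exE conjE)
  have gA: "fixes_aut M A g" by (rule fixes_aut_mono[OF g(1)]) simp
  have gi: "fixes_aut M A (inv g)" by (rule fixes_aut_inv[OF gA])
  have ggi: "map g (map (inv g) u) = u" for u
    using gA by (simp add: o_def fixes_aut_def automorphism_def bij_def surj_f_inv_f)
  have gd: "map g d = d" by (rule fixes_aut_map_id[OF g(1)]) simp
  have "Real (map (inv g) a) A" using real_aut[OF gi a] fixes_aut_image[OF gi, of "{}"] by simp
  then obtain y where y: "y \<in> set ys" "map (inv g) a @ y \<in> \<Theta>'" using ys(2) by blast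
  have yt: "y \<in> tuples M \<beta>" using eqtp_tuples[of M A b y \<beta>] ys(1) y(1) tuples_self[of b M] by blast
  have gyt: "map g y \<in> tuples M \<beta>" using fixes_aut_tuples[OF gA] yt by blast
  have "map g (map (inv g) a @ y) \<in> \<Theta>'" using fixes_aut_definable[OF struct gA \<Theta>'(1)] y(2) by blast
  then have "a @ map g y \<in> \<Theta>'" using ggi by simp
  moreover have "h a @ d @ map g y \<in> \<Psi>"
    if \<Psi>: "\<Psi> \<in> L" and P: "P {x \<in> tuples M \<sigma>. x @ d @ map g y \<in> Z (?\<delta> @ \<beta>) \<Psi>}" for \<Psi>
  proof -
    have def\<Psi>: "definable M A (\<tau> @ ?\<delta> @ \<beta>) \<Psi>" by (rule L_def[OF \<Psi>])
    have dy: "d @ y \<in> tuples M (?\<delta> @ \<beta>)" using yt by (intro tuples_appendI tuples_self)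
    have "map g (d @ y) = d @ map g y" using gd by simp
    then have "eqtp M A (d @ map g y) (d @ y)" using eqtp_sym[OF fixes_aut_eqtp[OF struct gA, of "d @ y"]] by simp
    then have "P {x \<in> tuples M \<sigma>. x @ (d @ y) \<in> Z (?\<delta> @ \<beta>) \<Psi>}" by (rule P_fibre_eqtp[OF definable_Z[OF def\<Psi>]]) (rule P)
    moreover have "Real c (A \<union> set (d @ y))" by (rule real_mono[OF c]) (use y(1) in auto)
    ultimately have "h c @ (d @ y) \<in> \<Psi>" using real_in_Z[OF _ dy def\<Psi>] by blast
    then have "map g (h c @ d @ y) \<in> \<Psi>" using fixes_aut_definable[OF struct gA def\<Psi>] by blast
    then show ?thesis using g(2) gd by simp
  qed
  ultimately show ?thesis using gyt by blast
qed

section \<open>Domination by an internal function\<close>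

theorem theorem4p3:
  fixes \<kappa> :: "'k rel"
    and M :: "('s, 'f, 'r, 'm) struct"
    and T p :: "('s, 'f, 'r, 'm) fm set"
    and A :: "'m set"
    and \<sigma> \<rho> :: "'s list"
    and b :: "'m list"
    and S :: "'m list set"
    and f :: "'m list \<Rightarrow> 'm list"
  assumes "complete_theory M T"
    and "monster_model \<kappa> T M"
    and "eliminates_imaginaries M"
    and "small \<kappa> A"
    and "generically_stable M A \<sigma> p"
    and "definable M A \<rho> S"
    and "stably_embedded M A \<rho> S"
    and "definable_fun_on_type M (A \<union> set b) \<sigma> p \<rho> S f"
    and "dominated M (A \<union> set b) \<sigma> p \<rho> f"
    and "\<not> forks M A (map (srt M) b) (tp M A b) \<or>
         (\<forall>n. \<exists>q. tensor_power \<kappa> M A \<sigma> p n q \<and>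
                   generically_stable M A (concat (replicate n \<sigma>)) q)"
  shows "\<exists>\<tau> h. definable_fun_on_type M A \<sigma> p \<tau> (Int_set M \<rho> S A) h \<and> dominated M A \<sigma> p \<tau> h"
proof -
  interpret generic_type \<kappa> M A \<sigma> p
    by unfold_locales (use assms in \<open>simp_all add: monster_model_def\<close>)
  obtain Xf where Xf: "definable_fun M (A \<union> set b) \<sigma> Xf \<rho> f" "{a. Real a (A \<union> set b)} \<subseteq> Xf"
    and fS: "\<forall>a. Real a (A \<union> set b) \<longrightarrow> f a \<in> S"
    using assms(8) unfolding definable_fun_on_type_def by blast
  have realXf: "\<forall>a. Real a (A \<union> set b) \<longrightarrow> a \<in> Xf" using Xf(2) by blast
  obtain G where G: "definable M A (\<sigma> @ \<rho> @ map (srt M) b) G"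
    "\<forall>x\<in>tuples M \<sigma>. \<forall>y\<in>tuples M (map (srt M) b). \<forall>z\<in>tuples M \<rho>. x @ z @ y \<in> G \<longrightarrow>
      z \<in> S \<and> (\<forall>z'\<in>tuples M \<rho>. x @ z' @ y \<in> G \<longrightarrow> z' = z)"
    "\<forall>a. Real a (A \<union> set b) \<longrightarrow> (\<forall>z\<in>tuples M \<rho>. a @ z @ b \<in> G \<longleftrightarrow> z = f a)"
    using graph_family[OF assms(6) Xf(1) realXf fS] by (elim exE conjE)
  interpret family \<kappa> M A \<sigma> p \<rho> S G b
  proof
    show "definable M A \<rho> S" by (rule assms(6))
    show "definable M A (\<sigma> @ \<rho> @ map (srt M) b) G" by (rule G(1))
    fix x y z z' assume *: "x \<in> tuples M \<sigma>" "y \<in> tuples M (map (srt M) b)" "z \<in> tuples M \<rho>"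
    show "x @ z @ y \<in> G \<Longrightarrow> z \<in> S" using G(2) * by blast
    assume "z' \<in> tuples M \<rho>" "x @ z @ y \<in> G" "x @ z' @ y \<in> G"
    then show "z = z'" using G(2) * by blast
  next
    fix a assume a: "Real a (A \<union> set b)"
    have "f a \<in> tuples M \<rho>" using fS a definable_sub[OF assms(6)] by blast
    then show "\<exists>z\<in>tuples M \<rho>. a @ z @ b \<in> G" using G(3) a by blast
  qed
  obtain \<Theta> where \<Theta>: "definable M A (\<sigma> @ \<beta>) \<Theta>" "P {x \<in> tuples M \<sigma>. x @ b \<in> \<Theta>}"
    "\<forall>a\<in>tuples M \<sigma>. \<forall>y\<in>tuples M \<beta>. \<forall>y'\<in>tuples M \<beta>. a @ y \<in> \<Theta> \<longrightarrow> a @ y' \<in> \<Theta> \<longrightarrow> germ y y' \<longrightarrow> agree a y y'"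
    using uniform_strong_germs by (elim exE conjE)
  interpret coded_family \<kappa> M A \<sigma> p \<rho> S G b \<Theta>
    by unfold_locales (use \<Theta> assms(3,7) in blast)+
  obtain \<tau> X h where code: "definable_fun M A \<sigma> X \<tau> h" "\<forall>a. Real a A \<longrightarrow> a \<in> X" "\<forall>a\<in>X. h a \<in> Int_set M \<rho> S A"
    "\<forall>a\<in>X. \<forall>a'\<in>X. h a = h a' \<longrightarrow> (\<forall>y z. H a y z \<longleftrightarrow> H a' y z)"
    using code_function by (elim exE conjE)
  interpret descent \<kappa> M A \<sigma> p \<rho> S G b \<Theta> f Xf \<tau> X h
  proof
    show "definable_fun M (A \<union> set b) \<sigma> Xf \<rho> f" by (rule Xf(1))
    show "dominated M (A \<union> set b) \<sigma> p \<rho> f" by (rule assms(9))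
    show "definable_fun M A \<sigma> X \<tau> h" by (rule code(1))
    show "a \<in> Xf" if "Real a (A \<union> set b)" for a using realXf that by blast
    show "a @ z @ b \<in> G \<longleftrightarrow> z = f a" if "Real a (A \<union> set b)" "z \<in> tuples M \<rho>" for a z using G(3) that by blast
    show "a \<in> X" if "Real a A" for a using code(2) that by blast
    show "H a y z \<longleftrightarrow> H a' y z" if "a \<in> X" "a' \<in> X" "h a = h a'" for a a' y z using code(4) that by blast
  qed
  have "dominated M A \<sigma> p \<tau> h" unfolding dominated_def
  proof (intro allI impI)
    fix a d assume a: "Real a A" and w: "realizes M \<tau> (h a) (pushforward M \<sigma> p \<tau> h) (A \<union> set d)"
    have ha: "h a \<in> \<Psi>" if \<Psi>: "definable M (A \<union> set d) \<tau> \<Psi>" "PH \<Psi>" for \<Psi>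
      by (rule pushforward_realD[OF w \<Psi>(1) \<Psi>(2)[unfolded PH_def]]) simp
    show "Real a (A \<union> set d)"
    proof (rule dominated_if_consistent[OF a])
      fix \<Theta>' L assume *: "definable M A (\<sigma> @ \<beta>) \<Theta>'" "P {x \<in> tuples M \<sigma>. x @ b \<in> \<Theta>'}" "finite L"
        "\<And>\<Psi>. \<Psi> \<in> L \<Longrightarrow> definable M A (\<tau> @ map (srt M) d @ \<beta>) \<Psi>"
      from assms(10) show "\<exists>y\<in>tuples M \<beta>. a @ y \<in> \<Theta>' \<and>
        (\<forall>\<Psi>\<in>L. P {x \<in> tuples M \<sigma>. x @ d @ y \<in> Z (map (srt M) d @ \<beta>) \<Psi>} \<longrightarrow> h a @ d @ y \<in> \<Psi>)"
      proof
        assume nf: "\<not> forks M A (map (srt M) b) (tp M A b)"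
        show ?thesis by (rule consistent_if_nonforking[OF nf a ha *])
      next
        assume powers: "\<forall>n. \<exists>q. tensor_power \<kappa> M A \<sigma> p n q \<and> generically_stable M A (concat (replicate n \<sigma>)) q"
        show ?thesis by (rule consistent_if_cover[OF powers a ha *(1,2,4)])
      qed
    qed
  qed
  moreover have "definable_fun_on_type M A \<sigma> p \<tau> (Int_set M \<rho> S A) h"
    unfolding definable_fun_on_type_def using code(1,2,3) by blast
  ultimately show ?thesis by (intro exI conjI)
qed

end
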